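(* Assume that $N(W)=\mathcal S_X(W)$ for each $W=\prod_vW_v\in\Upsilon_H$, where $\mathcal S_X(W)$ is the $\mathbb Z_p$-module of $W$-invariant functions in the Schwartz space $\mathcal S_X$ of $X=\prod'_vX_v$. Let $\phi_U=\otimes'\phi_{U_v}\in N(U)=\mathcal S_X(U)$, where $\phi_{U_v}=\mathrm{ch}(Y_v)$. Suppose that for each $v\in I$ and $1\le i\le r_v$, $$\bigl(\mathfrak h_{v,i,*}(\phi_{U_v})\bigr)(x)\in[V_{v,i}(x,H_{v,i}):V_{v,i}]\cdot\mathbb Z_p$$ for all $x\in\mathrm{supp}(\mathfrak h_{v,i,*}(\phi_{U_v}))\subset X_v$. Then there exist $y_\nu\in M(K[\nu])$ for all $\nu\in\mathcal N$ such that $y_\varnothing=\iota_*(\phi_U)\in M(K)$ and $$\mathfrak H_{\mu\setminus\nu,*}(y_\nu)=\mathrm{pr}_{\mu,\nu,*}(y_\mu)$$ for all $\nu\subset\mu$ in $\mathcal N$.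
   Context: **RIC functors.** Let $G$ be a locally profinite group and $\Upsilon$ a non-empty collection of compact open subgroups such that (T1) $\Upsilon$ is stable under $G$-conjugation; (T2) for $K,L\in\Upsilon$ there is $K'\in\Upsilon$ with $K'\triangleleft K$, $K'\subset L$; (T3) $\Upsilon$ is closed under pairwise intersection. $\mathcal P(G,\Upsilon)$ is the category with objects $\Upsilon$, $\mathrm{Hom}(L,K)=\{g\in G: g^{-1}Lg\subset K\}$ and composition $(L\xrightarrow{g}K)\circ(L'\xrightarrow{h}L)=(L'\xrightarrow{hg}K)$. An $R$-module valued RIC functor $M$ on $(G,\Upsilon)$ is a pair of functors $M^*:\mathcal P(G,\Upsilon)^{op}\to R\text{-Mod}$, $M_*:\mathcal P(G,\Upsilon)\to R\text{-Mod}$ agreeing on objects (common value $M(K)$); write $[g]^*_{L,K}:M(K)\to M(L)$, $[g]_{L,K,*}:M(L)\to M(K)$ for the induced maps and $\mathrm{pr}_{L,K}$ for $g=e$; it is required that $[g]^*_{L,K}=[g^{-1}]_{K,L,*}$ if $g^{-1}Lg=K$ and that $[\gamma]_{K,K,*}=\mathrm{id}$ for $\gamma\in K$. $M$ is *cohomological* if $\mathrm{pr}_{L,K,*}\circ\mathrm{pr}_{L,K}^*=[K:L]$ for $L\subset K$; *Mackey* if for $L,L'\subset K$ one has $\mathrm{pr}_{L,K}^*\circ\mathrm{pr}_{L',K,*}=\sum_{\gamma\in L\backslash K/L'}\mathrm{pr}_{L_\gamma,L,*}\circ[\gamma]^*_{L_\gamma,L'}$ with $L_\gamma=L\cap\gamma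 L'\gamma^{-1}$; *CoMack* if both. **Pushforwards.** For a closed subgroup $H\subset G$ and $\Upsilon_H\supset\{K\cap H:K\in\Upsilon_G\}$, a pushforward $\iota_*:N\to M$ from a RIC functor $N$ on $(H,\Upsilon_H)$ to $M$ on $(G,\Upsilon_G)$ is a family $\iota_{V,K',*}:N(V)\to M(K')$ for $V\in\Upsilon_H$, $K'\in\Upsilon_G$, $V\subset K'$, commuting with $[h]_*$ on both sides for $h\in H$ (whenever $h^{-1}V'h\subset V$, $h^{-1}L'h\subset K'$, $V'\subset L'$). It is *Mackey* if for $V,L\subset K'$: $\mathrm{pr}^*_{L,K'}\circ\iota_{V,K',*}=\sum_{\gamma\in V\backslash K'/L}[\gamma]_{\gamma L\gamma^{-1},L,*}\circ\iota_{V_\gamma,\gamma L\gamma^{-1},*}\circ\mathrm{pr}^*_{V_\gamma,V}$ with $V_\gamma=V\cap\gamma L\gamma^{-1}$. **Hecke correspondences.** $[K'\sigma K]:M(K)\to M(K')$ is $\mathrm{pr}_{K'\cap\sigma K\sigma^{-1},K',*}\circ[\sigma]^*\circ \mathrm{pr}^*_{K\cap\sigma^{-1}K'\sigma,K}$, and $[K'\sigma K]_*:=[K\sigma^{-1}K']$. **Setting.** $I$ is an index set; for $v\in I$, $H_v\subset G_v$ is a closed subgroup, both unimodular locally profinite; $K_v\subset G_v$ compact open, $U_v=H_v\cap K_v$, $L_v\triangleleft K_v$ compact open normal. $G=\prod'_vG_v$, $H=\prod'_vH_v$ are restricted products with respect to $K_v$, $U_v$; $K=\prod K_v$, $U=\prod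 U_v$. $\mathcal N$ is the set of finite subsets of $I$; for $\nu\in\mathcal N$, subscript $\nu$ denotes the product over $v\in\nu$ and superscript $\nu$ the part away from $\nu$; $K[\nu]=K^\nu L_\nu$. $\Upsilon_G$ satisfies (T1)-(T3) and contains $K$ and all $K[\nu]$; $\Upsilon_H$ satisfies (T1)-(T3) and contains $\{K'\cap H:K'\in\Upsilon_G\}$. $N$ on $(H,\Upsilon_H)$ and $M$ on $(G,\Upsilon_G)$ are $\mathbb Z_p$-module valued CoMack functors and $\iota_*:N\to M$ is a Mackey pushforward. For $\nu\subset\mu$, $\mathrm{pr}_{\mu,\nu,*}=\mathrm{pr}_{K[\mu],K[\nu],*}:M(K[\mu])\to M(K[\nu])$; $\iota_*(\phi_U)=\iota_{U,K,*}(\phi_U)$. For each $v$, $\mathfrak H_v$ is a finite $\mathbb Z_p$-linear combination of characteristic functions of double cosets in $K_v\backslash G_v/K_v$. For disjoint $\mu,\nu\in\mathcal N$, $\mathfrak H_{\mu,*}:M(K[\nu])\to M(K[\nu])$ is the composition over $v\in\mu$ of the (commuting) operators $\sum_\sigma c_\sigma[K[\nu]\sigma K[\nu]]_*$ where $\mathfrak H_v=\sum_\sigma c_\sigma\mathrm{ch}(K_v\sigma K_v)$. Elements $g_{v,1},\dots,g_{v,r_v}\in G_v$ form a fixed set of representatives of $H_v\backslash H_v\cdot\mathrm{supp}(\mathfrak H_v)/K_v$; $H_{v,i}=H_v\cap g_{v,i}K_vg_{v,i}^{-1}$ and $V_{v,i}=H_v\cap g_{v,i}L_vg_{v,i}^{-1}$.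 The function $\mathfrak h_{v,i}:H_v\to\mathbb Z_p$, $h\mapsto\mathfrak H_v(hg_{v,i})$ equals $\sum_jc_j\,\mathrm{ch}(U_vh_jH_{v,i})$ for finitely many distinct double cosets. **Schwartz spaces.** For each $v$, $X_v$ is a locally compact Hausdorff totally disconnected space with a continuous right action of $H_v$, and $Y_v\subset X_v$ is a $U_v$-invariant compact open subset; $X=\prod'_vX_v$ is the restricted topological product with respect to the $Y_v$, with its right $H$-action. $\mathcal S_X$ is the space of locally constant compactly supported $\mathbb Z_p$-valued functions on $X$, with left action $(h\cdot\xi)(x)=\xi(xh)$; similarly $\mathcal S_{X_v}$ with action of $H_v$. For $W$ of product form, the structure maps of $N$ are those of invariants of a smooth representation: for $h^{-1}Vh\subset W$, $[h]^*(\xi)=h\cdot\xi$ and $[h]_*(\xi)=\sum_{\gamma\in W/h^{-1}Vh}\gamma h^{-1}\cdot\xi$. The function $\phi_U=\otimes'\phi_{U_v}$ is the characteristic function of $\prod_vY_v$. With $N_v(W_v)=\mathcal S_{X_v}^{W_v}$, the map $\mathfrak h_{v,i,*}:N_v(U_v)\to N_v(H_{v,i})$ is $\sum_jc_j[H_{v,i}h_j^{-1}U_v]$, i.e. $\xi\mapsto\sum_jc_j\sum_{\beta\in H_{v,i}h_j^{-1}U_v/U_v}\beta\cdot\xi$. For compact open subgroups $V_v\subset W_v\subset H_v$ and $x\in X_v$, $V_v(x,W_v)$ is the subgroup of $W_v$ generated by $V_v$ and the stabilizer $\mathrm{Stab}_{W_v}(x)$. *)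

theory Defs
  imports
    "HOL-Analysis.Measure_Space"
    "HOL-Analysis.Abstract_Topological_Spaces"
    "HOL-Computational_Algebra.Primes"
    "HOL-Algebra.Module"
    "HOL-Algebra.Product_Groups"
    "HOL-Algebra.Generated_Groups"
begin

section \<open>The ring of p-adic integers\<close>

type_synonym padic = "nat \<Rightarrow> int"

text \<open>The inverse limit of the rings of integers modulo \<open>p ^ n\<close>, each residue class being
  represented by its least non-negative element.\<close>

definition padic_int :: "nat \<Rightarrow> padic ring" where
  "padic_int p =
     \<lparr>carrier = {a. \<forall>n. a n \<in> {0..<int p ^ n} \<and> a (Suc n) mod int p ^ n = a n},
      monoid.mult = (\<lambda>a b n. (a n * b n) mod int p ^ n),
      one = (\<lambda>n. 1 mod int p ^ n),
      zero = (\<lambda>n. 0),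
      add = (\<lambda>a b n. (a n + b n) mod int p ^ n)\<rparr>"

lemma padic_int_mod_closed:
  assumes "\<And>n. f (Suc n) mod int p ^ n = f n mod int p ^ n" and "p > 0"
  shows "(\<lambda>n. f n mod int p ^ n) \<in> carrier (padic_int p)"
  using assms by (auto simp: padic_int_def mod_mod_cancel)

lemma padic_int_closed:
  assumes "a \<in> carrier (padic_int p)" "b \<in> carrier (padic_int p)" "p > 0"
  shows "(\<lambda>n. (a n * b n) mod int p ^ n) \<in> carrier (padic_int p)"
    and "(\<lambda>n. (a n + b n) mod int p ^ n) \<in> carrier (padic_int p)"
    and "(\<lambda>n. (- a n) mod int p ^ n) \<in> carrier (padic_int p)"
proof -
  have A: "a (Suc n) mod int p ^ n = a n mod int p ^ n"
      and B: "b (Suc n) mod int p ^ n = b n mod int p ^ n" for n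
    using assms by (auto simp: padic_int_def)
  show "(\<lambda>n. (a n * b n) mod int p ^ n) \<in> carrier (padic_int p)"
    using A B assms(3) by (intro padic_int_mod_closed mod_mult_cong) auto
  show "(\<lambda>n. (a n + b n) mod int p ^ n) \<in> carrier (padic_int p)"
    using A B assms(3) by (intro padic_int_mod_closed mod_add_cong) auto
  show "(\<lambda>n. (- a n) mod int p ^ n) \<in> carrier (padic_int p)"
    using A assms(3) by (intro padic_int_mod_closed mod_minus_cong) auto
qed

lemma padic_int_cring:
  assumes "p > 0"
  shows "cring (padic_int p)"
proof (rule cringI)
  have red: "a n mod int p ^ n = a n" if "a \<in> carrier (padic_int p)" for a n
    using that by (auto simp: padic_int_def)
  have one: "\<one>\<^bsub>padic_int p\<^esub> \<in> carrier (padic_int p)"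
    using padic_int_mod_closed[of "\<lambda>_. 1" p] assms by (simp add: padic_int_def)
  have distrib: "(x + y) mod m * z mod m = (x * z mod m + y * z mod m) mod m" for x y z m :: int
    by (simp only: mod_mult_left_eq mod_add_eq distrib_right)
  have assoc: "x * y mod m * z mod m = x * (y * z mod m) mod m" for x y z m :: int
    by (simp only: mod_mult_left_eq mod_mult_right_eq mult.assoc)
  have add_assoc: "((x + y) mod m + z) mod m = (x + (y + z) mod m) mod m" for x y z m :: int
    by (simp only: mod_add_left_eq mod_add_right_eq add.assoc)
  have neg: "((- x) mod m + x) mod m = 0" for x m :: int
    by (simp only: mod_add_left_eq add.left_inverse mod_0)
  have mult_one: "1 mod m * x mod m = x mod m" for x m :: int
    by (simp only: mod_mult_left_eq mult_1)
  show "abelian_group (padic_int p)"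
  proof (rule abelian_groupI)
    show "x \<oplus>\<^bsub>padic_int p\<^esub> y \<in> carrier (padic_int p)"
      if "x \<in> carrier (padic_int p)" "y \<in> carrier (padic_int p)" for x y
      using padic_int_closed(2)[OF that assms] by (simp add: padic_int_def)
    show "\<zero>\<^bsub>padic_int p\<^esub> \<in> carrier (padic_int p)"
      using assms by (simp add: padic_int_def)
    show "\<exists>y\<in>carrier (padic_int p). y \<oplus>\<^bsub>padic_int p\<^esub> x = \<zero>\<^bsub>padic_int p\<^esub>"
      if "x \<in> carrier (padic_int p)" for x
      using padic_int_closed(3)[OF that that assms]
      by (intro bexI[of _ "\<lambda>n. (- x n) mod int p ^ n"]) (simp_all add: padic_int_def neg)
    show "\<zero>\<^bsub>padic_int p\<^esub> \<oplus>\<^bsub>padic_int p\<^esub> x = x" if "x \<in> carrier (padic_int p)" for x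
      using red[OF that] by (simp add: padic_int_def)
    show "(x \<oplus>\<^bsub>padic_int p\<^esub> y) \<oplus>\<^bsub>padic_int p\<^esub> z = x \<oplus>\<^bsub>padic_int p\<^esub> (y \<oplus>\<^bsub>padic_int p\<^esub> z)" for x y z
      by (simp add: padic_int_def add_assoc)
    show "x \<oplus>\<^bsub>padic_int p\<^esub> y = y \<oplus>\<^bsub>padic_int p\<^esub> x" for x y
      by (simp add: padic_int_def add.commute)
  qed
  show "Group.comm_monoid (padic_int p)"
  proof (rule comm_monoidI)
    show "x \<otimes>\<^bsub>padic_int p\<^esub> y \<in> carrier (padic_int p)"
      if "x \<in> carrier (padic_int p)" "y \<in> carrier (padic_int p)" for x y
      using padic_int_closed(1)[OF that assms] by (simp add: padic_int_def)
    show "\<one>\<^bsub>padic_int p\<^esub> \<otimes>\<^bsub>padic_int p\<^esub> x = x" if "x \<in> carrier (padic_int p)" for x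
      using red[OF that] by (simp add: padic_int_def mult_one)
    show "(x \<otimes>\<^bsub>padic_int p\<^esub> y) \<otimes>\<^bsub>padic_int p\<^esub> z = x \<otimes>\<^bsub>padic_int p\<^esub> (y \<otimes>\<^bsub>padic_int p\<^esub> z)" for x y z
      by (simp add: padic_int_def assoc)
    show "x \<otimes>\<^bsub>padic_int p\<^esub> y = y \<otimes>\<^bsub>padic_int p\<^esub> x" for x y
      by (simp add: padic_int_def mult.commute)
  qed (rule one)
  show "(x \<oplus>\<^bsub>padic_int p\<^esub> y) \<otimes>\<^bsub>padic_int p\<^esub> z =
        x \<otimes>\<^bsub>padic_int p\<^esub> z \<oplus>\<^bsub>padic_int p\<^esub> y \<otimes>\<^bsub>padic_int p\<^esub> z" for x y z
    by (simp add: padic_int_def distrib)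
qed


section \<open>Locally profinite groups\<close>

locale topological_group = group G for G :: "'g monoid" and T :: "'g topology" +
  assumes topspace_carrier: "topspace T = carrier G"
    and continuous_mult: "continuous_map (prod_topology T T) T (\<lambda>(x, y). x \<otimes>\<^bsub>G\<^esub> y)"
    and continuous_inv: "continuous_map T T (\<lambda>x. inv\<^bsub>G\<^esub> x)"

definition compact_open_subgroup :: "'g monoid \<Rightarrow> 'g topology \<Rightarrow> 'g set \<Rightarrow> bool" where
  "compact_open_subgroup G T K \<longleftrightarrow> subgroup K G \<and> compactin T K \<and> openin T K"

locale locally_profinite_group = topological_group +
  assumes hausdorff: "Hausdorff_space T"
    and compact_open_basis:
      "\<And>A. openin T A \<Longrightarrow> \<one>\<^bsub>G\<^esub> \<in> A \<Longrightarrow> \<exists>K. compact_open_subgroup G T K \<and> K \<subseteq> A"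

text \<open>A left Haar measure is taken to be a left invariant Radon measure on the Borel sets that is
  positive on non-empty open sets.\<close>

definition left_haar_measure :: "'g monoid \<Rightarrow> 'g topology \<Rightarrow> 'g measure \<Rightarrow> bool" where
  "left_haar_measure G T m \<longleftrightarrow>
     space m = carrier G \<and> sets m = sigma_sets (carrier G) {A. openin T A} \<and>
     (\<forall>C. compactin T C \<longrightarrow> emeasure m C < \<infinity>) \<and>
     (\<forall>A. openin T A \<and> A \<noteq> {} \<longrightarrow> 0 < emeasure m A) \<and>
     (\<forall>B\<in>sets m. emeasure m B = (INF A\<in>{A. openin T A \<and> B \<subseteq> A}. emeasure m A)) \<and>
     (\<forall>A. openin T A \<longrightarrow> emeasure m A = (SUP C\<in>{C. compactin T C \<and> C \<subseteq> A}. emeasure m C)) \<and>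
     (\<forall>g\<in>carrier G. \<forall>B\<in>sets m. emeasure m (g <#\<^bsub>G\<^esub> B) = emeasure m B)"

definition unimodular :: "'g monoid \<Rightarrow> 'g topology \<Rightarrow> bool" where
  "unimodular G T \<longleftrightarrow>
     (\<exists>m. left_haar_measure G T m \<and>
          (\<forall>g\<in>carrier G. \<forall>B\<in>sets m. emeasure m (B #>\<^bsub>G\<^esub> g) = emeasure m B))"


section \<open>Conjugates, cosets and indices\<close>

definition conjugate :: "'g monoid \<Rightarrow> 'g \<Rightarrow> 'g set \<Rightarrow> 'g set" where
  "conjugate G g A = (g <#\<^bsub>G\<^esub> A) #>\<^bsub>G\<^esub> inv\<^bsub>G\<^esub> g"

definition double_coset :: "'g monoid \<Rightarrow> 'g set \<Rightarrow> 'g \<Rightarrow> 'g set \<Rightarrow> 'g set" where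
  "double_coset G A g B = A <#>\<^bsub>G\<^esub> (g <#\<^bsub>G\<^esub> B)"

text \<open>The sets of double cosets \<open>A\C/B\<close> and of left cosets \<open>C/B\<close>, for \<open>C\<close> a union of such cosets.\<close>

definition double_cosets :: "'g monoid \<Rightarrow> 'g set \<Rightarrow> 'g set \<Rightarrow> 'g set \<Rightarrow> 'g set set" where
  "double_cosets G A C B = (\<lambda>g. double_coset G A g B) ` C"

definition left_cosets :: "'g monoid \<Rightarrow> 'g set \<Rightarrow> 'g set \<Rightarrow> 'g set set" where
  "left_cosets G C B = (\<lambda>g. g <#\<^bsub>G\<^esub> B) ` C"

text \<open>Sums over coset spaces are sums over the cosets themselves, each summand being evaluated at a
  chosen representative; the summands below do not depend on the choice.\<close>

definition rep :: "'g set \<Rightarrow> 'g" where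
  "rep C = (SOME g. g \<in> C)"

definition subgroup_index :: "'g monoid \<Rightarrow> 'g set \<Rightarrow> 'g set \<Rightarrow> nat" where
  "subgroup_index G K L = card (rcosets\<^bsub>G\<lparr>carrier := K\<rparr>\<^esub> L)"


section \<open>RIC functors\<close>

locale level_collection = locally_profinite_group +
  fixes \<Upsilon> :: "'a set set"
  assumes nonempty: "\<Upsilon> \<noteq> {}"
    and compact_open: "\<And>K. K \<in> \<Upsilon> \<Longrightarrow> compact_open_subgroup G T K"
    and T1: "\<And>g K. g \<in> carrier G \<Longrightarrow> K \<in> \<Upsilon> \<Longrightarrow> conjugate G g K \<in> \<Upsilon>"
    and T2: "\<And>K L. K \<in> \<Upsilon> \<Longrightarrow> L \<in> \<Upsilon> \<Longrightarrow> \<exists>K'\<in>\<Upsilon>. K' \<lhd> (G\<lparr>carrier := K\<rparr>) \<and> K' \<subseteq> L"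
    and T3: "\<And>K L. K \<in> \<Upsilon> \<Longrightarrow> L \<in> \<Upsilon> \<Longrightarrow> K \<inter> L \<in> \<Upsilon>"

definition level_hom :: "'g monoid \<Rightarrow> 'g set \<Rightarrow> 'g set \<Rightarrow> 'g set" where
  "level_hom G L K = {g \<in> carrier G. conjugate G (inv\<^bsub>G\<^esub> g) L \<subseteq> K}"

definition linear_maps :: "'r ring \<Rightarrow> ('r, 'm) module \<Rightarrow> ('r, 'n) module \<Rightarrow> ('m \<Rightarrow> 'n) set" where
  "linear_maps R A B =
     {f \<in> carrier A \<rightarrow> carrier B.
        (\<forall>x\<in>carrier A. \<forall>y\<in>carrier A. f (x \<oplus>\<^bsub>A\<^esub> y) = f x \<oplus>\<^bsub>B\<^esub> f y) \<and>
        (\<forall>a\<in>carrier R. \<forall>x\<in>carrier A. f (a \<odot>\<^bsub>A\<^esub> x) = a \<odot>\<^bsub>B\<^esub> f x)}"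

text \<open>\<open>pull M L K g\<close> stands for \<open>[g]\<^sup>* : M(K) \<rightarrow> M(L)\<close> and \<open>push M L K g\<close> for
  \<open>[g]\<^sub>* : M(L) \<rightarrow> M(K)\<close>, where \<open>g\<close> is a morphism from \<open>L\<close> to \<open>K\<close>. They are only meaningful
  on the carriers.\<close>

record ('g, 'r, 'm) ric =
  obj :: "'g set \<Rightarrow> ('r, 'm) module"
  pull :: "'g set \<Rightarrow> 'g set \<Rightarrow> 'g \<Rightarrow> 'm \<Rightarrow> 'm"
  push :: "'g set \<Rightarrow> 'g set \<Rightarrow> 'g \<Rightarrow> 'm \<Rightarrow> 'm"

locale ric_functor =
  fixes R :: "'r ring" and G :: "'g monoid" and \<Upsilon> :: "'g set set" and M :: "('g, 'r, 'm) ric"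
  assumes obj_module: "\<And>K. K \<in> \<Upsilon> \<Longrightarrow> Module.module R (obj M K)"
    and pull_linear: "\<And>L K g. \<lbrakk>L \<in> \<Upsilon>; K \<in> \<Upsilon>; g \<in> level_hom G L K\<rbrakk> \<Longrightarrow>
          pull M L K g \<in> linear_maps R (obj M K) (obj M L)"
    and push_linear: "\<And>L K g. \<lbrakk>L \<in> \<Upsilon>; K \<in> \<Upsilon>; g \<in> level_hom G L K\<rbrakk> \<Longrightarrow>
          push M L K g \<in> linear_maps R (obj M L) (obj M K)"
    and pull_id: "\<And>K x. \<lbrakk>K \<in> \<Upsilon>; x \<in> carrier (obj M K)\<rbrakk> \<Longrightarrow> pull M K K \<one>\<^bsub>G\<^esub> x = x"
    and push_id: "\<And>K x. \<lbrakk>K \<in> \<Upsilon>; x \<in> carrier (obj M K)\<rbrakk> \<Longrightarrow> push M K K \<one>\<^bsub>G\<^esub> x = x"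
    and pull_comp: "\<And>L' L K h g x.
          \<lbrakk>L' \<in> \<Upsilon>; L \<in> \<Upsilon>; K \<in> \<Upsilon>; h \<in> level_hom G L' L; g \<in> level_hom G L K; x \<in> carrier (obj M K)\<rbrakk>
          \<Longrightarrow> pull M L' K (h \<otimes>\<^bsub>G\<^esub> g) x = pull M L' L h (pull M L K g x)"
    and push_comp: "\<And>L' L K h g x.
          \<lbrakk>L' \<in> \<Upsilon>; L \<in> \<Upsilon>; K \<in> \<Upsilon>; h \<in> level_hom G L' L; g \<in> level_hom G L K; x \<in> carrier (obj M L')\<rbrakk>
          \<Longrightarrow> push M L' K (h \<otimes>\<^bsub>G\<^esub> g) x = push M L K g (push M L' L h x)"
    and pull_eq_push: "\<And>L K g x.
          \<lbrakk>L \<in> \<Upsilon>; K \<in> \<Upsilon>; g \<in> carrier G; conjugate G (inv\<^bsub>G\<^esub> g) L = K; x \<in> carrier (obj M K)\<rbrakk>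
          \<Longrightarrow> pull M L K g x = push M K L (inv\<^bsub>G\<^esub> g) x"
    and push_inner: "\<And>K \<gamma> x. \<lbrakk>K \<in> \<Upsilon>; \<gamma> \<in> K; x \<in> carrier (obj M K)\<rbrakk> \<Longrightarrow> push M K K \<gamma> x = x"

definition cohomological :: "'g monoid \<Rightarrow> 'g set set \<Rightarrow> ('g, 'r, 'm) ric \<Rightarrow> bool" where
  "cohomological G \<Upsilon> M \<longleftrightarrow>
     (\<forall>L\<in>\<Upsilon>. \<forall>K\<in>\<Upsilon>. L \<subseteq> K \<longrightarrow> (\<forall>x\<in>carrier (obj M K).
        push M L K \<one>\<^bsub>G\<^esub> (pull M L K \<one>\<^bsub>G\<^esub> x) = [subgroup_index G K L] \<cdot>\<^bsub>obj M K\<^esub> x))"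

definition mackey :: "'g monoid \<Rightarrow> 'g set set \<Rightarrow> ('g, 'r, 'm) ric \<Rightarrow> bool" where
  "mackey G \<Upsilon> M \<longleftrightarrow>
     (\<forall>K\<in>\<Upsilon>. \<forall>L\<in>\<Upsilon>. \<forall>L'\<in>\<Upsilon>. L \<subseteq> K \<and> L' \<subseteq> K \<longrightarrow> (\<forall>x\<in>carrier (obj M L').
        pull M L K \<one>\<^bsub>G\<^esub> (push M L' K \<one>\<^bsub>G\<^esub> x) =
        (\<Oplus>\<^bsub>obj M L\<^esub>C\<in>double_cosets G L K L'.
           (let \<gamma> = rep C; L\<^sub>\<gamma> = L \<inter> conjugate G \<gamma> L'
            in push M L\<^sub>\<gamma> L \<one>\<^bsub>G\<^esub> (pull M L\<^sub>\<gamma> L' \<gamma> x)))))"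

definition comackey_functor ::
  "'r ring \<Rightarrow> 'g monoid \<Rightarrow> 'g set set \<Rightarrow> ('g, 'r, 'm) ric \<Rightarrow> bool" where
  "comackey_functor R G \<Upsilon> M \<longleftrightarrow> ric_functor R G \<Upsilon> M \<and> cohomological G \<Upsilon> M \<and> mackey G \<Upsilon> M"

text \<open>The group \<open>H\<close> is a subgroup of \<open>G\<close>; the map \<open>\<iota> V K'\<close> goes from \<open>N(V)\<close> to \<open>M(K')\<close>.\<close>

locale pushforward =
  fixes R :: "'r ring" and H G :: "'g monoid" and \<Upsilon>\<^sub>H \<Upsilon>\<^sub>G :: "'g set set"
    and N :: "('g, 'r, 'n) ric" and M :: "('g, 'r, 'm) ric"
    and \<iota> :: "'g set \<Rightarrow> 'g set \<Rightarrow> 'n \<Rightarrow> 'm"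
  assumes linear: "\<And>V K'. \<lbrakk>V \<in> \<Upsilon>\<^sub>H; K' \<in> \<Upsilon>\<^sub>G; V \<subseteq> K'\<rbrakk> \<Longrightarrow>
        \<iota> V K' \<in> linear_maps R (obj N V) (obj M K')"
    and commute_push: "\<And>V V' K' L' h x.
        \<lbrakk>V \<in> \<Upsilon>\<^sub>H; V' \<in> \<Upsilon>\<^sub>H; K' \<in> \<Upsilon>\<^sub>G; L' \<in> \<Upsilon>\<^sub>G; V \<subseteq> K'; V' \<subseteq> L';
          h \<in> level_hom H V' V; h \<in> level_hom G L' K'; x \<in> carrier (obj N V')\<rbrakk>
        \<Longrightarrow> \<iota> V K' (push N V' V h x) = push M L' K' h (\<iota> V' L' x)"

definition mackey_pushforward ::
  "'g monoid \<Rightarrow> 'g set set \<Rightarrow> 'g set set \<Rightarrow> ('g, 'r, 'n) ric \<Rightarrow> ('g, 'r, 'm) ric \<Rightarrow>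
   ('g set \<Rightarrow> 'g set \<Rightarrow> 'n \<Rightarrow> 'm) \<Rightarrow> bool" where
  "mackey_pushforward G \<Upsilon>\<^sub>H \<Upsilon>\<^sub>G N M \<iota> \<longleftrightarrow>
     (\<forall>V\<in>\<Upsilon>\<^sub>H. \<forall>L\<in>\<Upsilon>\<^sub>G. \<forall>K'\<in>\<Upsilon>\<^sub>G. V \<subseteq> K' \<and> L \<subseteq> K' \<longrightarrow> (\<forall>x\<in>carrier (obj N V).
        pull M L K' \<one>\<^bsub>G\<^esub> (\<iota> V K' x) =
        (\<Oplus>\<^bsub>obj M L\<^esub>C\<in>double_cosets G V K' L.
           (let \<gamma> = rep C; L\<^sub>\<gamma> = conjugate G \<gamma> L; V\<^sub>\<gamma> = V \<inter> L\<^sub>\<gamma>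
            in push M L\<^sub>\<gamma> L \<gamma> (\<iota> V\<^sub>\<gamma> L\<^sub>\<gamma> (pull N V\<^sub>\<gamma> V \<one>\<^bsub>G\<^esub> x))))))"

text \<open>\<open>hecke G M K' \<sigma> K\<close> is \<open>[K'\<sigma>K] : M(K) \<rightarrow> M(K')\<close>.\<close>

definition hecke :: "'g monoid \<Rightarrow> ('g, 'r, 'm) ric \<Rightarrow> 'g set \<Rightarrow> 'g \<Rightarrow> 'g set \<Rightarrow> 'm \<Rightarrow> 'm" where
  "hecke G M K' \<sigma> K x =
     (let A = K' \<inter> conjugate G \<sigma> K; B = K \<inter> conjugate G (inv\<^bsub>G\<^esub> \<sigma>) K'
      in push M A K' \<one>\<^bsub>G\<^esub> (pull M A B \<sigma> (pull M B K \<one>\<^bsub>G\<^esub> x)))"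

definition hecke_push :: "'g monoid \<Rightarrow> ('g, 'r, 'm) ric \<Rightarrow> 'g set \<Rightarrow> 'g \<Rightarrow> 'g set \<Rightarrow> 'm \<Rightarrow> 'm" where
  "hecke_push G M K' \<sigma> K = hecke G M K (inv\<^bsub>G\<^esub> \<sigma>) K'"


section \<open>Restricted products\<close>

definition restricted_set :: "'i set \<Rightarrow> ('i \<Rightarrow> 'a set) \<Rightarrow> ('i \<Rightarrow> 'a set) \<Rightarrow> ('i \<Rightarrow> 'a) set" where
  "restricted_set I A B = {x \<in> (\<Pi>\<^sub>E v\<in>I. A v). finite {v \<in> I. x v \<notin> B v}}"

definition restricted_group ::
  "'i set \<Rightarrow> ('i \<Rightarrow> 'g monoid) \<Rightarrow> ('i \<Rightarrow> 'g set) \<Rightarrow> ('i \<Rightarrow> 'g) monoid" where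
  "restricted_group I G K =
     (product_group I G)\<lparr>carrier := restricted_set I (\<lambda>v. carrier (G v)) K\<rparr>"

text \<open>When all \<open>B v\<close> are open, the generating sets are closed under finite intersections and cover
  exactly the restricted product.\<close>

definition restricted_topology ::
  "'i set \<Rightarrow> ('i \<Rightarrow> 'a topology) \<Rightarrow> ('i \<Rightarrow> 'a set) \<Rightarrow> ('i \<Rightarrow> 'a) topology" where
  "restricted_topology I T B =
     topology_generated_by
       {\<Pi>\<^sub>E v\<in>I. A v | A. (\<forall>v\<in>I. openin (T v) (A v)) \<and> finite {v \<in> I. A v \<noteq> B v}}"

lemma topspace_restricted_topology:
  assumes B: "\<And>v. v \<in> I \<Longrightarrow> openin (T v) (B v)"
  shows "topspace (restricted_topology I T B) = restricted_set I (\<lambda>v. topspace (T v)) B"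
    (is "_ = ?R")
proof -
  define \<S> where
    "\<S> = {\<Pi>\<^sub>E v\<in>I. A v | A. (\<forall>v\<in>I. openin (T v) (A v)) \<and> finite {v \<in> I. A v \<noteq> B v}}"
  have "?R = \<Union>\<S>"
  proof (intro equalityI subsetI)
    fix x assume x: "x \<in> ?R"
    define A where "A = (\<lambda>v. if x v \<in> B v then B v else topspace (T v))"
    have "{v \<in> I. A v \<noteq> B v} \<subseteq> {v \<in> I. x v \<notin> B v}"
      by (auto simp: A_def)
    moreover have "finite {v \<in> I. x v \<notin> B v}"
      using x by (simp add: restricted_set_def)
    ultimately have "finite {v \<in> I. A v \<noteq> B v}"
      by (rule finite_subset)
    moreover have "\<forall>v\<in>I. openin (T v) (A v)"
      using B by (simp add: A_def)
    ultimately have "(\<Pi>\<^sub>E v\<in>I. A v) \<in> \<S>"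
      unfolding \<S>_def by (intro CollectI exI[of _ A] conjI refl)
    moreover have "x \<in> (\<Pi>\<^sub>E v\<in>I. A v)"
      using x by (auto simp: restricted_set_def A_def PiE_iff)
    ultimately show "x \<in> \<Union>\<S>"
      by (rule UnionI)
  next
    fix x assume "x \<in> \<Union>\<S>"
    then obtain P where P: "P \<in> \<S>" "x \<in> P"
      by (rule UnionE)
    from P(1) obtain A where A: "P = (\<Pi>\<^sub>E v\<in>I. A v)" "\<forall>v\<in>I. openin (T v) (A v)"
        "finite {v \<in> I. A v \<noteq> B v}"
      unfolding \<S>_def by (elim CollectE exE conjE)
    have "{v \<in> I. x v \<notin> B v} \<subseteq> {v \<in> I. A v \<noteq> B v}"
      using P(2) A(1) by (auto simp: PiE_iff)
    then have "finite {v \<in> I. x v \<notin> B v}"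
      using A(3) by (rule finite_subset)
    moreover have "x \<in> (\<Pi>\<^sub>E v\<in>I. topspace (T v))"
      using PiE_mono[of I A "\<lambda>v. topspace (T v)"] P(2) A(1,2) openin_subset by blast
    ultimately show "x \<in> ?R"
      by (simp add: restricted_set_def)
  qed
  then show ?thesis
    by (simp add: restricted_topology_def topology_generated_by_topspace \<S>_def)
qed

text \<open>The level \<open>K[\<nu>]\<close>.\<close>

definition level :: "'i set \<Rightarrow> ('i \<Rightarrow> 'g set) \<Rightarrow> ('i \<Rightarrow> 'g set) \<Rightarrow> 'i set \<Rightarrow> ('i \<Rightarrow> 'g) set" where
  "level I K L \<nu> = (\<Pi>\<^sub>E v\<in>I. if v \<in> \<nu> then L v else K v)"

definition at_place :: "'i set \<Rightarrow> ('i \<Rightarrow> 'g monoid) \<Rightarrow> 'i \<Rightarrow> 'g \<Rightarrow> 'i \<Rightarrow> 'g" where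
  "at_place I G v \<sigma> = (\<lambda>w\<in>I. if w = v then \<sigma> else \<one>\<^bsub>G w\<^esub>)"

definition product_form :: "'i set \<Rightarrow> ('i \<Rightarrow> 'g) set \<Rightarrow> bool" where
  "product_form I W \<longleftrightarrow> (\<exists>w. W = (\<Pi>\<^sub>E v\<in>I. w v))"


section \<open>Functions valued in a ring\<close>

definition ch :: "'r ring \<Rightarrow> 'a set \<Rightarrow> 'a \<Rightarrow> 'r" where
  "ch R A x = (if x \<in> A then \<one>\<^bsub>R\<^esub> else \<zero>\<^bsub>R\<^esub>)"

definition supp :: "'r ring \<Rightarrow> 'a topology \<Rightarrow> ('a \<Rightarrow> 'r) \<Rightarrow> 'a set" where
  "supp R X f = X closure_of {x \<in> topspace X. f x \<noteq> \<zero>\<^bsub>R\<^esub>}"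

text \<open>The function \<open>\<Sum>\<sigma>\<in>S. c \<sigma> ch(A\<sigma>B)\<close>.\<close>

definition double_coset_sum ::
  "'r ring \<Rightarrow> 'g monoid \<Rightarrow> 'g set \<Rightarrow> 'g set \<Rightarrow> 'g set \<Rightarrow> ('g \<Rightarrow> 'r) \<Rightarrow> 'g \<Rightarrow> 'r" where
  "double_coset_sum R G A B S c x =
     (\<Oplus>\<^bsub>R\<^esub>\<sigma>\<in>S. c \<sigma> \<otimes>\<^bsub>R\<^esub> ch R (double_coset G A \<sigma> B) x)"

text \<open>The operator \<open>\<Sum>\<sigma>\<in>S. c \<sigma> [P\<sigma>P]\<^sub>*\<close> on \<open>M(P)\<close>, where \<open>S\<close> is embedded in the restricted product
  at the place \<open>v\<close>. The operators at different places commute on \<open>M(P)\<close>, but not as functions on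
  the whole type; a composition over a finite set of places is therefore expressed by \<^const>\<open>foldr\<close>
  along an arbitrary enumeration of the set.\<close>

definition local_hecke ::
  "'i set \<Rightarrow> ('i \<Rightarrow> 'g monoid) \<Rightarrow> ('i \<Rightarrow> 'g) monoid \<Rightarrow> ('i \<Rightarrow> 'g, 'r, 'm) ric \<Rightarrow>
   ('i \<Rightarrow> 'g) set \<Rightarrow> 'i \<Rightarrow> 'g set \<Rightarrow> ('g \<Rightarrow> 'r) \<Rightarrow> 'm \<Rightarrow> 'm" where
  "local_hecke I G GG M P v S c x =
     (\<Oplus>\<^bsub>obj M P\<^esub>\<sigma>\<in>S. c \<sigma> \<odot>\<^bsub>obj M P\<^esub> hecke_push GG M P (at_place I G v \<sigma>) P x)"


section \<open>Schwartz spaces\<close>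

definition locally_profinite_space :: "'x topology \<Rightarrow> bool" where
  "locally_profinite_space X \<longleftrightarrow>
     locally_compact_space X \<and> Hausdorff_space X \<and> (\<forall>C. connectedin X C \<longrightarrow> (\<exists>x. C \<subseteq> {x}))"

locale continuous_right_action =
  fixes G :: "'g monoid" and T :: "'g topology" and X :: "'x topology" and act :: "'x \<Rightarrow> 'g \<Rightarrow> 'x"
  assumes act_one: "\<And>x. x \<in> topspace X \<Longrightarrow> act x \<one>\<^bsub>G\<^esub> = x"
    and act_mult: "\<And>x g h. \<lbrakk>x \<in> topspace X; g \<in> carrier G; h \<in> carrier G\<rbrakk> \<Longrightarrow>
          act x (g \<otimes>\<^bsub>G\<^esub> h) = act (act x g) h"
    and continuous_act: "continuous_map (prod_topology X T) X (\<lambda>(x, g). act x g)"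

text \<open>Functions on a space are normalised to be \<open>undefined\<close> outside of it. The fields
  \<open>mult\<close> and \<open>one\<close> of the record play no role for modules.\<close>

definition schwartz :: "'r ring \<Rightarrow> 'x topology \<Rightarrow> ('x \<Rightarrow> 'r) set" where
  "schwartz R X =
     {\<xi> \<in> topspace X \<rightarrow>\<^sub>E carrier R.
        (\<forall>x\<in>topspace X. \<exists>A. openin X A \<and> x \<in> A \<and> (\<forall>y\<in>A. \<xi> y = \<xi> x)) \<and>
        compactin X (supp R X \<xi>)}"

definition schwartz_invariants ::
  "'r ring \<Rightarrow> 'x topology \<Rightarrow> ('x \<Rightarrow> 'g \<Rightarrow> 'x) \<Rightarrow> 'g set \<Rightarrow> ('r, 'x \<Rightarrow> 'r) module" where
  "schwartz_invariants R X act W =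
     \<lparr>carrier = {\<xi> \<in> schwartz R X. \<forall>w\<in>W. \<forall>x\<in>topspace X. \<xi> (act x w) = \<xi> x},
      monoid.mult = (\<lambda>\<xi> \<eta>. \<lambda>x\<in>topspace X. \<xi> x \<otimes>\<^bsub>R\<^esub> \<eta> x),
      one = (\<lambda>x\<in>topspace X. \<one>\<^bsub>R\<^esub>),
      zero = (\<lambda>x\<in>topspace X. \<zero>\<^bsub>R\<^esub>),
      add = (\<lambda>\<xi> \<eta>. \<lambda>x\<in>topspace X. \<xi> x \<oplus>\<^bsub>R\<^esub> \<eta> x),
      smult = (\<lambda>a \<xi>. \<lambda>x\<in>topspace X. a \<otimes>\<^bsub>R\<^esub> \<xi> x)\<rparr>"

text \<open>The identification \<open>\<theta> W : N(W) \<rightarrow> S\<^sub>X(W)\<close> for \<open>W\<close> of product form, under which the structure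
  maps of \<open>N\<close> become those of the invariants of a smooth representation. The function
  \<open>\<gamma>h\<inverse>\<cdot>\<xi>\<close> sends \<open>x\<close> to \<open>\<xi>(x\<gamma>h\<inverse>)\<close>.\<close>

locale schwartz_identification =
  fixes R :: "'r ring" and I :: "'i set" and H :: "('i \<Rightarrow> 'g) monoid"
    and \<Upsilon>\<^sub>H :: "('i \<Rightarrow> 'g) set set" and N :: "('i \<Rightarrow> 'g, 'r, 'n) ric"
    and X :: "'x topology" and act :: "'x \<Rightarrow> ('i \<Rightarrow> 'g) \<Rightarrow> 'x"
    and \<theta> :: "('i \<Rightarrow> 'g) set \<Rightarrow> 'n \<Rightarrow> ('x \<Rightarrow> 'r)"
  assumes iso: "\<And>W. \<lbrakk>W \<in> \<Upsilon>\<^sub>H; product_form I W\<rbrakk> \<Longrightarrow>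
        \<theta> W \<in> linear_maps R (obj N W) (schwartz_invariants R X act W) \<and>
        bij_betw (\<theta> W) (carrier (obj N W)) (carrier (schwartz_invariants R X act W))"
    and pull_eq: "\<And>V W h \<xi>.
        \<lbrakk>V \<in> \<Upsilon>\<^sub>H; W \<in> \<Upsilon>\<^sub>H; product_form I V; product_form I W; h \<in> level_hom H V W;
          \<xi> \<in> carrier (obj N W)\<rbrakk>
        \<Longrightarrow> \<theta> V (pull N V W h \<xi>) = (\<lambda>x\<in>topspace X. \<theta> W \<xi> (act x h))"
    and push_eq: "\<And>V W h \<xi>.
        \<lbrakk>V \<in> \<Upsilon>\<^sub>H; W \<in> \<Upsilon>\<^sub>H; product_form I V; product_form I W; h \<in> level_hom H V W;
          \<xi> \<in> carrier (obj N V)\<rbrakk>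
        \<Longrightarrow> \<theta> W (push N V W h \<xi>) =
            (\<lambda>x\<in>topspace X. \<Oplus>\<^bsub>R\<^esub>C\<in>left_cosets H W (conjugate H (inv\<^bsub>H\<^esub> h) V).
               \<theta> V \<xi> (act x (rep C \<otimes>\<^bsub>H\<^esub> inv\<^bsub>H\<^esub> h)))"

text \<open>The map \<open>\<Sum>h\<in>J. d h [A h\<inverse> B]\<close> from \<open>B\<close>-invariant to \<open>A\<close>-invariant functions.\<close>

definition schwartz_hecke ::
  "'r ring \<Rightarrow> 'g monoid \<Rightarrow> ('x \<Rightarrow> 'g \<Rightarrow> 'x) \<Rightarrow> 'g set \<Rightarrow> 'g set \<Rightarrow> 'g set \<Rightarrow> ('g \<Rightarrow> 'r) \<Rightarrow>
   ('x \<Rightarrow> 'r) \<Rightarrow> 'x \<Rightarrow> 'r" where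
  "schwartz_hecke R G act A B J d \<xi> x =
     (\<Oplus>\<^bsub>R\<^esub>h\<in>J. d h \<otimes>\<^bsub>R\<^esub>
        (\<Oplus>\<^bsub>R\<^esub>C\<in>left_cosets G (double_coset G A (inv\<^bsub>G\<^esub> h) B) B. \<xi> (act x (rep C))))"

text \<open>The group \<open>V(x, W)\<close>.\<close>

definition stab_extension ::
  "'g monoid \<Rightarrow> ('x \<Rightarrow> 'g \<Rightarrow> 'x) \<Rightarrow> 'g set \<Rightarrow> 'x \<Rightarrow> 'g set \<Rightarrow> 'g set" where
  "stab_extension G act V x W = generate G (V \<union> {w \<in> W. act x w = x})"

end

theory Submission
  imports Defs
begin

text \<open>
  For \<open>\<tau> \<in> G\<close> and \<open>V \<subseteq> \<tau>P\<tau>\<inverse>\<close> write \<open>[V, \<tau>, x] = [\<tau>]\<^sub>* (\<iota>\<^sub>* x) \<in> M(P)\<close> for \<open>x \<in> N(V)\<close>. The Mackey property of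
  \<open>\<iota>\<close> gives \<open>[P\<sigma>P]\<^sub>* [W, g, x] = \<Sum>\<^sub>\<tau> [W \<inter> \<tau>P\<tau>\<inverse>, \<tau>, pr\<^sup>* x]\<close> over \<open>\<tau> \<in> W\gP\<sigma>P/P\<close>. At a place \<open>v\<close> where the level is
  \<open>K v\<close> and \<open>x\<close> is a pure tensor with factor \<open>\<phi>\<close> at \<open>v\<close>, sorting the double cosets by their class in
  \<open>H v\G v/K v\<close> turns the Hecke operator at \<open>v\<close> into the sum over \<open>i\<close> of the symbols in which \<open>\<tau>\<close> is
  multiplied by \<open>g v i\<close> and the factor \<open>\<phi>\<close> is replaced by \<open>h\<phi> v i\<close>.

  The divisibility condition makes \<open>h\<phi> v i\<close> a trace of some \<open>\<zeta> v i\<close> invariant under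
  \<open>Vg v i\<close>: a point \<open>x\<close> has a compact open neighbourhood \<open>A\<close>, stable under \<open>D = V(x, H)\<close> and disjoint from its
  translates by elements outside of \<open>D\<close>, and the trace of its characteristic function is \<open>[D : V]\<close> on
  the saturation of \<open>A\<close>. Taking \<open>y\<^sub>\<nu>\<close> to be the sum of the symbols of the pure tensors with factor
  \<open>\<zeta> v i\<close> at the places of \<open>\<nu>\<close> and \<open>\<phi>\<close> elsewhere, each trace from a place of \<open>\<mu> - \<nu>\<close> replaces \<open>\<zeta> v i\<close> by
  \<open>h\<phi> v i\<close>, as the Hecke operator does with \<open>\<phi>\<close>.
\<close>

section \<open>Cosets and sums over them\<close>

text \<open>The index [D : V] in the divisibility condition comes from a count. A function invariant
  under V and concentrated near x has support stable under V, and the stabilizer of x brings this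
  support back to x as well; so the elements that cannot be separated from the support generate D.
  In the trace over W/V exactly the cosets inside D return a point of A to A, and a constant z on A
  is sent to [D : V] z there. Elements of N can be handled as functions only at levels of product
  form. Every level used is therefore a product over I, and each operation changes it at a single
  place v; it then acts on the factor at v, while the rest of the tensor is carried along as a
  constant. The representative and the factor of a place change together. A Hecke operator at v can
  act as long as they are 1 and ch(Y_v), a state that the operators at other places do not disturb,
  so the places of \<mu> - \<nu> may be taken in any order.\<close>

lemma (in abelian_monoid) finsum_bij_betw:
  assumes "bij_betw h A B" and "\<And>x. x \<in> A \<Longrightarrow> f x = u (h x)" and "u \<in> B \<rightarrow> carrier G"
  shows "finsum G f A = finsum G u B"
proof -
  have B: "B = h ` A" and inj: "inj_on h A"
    using assms(1) by (auto simp: bij_betw_def)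
  have "finsum G u B = finsum G (\<lambda>x. u (h x)) A"
    unfolding B using assms(3) B inj by (intro finsum_reindex) auto
  also have "\<dots> = finsum G f A"
    using assms B by (intro finsum_cong') auto
  finally show ?thesis by simp
qed

lemma (in abelian_monoid) finsum_swap:
  assumes "finite A" "finite B" "\<And>i j. i \<in> A \<Longrightarrow> j \<in> B \<Longrightarrow> f i j \<in> carrier G"
  shows "(\<Oplus>i\<in>A. \<Oplus>j\<in>B. f i j) = (\<Oplus>j\<in>B. \<Oplus>i\<in>A. f i j)"
  using assms(1,3)
proof (induction A)
  case empty
  then show ?case by (simp add: finsum_zero)
next
  case (insert a A)
  then have "(\<Oplus>i\<in>insert a A. \<Oplus>j\<in>B. f i j) = (\<Oplus>j\<in>B. f a j) \<oplus> (\<Oplus>j\<in>B. \<Oplus>i\<in>A. f i j)"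
    by (simp add: Pi_def)
  also have "\<dots> = (\<Oplus>j\<in>B. f a j \<oplus> (\<Oplus>i\<in>A. f i j))"
    using insert by (subst finsum_addf) (auto simp: Pi_def)
  also have "\<dots> = (\<Oplus>j\<in>B. \<Oplus>i\<in>insert a A. f i j)"
    using insert by (intro finsum_cong') (auto simp: Pi_def)
  finally show ?case .
qed

lemma (in abelian_monoid) finsum_Sigma:
  assumes "finite A" "\<And>i. i \<in> A \<Longrightarrow> finite (B i)"
    and "\<And>i j. i \<in> A \<Longrightarrow> j \<in> B i \<Longrightarrow> f i j \<in> carrier G"
  shows "(\<Oplus>i\<in>A. \<Oplus>j\<in>B i. f i j) = (\<Oplus>x\<in>Sigma A B. f (fst x) (snd x))"
  using assms
proof (induction A)
  case empty
  then show ?case by simp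
next
  case (insert a A)
  have eq: "Sigma (insert a A) B = Pair a ` B a \<union> Sigma A B" by auto
  have "(\<Oplus>x\<in>Sigma (insert a A) B. f (fst x) (snd x)) =
      (\<Oplus>x\<in>Pair a ` B a. f (fst x) (snd x)) \<oplus> (\<Oplus>x\<in>Sigma A B. f (fst x) (snd x))"
    unfolding eq using insert by (intro finsum_Un_disjoint) auto
  also have "(\<Oplus>x\<in>Pair a ` B a. f (fst x) (snd x)) = (\<Oplus>j\<in>B a. f a j)"
    using insert by (subst finsum_reindex) (auto simp: inj_on_def)
  finally show ?case
    using insert by (simp add: Pi_def)
qed

lemma (in abelian_monoid) finsum_mono_neutral:
  assumes "finite B" "A \<subseteq> B" "\<And>x. x \<in> B - A \<Longrightarrow> f x = \<zero>" "f \<in> B \<rightarrow> carrier G"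
  shows "finsum G f A = finsum G f B"
  using add.finprod_mono_neutral_cong_left[OF assms(1,2,3) refl assms(4)] .

text \<open>The constants on cosets are only available for groups without record extension.\<close>

locale plain_group = group G for G :: "'g monoid" (structure)
begin

section \<open>Left cosets, double cosets and their representatives\<close>

lemma l_coset_mem_iff:
  assumes "g \<in> carrier G" "B \<subseteq> carrier G"
  shows "x \<in> g <# B \<longleftrightarrow> x \<in> carrier G \<and> inv g \<otimes> x \<in> B"
proof
  assume "x \<in> carrier G \<and> inv g \<otimes> x \<in> B"
  moreover have "x = g \<otimes> (inv g \<otimes> x)" if "x \<in> carrier G"
    using that assms by (simp add: m_assoc[symmetric])
  ultimately show "x \<in> g <# B" unfolding l_coset_def by blast
qed (use assms in \<open>auto simp: l_coset_def m_assoc[symmetric]\<close>)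

lemma l_coset_absorb:
  assumes "subgroup B G" "g \<in> carrier G" "b \<in> B"
  shows "(g \<otimes> b) <# B = g <# B"
proof -
  have b: "b \<in> carrier G" and B: "B \<subseteq> carrier G"
    using assms subgroup.subset by blast+
  have "inv (g \<otimes> b) \<otimes> x \<in> B \<longleftrightarrow> inv g \<otimes> x \<in> B" if x: "x \<in> carrier G" for x
  proof -
    have e: "inv (g \<otimes> b) \<otimes> x = inv b \<otimes> (inv g \<otimes> x)"
      using assms b x by (simp add: inv_mult_group m_assoc)
    have e': "inv g \<otimes> x = b \<otimes> (inv b \<otimes> (inv g \<otimes> x))"
      using assms b x by (simp add: m_assoc[symmetric])
    show ?thesis
      using e e' assms by (metis subgroup.m_closed subgroup.m_inv_closed)
  qed
  then show ?thesis
    using assms b B by (auto simp: l_coset_mem_iff)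
qed

lemma mem_own_l_coset:
  assumes "subgroup B G" "g \<in> carrier G"
  shows "g \<in> g <# B"
  using assms by (simp add: l_coset_mem_iff subgroup.subset subgroup.one_closed)

lemma l_coset_eq_iff:
  assumes "subgroup B G" "g \<in> carrier G" "g' \<in> carrier G"
  shows "g <# B = g' <# B \<longleftrightarrow> inv g \<otimes> g' \<in> B"
proof
  assume "g <# B = g' <# B"
  then have "g' \<in> g <# B" using mem_own_l_coset assms by blast
  then show "inv g \<otimes> g' \<in> B" using assms by (simp add: l_coset_mem_iff subgroup.subset)
next
  assume "inv g \<otimes> g' \<in> B"
  then have "(g \<otimes> (inv g \<otimes> g')) <# B = g <# B" using assms l_coset_absorb by blast
  then show "g <# B = g' <# B" using assms by (simp add: m_assoc[symmetric])
qed

text \<open>The element picked by \<open>rep\<close> differs from a given representative by right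
  multiplication with an element of \<open>B\<close>; independence of a summand from the choice is
  reduced to this.\<close>

lemma rep_l_coset:
  assumes "subgroup B G" "g \<in> carrier G"
  obtains b where "b \<in> B" "rep (g <# B) = g \<otimes> b"
proof -
  have "rep (g <# B) \<in> g <# B"
    unfolding rep_def using mem_own_l_coset[OF assms] by (rule someI)
  then show ?thesis using that by (auto simp: l_coset_def)
qed

lemma rep_left_cosets:
  assumes "subgroup B G" "E \<subseteq> carrier G" "C \<in> left_cosets G E B" "\<And>e b. e \<in> E \<Longrightarrow> b \<in> B \<Longrightarrow> e \<otimes> b \<in> E"
  shows "rep C \<in> E" "C = rep C <# B"
proof -
  obtain g where g: "g \<in> E" "C = g <# B" using assms(3) by (auto simp: left_cosets_def)
  then obtain b where "b \<in> B" "rep C = g \<otimes> b" using rep_l_coset assms by blast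
  then show "rep C \<in> E" "C = rep C <# B" using g assms l_coset_absorb by auto
qed

lemma translate_subgroup_image:
  assumes "subgroup B G" "b \<in> B"
  shows "(\<lambda>e. b \<otimes> e) ` B = B"
proof (intro equalityI subsetI)
  fix e assume e: "e \<in> B"
  then have "e = b \<otimes> (inv b \<otimes> e)"
    using assms subgroup.subset by (metis inv_closed m_assoc r_inv l_one subsetD)
  moreover have "inv b \<otimes> e \<in> B" using e assms by (simp add: subgroup.m_closed subgroup.m_inv_closed)
  ultimately show "e \<in> (\<lambda>e. b \<otimes> e) ` B" by blast
qed (use assms in \<open>auto intro: subgroup.m_closed\<close>)

lemma double_coset_mem_iff:
  "x \<in> double_coset G A g B \<longleftrightarrow> (\<exists>a\<in>A. \<exists>b\<in>B. x = a \<otimes> (g \<otimes> b))"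
  by (auto simp: double_coset_def set_mult_def l_coset_def)

lemma double_coset_subset:
  assumes "A \<subseteq> carrier G" "B \<subseteq> carrier G" "g \<in> carrier G"
  shows "double_coset G A g B \<subseteq> carrier G"
  using assms by (force simp: double_coset_mem_iff intro!: m_closed)

lemma mem_own_double_coset:
  assumes "subgroup A G" "subgroup B G" "g \<in> carrier G"
  shows "g \<in> double_coset G A g B"
  unfolding double_coset_mem_iff using assms
  by (intro bexI[of _ \<one>]) (auto simp: subgroup.one_closed)

lemma double_coset_absorb:
  assumes "subgroup A G" "subgroup B G" "g \<in> carrier G" "a \<in> A" "b \<in> B"
  shows "double_coset G A (a \<otimes> (g \<otimes> b)) B = double_coset G A g B"
proof -
  have sub: "A \<subseteq> carrier G" "B \<subseteq> carrier G" using assms subgroup.subset by auto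
  then have c: "a \<in> carrier G" "b \<in> carrier G" using assms by auto
  show ?thesis
  proof (intro equalityI subsetI)
    fix x assume "x \<in> double_coset G A (a \<otimes> (g \<otimes> b)) B"
    then obtain a' b' where x: "a' \<in> A" "b' \<in> B" "x = a' \<otimes> (a \<otimes> (g \<otimes> b) \<otimes> b')"
      by (auto simp: double_coset_mem_iff)
    then have "a' \<in> carrier G" "b' \<in> carrier G" using sub by auto
    then have "x = (a' \<otimes> a) \<otimes> (g \<otimes> (b \<otimes> b'))" using x c assms by (simp add: m_assoc)
    then show "x \<in> double_coset G A g B"
      using x assms by (auto simp: double_coset_mem_iff intro!: subgroup.m_closed)
  next
    fix x assume "x \<in> double_coset G A g B"
    then obtain a' b' where x: "a' \<in> A" "b' \<in> B" "x = a' \<otimes> (g \<otimes> b')"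
      by (auto simp: double_coset_mem_iff)
    then have c': "a' \<in> carrier G" "b' \<in> carrier G" using sub by auto
    have "inv b \<otimes> b' \<in> B" "a' \<otimes> inv a \<in> A"
      using x assms by (auto intro!: subgroup.m_closed subgroup.m_inv_closed)
    moreover have "x = (a' \<otimes> inv a) \<otimes> (a \<otimes> (g \<otimes> b) \<otimes> (inv b \<otimes> b'))"
    proof -
      have "(a' \<otimes> inv a) \<otimes> (a \<otimes> (g \<otimes> b) \<otimes> (inv b \<otimes> b')) =
          a' \<otimes> ((inv a \<otimes> a) \<otimes> (g \<otimes> ((b \<otimes> inv b) \<otimes> b')))"
        using c c' assms by (simp only: m_assoc m_closed inv_closed)
      then show ?thesis using x c c' assms by simp
    qed
    ultimately show "x \<in> double_coset G A (a \<otimes> (g \<otimes> b)) B"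
      by (auto simp: double_coset_mem_iff)
  qed
qed

lemma double_coset_eqI:
  assumes "subgroup A G" "subgroup B G" "g \<in> carrier G" "x \<in> double_coset G A g B"
  shows "double_coset G A x B = double_coset G A g B"
  using assms double_coset_absorb by (auto simp: double_coset_mem_iff)

lemma rep_double_coset:
  assumes "subgroup A G" "subgroup B G" "g \<in> carrier G"
  shows "rep (double_coset G A g B) \<in> double_coset G A g B"
  unfolding rep_def using mem_own_double_coset[OF assms] by (rule someI)

lemma double_coset_assoc_mem:
  assumes "subgroup A G" "subgroup B G" "g \<in> carrier G" "x \<in> double_coset G A g B" "a \<in> A" "b \<in> B"
  shows "a \<otimes> x \<in> double_coset G A g B" "x \<otimes> b \<in> double_coset G A g B"
proof -
  have sub: "A \<subseteq> carrier G" "B \<subseteq> carrier G" using assms subgroup.subset by auto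
  obtain a' b' where x: "a' \<in> A" "b' \<in> B" "x = a' \<otimes> (g \<otimes> b')"
    using assms by (auto simp: double_coset_mem_iff)
  have c: "a \<in> carrier G" "b \<in> carrier G" "a' \<in> carrier G" "b' \<in> carrier G" using sub assms x by auto
  have "a \<otimes> x = (a \<otimes> a') \<otimes> (g \<otimes> b')" "x \<otimes> b = a' \<otimes> (g \<otimes> (b' \<otimes> b))"
    using x c assms by (simp_all add: m_assoc)
  moreover have "a \<otimes> a' \<in> A" "b' \<otimes> b \<in> B" using assms x by (auto intro: subgroup.m_closed)
  ultimately show "a \<otimes> x \<in> double_coset G A g B" "x \<otimes> b \<in> double_coset G A g B"
    using x by (auto simp: double_coset_mem_iff)
qed

text \<open>Finiteness of a set of double cosets is inherited from left cosets in this way.\<close>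

lemma double_cosets_conv_left_cosets:
  "double_cosets G A C B = (\<lambda>D. A <#> D) ` left_cosets G C B"
  by (auto simp: double_cosets_def left_cosets_def double_coset_def)

section \<open>Conjugates of subsets and subgroups\<close>

lemma conjugate_mem_iff:
  assumes "g \<in> carrier G" "A \<subseteq> carrier G"
  shows "x \<in> conjugate G g A \<longleftrightarrow> x \<in> carrier G \<and> inv g \<otimes> x \<otimes> g \<in> A"
proof
  assume "x \<in> carrier G \<and> inv g \<otimes> x \<otimes> g \<in> A"
  moreover have "x = g \<otimes> (inv g \<otimes> x \<otimes> g) \<otimes> inv g" if "x \<in> carrier G"
  proof -
    have "g \<otimes> (inv g \<otimes> x \<otimes> g) \<otimes> inv g = (g \<otimes> inv g) \<otimes> x \<otimes> (g \<otimes> inv g)"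
      using that assms by (simp only: m_assoc m_closed inv_closed)
    then show ?thesis using that assms by simp
  qed
  ultimately show "x \<in> conjugate G g A"
    unfolding conjugate_def l_coset_def r_coset_def by blast
next
  assume "x \<in> conjugate G g A"
  then obtain a where a: "a \<in> A" "x = g \<otimes> a \<otimes> inv g"
    by (auto simp: conjugate_def l_coset_def r_coset_def)
  then have ac: "a \<in> carrier G" using assms by auto
  then have "inv g \<otimes> x \<otimes> g = (inv g \<otimes> g) \<otimes> a \<otimes> (inv g \<otimes> g)"
    using a assms by (simp only: m_assoc m_closed inv_closed)
  then show "x \<in> carrier G \<and> inv g \<otimes> x \<otimes> g \<in> A" using a ac assms by simp
qed

lemma conjugate_subset_carrier:
  "g \<in> carrier G \<Longrightarrow> A \<subseteq> carrier G \<Longrightarrow> conjugate G g A \<subseteq> carrier G"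
  by (auto simp: conjugate_mem_iff)

lemma conjugate_one:
  "A \<subseteq> carrier G \<Longrightarrow> conjugate G \<one> A = A"
  by (auto simp: conjugate_mem_iff subsetD)

lemma conjugate_mult:
  assumes "g \<in> carrier G" "h \<in> carrier G" "A \<subseteq> carrier G"
  shows "conjugate G (g \<otimes> h) A = conjugate G g (conjugate G h A)"
proof -
  have "inv (g \<otimes> h) \<otimes> x \<otimes> (g \<otimes> h) = inv h \<otimes> (inv g \<otimes> x \<otimes> g) \<otimes> h" if "x \<in> carrier G" for x
    using that assms by (simp add: inv_mult_group m_assoc)
  then show ?thesis
    using assms by (auto simp: conjugate_mem_iff conjugate_subset_carrier)
qed

lemma conjugate_inv_cancel:
  assumes "g \<in> carrier G" "A \<subseteq> carrier G"
  shows "conjugate G (inv g) (conjugate G g A) = A" "conjugate G g (conjugate G (inv g) A) = A"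
  using assms by (simp_all add: conjugate_mult[symmetric] conjugate_one)

lemma conjugate_mono: "A \<subseteq> B \<Longrightarrow> conjugate G g A \<subseteq> conjugate G g B"
  by (auto simp: conjugate_def l_coset_def r_coset_def)

lemma conjugate_Int:
  assumes "g \<in> carrier G" "A \<subseteq> carrier G" "B \<subseteq> carrier G"
  shows "conjugate G g (A \<inter> B) = conjugate G g A \<inter> conjugate G g B"
proof -
  have "A \<inter> B \<subseteq> carrier G" using assms by auto
  then show ?thesis using assms by (auto simp: conjugate_mem_iff)
qed

lemma subgroup_conjugate:
  assumes "subgroup A G" "g \<in> carrier G"
  shows "subgroup (conjugate G g A) G"
proof -
  note sub = subgroup.subset[OF assms(1)]
  show ?thesis
  proof (rule subgroupI)
    show "conjugate G g A \<subseteq> carrier G" using sub assms conjugate_subset_carrier by blast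
    have "\<one> \<in> conjugate G g A"
      using assms sub by (auto simp: conjugate_mem_iff subgroup.one_closed)
    then show "conjugate G g A \<noteq> {}" by auto
    fix a assume "a \<in> conjugate G g A"
    then have a: "a \<in> carrier G" "inv g \<otimes> a \<otimes> g \<in> A" using assms sub by (auto simp: conjugate_mem_iff)
    have "inv g \<otimes> inv a \<otimes> g = inv (inv g \<otimes> a \<otimes> g)"
      using a assms by (simp add: inv_mult_group m_assoc)
    then show "inv a \<in> conjugate G g A"
      using a assms sub by (simp add: conjugate_mem_iff subgroup.m_inv_closed)
    fix b assume "b \<in> conjugate G g A"
    then have b: "b \<in> carrier G" "inv g \<otimes> b \<otimes> g \<in> A" using assms sub by (auto simp: conjugate_mem_iff)
    have "(inv g \<otimes> a \<otimes> g) \<otimes> (inv g \<otimes> b \<otimes> g) = inv g \<otimes> a \<otimes> (g \<otimes> inv g) \<otimes> b \<otimes> g"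
      using a b assms by (simp only: m_assoc m_closed inv_closed)
    then have "inv g \<otimes> (a \<otimes> b) \<otimes> g = (inv g \<otimes> a \<otimes> g) \<otimes> (inv g \<otimes> b \<otimes> g)"
      using a b assms by (simp add: m_assoc)
    then show "a \<otimes> b \<in> conjugate G g A"
      using a b assms sub by (simp add: conjugate_mem_iff subgroup.m_closed)
  qed
qed

lemma conjugate_self:
  assumes "subgroup A G" "a \<in> A"
  shows "conjugate G a A = A"
proof -
  have sub: "A \<subseteq> carrier G" and a: "a \<in> carrier G" using assms subgroup.subset by auto
  have "inv a \<otimes> x \<otimes> a \<in> A \<longleftrightarrow> x \<in> A" if x: "x \<in> carrier G" for x
  proof
    assume h: "inv a \<otimes> x \<otimes> a \<in> A"
    have "a \<otimes> (inv a \<otimes> x \<otimes> a) \<otimes> inv a = (a \<otimes> inv a) \<otimes> x \<otimes> (a \<otimes> inv a)"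
      using a x by (simp only: m_assoc m_closed inv_closed)
    then have "x = a \<otimes> (inv a \<otimes> x \<otimes> a) \<otimes> inv a" using a x by simp
    then show "x \<in> A" using h assms by (metis subgroup.m_closed subgroup.m_inv_closed)
  qed (use assms in \<open>auto intro!: subgroup.m_closed subgroup.m_inv_closed\<close>)
  then show ?thesis using sub a by (auto simp: conjugate_mem_iff subsetD)
qed

end

section \<open>Locally profinite spaces\<close>

text \<open>Total disconnectedness is given through connected sets, so the component of
  \<open>x\<close> is the single point \<open>x\<close>. In a locally compact Hausdorff space a
  compact component has clopen neighbourhoods inside each of its open neighbourhoods.\<close>

lemma locally_profinite_compact_open:
  assumes X: "locally_profinite_space X" and "openin X A" "x \<in> A"
  obtains B where "openin X B" "compactin X B" "x \<in> B" "B \<subseteq> A"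
proof -
  have lc: "locally_compact_space X" and H: "Hausdorff_space X"
    and td: "\<And>C. connectedin X C \<Longrightarrow> \<exists>x. C \<subseteq> {x}"
    using X by (auto simp: locally_profinite_space_def)
  have x: "x \<in> topspace X" using assms openin_subset by blast
  obtain O' C where O': "openin X O'" "compactin X C" "x \<in> O'" "O' \<subseteq> C"
    using lc x unfolding locally_compact_space_def by blast
  have "connectedin X (connected_component_of_set X x)"
    by (rule connectedin_connected_component_of)
  then have c: "connected_component_of_set X x = {x}"
    using td x by (metis connected_component_of_refl mem_Collect_eq singletonD subset_singletonD empty_iff)
  have "{x} \<in> connected_components_of X"
    using x c by (metis connected_component_in_connected_components_of)
  \<comment> \<open>The target is shrunk into the compact set \<open>C\<close>, so that the clopen
    set found there is compact.\<close>
  moreover have "compactin X {x}" "openin X (A \<inter> O')" "{x} \<subseteq> A \<inter> O'"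
    using x assms O' by auto
  ultimately obtain B B' where B: "openin X B" "openin X B'" "disjnt B B'" "B \<union> B' = topspace X"
      "{x} \<subseteq> B" "B \<subseteq> A \<inter> O'"
    using wilder_locally_compact_component_thm[OF lc H] by metis
  have "B = topspace X - B'" using B by (auto simp: disjnt_iff)
  then have "closedin X B" using B by blast
  then have "compactin X B" using B O' by (meson closed_compactin inf.boundedE order_trans)
  then show thesis using that B by auto
qed

section \<open>Locally constant functions\<close>

definition locally_constant :: "'x topology \<Rightarrow> ('x \<Rightarrow> 'r) \<Rightarrow> bool" where
  "locally_constant X f \<longleftrightarrow> (\<forall>x\<in>topspace X. \<exists>A. openin X A \<and> x \<in> A \<and> (\<forall>y\<in>A. f y = f x))"

lemma locally_constantE:
  assumes "locally_constant X f" "x \<in> topspace X"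
  obtains A where "openin X A" "x \<in> A" "A \<subseteq> {y. f y = f x}"
proof -
  have "\<exists>A. openin X A \<and> x \<in> A \<and> (\<forall>y\<in>A. f y = f x)"
    using assms unfolding locally_constant_def by (rule bspec)
  then obtain A where A: "openin X A" "x \<in> A" "\<forall>y\<in>A. f y = f x" by (elim exE conjE)
  have "A \<subseteq> {y. f y = f x}" using A(3) by blast
  then show thesis using that A(1,2) by blast
qed

lemma locally_constantI:
  assumes "\<And>x. x \<in> topspace X \<Longrightarrow> \<exists>A. openin X A \<and> x \<in> A \<and> A \<subseteq> {y. f y = f x}"
  shows "locally_constant X f"
  unfolding locally_constant_def
proof
  fix x assume "x \<in> topspace X"
  from assms[OF this] obtain A where "openin X A" "x \<in> A" and A: "A \<subseteq> {y. f y = f x}"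
    by (elim exE conjE)
  then show "\<exists>A. openin X A \<and> x \<in> A \<and> (\<forall>y\<in>A. f y = f x)" by (intro exI[of _ A]) blast
qed

lemma openin_locally_constant:
  assumes "locally_constant X f"
  shows "openin X {x \<in> topspace X. P (f x)}"
proof (subst openin_subopen, intro ballI)
  fix x assume x: "x \<in> {x \<in> topspace X. P (f x)}"
  then obtain A where A: "openin X A" "x \<in> A" "A \<subseteq> {y. f y = f x}"
    using locally_constantE[OF assms] by blast
  have "A \<subseteq> {x \<in> topspace X. P (f x)}"
    using A(3) x openin_subset[OF A(1)] by force
  then show "\<exists>T. openin X T \<and> x \<in> T \<and> T \<subseteq> {x \<in> topspace X. P (f x)}"
    using A by blast
qed

lemma closedin_locally_constant:
  assumes "locally_constant X f"
  shows "closedin X {x \<in> topspace X. P (f x)}"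
proof -
  have "topspace X - {x \<in> topspace X. P (f x)} = {x \<in> topspace X. \<not> P (f x)}" by auto
  then show ?thesis
    using openin_locally_constant[OF assms, of "\<lambda>z. \<not> P z"] by (simp add: closedin_def)
qed

lemma locally_constant_const: "locally_constant X (\<lambda>x. k)"
  by (auto simp: locally_constant_def)

lemma locally_constant_comp2:
  assumes "locally_constant X f" "locally_constant X u"
  shows "locally_constant X (\<lambda>x. F (f x) (u x))"
proof (rule locally_constantI)
  fix x assume x: "x \<in> topspace X"
  obtain A where A: "openin X A" "x \<in> A" "A \<subseteq> {y. f y = f x}"
    using locally_constantE[OF assms(1) x] .
  obtain B where B: "openin X B" "x \<in> B" "B \<subseteq> {y. u y = u x}"
    using locally_constantE[OF assms(2) x] .
  have "openin X (A \<inter> B)" "x \<in> A \<inter> B" using A B by auto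
  moreover have "A \<inter> B \<subseteq> {y. F (f y) (u y) = F (f x) (u x)}" using A(3) B(3) by force
  ultimately show "\<exists>A. openin X A \<and> x \<in> A \<and> A \<subseteq> {y. F (f y) (u y) = F (f x) (u x)}" by blast
qed

lemma locally_constant_cong:
  assumes "locally_constant X f" "\<And>x. x \<in> topspace X \<Longrightarrow> f x = u x"
  shows "locally_constant X u"
proof (rule locally_constantI)
  fix x assume x: "x \<in> topspace X"
  obtain A where A: "openin X A" "x \<in> A" "A \<subseteq> {y. f y = f x}"
    using locally_constantE[OF assms(1) x] .
  have "A \<subseteq> {y. u y = u x}"
    using A(3) assms(2) x openin_subset[OF A(1)] by (smt (verit, best) mem_Collect_eq subset_iff)
  then show "\<exists>A. openin X A \<and> x \<in> A \<and> A \<subseteq> {y. u y = u x}" using A by blast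
qed

text \<open>Since \<open>B\<close> is open and closed, every point has a neighbourhood on which only
  one branch is active.\<close>

lemma locally_constant_if:
  assumes "openin X B" "closedin X B" "locally_constant X f" "locally_constant X u"
  shows "locally_constant X (\<lambda>x. if x \<in> B then f x else u x)" (is "locally_constant X ?h")
proof (rule locally_constantI)
  fix x assume x: "x \<in> topspace X"
  obtain A where A: "openin X A" "x \<in> A" "A \<subseteq> {y. f y = f x}"
    using locally_constantE[OF assms(3) x] .
  obtain A' where A': "openin X A'" "x \<in> A'" "A' \<subseteq> {y. u y = u x}"
    using locally_constantE[OF assms(4) x] .
  show "\<exists>A. openin X A \<and> x \<in> A \<and> A \<subseteq> {y. ?h y = ?h x}"
  proof (cases "x \<in> B")
    case True
    then have "A \<inter> B \<subseteq> {y. ?h y = ?h x}" using A(3) by force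
    then show ?thesis using True A assms(1) by blast
  next
    case False
    then have "A' - B \<subseteq> {y. ?h y = ?h x}" using A'(3) by force
    moreover have "openin X (A' - B)" using A' assms by blast
    ultimately show ?thesis using False A' by blast
  qed
qed

lemma locally_constant_precompose:
  assumes "continuous_map X Z h" "locally_constant Z f"
  shows "locally_constant X (\<lambda>x. f (h x))"
proof (rule locally_constantI)
  fix x assume x: "x \<in> topspace X"
  then have "h x \<in> topspace Z" using assms(1) by (auto simp: continuous_map_def)
  then obtain A where A: "openin Z A" "h x \<in> A" "A \<subseteq> {y. f y = f (h x)}"
    using locally_constantE[OF assms(2)] by blast
  have "{y \<in> topspace X. h y \<in> A} \<subseteq> {y. f (h y) = f (h x)}" using A(3) by blast
  moreover have "openin X {y \<in> topspace X. h y \<in> A}"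
    using openin_continuous_map_preimage[OF assms(1) A(1)] .
  ultimately show "\<exists>A. openin X A \<and> x \<in> A \<and> A \<subseteq> {y. f (h y) = f (h x)}"
    using A x by blast
qed

text \<open>Unlike for \<^const>\<open>schwartz\<close>, the values outside of the space are unconstrained.\<close>

definition schwartz_fun :: "'r ring \<Rightarrow> 'x topology \<Rightarrow> ('x \<Rightarrow> 'r) \<Rightarrow> bool" where
  "schwartz_fun R X f \<longleftrightarrow> f \<in> topspace X \<rightarrow> carrier R \<and> locally_constant X f \<and>
     (\<exists>C. compactin X C \<and> (\<forall>x\<in>topspace X - C. f x = \<zero>\<^bsub>R\<^esub>))"

lemma schwartz_fun_closed: "schwartz_fun R X f \<Longrightarrow> x \<in> topspace X \<Longrightarrow> f x \<in> carrier R"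
  by (auto simp: schwartz_fun_def)

text \<open>The set where a locally constant function is nonzero is already closed, and it lies in a
  compact set.\<close>

lemma compactin_schwartz_fun_support:
  assumes "schwartz_fun R X f"
  shows "compactin X {x \<in> topspace X. f x \<noteq> \<zero>\<^bsub>R\<^esub>}"
proof -
  obtain C where C: "compactin X C" "\<forall>x\<in>topspace X - C. f x = \<zero>\<^bsub>R\<^esub>"
    using assms by (auto simp: schwartz_fun_def)
  have "closedin X {x \<in> topspace X. f x \<noteq> \<zero>\<^bsub>R\<^esub>}"
    using assms closedin_locally_constant[of X f "\<lambda>z. z \<noteq> \<zero>\<^bsub>R\<^esub>"] by (auto simp: schwartz_fun_def)
  then show ?thesis using C by (intro closed_compactin[OF C(1)]) auto
qed

text \<open>Passage from the loose predicate to the normalised space: \<open>supp\<close> is defined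
  as a closure, but the set where the function is nonzero is closed and coincides with it.\<close>

lemma restrict_schwartz:
  assumes "schwartz_fun R X f"
  shows "restrict f (topspace X) \<in> schwartz R X"
proof -
  have lc: "locally_constant X f" using assms by (simp add: schwartz_fun_def)
  have "{x \<in> topspace X. restrict f (topspace X) x \<noteq> \<zero>\<^bsub>R\<^esub>} = {x \<in> topspace X. f x \<noteq> \<zero>\<^bsub>R\<^esub>}"
    by auto
  then have "supp R X (restrict f (topspace X)) = {x \<in> topspace X. f x \<noteq> \<zero>\<^bsub>R\<^esub>}"
    using closedin_locally_constant[OF lc, of "\<lambda>z. z \<noteq> \<zero>\<^bsub>R\<^esub>"]
    unfolding supp_def by (metis closure_of_eq)
  then have "compactin X (supp R X (restrict f (topspace X)))"
    using compactin_schwartz_fun_support[OF assms] by simp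
  moreover have "locally_constant X (restrict f (topspace X))"
    using lc by (rule locally_constant_cong) simp
  ultimately show ?thesis
    using assms unfolding schwartz_def schwartz_fun_def locally_constant_def by auto
qed

lemma schwartz_fun_finsum:
  assumes R: "cring R" and "finite A" "\<And>i. i \<in> A \<Longrightarrow> schwartz_fun R X (f i)"
  shows "schwartz_fun R X (\<lambda>x. \<Oplus>\<^bsub>R\<^esub>i\<in>A. f i x)"
  using assms(2,3)
proof (induction A)
  interpret cring R by fact
  case empty
  then show ?case by (auto simp: schwartz_fun_def locally_constant_const intro: exI[of _ "{}"])
next
  interpret cring R by fact
  case (insert a A)
  have cl: "f i x \<in> carrier R" if "i \<in> insert a A" "x \<in> topspace X" for i x
    using schwartz_fun_closed[OF insert.prems] that by blast
  have eq: "(\<Oplus>\<^bsub>R\<^esub>i\<in>insert a A. f i x) = f a x \<oplus>\<^bsub>R\<^esub> (\<Oplus>\<^bsub>R\<^esub>i\<in>A. f i x)" if "x \<in> topspace X" for x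
    using insert that cl by (intro finsum_insert) auto
  have IH: "schwartz_fun R X (\<lambda>x. \<Oplus>\<^bsub>R\<^esub>i\<in>A. f i x)" and a: "schwartz_fun R X (f a)"
    using insert by auto
  obtain C C' where C: "compactin X C" "\<forall>x\<in>topspace X - C. (\<Oplus>\<^bsub>R\<^esub>i\<in>A. f i x) = \<zero>\<^bsub>R\<^esub>"
      "compactin X C'" "\<forall>x\<in>topspace X - C'. f a x = \<zero>\<^bsub>R\<^esub>"
    using IH a by (auto simp: schwartz_fun_def)
  have "locally_constant X (\<lambda>x. f a x \<oplus>\<^bsub>R\<^esub> (\<Oplus>\<^bsub>R\<^esub>i\<in>A. f i x))"
    using locally_constant_comp2[of X "f a" "\<lambda>x. \<Oplus>\<^bsub>R\<^esub>i\<in>A. f i x" "\<lambda>y z. y \<oplus>\<^bsub>R\<^esub> z"] IH a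
    by (simp add: schwartz_fun_def)
  then have "locally_constant X (\<lambda>x. \<Oplus>\<^bsub>R\<^esub>i\<in>insert a A. f i x)"
    by (rule locally_constant_cong) (use eq in simp)
  moreover have "compactin X (C \<union> C')" using C compactin_Un by blast
  moreover have "(\<Oplus>\<^bsub>R\<^esub>i\<in>insert a A. f i x) = \<zero>\<^bsub>R\<^esub>" if "x \<in> topspace X - (C \<union> C')" for x
    using that C eq by auto
  moreover have "(\<Oplus>\<^bsub>R\<^esub>i\<in>insert a A. f i x) \<in> carrier R" if "x \<in> topspace X" for x
    using that cl by (intro finsum_closed) auto
  ultimately show ?case unfolding schwartz_fun_def by blast
qed

lemma schwartz_fun_smult:
  assumes R: "cring R" and "schwartz_fun R X f" "a \<in> carrier R"
  shows "schwartz_fun R X (\<lambda>x. a \<otimes>\<^bsub>R\<^esub> f x)"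
proof -
  interpret cring R by fact
  have "locally_constant X (\<lambda>x. a \<otimes>\<^bsub>R\<^esub> f x)"
    using locally_constant_comp2[of X f f "\<lambda>y z. a \<otimes>\<^bsub>R\<^esub> y"] assms by (simp add: schwartz_fun_def)
  then show ?thesis using assms unfolding schwartz_fun_def by fastforce
qed

lemma schwartz_fun_ch:
  assumes "cring R" "openin X B" "compactin X B" "Hausdorff_space X"
  shows "schwartz_fun R X (ch R B)"
proof -
  interpret cring R by fact
  have "locally_constant X (\<lambda>x. if x \<in> B then \<one>\<^bsub>R\<^esub> else \<zero>\<^bsub>R\<^esub>)"
    using assms by (intro locally_constant_if locally_constant_const) (auto intro: compactin_imp_closedin)
  then have "locally_constant X (ch R B)" by (simp add: ch_def[abs_def])
  then show ?thesis using assms by (auto simp: schwartz_fun_def ch_def intro!: exI[of _ B])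
qed


section \<open>Continuous actions of topological groups\<close>

sublocale topological_group \<subseteq> plain_group G
  by unfold_locales

context topological_group begin

lemma openin_subgroup_l_coset:
  assumes "openin T B" "g \<in> carrier G"
  shows "openin T (g <#\<^bsub>G\<^esub> B)"
proof -
  have B: "B \<subseteq> carrier G" using assms openin_subset topspace_carrier by blast
  have "continuous_map T T (\<lambda>x. inv\<^bsub>G\<^esub> g \<otimes>\<^bsub>G\<^esub> x)"
  proof -
    have "continuous_map T (prod_topology T T) (\<lambda>x. (inv\<^bsub>G\<^esub> g, x))"
      using assms topspace_carrier by (intro continuous_map_pairedI) auto
    from continuous_map_compose[OF this continuous_mult] show ?thesis by (simp add: o_def)
  qed
  from openin_continuous_map_preimage[OF this assms(1)]
  have "openin T {x \<in> topspace T. inv\<^bsub>G\<^esub> g \<otimes>\<^bsub>G\<^esub> x \<in> B}" .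
  also have "{x \<in> topspace T. inv\<^bsub>G\<^esub> g \<otimes>\<^bsub>G\<^esub> x \<in> B} = g <#\<^bsub>G\<^esub> B"
    using assms B topspace_carrier by (auto simp: l_coset_mem_iff)
  finally show ?thesis .
qed

text \<open>The cosets of the open subgroup \<open>B\<close> form a disjoint open cover of
  \<open>C\<close>, so a finite subcover already contains every coset of a point of
  \<open>C\<close>.\<close>

lemma finite_left_cosets:
  assumes C: "compactin T C" and B: "openin T B" "subgroup B G"
  shows "finite (left_cosets G C B)"
proof -
  have Cs: "C \<subseteq> carrier G" using C compactin_subset_topspace topspace_carrier by blast
  have "\<exists>\<F>. finite \<F> \<and> \<F> \<subseteq> left_cosets G C B \<and> C \<subseteq> \<Union>\<F>"
  proof (rule compactinD[OF C])
    show "openin T A" if "A \<in> left_cosets G C B" for A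
      using that Cs B openin_subgroup_l_coset by (auto simp: left_cosets_def)
    show "C \<subseteq> \<Union>(left_cosets G C B)"
      using Cs B mem_own_l_coset by (force simp: left_cosets_def)
  qed
  then obtain \<F> where F: "finite \<F>" "\<F> \<subseteq> left_cosets G C B" "C \<subseteq> \<Union>\<F>" by blast
  have "left_cosets G C B \<subseteq> \<F>"
  proof
    fix A assume "A \<in> left_cosets G C B"
    then obtain c where c: "c \<in> C" "A = c <#\<^bsub>G\<^esub> B" by (auto simp: left_cosets_def)
    then obtain D where D: "D \<in> \<F>" "c \<in> D" using F by blast
    then obtain e where e: "e \<in> C" "D = e <#\<^bsub>G\<^esub> B" using F by (auto simp: left_cosets_def)
    have "c \<in> carrier G" "e \<in> carrier G" using c e Cs by auto
    moreover from this have "inv\<^bsub>G\<^esub> e \<otimes>\<^bsub>G\<^esub> c \<in> B"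
      using D e B by (simp add: l_coset_mem_iff subgroup.subset)
    ultimately have "A = D" using c e B l_coset_eq_iff by metis
    then show "A \<in> \<F>" using D by simp
  qed
  then show ?thesis using F finite_subset by blast
qed

lemma finite_double_cosets:
  assumes "compactin T C" "openin T B" "subgroup B G"
  shows "finite (double_cosets G A C B)"
  using finite_left_cosets[OF assms] by (simp add: double_cosets_conv_left_cosets)

text \<open>\<open>D\<close> is the union of the translates \<open>d V\<close>. This makes the
  groups V(x, W) open, whatever the stabilizer of x looks like.\<close>

lemma openin_subgroup_supset:
  assumes "subgroup D G" "openin T V" "V \<subseteq> D" "\<one>\<^bsub>G\<^esub> \<in> V"
  shows "openin T D"
proof (subst openin_subopen, intro ballI)
  fix d assume d: "d \<in> D"
  then have dc: "d \<in> carrier G" using assms subgroup.subset by blast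
  have "d <#\<^bsub>G\<^esub> V \<subseteq> D" using assms d by (auto simp: l_coset_def intro: subgroup.m_closed)
  moreover have "d \<in> d <#\<^bsub>G\<^esub> V" using assms dc by (force simp: l_coset_def)
  ultimately show "\<exists>A. openin T A \<and> d \<in> A \<and> A \<subseteq> D"
    using openin_subgroup_l_coset assms dc by blast
qed

lemma closedin_open_subgroup:
  assumes "subgroup D G" "openin T D"
  shows "closedin T D"
proof -
  have D: "D \<subseteq> carrier G" using assms subgroup.subset by blast
  have "openin T (carrier G - D)"
  proof (subst openin_subopen, intro ballI)
    fix g assume g: "g \<in> carrier G - D"
    have disj: "x \<notin> D" if x: "x \<in> g <#\<^bsub>G\<^esub> D" for x
    proof
      assume xD: "x \<in> D"
      have "x \<in> carrier G" "inv\<^bsub>G\<^esub> g \<otimes>\<^bsub>G\<^esub> x \<in> D" using x g D by (auto simp: l_coset_mem_iff)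
      moreover have "g = x \<otimes>\<^bsub>G\<^esub> inv\<^bsub>G\<^esub> (inv\<^bsub>G\<^esub> g \<otimes>\<^bsub>G\<^esub> x)"
        using g calculation by (simp add: inv_mult_group m_assoc[symmetric])
      ultimately have "g \<in> D" using xD assms by (metis subgroup.m_closed subgroup.m_inv_closed)
      then show False using g by simp
    qed
    have op: "openin T (g <#\<^bsub>G\<^esub> D)" using g assms openin_subgroup_l_coset by blast
    then have "g <#\<^bsub>G\<^esub> D \<subseteq> carrier G" using openin_subset topspace_carrier by metis
    moreover have "g \<in> g <#\<^bsub>G\<^esub> D" using g assms mem_own_l_coset by blast
    ultimately show "\<exists>A. openin T A \<and> g \<in> A \<and> A \<subseteq> carrier G - D"
      using op disj by (intro exI[of _ "g <#\<^bsub>G\<^esub> D"]) auto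
  qed
  then show ?thesis using D topspace_carrier by (simp add: closedin_def)
qed

end

locale topological_action = topological_group G T + continuous_right_action G T X act
  for G :: "'g monoid" and T :: "'g topology" and X :: "'x topology" and act :: "'x \<Rightarrow> 'g \<Rightarrow> 'x"
begin

lemma act_closed:
  assumes "x \<in> topspace X" "g \<in> carrier G"
  shows "act x g \<in> topspace X"
proof -
  have "(x, g) \<in> topspace (prod_topology X T)" using assms topspace_carrier by simp
  then have "(\<lambda>(x, g). act x g) (x, g) \<in> topspace X"
    using continuous_act unfolding continuous_map_def by blast
  then show ?thesis by simp
qed

lemma continuous_act_right:
  assumes "g \<in> carrier G"
  shows "continuous_map X X (\<lambda>x. act x g)"
proof -
  have "continuous_map X (prod_topology X T) (\<lambda>x. (x, g))"
    using assms topspace_carrier by (intro continuous_map_pairedI) auto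
  from continuous_map_compose[OF this continuous_act] show ?thesis by (simp add: o_def)
qed

lemma act_inv_cancel:
  assumes "x \<in> topspace X" "g \<in> carrier G"
  shows "act (act x g) (inv\<^bsub>G\<^esub> g) = x" "act (act x (inv\<^bsub>G\<^esub> g)) g = x"
  using assms act_mult[of x g "inv\<^bsub>G\<^esub> g"] act_mult[of x "inv\<^bsub>G\<^esub> g" g] by (simp_all add: act_one)

lemma schwartz_fun_translate:
  assumes "schwartz_fun R X f" "g \<in> carrier G"
  shows "schwartz_fun R X (\<lambda>x. f (act x g))"
proof -
  obtain C where C: "compactin X C" "\<forall>x\<in>topspace X - C. f x = \<zero>\<^bsub>R\<^esub>"
    using assms by (auto simp: schwartz_fun_def)
  have "compactin X ((\<lambda>x. act x (inv\<^bsub>G\<^esub> g)) ` C)"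
    using C assms by (intro image_compactin[OF _ continuous_act_right]) auto
  moreover have "f (act x g) = \<zero>\<^bsub>R\<^esub>" if "x \<in> topspace X - (\<lambda>x. act x (inv\<^bsub>G\<^esub> g)) ` C" for x
  proof -
    have "act x g \<notin> C" using that assms act_inv_cancel(1)[of x g] by force
    then show ?thesis using that assms C act_closed by blast
  qed
  moreover have "locally_constant X (\<lambda>x. f (act x g))"
    using assms by (intro locally_constant_precompose[OF continuous_act_right]) (auto simp: schwartz_fun_def)
  ultimately show ?thesis
    using assms act_closed unfolding schwartz_fun_def by blast
qed

end

lemma (in plain_group) rep_left_cosets_subgroup:
  assumes "subgroup B G" "subgroup E G" "B \<subseteq> E" "C \<in> left_cosets G E B"
  shows "rep C \<in> E" "C = rep C <# B"
  using rep_left_cosets[OF assms(1) subgroup.subset[OF assms(2)] assms(4)] subgroup.m_closed[OF assms(2)]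
    assms(3) by blast+

context topological_action begin

section \<open>Sums of translates over left cosets\<close>

definition invariant_under :: "'g set \<Rightarrow> ('x \<Rightarrow> 'r) \<Rightarrow> bool" where
  "invariant_under B f \<longleftrightarrow> (\<forall>b\<in>B. \<forall>x\<in>topspace X. f (act x b) = f x)"

text \<open>If \<open>E\<close> is a subgroup containing \<open>B\<close>, this is the trace from
  \<open>B\<close>-invariants to \<open>E\<close>-invariants. The set \<open>E\<close> is left
  arbitrary because a double coset in its place gives the action of a Hecke correspondence.\<close>

definition coset_sum :: "'r ring \<Rightarrow> 'g set \<Rightarrow> 'g set \<Rightarrow> ('x \<Rightarrow> 'r) \<Rightarrow> 'x \<Rightarrow> 'r" where
  "coset_sum R E B f x = (\<Oplus>\<^bsub>R\<^esub>C\<in>left_cosets G E B. f (act x (rep C)))"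

lemma act_rep_l_coset:
  assumes "subgroup B G" "invariant_under B f" "e \<in> carrier G" "x \<in> topspace X"
  shows "f (act x (rep (e <#\<^bsub>G\<^esub> B))) = f (act x e)"
proof -
  obtain b where b: "b \<in> B" "rep (e <#\<^bsub>G\<^esub> B) = e \<otimes>\<^bsub>G\<^esub> b"
    using rep_l_coset assms by blast
  moreover have "b \<in> carrier G" using b assms subgroup.subset by blast
  ultimately show ?thesis
    using assms by (simp add: act_mult invariant_under_def act_closed)
qed

lemma coset_sum_closed:
  assumes "cring R" "subgroup B G" "f \<in> topspace X \<rightarrow> carrier R" "E \<subseteq> carrier G"
    "invariant_under B f" "x \<in> topspace X"
  shows "coset_sum R E B f x \<in> carrier R"
proof -
  interpret cring R by fact
  have "f (act x (rep C)) \<in> carrier R" if C: "C \<in> left_cosets G E B" for C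
  proof -
    obtain e where "e \<in> E" "C = e <#\<^bsub>G\<^esub> B" using C by (auto simp: left_cosets_def)
    moreover from this have "e \<in> carrier G" using assms by auto
    ultimately show ?thesis using assms act_closed by (auto simp: act_rep_l_coset)
  qed
  then show ?thesis unfolding coset_sum_def by (intro finsum_closed) auto
qed

text \<open>The action is on the right, so moving the point by \<open>a\<close> multiplies the
  representatives by \<open>a\<close> on the left, which permutes the cosets of \<open>B\<close> in
  \<open>E\<close>.\<close>

lemma coset_sum_translate:
  assumes R: "cring R" and B: "subgroup B G" "invariant_under B f"
    and f: "f \<in> topspace X \<rightarrow> carrier R" and E: "E \<subseteq> carrier G"
    and a: "a \<in> carrier G" "(\<lambda>e. a \<otimes>\<^bsub>G\<^esub> e) ` E = E" and x: "x \<in> topspace X"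
  shows "coset_sum R E B f (act x a) = coset_sum R E B f x"
proof -
  interpret R: cring R by fact
  have assoc: "a <#\<^bsub>G\<^esub> (e <#\<^bsub>G\<^esub> B) = (a \<otimes>\<^bsub>G\<^esub> e) <#\<^bsub>G\<^esub> B" if "e \<in> E" for e
    using that E a B by (intro lcos_m_assoc) (auto dest: subgroup.subset)
  have "bij_betw (\<lambda>C. a <#\<^bsub>G\<^esub> C) (left_cosets G E B) (left_cosets G E B)"
    unfolding bij_betw_def
  proof
    show "inj_on ((<#\<^bsub>G\<^esub>) a) (left_cosets G E B)"
    proof (rule inj_onI)
      fix C D assume C: "C \<in> left_cosets G E B" "D \<in> left_cosets G E B" "a <#\<^bsub>G\<^esub> C = a <#\<^bsub>G\<^esub> D"
      have id: "inv\<^bsub>G\<^esub> a <#\<^bsub>G\<^esub> (a <#\<^bsub>G\<^esub> C) = C" if "C \<in> left_cosets G E B" for C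
      proof -
        have "C \<subseteq> carrier G"
          using that E B by (auto simp: left_cosets_def l_coset_mem_iff subgroup.subset)
        then show ?thesis using a by (simp add: lcos_m_assoc lcos_mult_one)
      qed
      show "C = D" using id[OF C(1)] id[OF C(2)] C(3) by metis
    qed
    have "(\<lambda>C. a <#\<^bsub>G\<^esub> C) ` left_cosets G E B = (\<lambda>e. e <#\<^bsub>G\<^esub> B) ` ((\<lambda>e. a \<otimes>\<^bsub>G\<^esub> e) ` E)"
      using assoc by (simp add: left_cosets_def image_image cong: image_cong)
    then show "(\<lambda>C. a <#\<^bsub>G\<^esub> C) ` left_cosets G E B = left_cosets G E B"
      using a by (simp add: left_cosets_def)
  qed
  then show ?thesis
    unfolding coset_sum_def
  proof (rule R.finsum_bij_betw)
    fix C assume "C \<in> left_cosets G E B"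
    then obtain e where e: "e \<in> E" "C = e <#\<^bsub>G\<^esub> B" by (auto simp: left_cosets_def)
    then have "e \<in> carrier G" using E by auto
    then show "f (act (act x a) (rep C)) = f (act x (rep (a <#\<^bsub>G\<^esub> C)))"
      using e a x B by (simp add: assoc act_rep_l_coset act_closed act_mult)
  next
    show "(\<lambda>C. f (act x (rep C))) \<in> left_cosets G E B \<rightarrow> carrier R"
    proof
      fix C assume C: "C \<in> left_cosets G E B"
      obtain e where "e \<in> E" "C = e <#\<^bsub>G\<^esub> B" using C by (auto simp: left_cosets_def)
      moreover from this have "e \<in> carrier G" using E by auto
      ultimately show "f (act x (rep C)) \<in> carrier R" using B f x act_closed by (auto simp: act_rep_l_coset)
    qed
  qed
qed

text \<open>Each \<open>w \<in> W - D\<close> moves \<open>x\<close>; by compactness finitely many neighbourhoods witness this.\<close>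

lemma small_neighbourhood:
  assumes X: "locally_profinite_space X" and W: "compactin T W" and D: "openin T D"
    and stab: "\<And>w. w \<in> W - D \<Longrightarrow> act x w \<noteq> x"
    and O': "openin X O'" "x \<in> O'"
  obtains B where "openin X B" "compactin X B" "x \<in> B" "B \<subseteq> O'"
    "\<And>b w. b \<in> B \<Longrightarrow> w \<in> W - D \<Longrightarrow> act b w \<notin> B"
proof -
  have H: "Hausdorff_space X" using X by (simp add: locally_profinite_space_def)
  have x: "x \<in> topspace X" using O' openin_subset by blast
  have Ws: "W \<subseteq> carrier G" using W compactin_subset_topspace topspace_carrier by blast
  define good where
    "good = (\<lambda>A E. openin X A \<and> x \<in> A \<and> openin T E \<and> (\<forall>b\<in>A. \<forall>w\<in>E. act b w \<notin> A))"
  have ex: "\<exists>A E. good A E \<and> w \<in> E" if w: "w \<in> W - D" for w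
  proof -
    have wc: "w \<in> carrier G" using w Ws by auto
    have xw: "act x w \<in> topspace X" using act_closed x wc by blast
    have "\<exists>P Q. openin X P \<and> openin X Q \<and> x \<in> P \<and> act x w \<in> Q \<and> disjnt P Q"
      using H stab[OF w] x xw unfolding Hausdorff_space_def by metis
    then obtain P Q where PQ: "openin X P" "openin X Q" "x \<in> P" "act x w \<in> Q" "disjnt P Q"
      by blast
    \<comment> \<open>Continuity in both variables yields a neighbourhood of \<open>x\<close> and
      one of \<open>w\<close> at the same time; intersecting the former with \<open>P\<close>, which
      is disjoint from \<open>Q\<close>, makes the translates leave it.\<close>
    define S where "S = {z \<in> topspace (prod_topology X T). (\<lambda>(x, g). act x g) z \<in> Q}"
    have "openin (prod_topology X T) S"
      unfolding S_def by (rule openin_continuous_map_preimage[OF continuous_act PQ(2)])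
    moreover have "(x, w) \<in> S" unfolding S_def using x wc PQ topspace_carrier by simp
    ultimately obtain A E where AE: "openin X A" "openin T E" "x \<in> A" "w \<in> E" "A \<times> E \<subseteq> S"
      unfolding openin_prod_topology_alt by meson
    have "act b w' \<notin> A \<inter> P" if "b \<in> A \<inter> P" "w' \<in> E" for b w'
    proof -
      have "act b w' \<in> Q" using that AE(5) unfolding S_def by auto
      then show ?thesis using PQ(5) by (auto simp: disjnt_iff)
    qed
    then have "good (A \<inter> P) E" unfolding good_def using AE PQ by auto
    then show ?thesis using AE by blast
  qed
  then obtain A E where AE: "\<And>w. w \<in> W - D \<Longrightarrow> good (A w) (E w)" "\<And>w. w \<in> W - D \<Longrightarrow> w \<in> E w"
    by metis
  have "compactin T (W \<inter> (topspace T - D))"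
    using W D by (intro compact_Int_closedin) auto
  moreover have "W \<inter> (topspace T - D) = W - D" using Ws topspace_carrier by auto
  ultimately have c: "compactin T (W - D)" by simp
  have "\<exists>\<F>. finite \<F> \<and> \<F> \<subseteq> E ` (W - D) \<and> W - D \<subseteq> \<Union>\<F>"
    by (rule compactinD[OF c]) (use AE in \<open>auto simp: good_def\<close>)
  then obtain F where F: "finite F" "F \<subseteq> W - D" "W - D \<subseteq> \<Union>(E ` F)"
    by (metis finite_subset_image)
  define A0 where "A0 = \<Inter>(insert O' (A ` F))"
  have "openin X A0" unfolding A0_def
    using F AE O' by (intro openin_Inter) (auto simp: good_def)
  moreover have "x \<in> A0" unfolding A0_def using F AE O' by (auto simp: good_def)
  ultimately obtain B where B: "openin X B" "compactin X B" "x \<in> B" "B \<subseteq> A0"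
    using locally_profinite_compact_open[OF X] by metis
  have "act b w \<notin> B" if "b \<in> B" "w \<in> W - D" for b w
  proof -
    from that(2) have "w \<in> \<Union>(E ` F)" using F(3) by auto
    then obtain w' where "w' \<in> F" "w \<in> E w'" by auto
    then have "b \<in> A w'" "good (A w') (E w')" "B \<subseteq> A w'"
      using that B AE F unfolding A0_def by auto
    then show ?thesis using that \<open>w \<in> E w'\<close> unfolding good_def by blast
  qed
  then show thesis using that B unfolding A0_def by auto
qed

text \<open>A neighbourhood \<open>B\<close> that no element of \<open>W - D\<close> can bring back
  to itself is swept out by \<open>D\<close>. Elements of \<open>D\<close> preserve the result by
  construction, and an element of \<open>W\<close> that brings one of its points back reduces, after
  correction by \<open>D\<close> on both sides, to one bringing a point of \<open>B\<close> back to
  \<open>B\<close>.\<close>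

lemma stabilizer_neighbourhood:
  assumes X: "locally_profinite_space X" and W: "compactin T W" "subgroup W G"
    and D: "openin T D" "subgroup D G" "D \<subseteq> W"
    and stab: "\<And>w. w \<in> W \<Longrightarrow> act x w = x \<Longrightarrow> w \<in> D" and x: "x \<in> topspace X"
    and f: "locally_constant X f" "invariant_under W f"
  obtains A where "openin X A" "compactin X A" "x \<in> A" "\<And>a. a \<in> A \<Longrightarrow> f a = f x"
    "\<And>a w. a \<in> A \<Longrightarrow> w \<in> W \<Longrightarrow> act a w \<in> A \<longleftrightarrow> w \<in> D"
proof -
  obtain O' where O': "openin X O'" "x \<in> O'" "O' \<subseteq> {y. f y = f x}"
    using locally_constantE[OF f(1) x] .
  obtain B where B: "openin X B" "compactin X B" "x \<in> B" "B \<subseteq> O'"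
      "\<And>b w. b \<in> B \<Longrightarrow> w \<in> W - D \<Longrightarrow> act b w \<notin> B"
    using small_neighbourhood[OF X W(1) D(1) _ O'(1,2)] stab by blast
  note Bs = openin_subset[OF B(1)] and Ds = subgroup.subset[OF D(2)] and Ws = subgroup.subset[OF W(2)]
  \<comment> \<open>\<open>A\<close> is the product \<open>B D\<close>: it is compact as the image
    of \<open>B \<times> D\<close> under the action, and open as a union of translates of
    \<open>B\<close>.\<close>
  define A where "A = (\<lambda>(x, g). act x g) ` (B \<times> D)"
  have memA: "a \<in> A \<longleftrightarrow> (\<exists>b\<in>B. \<exists>d\<in>D. a = act b d)" for a unfolding A_def by auto
  have "closedin T D" using D closedin_open_subgroup by blast
  then have "compactin T D" using W D by (meson closed_compactin)
  then have "compactin (prod_topology X T) (B \<times> D)" using B by (simp add: compactin_Times)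
  then have "compactin X A" unfolding A_def by (rule image_compactin[OF _ continuous_act])
  moreover have "openin X A"
  proof -
    have "A = (\<Union>d\<in>D. {y \<in> topspace X. act y (inv\<^bsub>G\<^esub> d) \<in> B})"
    proof (intro equalityI subsetI)
      fix a assume "a \<in> A"
      then obtain b d where b: "b \<in> B" "d \<in> D" "a = act b d" by (auto simp: memA)
      then have "b \<in> topspace X" "d \<in> carrier G" using Bs Ds by auto
      then have "act a (inv\<^bsub>G\<^esub> d) \<in> B" "a \<in> topspace X"
        using b by (simp_all add: act_inv_cancel act_closed)
      then show "a \<in> (\<Union>d\<in>D. {y \<in> topspace X. act y (inv\<^bsub>G\<^esub> d) \<in> B})"
        using b by blast
    next
      fix a assume "a \<in> (\<Union>d\<in>D. {y \<in> topspace X. act y (inv\<^bsub>G\<^esub> d) \<in> B})"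
      then obtain d where d: "d \<in> D" "a \<in> topspace X" "act a (inv\<^bsub>G\<^esub> d) \<in> B" by auto
      then have "a = act (act a (inv\<^bsub>G\<^esub> d)) d" using Ds act_inv_cancel(2)[of a d] by auto
      then show "a \<in> A" using d memA by blast
    qed
    moreover have "openin X {y \<in> topspace X. act y (inv\<^bsub>G\<^esub> d) \<in> B}" if "d \<in> D" for d
      using that Ds B by (intro openin_continuous_map_preimage[OF continuous_act_right]) auto
    ultimately show ?thesis by (auto intro: openin_Union)
  qed
  moreover have "x \<in> A" unfolding memA
    using B D subgroup.one_closed act_one x by metis
  moreover have "f a = f x" if aA: "a \<in> A" for a
  proof -
    obtain b d where b: "b \<in> B" "d \<in> D" "a = act b d" using aA by (auto simp: memA)
    then have "f a = f b" using f(2) D(3) Bs by (auto simp: invariant_under_def)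
    moreover have "b \<in> {y. f y = f x}" using b(1) B(4) O'(3) by (meson subsetD)
    ultimately show ?thesis by simp
  qed
  moreover have "act a w \<in> A \<longleftrightarrow> w \<in> D" if a: "a \<in> A" and w: "w \<in> W" for a w
  proof -
    obtain b d where b: "b \<in> B" "d \<in> D" "a = act b d" using a unfolding memA by blast
    have c: "b \<in> topspace X" "d \<in> carrier G" "w \<in> carrier G" using b w Bs Ds Ws by auto
    have aw: "act a w = act b (d \<otimes>\<^bsub>G\<^esub> w)" using b c by (simp add: act_mult)
    show ?thesis
    proof
      assume "w \<in> D"
      then show "act a w \<in> A" using aw b D memA subgroup.m_closed by metis
    next
      assume "act a w \<in> A"
      then obtain b' d' where b': "b' \<in> B" "d' \<in> D" "act a w = act b' d'" unfolding memA by blast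
      have c': "b' \<in> topspace X" "d' \<in> carrier G" using b' Bs Ds by auto
      \<comment> \<open>If b d w = b' d', then d w d'^-1 carries the point b of \<open>B\<close> to
        the point b' of \<open>B\<close>, so it cannot lie in \<open>W - D\<close>.\<close>
      have "act b (d \<otimes>\<^bsub>G\<^esub> w \<otimes>\<^bsub>G\<^esub> inv\<^bsub>G\<^esub> d') = act (act b' d') (inv\<^bsub>G\<^esub> d')"
        using b'(3) aw c c' by (simp add: act_mult)
      also have "\<dots> = b'" using c' by (simp add: act_inv_cancel)
      finally have "d \<otimes>\<^bsub>G\<^esub> w \<otimes>\<^bsub>G\<^esub> inv\<^bsub>G\<^esub> d' \<notin> W - D" using B(5) b(1) b'(1) by metis
      moreover have "d \<otimes>\<^bsub>G\<^esub> w \<otimes>\<^bsub>G\<^esub> inv\<^bsub>G\<^esub> d' \<in> W"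
        using b b' w D W(2) by (auto intro!: subgroup.m_closed subgroup.m_inv_closed)
      ultimately have "d \<otimes>\<^bsub>G\<^esub> w \<otimes>\<^bsub>G\<^esub> inv\<^bsub>G\<^esub> d' \<in> D" by blast
      then have "inv\<^bsub>G\<^esub> d \<otimes>\<^bsub>G\<^esub> (d \<otimes>\<^bsub>G\<^esub> w \<otimes>\<^bsub>G\<^esub> inv\<^bsub>G\<^esub> d') \<otimes>\<^bsub>G\<^esub> d' \<in> D"
        using b b' D by (auto intro!: subgroup.m_closed subgroup.m_inv_closed)
      moreover have "inv\<^bsub>G\<^esub> d \<otimes>\<^bsub>G\<^esub> (d \<otimes>\<^bsub>G\<^esub> w \<otimes>\<^bsub>G\<^esub> inv\<^bsub>G\<^esub> d') \<otimes>\<^bsub>G\<^esub> d' = w"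
      proof -
        have "inv\<^bsub>G\<^esub> d \<otimes>\<^bsub>G\<^esub> (d \<otimes>\<^bsub>G\<^esub> w \<otimes>\<^bsub>G\<^esub> inv\<^bsub>G\<^esub> d') \<otimes>\<^bsub>G\<^esub> d' =
          (inv\<^bsub>G\<^esub> d \<otimes>\<^bsub>G\<^esub> d) \<otimes>\<^bsub>G\<^esub> w \<otimes>\<^bsub>G\<^esub> (inv\<^bsub>G\<^esub> d' \<otimes>\<^bsub>G\<^esub> d')"
          using c c' by (simp only: m_assoc m_closed inv_closed)
        then show ?thesis using c c' by simp
      qed
      ultimately show "w \<in> D" by simp
    qed
  qed
  ultimately show thesis using that by blast
qed

text \<open>\<open>subgroup_index\<close> counts right cosets whereas traces run over left cosets;
  normality of \<open>V\<close> in \<open>W\<close> reconciles the two on every subset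
  \<open>D\<close> of \<open>W\<close>.\<close>

lemma left_cosets_eq_rcosets:
  assumes "V \<lhd> G\<lparr>carrier := W\<rparr>" "subgroup W G" "D \<subseteq> W"
  shows "left_cosets G D V = rcosets\<^bsub>G\<lparr>carrier := D\<rparr>\<^esub> V"
proof -
  interpret normal V "G\<lparr>carrier := W\<rparr>" by fact
  have "V #>\<^bsub>G\<^esub> d = d <#\<^bsub>G\<^esub> V" if "d \<in> D" for d
  proof -
    have "V #>\<^bsub>G\<lparr>carrier := W\<rparr>\<^esub> d = d <#\<^bsub>G\<lparr>carrier := W\<rparr>\<^esub> V"
      using coset_eq that assms(3) by auto
    then show ?thesis by (simp add: r_coset_def l_coset_def)
  qed
  then have "(\<lambda>d. d <#\<^bsub>G\<^esub> V) ` D = (\<lambda>d. V #>\<^bsub>G\<^esub> d) ` D" by simp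
  then show ?thesis by (auto simp: left_cosets_def RCOSETS_def r_coset_def)
qed

text \<open>Among the representatives of \<open>W\<close> modulo \<open>V\<close>, those bringing
  \<open>a\<close> back to \<open>A\<close> are the ones in \<open>D\<close>, and since
  \<open>V \<subseteq> D\<close> they belong to whole cosets inside \<open>D\<close>. This is the
  origin of the index in the divisibility condition.\<close>

lemma coset_sum_indicator:
  assumes R: "cring R" and z: "z \<in> carrier R"
    and W: "subgroup W G" and V: "V \<lhd> G\<lparr>carrier := W\<rparr>" and fin: "finite (left_cosets G W V)"
    and D: "V \<subseteq> D" "D \<subseteq> W" "subgroup D G"
    and A: "\<And>w. w \<in> W \<Longrightarrow> act a w \<in> A \<longleftrightarrow> w \<in> D"
  shows "(\<Oplus>\<^bsub>R\<^esub>C\<in>left_cosets G W V. if act a (rep C) \<in> A then z else \<zero>\<^bsub>R\<^esub>) =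
    [subgroup_index G D V] \<cdot>\<^bsub>R\<^esub> z"
proof -
  interpret R: cring R by fact
  have "subgroup V (G\<lparr>carrier := W\<rparr>)" using V by (simp add: normal_def)
  then have Vs: "subgroup V G" "V \<subseteq> W" using W
    using incl_subgroup subgroup.subset by fastforce+
  have sub: "left_cosets G D V \<subseteq> left_cosets G W V" using D by (auto simp: left_cosets_def)
  have rD: "rep C \<in> D \<longleftrightarrow> C \<in> left_cosets G D V" "rep C \<in> W" if C: "C \<in> left_cosets G W V" for C
  proof -
    have *: "rep C \<in> W" "C = rep C <#\<^bsub>G\<^esub> V"
      using rep_left_cosets_subgroup[OF Vs(1) W Vs(2) C] by auto
    show "rep C \<in> W" by fact
    show "rep C \<in> D \<longleftrightarrow> C \<in> left_cosets G D V"
    proof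
      assume "rep C \<in> D"
      then show "C \<in> left_cosets G D V" using * by (auto simp: left_cosets_def)
    next
      assume "C \<in> left_cosets G D V"
      then show "rep C \<in> D" using rep_left_cosets_subgroup(1)[OF Vs(1) D(3) D(1)] by blast
    qed
  qed
  have "(\<Oplus>\<^bsub>R\<^esub>C\<in>left_cosets G W V. if act a (rep C) \<in> A then z else \<zero>\<^bsub>R\<^esub>) =
      (\<Oplus>\<^bsub>R\<^esub>C\<in>left_cosets G W V. if C \<in> left_cosets G D V then z else \<zero>\<^bsub>R\<^esub>)"
    using z rD A by (intro R.finsum_cong') auto
  also have "\<dots> = (\<Oplus>\<^bsub>R\<^esub>C\<in>left_cosets G D V. if C \<in> left_cosets G D V then z else \<zero>\<^bsub>R\<^esub>)"
    using fin sub z by (intro R.finsum_mono_neutral[symmetric]) auto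
  also have "\<dots> = (\<Oplus>\<^bsub>R\<^esub>C\<in>left_cosets G D V. z)"
    using z by (intro R.finsum_cong') auto
  also have "\<dots> = [card (left_cosets G D V)] \<cdot>\<^bsub>R\<^esub> z" using z by (simp add: R.add.finprod_const)
  also have "card (left_cosets G D V) = subgroup_index G D V"
    using left_cosets_eq_rcosets[OF V W D(2)] by (simp add: subgroup_index_def)
  finally show ?thesis .
qed

text \<open>The set where \<eta> is nonzero is compact and hence covered by finitely many
  neighbourhoods on which the coset count applies. The equation is solved on their
  \<open>W\<close>-saturations one after the other, each new piece being supported outside of those
  already treated.\<close>

proposition divisible_imp_coset_sum:
  fixes \<eta> :: "'x \<Rightarrow> 'r"
  assumes R: "cring R" and X: "locally_profinite_space X"
    and W: "compactin T W" "subgroup W G"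
    and V: "openin T V" "V \<lhd> G\<lparr>carrier := W\<rparr>"
    and \<eta>: "schwartz_fun R X \<eta>" "invariant_under W \<eta>"
    and div: "\<And>x. x \<in> topspace X \<Longrightarrow> \<eta> x \<noteq> \<zero>\<^bsub>R\<^esub> \<Longrightarrow>
      \<exists>z\<in>carrier R. \<eta> x = [subgroup_index G (stab_extension G act V x W) V] \<cdot>\<^bsub>R\<^esub> z"
  obtains \<zeta> where "schwartz_fun R X \<zeta>" "invariant_under V \<zeta>"
    "\<And>x. x \<in> topspace X \<Longrightarrow> coset_sum R W V \<zeta> x = \<eta> x"
proof -
  interpret R: cring R by fact
  have "subgroup V (G\<lparr>carrier := W\<rparr>)" using V by (simp add: normal_def)
  then have Vs: "subgroup V G" "V \<subseteq> W" using W
    using incl_subgroup subgroup.subset by fastforce+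
  have Ws: "W \<subseteq> carrier G" using W subgroup.subset by blast
  have fin: "finite (left_cosets G W V)" using finite_left_cosets W V Vs by blast
  have H: "Hausdorff_space X" using X by (simp add: locally_profinite_space_def)
  define D where "D = (\<lambda>x. stab_extension G act V x W)"
  define nb where "nb = (\<lambda>x A. openin X A \<and> compactin X A \<and> x \<in> A \<and> (\<forall>a\<in>A. \<eta> a = \<eta> x) \<and>
      (\<forall>a\<in>A. \<forall>w\<in>W. act a w \<in> A \<longleftrightarrow> w \<in> D x))"
  have D: "subgroup (D x) G" "V \<subseteq> D x" "D x \<subseteq> W" "openin T (D x)"
    "\<And>w. w \<in> W \<Longrightarrow> act x w = x \<Longrightarrow> w \<in> D x" for x
  proof -
    have s: "V \<union> {w \<in> W. act x w = x} \<subseteq> W" using Vs by auto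
    then show "subgroup (D x) G" unfolding D_def stab_extension_def
      using Ws by (intro generate_is_subgroup) auto
    show *: "V \<subseteq> D x" unfolding D_def stab_extension_def by (auto intro: generate.incl)
    show "D x \<subseteq> W" unfolding D_def stab_extension_def
      by (rule generate_subgroup_incl[OF s W(2)])
    show "openin T (D x)"
      using openin_subgroup_supset \<open>subgroup (D x) G\<close> V(1) * subgroup.one_closed[OF Vs(1)] by blast
    show "w \<in> D x" if "w \<in> W" "act x w = x" for w
      using that unfolding D_def stab_extension_def by (auto intro: generate.incl)
  qed
  have "\<exists>A. nb x A" if x: "x \<in> topspace X" for x
  proof -
    have lc: "locally_constant X \<eta>" using \<eta> by (simp add: schwartz_fun_def)
    show ?thesis
      using stabilizer_neighbourhood[OF X W D(4) D(1) D(3) D(5) x lc \<eta>(2), of x]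
      unfolding nb_def by metis
  qed
  then obtain A where A: "\<And>x. x \<in> topspace X \<Longrightarrow> nb x (A x)" by metis
  \<comment> \<open>The trace at a point involves its whole \<open>W\<close>-orbit. Working on
    \<open>W\<close>-stable sets keeps a solution found on one of them undisturbed by later
    pieces.\<close>
  define sat where "sat = (\<lambda>x. {y \<in> topspace X. \<exists>w\<in>W. act y w \<in> A x})"
  have sat_inv: "act y w \<in> sat x \<longleftrightarrow> y \<in> sat x" if y: "y \<in> topspace X" and w: "w \<in> W" for x y w
  proof -
    have "\<exists>w'\<in>W. act y w' \<in> A x" if "w' \<in> W" "act (act y w) w' \<in> A x" for w'
      using that w y Ws W(2) by (metis act_mult subgroup.m_closed subsetD)
    moreover have "\<exists>w''\<in>W. act (act y w) w'' \<in> A x" if "w' \<in> W" "act y w' \<in> A x" for w'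
    proof (intro bexI)
      have "w \<in> carrier G" "w' \<in> carrier G" using w that Ws by auto
      then have "act (act y w) (inv\<^bsub>G\<^esub> w \<otimes>\<^bsub>G\<^esub> w') = act y w'"
        using y by (metis act_closed act_inv_cancel(1) act_mult inv_closed)
      then show "act (act y w) (inv\<^bsub>G\<^esub> w \<otimes>\<^bsub>G\<^esub> w') \<in> A x" using that by simp
      show "inv\<^bsub>G\<^esub> w \<otimes>\<^bsub>G\<^esub> w' \<in> W" using w that W(2) by (simp add: subgroup.m_closed subgroup.m_inv_closed)
    qed
    ultimately show ?thesis using y w Ws act_closed unfolding sat_def by blast
  qed
  have sat_clopen: "openin X (sat x)" "compactin X (sat x)" "A x \<subseteq> sat x" if x: "x \<in> topspace X" for x
  proof -
    have As: "A x \<subseteq> topspace X" "openin X (A x)" "compactin X (A x)"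
      using A[OF x] openin_subset unfolding nb_def by auto
    have "sat x = (\<Union>w\<in>W. {y \<in> topspace X. act y w \<in> A x})" unfolding sat_def by auto
    moreover have "openin X {y \<in> topspace X. act y w \<in> A x}" if "w \<in> W" for w
      using that Ws As by (intro openin_continuous_map_preimage[OF continuous_act_right]) auto
    ultimately show "openin X (sat x)" by (auto intro: openin_Union)
    \<comment> \<open>Openness was read off from a union of preimages; compactness comes from this
      description as the image of \<open>A x \<times> W\<close>.\<close>
    have "sat x = (\<lambda>(x, g). act x g) ` (A x \<times> W)"
    proof (intro equalityI subsetI)
      fix y assume "y \<in> sat x"
      then obtain w where w: "w \<in> W" "act y w \<in> A x" "y \<in> topspace X" unfolding sat_def by auto
      then have "y = act (act y w) (inv\<^bsub>G\<^esub> w)" using Ws act_inv_cancel(1)[of y w] by auto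
      then show "y \<in> (\<lambda>(x, g). act x g) ` (A x \<times> W)"
        using w W(2) subgroup.m_inv_closed by (intro image_eqI[of _ _ "(act y w, inv\<^bsub>G\<^esub> w)"]) auto
    next
      fix y assume "y \<in> (\<lambda>(x, g). act x g) ` (A x \<times> W)"
      then obtain a w where a: "a \<in> A x" "w \<in> W" "y = act a w" by auto
      then have "act y (inv\<^bsub>G\<^esub> w) = a" "y \<in> topspace X"
        using As Ws act_inv_cancel(1)[of a w] act_closed by auto
      then show "y \<in> sat x" unfolding sat_def using a W(2) subgroup.m_inv_closed by fastforce
    qed
    moreover have "compactin (prod_topology X T) (A x \<times> W)" using As W by (simp add: compactin_Times)
    ultimately show "compactin X (sat x)" using image_compactin[OF _ continuous_act] by metis
    show "A x \<subseteq> sat x"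
    proof
      fix a assume "a \<in> A x"
      then have "act a \<one>\<^bsub>G\<^esub> \<in> A x" "a \<in> topspace X" using As act_one by auto
      then show "a \<in> sat x" unfolding sat_def using subgroup.one_closed[OF W(2)] by auto
    qed
  qed
  define solves where
    "solves = (\<lambda>F \<zeta>. schwartz_fun R X \<zeta> \<and> invariant_under V \<zeta> \<and>
      (\<forall>y\<in>topspace X. y \<in> \<Union>(sat ` F) \<longrightarrow> coset_sum R W V \<zeta> y = \<eta> y) \<and>
      (\<forall>y\<in>topspace X. y \<notin> \<Union>(sat ` F) \<longrightarrow> \<zeta> y = \<zero>\<^bsub>R\<^esub>))"
  have solvesD: "schwartz_fun R X \<zeta>" "invariant_under V \<zeta>"
      "\<And>y. y \<in> topspace X \<Longrightarrow> y \<in> \<Union>(sat ` F) \<Longrightarrow> coset_sum R W V \<zeta> y = \<eta> y"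
      "\<And>y. y \<in> topspace X \<Longrightarrow> y \<notin> \<Union>(sat ` F) \<Longrightarrow> \<zeta> y = \<zero>\<^bsub>R\<^esub>"
    if "solves F \<zeta>" for F \<zeta>
    using that unfolding solves_def by blast+
  have step: "\<exists>\<zeta>. solves F \<zeta>"
    if "finite F" "F \<subseteq> {x \<in> topspace X. \<eta> x \<noteq> \<zero>\<^bsub>R\<^esub>}" for F
    using that
  proof (induction F)
    case empty
    show ?case unfolding solves_def
      by (intro exI[of _ "\<lambda>_. \<zero>\<^bsub>R\<^esub>"])
        (auto simp: schwartz_fun_def locally_constant_const invariant_under_def intro: exI[of _ "{}"])
  next
    case (insert x F)
    then have x: "x \<in> topspace X" "\<eta> x \<noteq> \<zero>\<^bsub>R\<^esub>" by auto
    have nb: "nb x (A x)" using A x by blast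
    have nbA: "act a w \<in> A x \<longleftrightarrow> w \<in> D x" if "a \<in> A x" "w \<in> W" for a w
      using nb that unfolding nb_def by simp
    have nb\<eta>: "\<forall>a\<in>A x. \<eta> a = \<eta> x"
      using nb unfolding nb_def by (elim conjE)
    have VD: "v \<in> W" "v \<in> D x" if "v \<in> V" for v
      using that D(2)[of x] Vs(2) by auto
    \<comment> \<open>As \<eta> is constant on \<open>A x\<close>, the quotient at \<open>x\<close>
      serves for the whole neighbourhood.\<close>
    obtain z where z: "z \<in> carrier R" "\<eta> x = [subgroup_index G (D x) V] \<cdot>\<^bsub>R\<^esub> z"
      using div x unfolding D_def by blast
    from insert obtain \<zeta> where "solves F \<zeta>" by auto
    note \<zeta> = solvesD[OF this]
    define Z where "Z = \<Union>(sat ` F)"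
    have Z: "openin X Z" "compactin X Z" unfolding Z_def
      using insert sat_clopen by (auto intro!: openin_Union compactin_Union)
    have Zc: "closedin X Z" "closedin X (A x)"
      using Z H nb by (auto intro: compactin_imp_closedin simp: nb_def)
    have Zinv: "act y w \<in> Z \<longleftrightarrow> y \<in> Z" if "y \<in> topspace X" "w \<in> W" for y w
      unfolding Z_def using sat_inv that by blast
    \<comment> \<open>The earlier solution is kept on \<open>Z\<close>, and outside of
      \<open>Z\<close> only \<open>A x\<close> contributes. Since \<open>Z\<close> is clopen and
      stable under \<open>W\<close>, local constancy, invariance under \<open>V\<close> and the
      traces already obtained survive.\<close>
    define \<zeta>' where "\<zeta>' = (\<lambda>y. if y \<in> Z then \<zeta> y else if y \<in> A x then z else \<zero>\<^bsub>R\<^esub>)"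
    have "schwartz_fun R X \<zeta>'"
      unfolding schwartz_fun_def
    proof (intro conjI exI[of _ "Z \<union> A x"])
      show "\<zeta>' \<in> topspace X \<rightarrow> carrier R" unfolding \<zeta>'_def using \<zeta> z by (auto simp: schwartz_fun_closed)
      show "locally_constant X \<zeta>'" unfolding \<zeta>'_def
        using \<zeta> Z Zc nb
        by (intro locally_constant_if locally_constant_const) (auto simp: schwartz_fun_def nb_def)
      show "compactin X (Z \<union> A x)" using Z nb by (intro compactin_Un) (auto simp: nb_def)
      show "\<forall>y\<in>topspace X - (Z \<union> A x). \<zeta>' y = \<zero>\<^bsub>R\<^esub>" unfolding \<zeta>'_def by auto
    qed
    moreover have inv': "invariant_under V \<zeta>'"
      unfolding invariant_under_def
    proof (intro ballI)
      fix v y assume v: "v \<in> V" and y: "y \<in> topspace X"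
      have vc: "v \<in> carrier G" using v Ws Vs by auto
      have "act y v \<in> Z \<longleftrightarrow> y \<in> Z" using Zinv y v Vs by auto
      moreover have "act y v \<in> A x \<longleftrightarrow> y \<in> A x"
      proof
        assume "y \<in> A x"
        then show "act y v \<in> A x" using nbA[OF _ VD(1)[OF v]] VD(2)[OF v] by blast
      next
        assume "act y v \<in> A x"
        moreover have iv: "inv\<^bsub>G\<^esub> v \<in> V" using subgroup.m_inv_closed[OF Vs(1) v] .
        ultimately have "act (act y v) (inv\<^bsub>G\<^esub> v) \<in> A x"
          using nbA[OF _ VD(1)[OF iv]] VD(2)[OF iv] by blast
        then show "y \<in> A x" using act_inv_cancel(1) y vc by simp
      qed
      ultimately show "\<zeta>' (act y v) = \<zeta>' y"
        unfolding \<zeta>'_def using \<zeta>(2) v y by (auto simp: invariant_under_def)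
    qed
    moreover have "\<zeta>' y = \<zero>\<^bsub>R\<^esub>" if "y \<in> topspace X" "y \<notin> \<Union>(sat ` insert x F)" for y
      using that sat_clopen(3)[OF x(1)] unfolding \<zeta>'_def Z_def by auto
    moreover have "coset_sum R W V \<zeta>' y = \<eta> y" if y: "y \<in> topspace X" "y \<in> \<Union>(sat ` insert x F)" for y
    proof (cases "y \<in> Z")
      case True
      have "coset_sum R W V \<zeta>' y = coset_sum R W V \<zeta> y"
        unfolding coset_sum_def
      proof (rule R.finsum_cong')
        fix C assume C: "C \<in> left_cosets G W V"
        have "rep C \<in> W"
          using rep_left_cosets_subgroup(1)[OF Vs(1) W(2) Vs(2) C] .
        then show "\<zeta>' (act y (rep C)) = \<zeta> (act y (rep C))"
          using Zinv y True unfolding \<zeta>'_def by simp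
      next
        show "(\<lambda>C. \<zeta> (act y (rep C))) \<in> left_cosets G W V \<rightarrow> carrier R"
        proof
          fix C assume C: "C \<in> left_cosets G W V"
          have "rep C \<in> W"
            using rep_left_cosets_subgroup(1)[OF Vs(1) W(2) Vs(2) C] .
          then show "\<zeta> (act y (rep C)) \<in> carrier R"
            using \<zeta>(1) y Ws act_closed schwartz_fun_closed by (metis subsetD)
        qed
      qed simp
      then show ?thesis using \<zeta>(3) y True unfolding Z_def by simp
    next
      case False
      then have "y \<in> sat x" using y unfolding Z_def by auto
      then obtain w where w: "w \<in> W" "act y w \<in> A x" unfolding sat_def by auto
      \<comment> \<open>Both the trace and \<eta> are invariant under \<open>W\<close>, so
        \<open>y\<close> may be replaced by a point of \<open>A x\<close>, where the coset count
        applies; the new point is still outside of \<open>Z\<close>.\<close>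
      define a where "a = act y w"
      have a: "a \<in> A x" "a \<in> topspace X" "a \<notin> Z"
        using w y False Zinv Ws act_closed unfolding a_def by auto
      have img: "(\<lambda>e. w \<otimes>\<^bsub>G\<^esub> e) ` W = W" using translate_subgroup_image W(2) w(1) by blast
      have "coset_sum R W V \<zeta>' y = coset_sum R W V \<zeta>' a"
        unfolding a_def using \<open>schwartz_fun R X \<zeta>'\<close> w Ws y Vs inv' img
        by (intro coset_sum_translate[symmetric] R) (auto simp: schwartz_fun_def)
      also have "\<dots> = (\<Oplus>\<^bsub>R\<^esub>C\<in>left_cosets G W V. if act a (rep C) \<in> A x then z else \<zero>\<^bsub>R\<^esub>)"
        unfolding coset_sum_def
      proof (rule R.finsum_cong')
        fix C assume C: "C \<in> left_cosets G W V"
        have "rep C \<in> W"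
          using rep_left_cosets_subgroup(1)[OF Vs(1) W(2) Vs(2) C] .
        then show "\<zeta>' (act a (rep C)) = (if act a (rep C) \<in> A x then z else \<zero>\<^bsub>R\<^esub>)"
          using Zinv a unfolding \<zeta>'_def by simp
      qed (use z in auto)
      also have "\<dots> = [subgroup_index G (D x) V] \<cdot>\<^bsub>R\<^esub> z"
        using nb a by (intro coset_sum_indicator R z W V fin D) (auto simp: nb_def)
      also have "\<dots> = \<eta> x" using z by simp
      also have "\<dots> = \<eta> a" using nb\<eta>[THEN bspec, OF a(1)] by (rule sym)
      also have "\<dots> = \<eta> y" unfolding a_def using \<eta>(2) w y by (simp add: invariant_under_def)
      finally show ?thesis .
    qed
    ultimately have "solves (insert x F) \<zeta>'" unfolding solves_def by blast
    then show ?case by (rule exI[of _ \<zeta>'])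
  qed
  define S where "S = {x \<in> topspace X. \<eta> x \<noteq> \<zero>\<^bsub>R\<^esub>}"
  have "compactin X S" unfolding S_def by (rule compactin_schwartz_fun_support[OF \<eta>(1)])
  then have "\<exists>\<F>. finite \<F> \<and> \<F> \<subseteq> A ` S \<and> S \<subseteq> \<Union>\<F>"
    by (rule compactinD) (use A in \<open>auto simp: S_def nb_def\<close>)
  then obtain F where F: "finite F" "F \<subseteq> S" "S \<subseteq> \<Union>(A ` F)" by (metis finite_subset_image)
  obtain \<zeta> where "solves F \<zeta>"
    using step[of F] F unfolding S_def by auto
  note \<zeta> = solvesD[OF this]
  have "coset_sum R W V \<zeta> y = \<eta> y" if y: "y \<in> topspace X" for y
  proof (cases "y \<in> \<Union>(sat ` F)")
    case True
    then show ?thesis using \<zeta> y by blast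
  next
    \<comment> \<open>The chosen neighbourhoods cover the set where \<eta> is nonzero, and
      translates by \<open>W\<close> never enter a saturation from outside, so both sides
      vanish.\<close>
    case False
    have "y \<notin> S"
    proof
      assume "y \<in> S"
      then obtain x where "x \<in> F" "y \<in> A x" using F(3) by auto
      moreover from this have "x \<in> topspace X" using F(2) by (auto simp: S_def)
      ultimately show False using False sat_clopen(3) by blast
    qed
    then have "\<eta> y = \<zero>\<^bsub>R\<^esub>" using y by (simp add: S_def)
    moreover have "coset_sum R W V \<zeta> y = \<zero>\<^bsub>R\<^esub>"
      unfolding coset_sum_def
    proof (rule R.add.finprod_one_eqI)
      fix C assume C: "C \<in> left_cosets G W V"
      have r: "rep C \<in> W"
        using rep_left_cosets_subgroup(1)[OF Vs(1) W(2) Vs(2) C] .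
      then have "act y (rep C) \<notin> \<Union>(sat ` F)" using False sat_inv y by blast
      then show "\<zeta> (act y (rep C)) = \<zero>\<^bsub>R\<^esub>" using \<zeta>(4) r Ws y act_closed by (metis subsetD)
    qed
    ultimately show ?thesis by simp
  qed
  then show thesis using that \<zeta> by blast
qed

end

section \<open>Pushforwards of RIC functors\<close>

lemma linear_mapsD:
  assumes "f \<in> linear_maps R A B"
  shows "x \<in> carrier A \<Longrightarrow> f x \<in> carrier B"
    and "x \<in> carrier A \<Longrightarrow> y \<in> carrier A \<Longrightarrow> f (x \<oplus>\<^bsub>A\<^esub> y) = f x \<oplus>\<^bsub>B\<^esub> f y"
    and "a \<in> carrier R \<Longrightarrow> x \<in> carrier A \<Longrightarrow> f (a \<odot>\<^bsub>A\<^esub> x) = a \<odot>\<^bsub>B\<^esub> f x"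
  using assms by (auto simp: linear_maps_def)

lemma linear_maps_zero:
  assumes "f \<in> linear_maps R A B" "Module.module R A" "Module.module R B"
  shows "f \<zero>\<^bsub>A\<^esub> = \<zero>\<^bsub>B\<^esub>"
proof -
  interpret A: Module.module R A by fact
  interpret B: Module.module R B by fact
  have "f \<zero>\<^bsub>A\<^esub> = f (\<zero>\<^bsub>R\<^esub> \<odot>\<^bsub>A\<^esub> \<zero>\<^bsub>A\<^esub>)" by simp
  also have "\<dots> = \<zero>\<^bsub>R\<^esub> \<odot>\<^bsub>B\<^esub> f \<zero>\<^bsub>A\<^esub>" by (rule linear_mapsD(3)[OF assms(1)]) auto
  also have "\<dots> = \<zero>\<^bsub>B\<^esub>" using linear_mapsD(1)[OF assms(1)] by (intro B.smult_l_null) auto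
  finally show ?thesis .
qed

lemma linear_maps_finsum:
  assumes f: "f \<in> linear_maps R A B" and A: "Module.module R A" and B: "Module.module R B"
    and u: "u \<in> S \<rightarrow> carrier A"
  shows "f (\<Oplus>\<^bsub>A\<^esub>i\<in>S. u i) = (\<Oplus>\<^bsub>B\<^esub>i\<in>S. f (u i))"
proof -
  interpret A: Module.module R A by fact
  interpret B: Module.module R B by fact
  have fin: "f (\<Oplus>\<^bsub>A\<^esub>i\<in>S. u i) = (\<Oplus>\<^bsub>B\<^esub>i\<in>S. f (u i))" if "finite S" "u \<in> S \<rightarrow> carrier A" for S
    using that
  proof (induction S)
    case empty
    then show ?case using linear_maps_zero[OF f A B] by simp
  next
    case (insert s S)
    have cl: "u s \<in> carrier A" "u \<in> S \<rightarrow> carrier A" using insert.prems by auto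
    have "(\<lambda>i. f (u i)) \<in> S \<rightarrow> carrier B" using cl linear_mapsD(1)[OF f] by auto
    then show ?case
      using insert.IH[OF cl(2)] insert.hyps cl linear_mapsD(1,2)[OF f]
      by (simp add: A.finsum_insert B.finsum_insert A.finsum_closed)
  qed
  show ?thesis
  proof (cases "finite S")
    case True
    then show ?thesis using fin u by blast
  next
    \<comment> \<open>Over an infinite index set both sums take the default value zero, which a
      linear map preserves.\<close>
    case False
    then show ?thesis using linear_maps_zero[OF f A B]
      by (simp add: A.finsum_infinite B.finsum_infinite)
  qed
qed

text \<open>The conjugation is moved from the source to the target, so that a morphism is expressed
  by the inclusion under which symbols make sense.\<close>

lemma (in plain_group) level_hom_iff:
  assumes "L \<subseteq> carrier G" "K \<subseteq> carrier G"
  shows "g \<in> level_hom G L K \<longleftrightarrow> g \<in> carrier G \<and> L \<subseteq> conjugate G g K"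
proof -
  have "conjugate G (inv g) L \<subseteq> K \<longleftrightarrow> L \<subseteq> conjugate G g K" if g: "g \<in> carrier G"
  proof
    assume "conjugate G (inv g) L \<subseteq> K"
    from conjugate_mono[OF this, of g] show "L \<subseteq> conjugate G g K"
      using g assms by (simp add: conjugate_inv_cancel)
  next
    assume "L \<subseteq> conjugate G g K"
    from conjugate_mono[OF this, of "inv g"] show "conjugate G (inv g) L \<subseteq> K"
      using g assms by (simp add: conjugate_inv_cancel)
  qed
  then show ?thesis by (auto simp: level_hom_def)
qed

text \<open>By \<open>H_eq\<close> the product and unit of \<open>H\<close> are literally those of
  \<open>G\<close>, so elements of \<open>H\<close> can be used in both groups. Only the inverse,
  whose definition refers to the carrier, has to be compared separately.\<close>

locale ric_pushforward =
  G: level_collection G TG \<Upsilon>\<^sub>G + H: level_collection H TH \<Upsilon>\<^sub>H +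
  M: ric_functor R G \<Upsilon>\<^sub>G M + N: ric_functor R H \<Upsilon>\<^sub>H N +
  \<iota>: pushforward R H G \<Upsilon>\<^sub>H \<Upsilon>\<^sub>G N M \<iota>
  for R :: "'r ring" and G H :: "'g monoid" and TG TH :: "'g topology"
    and \<Upsilon>\<^sub>G \<Upsilon>\<^sub>H :: "'g set set" and M :: "('g, 'r, 'm) ric" and N :: "('g, 'r, 'n) ric"
    and \<iota> :: "'g set \<Rightarrow> 'g set \<Rightarrow> 'n \<Rightarrow> 'm" +
  assumes cring_R: "cring R"
    and H_eq: "H = G\<lparr>carrier := carrier H\<rparr>" and H_subset: "carrier H \<subseteq> carrier G"
    and restrict_level: "\<And>P. P \<in> \<Upsilon>\<^sub>G \<Longrightarrow> P \<inter> carrier H \<in> \<Upsilon>\<^sub>H"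
    and mackey_\<iota>: "mackey_pushforward G \<Upsilon>\<^sub>H \<Upsilon>\<^sub>G N M \<iota>"
begin

lemma mult_H [simp]: "(\<otimes>\<^bsub>H\<^esub>) = (\<otimes>\<^bsub>G\<^esub>)"
  using arg_cong[OF H_eq, of monoid.mult] by simp

lemma one_H [simp]: "\<one>\<^bsub>H\<^esub> = \<one>\<^bsub>G\<^esub>"
  using arg_cong[OF H_eq, of monoid.one] by simp

lemma subgroup_H: "subgroup (carrier H) G"
  by (rule G.group_incl_imp_subgroup[OF H_subset]) (rule subst[OF H_eq, of Group.group, OF H.is_group])

lemma inv_H:
  assumes "x \<in> carrier H"
  shows "inv\<^bsub>H\<^esub> x = inv\<^bsub>G\<^esub> x"
  using arg_cong[OF H_eq, of m_inv] G.m_inv_consistent[OF subgroup_H assms] by simp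

lemma conjugate_H:
  assumes "h \<in> carrier H"
  shows "conjugate H h A = conjugate G h A"
  using assms by (simp add: conjugate_def l_coset_def r_coset_def inv_H)

lemma level_G: 
  assumes "P \<in> \<Upsilon>\<^sub>G"
  shows "subgroup P G" "P \<subseteq> carrier G"
  using G.compact_open[OF assms] subgroup.subset by (auto simp: compact_open_subgroup_def)

lemma level_H:
  assumes "V \<in> \<Upsilon>\<^sub>H"
  shows "subgroup V H" "V \<subseteq> carrier H" "V \<subseteq> carrier G" "subgroup V G"
proof -
  show 1: "subgroup V H" using H.compact_open[OF assms] by (auto simp: compact_open_subgroup_def)
  then show 2: "V \<subseteq> carrier H" by (rule subgroup.subset)
  then show "V \<subseteq> carrier G" using H_subset by auto
  show "subgroup V G"
    using 1 H_eq by (metis G.incl_subgroup subgroup_H)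
qed

lemma level_hom_H_iff:
  assumes "V \<in> \<Upsilon>\<^sub>H" "W \<in> \<Upsilon>\<^sub>H"
  shows "h \<in> level_hom H V W \<longleftrightarrow> h \<in> carrier H \<and> V \<subseteq> conjugate G h W"
  using H.level_hom_iff[OF level_H(2)[OF assms(1)] level_H(2)[OF assms(2)]] conjugate_H by auto

lemma level_hom_G_iff:
  assumes "P \<in> \<Upsilon>\<^sub>G" "Q \<in> \<Upsilon>\<^sub>G"
  shows "h \<in> level_hom G P Q \<longleftrightarrow> h \<in> carrier G \<and> P \<subseteq> conjugate G h Q"
  by (rule G.level_hom_iff[OF level_G(2)[OF assms(1)] level_G(2)[OF assms(2)]])

lemma Int_level:
  assumes "V \<in> \<Upsilon>\<^sub>H" "P \<in> \<Upsilon>\<^sub>G"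
  shows "V \<inter> P \<in> \<Upsilon>\<^sub>H"
proof -
  have "V \<inter> (P \<inter> carrier H) \<in> \<Upsilon>\<^sub>H" using H.T3 restrict_level assms by blast
  moreover have "V \<inter> (P \<inter> carrier H) = V \<inter> P" using level_H(2)[OF assms(1)] by auto
  ultimately show ?thesis by simp
qed

lemma one_level_hom_G: "P \<in> \<Upsilon>\<^sub>G \<Longrightarrow> Q \<in> \<Upsilon>\<^sub>G \<Longrightarrow> P \<subseteq> Q \<Longrightarrow> \<one>\<^bsub>G\<^esub> \<in> level_hom G P Q"
  by (simp add: level_hom_G_iff G.conjugate_one level_G)

lemma one_level_hom_H: "V \<in> \<Upsilon>\<^sub>H \<Longrightarrow> W \<in> \<Upsilon>\<^sub>H \<Longrightarrow> V \<subseteq> W \<Longrightarrow> \<one>\<^bsub>G\<^esub> \<in> level_hom H V W"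
  using G.subgroup_self subgroup.one_closed[OF subgroup_H]
  by (simp add: level_hom_H_iff G.conjugate_one level_H)

lemma conj_level_hom: "P \<in> \<Upsilon>\<^sub>G \<Longrightarrow> \<tau> \<in> carrier G \<Longrightarrow> \<tau> \<in> level_hom G (conjugate G \<tau> P) P"
  by (simp add: level_hom_G_iff G.T1)

section \<open>Symbols and their transformation rules\<close>

definition symbol :: "'g set \<Rightarrow> 'g set \<Rightarrow> 'g \<Rightarrow> 'n \<Rightarrow> 'm" where
  "symbol P V \<tau> x = push M (conjugate G \<tau> P) P \<tau> (\<iota> V (conjugate G \<tau> P) x)"

lemma symbol_linear:
  assumes "P \<in> \<Upsilon>\<^sub>G" "V \<in> \<Upsilon>\<^sub>H" "\<tau> \<in> carrier G" "V \<subseteq> conjugate G \<tau> P"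
  shows "symbol P V \<tau> \<in> linear_maps R (obj N V) (obj M P)"
proof -
  have Q: "conjugate G \<tau> P \<in> \<Upsilon>\<^sub>G" using assms G.T1 by blast
  have 1: "push M (conjugate G \<tau> P) P \<tau> \<in> linear_maps R (obj M (conjugate G \<tau> P)) (obj M P)"
    using M.push_linear[OF Q assms(1) conj_level_hom] assms by blast
  have 2: "\<iota> V (conjugate G \<tau> P) \<in> linear_maps R (obj N V) (obj M (conjugate G \<tau> P))"
    using \<iota>.linear[OF assms(2) Q assms(4)] .
  show ?thesis
    unfolding linear_maps_def symbol_def
    using linear_mapsD[OF 1] linear_mapsD[OF 2] by auto
qed

lemma symbol_closed:
  assumes "P \<in> \<Upsilon>\<^sub>G" "V \<in> \<Upsilon>\<^sub>H" "\<tau> \<in> carrier G" "V \<subseteq> conjugate G \<tau> P" "x \<in> carrier (obj N V)"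
  shows "symbol P V \<tau> x \<in> carrier (obj M P)"
  using linear_mapsD(1)[OF symbol_linear] assms by blast

text \<open>The level \<tau>P\<tau>^-1 is the same for \<tau> and \<tau>k, and the additional
  pushforward along k is inner on \<open>M(P)\<close>, hence trivial.\<close>

lemma symbol_right:
  assumes P: "P \<in> \<Upsilon>\<^sub>G" and V: "V \<in> \<Upsilon>\<^sub>H" "V \<subseteq> conjugate G \<tau> P" and \<tau>: "\<tau> \<in> carrier G"
    and k: "k \<in> P" and x: "x \<in> carrier (obj N V)"
  shows "symbol P V (\<tau> \<otimes>\<^bsub>G\<^esub> k) x = symbol P V \<tau> x"
proof -
  have kc: "k \<in> carrier G" using k level_G P by blast
  have c: "conjugate G (\<tau> \<otimes>\<^bsub>G\<^esub> k) P = conjugate G \<tau> P"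
    using G.conjugate_mult[OF \<tau> kc] G.conjugate_self[OF level_G(1)[OF P] k] level_G[OF P] by simp
  define Q where "Q = conjugate G \<tau> P"
  have Q: "Q \<in> \<Upsilon>\<^sub>G" unfolding Q_def using G.T1 P \<tau> by blast
  have y: "\<iota> V Q x \<in> carrier (obj M Q)"
    using linear_mapsD(1)[OF \<iota>.linear[OF V(1) Q]] V x unfolding Q_def by blast
  have h: "\<tau> \<in> level_hom G Q P" unfolding Q_def using conj_level_hom P \<tau> by blast
  have k': "k \<in> level_hom G P P"
    using kc P G.conjugate_self[OF level_G(1)[OF P] k] by (simp add: level_hom_G_iff)
  have "push M Q P (\<tau> \<otimes>\<^bsub>G\<^esub> k) (\<iota> V Q x) = push M P P k (push M Q P \<tau> (\<iota> V Q x))"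
    by (rule M.push_comp[OF Q P P h k' y])
  also have "\<dots> = push M Q P \<tau> (\<iota> V Q x)"
    using M.push_inner[OF P k] linear_mapsD(1)[OF M.push_linear[OF Q P h] y] by blast
  finally show ?thesis unfolding symbol_def c Q_def .
qed

text \<open>A left factor from \<open>H\<close> is traded for a pushforward in \<open>N\<close>,
  because \<iota> commutes with pushforwards along \<open>H\<close>. This links representatives that
  differ by an element of \<open>H\<close>.\<close>

lemma symbol_push:
  assumes P: "P \<in> \<Upsilon>\<^sub>G" and V: "V \<in> \<Upsilon>\<^sub>H" "V' \<in> \<Upsilon>\<^sub>H" "V \<subseteq> conjugate G h V'" "V' \<subseteq> conjugate G \<tau> P"
    and \<tau>: "\<tau> \<in> carrier G" and h: "h \<in> carrier H" and x: "x \<in> carrier (obj N V)"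
  shows "symbol P V (h \<otimes>\<^bsub>G\<^esub> \<tau>) x = symbol P V' \<tau> (push N V V' h x)"
proof -
  define Q where "Q = conjugate G \<tau> P"
  define Q' where "Q' = conjugate G (h \<otimes>\<^bsub>G\<^esub> \<tau>) P"
  have hc: "h \<in> carrier G" using h H_subset by auto
  have Q: "Q \<in> \<Upsilon>\<^sub>G" "Q' \<in> \<Upsilon>\<^sub>G" unfolding Q_def Q'_def using G.T1 P \<tau> hc by auto
  have Q'Q: "Q' = conjugate G h Q"
    unfolding Q_def Q'_def using G.conjugate_mult[OF hc \<tau>] level_G[OF P] by simp
  have VQ': "V \<subseteq> Q'" using V G.conjugate_mono[of V' Q h] unfolding Q'Q Q_def by blast
  have y: "\<iota> V Q' x \<in> carrier (obj M Q')"
    using linear_mapsD(1)[OF \<iota>.linear[OF V(1) Q(2) VQ']] x by blast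
  have hQ: "h \<in> level_hom G Q' Q" using Q hc by (simp add: level_hom_G_iff Q'Q)
  have hV: "h \<in> level_hom H V V'" using V h by (simp add: level_hom_H_iff)
  have tQ: "\<tau> \<in> level_hom G Q P" unfolding Q_def using conj_level_hom P \<tau> by blast
  have "\<iota> V' Q (push N V V' h x) = push M Q' Q h (\<iota> V Q' x)"
    using V(4) by (intro \<iota>.commute_push V(1,2) Q VQ' hV hQ x) (simp add: Q_def)
  moreover have "push M Q' P (h \<otimes>\<^bsub>G\<^esub> \<tau>) (\<iota> V Q' x) = push M Q P \<tau> (push M Q' Q h (\<iota> V Q' x))"
    by (rule M.push_comp[OF Q(2) Q(1) P hQ tQ y])
  ultimately show ?thesis by (simp add: symbol_def flip: Q_def Q'_def)
qed

text \<open>The trace to the larger level \<open>P'\<close> and the pushforward along \<tau> are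
  interchanged through \<tau> 1 = 1 \<tau>; the trace then passes through \<iota> into
  \<open>N\<close>.\<close>

lemma push_symbol:
  assumes P: "P \<in> \<Upsilon>\<^sub>G" "P' \<in> \<Upsilon>\<^sub>G" "P \<subseteq> P'" and V: "V \<in> \<Upsilon>\<^sub>H" "V' \<in> \<Upsilon>\<^sub>H" "V \<subseteq> V'"
    "V \<subseteq> conjugate G \<tau> P" "V' \<subseteq> conjugate G \<tau> P'"
    and \<tau>: "\<tau> \<in> carrier G" and x: "x \<in> carrier (obj N V)"
  shows "push M P P' \<one>\<^bsub>G\<^esub> (symbol P V \<tau> x) = symbol P' V' \<tau> (push N V V' \<one>\<^bsub>G\<^esub> x)"
proof -
  define Q where "Q = conjugate G \<tau> P"
  define Q' where "Q' = conjugate G \<tau> P'"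
  have Q: "Q \<in> \<Upsilon>\<^sub>G" "Q' \<in> \<Upsilon>\<^sub>G" "Q \<subseteq> Q'"
    unfolding Q_def Q'_def using G.T1 P \<tau> G.conjugate_mono by auto
  have VQ: "V \<subseteq> Q" "V' \<subseteq> Q'" using V unfolding Q_def Q'_def by auto
  have y: "\<iota> V Q x \<in> carrier (obj M Q)"
    using linear_mapsD(1)[OF \<iota>.linear[OF V(1) Q(1) VQ(1)]] x by blast
  have h: "\<tau> \<in> level_hom G Q P" "\<tau> \<in> level_hom G Q' P'"
    unfolding Q_def Q'_def using conj_level_hom P \<tau> by auto
  have "push M P P' \<one>\<^bsub>G\<^esub> (push M Q P \<tau> (\<iota> V Q x)) = push M Q P' (\<tau> \<otimes>\<^bsub>G\<^esub> \<one>\<^bsub>G\<^esub>) (\<iota> V Q x)"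
    by (rule M.push_comp[OF Q(1) P(1,2) h(1) one_level_hom_G[OF P] y, symmetric])
  also have "\<dots> = push M Q P' (\<one>\<^bsub>G\<^esub> \<otimes>\<^bsub>G\<^esub> \<tau>) (\<iota> V Q x)" using \<tau> by simp
  also have "\<dots> = push M Q' P' \<tau> (push M Q Q' \<one>\<^bsub>G\<^esub> (\<iota> V Q x))"
    by (rule M.push_comp[OF Q(1,2) P(2) one_level_hom_G[OF Q] h(2) y])
  also have "push M Q Q' \<one>\<^bsub>G\<^esub> (\<iota> V Q x) = \<iota> V' Q' (push N V V' \<one>\<^bsub>G\<^esub> x)"
    by (rule \<iota>.commute_push[symmetric])
      (use V Q VQ x one_level_hom_G one_level_hom_H in auto)
  finally show ?thesis by (simp add: symbol_def flip: Q_def Q'_def)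
qed

text \<open>The summand at \<tau> in the Mackey formula: \<open>x\<close> is restricted to the
  largest subgroup of \<open>W\<close> at which a symbol with representative \<tau> makes
  sense.\<close>

definition res_symbol :: "'g set \<Rightarrow> 'g set \<Rightarrow> 'g \<Rightarrow> 'n \<Rightarrow> 'm" where
  "res_symbol P W \<tau> x =
     symbol P (W \<inter> conjugate G \<tau> P) \<tau> (pull N (W \<inter> conjugate G \<tau> P) W \<one>\<^bsub>G\<^esub> x)"

lemma Int_conjugate_level:
  "P \<in> \<Upsilon>\<^sub>G \<Longrightarrow> W \<in> \<Upsilon>\<^sub>H \<Longrightarrow> \<tau> \<in> carrier G \<Longrightarrow> W \<inter> conjugate G \<tau> P \<in> \<Upsilon>\<^sub>H"
  using Int_level G.T1 by blast

lemma pull_sub_closed: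
  assumes "V \<in> \<Upsilon>\<^sub>H" "W \<in> \<Upsilon>\<^sub>H" "V \<subseteq> W" "x \<in> carrier (obj N W)"
  shows "pull N V W \<one>\<^bsub>G\<^esub> x \<in> carrier (obj N V)"
  using linear_mapsD(1)[OF N.pull_linear[OF assms(1,2) one_level_hom_H]] assms by blast

lemma res_symbol_closed:
  assumes "P \<in> \<Upsilon>\<^sub>G" "W \<in> \<Upsilon>\<^sub>H" "\<tau> \<in> carrier G" "x \<in> carrier (obj N W)"
  shows "res_symbol P W \<tau> x \<in> carrier (obj M P)"
  unfolding res_symbol_def
  using assms Int_conjugate_level by (intro symbol_closed pull_sub_closed) auto

lemma res_symbol_right:
  assumes P: "P \<in> \<Upsilon>\<^sub>G" and W: "W \<in> \<Upsilon>\<^sub>H" and \<tau>: "\<tau> \<in> carrier G" and k: "k \<in> P"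
    and x: "x \<in> carrier (obj N W)"
  shows "res_symbol P W (\<tau> \<otimes>\<^bsub>G\<^esub> k) x = res_symbol P W \<tau> x"
proof -
  have kc: "k \<in> carrier G" using k level_G P by blast
  have c: "conjugate G (\<tau> \<otimes>\<^bsub>G\<^esub> k) P = conjugate G \<tau> P"
    using G.conjugate_mult[OF \<tau> kc] G.conjugate_self[OF level_G(1)[OF P] k] level_G[OF P] by simp
  show ?thesis
    unfolding res_symbol_def c
    using assms Int_conjugate_level by (intro symbol_right pull_sub_closed) auto
qed

text \<open>Replacing \<tau> by u\<tau> conjugates the level W \<inter> \<tau>P\<tau>^-1 by u. The
  resulting pushforward in \<open>N\<close> is a pullback along u^-1; it can be taken before the
  restriction, and there u acts trivially because it lies in \<open>W\<close>. Together with
  invariance on the right, the term depends only on the double coset W\<tau>P.\<close>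

lemma res_symbol_left:
  assumes P: "P \<in> \<Upsilon>\<^sub>G" and W: "W \<in> \<Upsilon>\<^sub>H" and \<tau>: "\<tau> \<in> carrier G" and u: "u \<in> W"
    and x: "x \<in> carrier (obj N W)"
  shows "res_symbol P W (u \<otimes>\<^bsub>G\<^esub> \<tau>) x = res_symbol P W \<tau> x"
proof -
  have uH: "u \<in> carrier H" "u \<in> carrier G" using u level_H[OF W] by auto
  define V where "V = W \<inter> conjugate G \<tau> P"
  define V' where "V' = W \<inter> conjugate G (u \<otimes>\<^bsub>G\<^esub> \<tau>) P"
  have V: "V \<in> \<Upsilon>\<^sub>H" "V' \<in> \<Upsilon>\<^sub>H" "V \<subseteq> W" "V' \<subseteq> W"
    unfolding V_def V'_def using Int_conjugate_level P W \<tau> uH by auto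
  have QG: "conjugate G \<tau> P \<subseteq> carrier G" using G.conjugate_subset_carrier level_G P \<tau> by blast
  have V'V: "V' = conjugate G u V"
    unfolding V_def V'_def
    using G.conjugate_Int[OF uH(2) level_H(3)[OF W] QG] G.conjugate_mult[OF uH(2) \<tau> level_G(2)[OF P]]
      G.conjugate_self[OF level_H(4)[OF W] u] by simp
  have cV: "conjugate H (inv\<^bsub>H\<^esub> (inv\<^bsub>H\<^esub> u)) V = V'"
    using uH V'V conjugate_H by simp
  have iu: "inv\<^bsub>H\<^esub> u \<in> W" using subgroup.m_inv_closed[OF level_H(4)[OF W] u] inv_H uH by simp
  have y: "pull N V' W \<one>\<^bsub>G\<^esub> x \<in> carrier (obj N V')" using V W x by (intro pull_sub_closed)
  have hu: "inv\<^bsub>H\<^esub> u \<in> level_hom H V V'"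
    using V uH V'V inv_H G.conjugate_inv_cancel level_H(3)[OF V(1)] subgroup.m_inv_closed[OF subgroup_H uH(1)]
    by (simp add: level_hom_H_iff)
  have hW: "inv\<^bsub>H\<^esub> u \<in> level_hom H W W"
    using W iu level_H[OF W] G.conjugate_self[OF level_H(4)[OF W] iu] by (auto simp: level_hom_H_iff)
  have "res_symbol P W (u \<otimes>\<^bsub>G\<^esub> \<tau>) x = symbol P V' (u \<otimes>\<^bsub>G\<^esub> \<tau>) (pull N V' W \<one>\<^bsub>G\<^esub> x)"
    unfolding res_symbol_def V'_def ..
  also have "\<dots> = symbol P V \<tau> (push N V' V u (pull N V' W \<one>\<^bsub>G\<^esub> x))"
    using P V y uH \<tau> by (intro symbol_push) (auto simp: V'V V_def)
  also have "push N V' V u (pull N V' W \<one>\<^bsub>G\<^esub> x) = pull N V V' (inv\<^bsub>H\<^esub> u) (pull N V' W \<one>\<^bsub>G\<^esub> x)"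
    using N.pull_eq_push[OF V(1,2) _ cV y] uH by simp
  also have "\<dots> = pull N V W (inv\<^bsub>H\<^esub> u \<otimes>\<^bsub>H\<^esub> \<one>\<^bsub>G\<^esub>) x"
    using N.pull_comp[OF V(1,2) W hu one_level_hom_H[OF V(2) W V(4)] x] by simp
  also have "\<dots> = pull N V W (\<one>\<^bsub>G\<^esub> \<otimes>\<^bsub>H\<^esub> inv\<^bsub>H\<^esub> u) x"
    using uH inv_H by simp
  also have "\<dots> = pull N V W \<one>\<^bsub>G\<^esub> (pull N W W (inv\<^bsub>H\<^esub> u) x)"
    using N.pull_comp[OF V(1) W W one_level_hom_H[OF V(1) W V(3)] hW x] by simp
  also have "pull N W W (inv\<^bsub>H\<^esub> u) x = push N W W (inv\<^bsub>H\<^esub> (inv\<^bsub>H\<^esub> u)) x"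
    using uH G.conjugate_self[OF level_H(4)[OF W] u]
    by (intro N.pull_eq_push[OF W W _ _ x]) (auto simp: conjugate_H)
  also have "\<dots> = x" using N.push_inner[OF W u x] uH by simp
  finally show ?thesis unfolding res_symbol_def V_def .
qed

text \<open>Terms whose representatives differ by \<open>H\<close> are brought to the common
  representative \<tau>. The composite of pullback and pushforward that appears is the Hecke
  correspondence [W' h^-1 W] of \<open>N\<close>, which is how Hecke operators on \<open>M\<close>
  turn into Hecke operators on \<open>N\<close>.\<close>

lemma res_symbol_push:
  assumes P: "P \<in> \<Upsilon>\<^sub>G" and W: "W \<in> \<Upsilon>\<^sub>H" "W' \<in> \<Upsilon>\<^sub>H" and W': "W' = carrier H \<inter> conjugate G \<tau> P"
    and \<tau>: "\<tau> \<in> carrier G" and h: "h \<in> carrier H" and x: "x \<in> carrier (obj N W)"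
    and V: "V = W \<inter> conjugate G (h \<otimes>\<^bsub>G\<^esub> \<tau>) P"
  shows "res_symbol P W (h \<otimes>\<^bsub>G\<^esub> \<tau>) x = symbol P W' \<tau> (push N V W' h (pull N V W \<one>\<^bsub>G\<^esub> x))"
    and "V \<in> \<Upsilon>\<^sub>H" "V \<subseteq> W" "h \<in> level_hom H V W'"
proof -
  have hc: "h \<in> carrier G" using h H_subset by auto
  show VH: "V \<in> \<Upsilon>\<^sub>H" and VW: "V \<subseteq> W" unfolding V using Int_conjugate_level P W \<tau> hc by auto
  have QG: "conjugate G \<tau> P \<subseteq> carrier G" using G.conjugate_subset_carrier level_G P \<tau> by blast
  have "conjugate G h W' = carrier H \<inter> conjugate G (h \<otimes>\<^bsub>G\<^esub> \<tau>) P"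
    unfolding W' using G.conjugate_Int[OF hc H_subset QG]
      G.conjugate_mult[OF hc \<tau> level_G(2)[OF P]] G.conjugate_self[OF subgroup_H h] by simp
  then have sub: "V \<subseteq> conjugate G h W'" unfolding V using level_H(2)[OF W(1)] by auto
  then show "h \<in> level_hom H V W'" using VH W h by (simp add: level_hom_H_iff)
  show "res_symbol P W (h \<otimes>\<^bsub>G\<^esub> \<tau>) x = symbol P W' \<tau> (push N V W' h (pull N V W \<one>\<^bsub>G\<^esub> x))"
    unfolding res_symbol_def V[symmetric]
    using P VH W sub \<tau> h x VW W' by (intro symbol_push pull_sub_closed) auto
qed

text \<open>Since \<open>[P\<sigma>P]\<^sub>* = [\<sigma>]\<^sub>* \<circ> pr\<^sup>*\<close> with both maps passing through the level \<open>P \<inter> \<sigma>P\<sigma>\<inverse>\<close>, the Mackey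
  property of the pushforward computes it on symbols.\<close>

lemma hecke_push_eq:
  assumes P: "P \<in> \<Upsilon>\<^sub>G" and \<sigma>: "\<sigma> \<in> carrier G" and x: "x \<in> carrier (obj M P)"
    and B: "B = P \<inter> conjugate G \<sigma> P"
  shows "hecke_push G M P \<sigma> P x = push M B P \<sigma> (pull M B P \<one>\<^bsub>G\<^esub> x)"
proof -
  define A where "A = P \<inter> conjugate G (inv\<^bsub>G\<^esub> \<sigma>) P"
  have AB: "A \<in> \<Upsilon>\<^sub>G" "B \<in> \<Upsilon>\<^sub>G" unfolding A_def B using G.T1 G.T3 P \<sigma> by auto
  have cA: "conjugate G \<sigma> A = B"
    unfolding A_def B
    using G.conjugate_Int[OF \<sigma> level_G(2)[OF P], of "conjugate G (inv\<^bsub>G\<^esub> \<sigma>) P"]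
      G.conjugate_subset_carrier[of "inv\<^bsub>G\<^esub> \<sigma>" P] G.conjugate_inv_cancel(2)[OF \<sigma> level_G(2)[OF P]]
      level_G(2)[OF P] \<sigma>
    by auto
  have sub: "A \<subseteq> P" "B \<subseteq> P" unfolding A_def B by auto
  have y: "pull M B P \<one>\<^bsub>G\<^esub> x \<in> carrier (obj M B)" (is "?y \<in> _")
    using linear_mapsD(1)[OF M.pull_linear[OF AB(2) P one_level_hom_G]] AB P sub x by blast
  have h: "\<sigma> \<in> level_hom G B A" using AB \<sigma> cA by (simp add: level_hom_G_iff)
  have "hecke_push G M P \<sigma> P x = push M A P \<one>\<^bsub>G\<^esub> (pull M A B (inv\<^bsub>G\<^esub> \<sigma>) ?y)"
    unfolding hecke_push_def hecke_def Let_def using \<sigma> by (simp add: A_def B)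
  also have "pull M A B (inv\<^bsub>G\<^esub> \<sigma>) ?y = push M B A (inv\<^bsub>G\<^esub> (inv\<^bsub>G\<^esub> \<sigma>)) ?y"
    using \<sigma> cA by (intro M.pull_eq_push[OF AB _ _ y]) auto
  also have "push M A P \<one>\<^bsub>G\<^esub> (push M B A (inv\<^bsub>G\<^esub> (inv\<^bsub>G\<^esub> \<sigma>)) ?y) = push M B P (\<sigma> \<otimes>\<^bsub>G\<^esub> \<one>\<^bsub>G\<^esub>) ?y"
    using M.push_comp[OF AB(2,1) P h one_level_hom_G[OF AB(1) P sub(1)] y] \<sigma> by simp
  finally show ?thesis using \<sigma> by simp
qed

text \<open>Conjugating by g first brings the restriction to the level P' = gPg^-1 that contains
  \<open>W\<close>, where the Mackey property of \<iota> applies with B' = gBg^-1. Pushing the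
  summand at \<gamma> forward along g\<sigma> gives the term with representative
  \<gamma>g\<sigma>.\<close>

lemma hecke_push_symbol:
  assumes P: "P \<in> \<Upsilon>\<^sub>G" and \<sigma>: "\<sigma> \<in> carrier G" and g: "g \<in> carrier G"
    and W: "W \<in> \<Upsilon>\<^sub>H" "W \<subseteq> conjugate G g P" and x: "x \<in> carrier (obj N W)"
  shows "hecke_push G M P \<sigma> P (symbol P W g x) =
    (\<Oplus>\<^bsub>obj M P\<^esub>C\<in>double_cosets G W (conjugate G g P) (conjugate G g (P \<inter> conjugate G \<sigma> P)).
       res_symbol P W (rep C \<otimes>\<^bsub>G\<^esub> g \<otimes>\<^bsub>G\<^esub> \<sigma>) x)"
proof -
  define B where "B = P \<inter> conjugate G \<sigma> P"
  define P' where "P' = conjugate G g P"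
  define B' where "B' = conjugate G g B"
  define DC where "DC = double_cosets G W P' B'"
  note PG = level_G(2)[OF P]
  have B: "B \<in> \<Upsilon>\<^sub>G" "B \<subseteq> P" unfolding B_def using G.T1 G.T3 P \<sigma> by auto
  have lv: "P' \<in> \<Upsilon>\<^sub>G" "B' \<in> \<Upsilon>\<^sub>G" "B' \<subseteq> P'"
    unfolding P'_def B'_def using G.T1 P B g G.conjugate_mono by auto
  have gc: "conjugate G (inv\<^bsub>G\<^esub> g) P' = P" "conjugate G (inv\<^bsub>G\<^esub> g) B' = B"
    unfolding P'_def B'_def using G.conjugate_inv_cancel g PG level_G(2)[OF B(1)] by auto
  define y where "y = \<iota> W P' x"
  have y: "y \<in> carrier (obj M P')" unfolding y_def
    using linear_mapsD(1)[OF \<iota>.linear[OF W(1) lv(1)]] W(2) x unfolding P'_def by blast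
  have hom: "g \<in> level_hom G P' P" "g \<in> level_hom G B' B" "inv\<^bsub>G\<^esub> g \<in> level_hom G P P'"
    "inv\<^bsub>G\<^esub> g \<in> level_hom G B B'" "\<sigma> \<in> level_hom G B P"
    using g \<sigma> lv P B gc by (auto simp: level_hom_G_iff P'_def B'_def B_def)
  \<comment> \<open>Between the conjugate levels \<open>P'\<close> and \<open>P\<close>, pushing
    along g is pulling along g^-1; in this form it composes with the restriction to
    \<open>B\<close>.\<close>
  have symx: "symbol P W g x = pull M P P' (inv\<^bsub>G\<^esub> g) y"
    unfolding symbol_def y_def P'_def[symmetric]
    using M.pull_eq_push[OF P lv(1) _ _ y, of "inv\<^bsub>G\<^esub> g"] g
    by (simp add: P'_def[symmetric] y_def)
  define u where "u = pull M B' P' \<one>\<^bsub>G\<^esub> y"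
  have u: "u \<in> carrier (obj M B')" unfolding u_def
    using linear_mapsD(1)[OF M.pull_linear[OF lv(2,1) one_level_hom_G[OF lv(2,1,3)]] y] .
  have "pull M B P \<one>\<^bsub>G\<^esub> (symbol P W g x) = pull M B P' (\<one>\<^bsub>G\<^esub> \<otimes>\<^bsub>G\<^esub> inv\<^bsub>G\<^esub> g) y"
    unfolding symx by (rule M.pull_comp[OF B(1) P lv(1) one_level_hom_G[OF B(1) P B(2)] hom(3) y, symmetric])
  also have "\<dots> = pull M B P' (inv\<^bsub>G\<^esub> g \<otimes>\<^bsub>G\<^esub> \<one>\<^bsub>G\<^esub>) y" using g by simp
  also have "\<dots> = pull M B B' (inv\<^bsub>G\<^esub> g) u"
    unfolding u_def by (rule M.pull_comp[OF B(1) lv(2,1) hom(4) one_level_hom_G[OF lv(2,1,3)] y])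
  also have "\<dots> = push M B' B (inv\<^bsub>G\<^esub> (inv\<^bsub>G\<^esub> g)) u"
    using g by (intro M.pull_eq_push[OF B(1) lv(2) _ _ u]) (auto simp: B'_def)
  finally have pb: "pull M B P \<one>\<^bsub>G\<^esub> (symbol P W g x) = push M B' B g u" using g by simp
  have sc: "symbol P W g x \<in> carrier (obj M P)" using symbol_closed P W g x by blast
  have gs: "g \<otimes>\<^bsub>G\<^esub> \<sigma> \<in> level_hom G B' P"
  proof -
    have "B' \<subseteq> conjugate G g (conjugate G \<sigma> P)" unfolding B'_def B_def by (intro G.conjugate_mono) auto
    then show ?thesis using g \<sigma> lv P PG by (simp add: level_hom_G_iff G.conjugate_mult)
  qed
  have "hecke_push G M P \<sigma> P (symbol P W g x) = push M B P \<sigma> (push M B' B g u)"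
    using hecke_push_eq[OF P \<sigma> sc B_def] pb by simp
  also have "\<dots> = push M B' P (g \<otimes>\<^bsub>G\<^esub> \<sigma>) u"
    by (rule M.push_comp[OF lv(2) B(1) P hom(2,5) u, symmetric])
  finally have 1: "hecke_push G M P \<sigma> P (symbol P W g x) = push M B' P (g \<otimes>\<^bsub>G\<^esub> \<sigma>) u" .
  define F where "F = (\<lambda>\<gamma>. push M (conjugate G \<gamma> B') B' \<gamma> (\<iota> (W \<inter> conjugate G \<gamma> B') (conjugate G \<gamma> B')
      (pull N (W \<inter> conjugate G \<gamma> B') W \<one>\<^bsub>G\<^esub> x)))"
  have uF: "u = (\<Oplus>\<^bsub>obj M B'\<^esub>C\<in>DC. F (rep C))"
    using mackey_\<iota> W lv x unfolding mackey_pushforward_def u_def y_def F_def DC_def P'_def Let_def by blast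
  have F: "F \<gamma> \<in> carrier (obj M B')" "push M B' P (g \<otimes>\<^bsub>G\<^esub> \<sigma>) (F \<gamma>) = res_symbol P W (\<gamma> \<otimes>\<^bsub>G\<^esub> g \<otimes>\<^bsub>G\<^esub> \<sigma>) x"
    if \<gamma>: "\<gamma> \<in> P'" for \<gamma>
  proof -
    have \<gamma>c: "\<gamma> \<in> carrier G" using \<gamma> level_G lv by blast
    define \<tau> where "\<tau> = \<gamma> \<otimes>\<^bsub>G\<^esub> g \<otimes>\<^bsub>G\<^esub> \<sigma>"
    have \<tau>: "\<tau> \<in> carrier G" unfolding \<tau>_def using \<gamma>c g \<sigma> by simp
    define Q where "Q = conjugate G \<gamma> B'"
    define Q2 where "Q2 = conjugate G \<tau> P"
    define V where "V = W \<inter> Q"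
    have Qs: "Q \<in> \<Upsilon>\<^sub>G" "Q2 \<in> \<Upsilon>\<^sub>G" unfolding Q_def Q2_def using G.T1 lv P \<gamma>c \<tau> by auto
    have \<sigma>P: "conjugate G \<sigma> P \<subseteq> carrier G" using G.conjugate_subset_carrier \<sigma> PG by blast
    have c1: "conjugate G \<gamma> P' = P'" using G.conjugate_self[OF level_G(1)[OF lv(1)] \<gamma>] .
    have c2: "B' = P' \<inter> conjugate G (g \<otimes>\<^bsub>G\<^esub> \<sigma>) P"
      unfolding B'_def B_def P'_def using G.conjugate_Int[OF g PG \<sigma>P] G.conjugate_mult[OF g \<sigma> PG] by simp
    have gsP: "conjugate G (g \<otimes>\<^bsub>G\<^esub> \<sigma>) P \<subseteq> carrier G"
      using G.conjugate_subset_carrier g \<sigma> PG by blast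
    have Q2': "Q2 = conjugate G \<gamma> (conjugate G (g \<otimes>\<^bsub>G\<^esub> \<sigma>) P)"
      unfolding Q2_def \<tau>_def using \<gamma>c g \<sigma> PG by (simp add: G.conjugate_mult[symmetric] G.m_assoc)
    have c3: "Q = P' \<inter> Q2"
      unfolding Q_def c2 using G.conjugate_Int[OF \<gamma>c level_G(2)[OF lv(1)] gsP] c1 Q2' by simp
    \<comment> \<open>\<gamma> lies in \<open>P'\<close>, so \<open>Q\<close> is the intersection of
      \<open>P'\<close> with \<open>Q2\<close>, and \<open>W\<close> is inside \<open>P'\<close>.
      Hence the level in the Mackey formula is the one in \<open>res_symbol\<close> at
      \<open>\<tau>\<close>.\<close>
    have VQ2: "V = W \<inter> Q2" unfolding V_def c3 using W(2) unfolding P'_def by blast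
    have V: "V \<in> \<Upsilon>\<^sub>H" unfolding V_def using Int_level W Qs by blast
    define m where "m = pull N V W \<one>\<^bsub>G\<^esub> x"
    have m: "m \<in> carrier (obj N V)" unfolding m_def using V W x by (intro pull_sub_closed) (auto simp: V_def)
    have VQ: "V \<subseteq> Q" "V \<subseteq> Q2" using V_def VQ2 by auto
    have z: "\<iota> V Q m \<in> carrier (obj M Q)" using linear_mapsD(1)[OF \<iota>.linear[OF V Qs(1) VQ(1)] m] .
    have \<gamma>h: "\<gamma> \<in> level_hom G Q B'" unfolding Q_def using conj_level_hom lv \<gamma>c by blast
    have F\<gamma>: "F \<gamma> = push M Q B' \<gamma> (\<iota> V Q m)" unfolding F_def m_def V_def Q_def ..
    show "F \<gamma> \<in> carrier (obj M B')"
      unfolding F\<gamma> using linear_mapsD(1)[OF M.push_linear[OF Qs(1) lv(2) \<gamma>h] z] .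
    have \<tau>h: "\<tau> \<in> level_hom G Q2 P" unfolding Q2_def using conj_level_hom P \<tau> by blast
    have QQ2: "Q \<subseteq> Q2" using c3 by simp
    have "push M B' P (g \<otimes>\<^bsub>G\<^esub> \<sigma>) (F \<gamma>) = push M Q P (\<gamma> \<otimes>\<^bsub>G\<^esub> (g \<otimes>\<^bsub>G\<^esub> \<sigma>)) (\<iota> V Q m)"
      unfolding F\<gamma> by (rule M.push_comp[OF Qs(1) lv(2) P \<gamma>h gs z, symmetric])
    also have "\<gamma> \<otimes>\<^bsub>G\<^esub> (g \<otimes>\<^bsub>G\<^esub> \<sigma>) = \<one>\<^bsub>G\<^esub> \<otimes>\<^bsub>G\<^esub> \<tau>" unfolding \<tau>_def using \<gamma>c g \<sigma> by (simp add: G.m_assoc)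
    also have "push M Q P (\<one>\<^bsub>G\<^esub> \<otimes>\<^bsub>G\<^esub> \<tau>) (\<iota> V Q m) = push M Q2 P \<tau> (push M Q Q2 \<one>\<^bsub>G\<^esub> (\<iota> V Q m))"
      by (rule M.push_comp[OF Qs P one_level_hom_G[OF Qs QQ2] \<tau>h z])
    \<comment> \<open>With the same level \<open>V\<close> on the side of \<open>N\<close>,
      compatibility with pushforwards merely enlarges the target of \<iota> from \<open>Q\<close> to
      \<open>Q2\<close>.\<close>
    also have "push M Q Q2 \<one>\<^bsub>G\<^esub> (\<iota> V Q m) = \<iota> V Q2 (push N V V \<one>\<^bsub>G\<^esub> m)"
      by (rule \<iota>.commute_push[symmetric])
        (use V Qs VQ m QQ2 one_level_hom_G one_level_hom_H in auto)
    also have "push N V V \<one>\<^bsub>G\<^esub> m = m" using N.push_id[OF V m] by simp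
    finally show "push M B' P (g \<otimes>\<^bsub>G\<^esub> \<sigma>) (F \<gamma>) = res_symbol P W (\<gamma> \<otimes>\<^bsub>G\<^esub> g \<otimes>\<^bsub>G\<^esub> \<sigma>) x"
      unfolding res_symbol_def symbol_def \<tau>_def[symmetric] Q2_def[symmetric] VQ2[symmetric] m_def .
  qed
  have repC: "rep C \<in> P'" if C: "C \<in> DC" for C
  proof -
    obtain \<gamma> where \<gamma>: "\<gamma> \<in> P'" "C = double_coset G W \<gamma> B'" using C by (auto simp: DC_def double_cosets_def)
    have "rep C \<in> C"
      unfolding \<gamma>(2) using \<gamma> level_G lv level_H W by (intro G.rep_double_coset) auto
    then obtain a b where ab: "a \<in> W" "b \<in> B'" "rep C = a \<otimes>\<^bsub>G\<^esub> (\<gamma> \<otimes>\<^bsub>G\<^esub> b)"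
      unfolding \<gamma>(2) by (auto simp: G.double_coset_mem_iff)
    moreover have "a \<in> P'" "b \<in> P'" using ab W(2) lv(3) by (auto simp: P'_def)
    ultimately show ?thesis using \<gamma> level_G(1)[OF lv(1)] by (simp add: subgroup.m_closed)
  qed
  have "push M B' P (g \<otimes>\<^bsub>G\<^esub> \<sigma>) u = (\<Oplus>\<^bsub>obj M P\<^esub>C\<in>DC. push M B' P (g \<otimes>\<^bsub>G\<^esub> \<sigma>) (F (rep C)))"
    unfolding uF
    by (rule linear_maps_finsum[OF M.push_linear[OF lv(2) P gs] M.obj_module[OF lv(2)] M.obj_module[OF P]])
      (use F(1) repC in auto)
  also have "\<dots> = (\<Oplus>\<^bsub>obj M P\<^esub>C\<in>DC. res_symbol P W (rep C \<otimes>\<^bsub>G\<^esub> g \<otimes>\<^bsub>G\<^esub> \<sigma>) x)"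
  proof -
    interpret MP: Module.module R "obj M P" using M.obj_module[OF P] .
    have cl: "rep C \<otimes>\<^bsub>G\<^esub> g \<otimes>\<^bsub>G\<^esub> \<sigma> \<in> carrier G" if "C \<in> DC" for C
      using repC[OF that] level_G(2)[OF lv(1)] g \<sigma> by auto
    show ?thesis
      using F(2) repC cl P W x by (intro MP.finsum_cong') (auto intro!: res_symbol_closed)
  qed
  finally show ?thesis using 1 by (simp add: DC_def P'_def B'_def B_def)
qed

end

section \<open>Pure tensors on restricted products\<close>

text \<open>The factors of a pure tensor at a point of the restricted product are almost all \<open>1\<close>; the
  others are multiplied.\<close>

definition tensor :: "'r ring \<Rightarrow> 'i set \<Rightarrow> ('i \<Rightarrow> 'x \<Rightarrow> 'r) \<Rightarrow> ('i \<Rightarrow> 'x) \<Rightarrow> 'r" where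
  "tensor R J f x = (\<Otimes>\<^bsub>R\<^esub>w\<in>{w \<in> J. f w (x w) \<noteq> \<one>\<^bsub>R\<^esub>}. f w (x w))"

lemma tensor_cong:
  assumes "\<And>w. w \<in> J \<Longrightarrow> f w (x w) = f' w (x' w)" "cring R"
    "\<And>w. w \<in> J \<Longrightarrow> f' w (x' w) \<in> carrier R"
  shows "tensor R J f x = tensor R J f' x'"
proof -
  interpret cring R by fact
  show ?thesis unfolding tensor_def
    using assms by (intro finprod_cong') auto
qed

lemma tensor_superset:
  assumes "cring R" "finite F" "F \<subseteq> J" "\<And>w. w \<in> J - F \<Longrightarrow> f w (x w) = \<one>\<^bsub>R\<^esub>"
    "\<And>w. w \<in> J \<Longrightarrow> f w (x w) \<in> carrier R"
  shows "tensor R J f x = (\<Otimes>\<^bsub>R\<^esub>w\<in>F. f w (x w))"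
proof -
  interpret cring R by fact
  show ?thesis unfolding tensor_def
    using assms by (intro finprod_mono_neutral_cong_left) auto
qed

text \<open>An operation at the place \<open>v\<close> changes only the first factor of this
  product; the second one is then a constant that can be taken out of sums.\<close>

lemma tensor_split:
  assumes R: "cring R" and fin: "finite {w \<in> J. f w (x w) \<noteq> \<one>\<^bsub>R\<^esub>}" and v: "v \<in> J"
    and cl: "\<And>w. w \<in> J \<Longrightarrow> f w (x w) \<in> carrier R"
  shows "tensor R J f x = f v (x v) \<otimes>\<^bsub>R\<^esub> tensor R (J - {v}) f x"
proof -
  interpret cring R by fact
  define F where "F = {w \<in> J - {v}. f w (x w) \<noteq> \<one>\<^bsub>R\<^esub>}"
  have F: "finite F" "v \<notin> F" "F \<subseteq> J" using fin unfolding F_def by (auto elim: rev_finite_subset)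
  have "tensor R J f x = (\<Otimes>\<^bsub>R\<^esub>w\<in>insert v F. f w (x w))"
    using F v cl by (intro tensor_superset R) (auto simp: F_def)
  also have "\<dots> = f v (x v) \<otimes>\<^bsub>R\<^esub> (\<Otimes>\<^bsub>R\<^esub>w\<in>F. f w (x w))"
    using F v cl by (intro finprod_insert) auto
  finally show ?thesis unfolding tensor_def F_def .
qed

lemma tensor_closed:
  assumes "cring R" "\<And>w. w \<in> J \<Longrightarrow> f w (x w) \<in> carrier R"
  shows "tensor R J f x \<in> carrier R"
proof -
  interpret cring R by fact
  show ?thesis unfolding tensor_def using assms by (intro finprod_closed) auto
qed

locale restricted_space =
  fixes R :: "'r ring" and I :: "'i set" and X :: "'i \<Rightarrow> 'x topology" and Y :: "'i \<Rightarrow> 'x set"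
    and XX :: "('i \<Rightarrow> 'x) topology"
  assumes cring_R: "cring R"
    and Y_open: "\<And>v. v \<in> I \<Longrightarrow> openin (X v) (Y v)"
    and Y_compact: "\<And>v. v \<in> I \<Longrightarrow> compactin (X v) (Y v)"
    and X_hausdorff: "\<And>v. v \<in> I \<Longrightarrow> Hausdorff_space (X v)"
    and XX_eq: "XX = restricted_topology I X Y"
begin

lemma topspace_XX:
  "x \<in> topspace XX \<longleftrightarrow> x \<in> (\<Pi>\<^sub>E v\<in>I. topspace (X v)) \<and> finite {v \<in> I. x v \<notin> Y v}"
  unfolding XX_eq using topspace_restricted_topology[of I X Y] Y_open by (simp add: restricted_set_def)

text \<open>By Tychonoff the box is compact in the product topology of its factors, and the identity
  from there to the restricted product is continuous because \<open>C v\<close> equals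
  \<open>Y v\<close> almost everywhere.\<close>

lemma compactin_PiE_XX:
  assumes C: "\<And>v. v \<in> I \<Longrightarrow> compactin (X v) (C v)" and fin: "finite {v \<in> I. C v \<noteq> Y v}"
  shows "compactin XX (\<Pi>\<^sub>E v\<in>I. C v)"
proof -
  define P where "P = product_topology (\<lambda>v. subtopology (X v) (C v)) I"
  define \<S> where "\<S> = {\<Pi>\<^sub>E v\<in>I. A v | A. (\<forall>v\<in>I. openin (X v) (A v)) \<and> finite {v \<in> I. A v \<noteq> Y v}}"
  have Cs: "C v \<subseteq> topspace (X v)" if "v \<in> I" for v using C[OF that] compactin_subset_topspace by blast
  have tP: "topspace P = (\<Pi>\<^sub>E v\<in>I. C v)"
    unfolding P_def using Cs by (auto simp: Int_absorb1 cong: PiE_cong)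
  have cP: "compact_space P"
    unfolding P_def using C by (auto simp: compact_space_product_topology compactin_subspace)
  have ttop: "\<Union>\<S> = topspace XX"
    unfolding XX_eq restricted_topology_def \<S>_def topology_generated_by_topspace ..
  have "continuous_map P (topology_generated_by \<S>) id"
  proof (rule continuous_on_generated_topo)
    fix U assume "U \<in> \<S>"
    then obtain A where A: "U = (\<Pi>\<^sub>E v\<in>I. A v)" "\<forall>v\<in>I. openin (X v) (A v)" "finite {v \<in> I. A v \<noteq> Y v}"
      unfolding \<S>_def by blast
    have "id -` U \<inter> topspace P = (\<Pi>\<^sub>E v\<in>I. A v \<inter> C v)"
      unfolding tP A(1) by (auto simp: PiE_Int)
    moreover have "openin P (\<Pi>\<^sub>E v\<in>I. A v \<inter> C v)"
      unfolding P_def openin_PiE_gen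
    proof (rule disjI2, rule conjI)
      \<comment> \<open>Where \<open>A v\<close> and \<open>C v\<close> are both \<open>Y v\<close>,
        their intersection is the whole factor, so only finitely many coordinates are
        constrained.\<close>
      have "{v \<in> I. A v \<inter> C v \<noteq> topspace (subtopology (X v) (C v))} \<subseteq> {v \<in> I. A v \<noteq> Y v} \<union> {v \<in> I. C v \<noteq> Y v}"
        using Cs by auto
      then show "finite {v \<in> I. A v \<inter> C v \<noteq> topspace (subtopology (X v) (C v))}"
        using A(3) fin finite_subset by blast
      show "\<forall>v\<in>I. openin (subtopology (X v) (C v)) (A v \<inter> C v)"
        using A(2) by (auto simp: openin_subtopology)
    qed
    ultimately show "openin P (id -` U \<inter> topspace P)" by simp
  next
    have "(\<Pi>\<^sub>E v\<in>I. C v) \<subseteq> topspace XX"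
    proof
      fix x assume x: "x \<in> (\<Pi>\<^sub>E v\<in>I. C v)"
      have "{v \<in> I. x v \<notin> Y v} \<subseteq> {v \<in> I. C v \<noteq> Y v}" using x by auto
      then have "finite {v \<in> I. x v \<notin> Y v}" using fin finite_subset by blast
      moreover have "x \<in> (\<Pi>\<^sub>E v\<in>I. topspace (X v))" using x Cs by fastforce
      ultimately show "x \<in> topspace XX" unfolding topspace_XX by simp
    qed
    then show "id ` topspace P \<subseteq> \<Union>\<S>" unfolding ttop tP by simp
  qed
  then have "continuous_map P XX id"
    unfolding XX_eq restricted_topology_def \<S>_def .
  then have "compactin XX (id ` topspace P)"
    using image_compactin cP unfolding compact_space_def by blast
  then show ?thesis unfolding tP by simp
qed

definition almost_unit :: "('i \<Rightarrow> 'x \<Rightarrow> 'r) \<Rightarrow> bool" where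
  "almost_unit f \<longleftrightarrow> finite {w \<in> I. f w \<noteq> ch R (Y w)} \<and> (\<forall>w\<in>I. schwartz_fun R (X w) (f w))"

lemma almost_unit_closed:
  assumes "almost_unit f" "x \<in> topspace XX" "w \<in> I"
  shows "f w (x w) \<in> carrier R"
  using assms unfolding almost_unit_def topspace_XX
  by (intro schwartz_fun_closed[of R "X w"]) auto

lemma finite_nonunit:
  assumes "almost_unit f" "x \<in> topspace XX"
  shows "finite {w \<in> I. f w (x w) \<noteq> \<one>\<^bsub>R\<^esub>}"
proof -
  have "{w \<in> I. f w (x w) \<noteq> \<one>\<^bsub>R\<^esub>} \<subseteq> {w \<in> I. f w \<noteq> ch R (Y w)} \<union> {w \<in> I. x w \<notin> Y w}"
    by (auto simp: ch_def)
  then show ?thesis using assms finite_subset unfolding almost_unit_def topspace_XX by blast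
qed

lemma tensor_split_XX:
  assumes "almost_unit f" "x \<in> topspace XX" "v \<in> I"
  shows "tensor R I f x = f v (x v) \<otimes>\<^bsub>R\<^esub> tensor R (I - {v}) f x"
  using assms finite_nonunit almost_unit_closed by (intro tensor_split cring_R) auto

text \<open>Local constancy has to hold in infinitely many coordinates at once. The open box is cut
  down in finitely many of them, and in all others it is contained in a set where the factor is
  identically 1.\<close>

lemma schwartz_fun_tensor:
  assumes f: "almost_unit f"
  shows "schwartz_fun R XX (tensor R I f)"
  unfolding schwartz_fun_def
proof (intro conjI)
  interpret cring R by (rule cring_R)
  show "tensor R I f \<in> topspace XX \<rightarrow> carrier R"
    using almost_unit_closed[OF f] by (auto intro: tensor_closed cring_R)
  show "locally_constant XX (tensor R I f)"
  proof (rule locally_constantI)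
    fix x assume x: "x \<in> topspace XX"
    \<comment> \<open>Outside of \<open>F\<close> the factor is ch(Y w) and \<open>x w\<close> lies
      in \<open>Y w\<close>, so remaining in \<open>Y w\<close> keeps the factor equal to 1.\<close>
    define F where "F = {w \<in> I. f w \<noteq> ch R (Y w)} \<union> {w \<in> I. x w \<notin> Y w}"
    have F: "finite F" "F \<subseteq> I" using f x unfolding F_def almost_unit_def topspace_XX by auto
    have "\<exists>A. openin (X w) A \<and> x w \<in> A \<and> A \<subseteq> {y. f w y = f w (x w)}" if w: "w \<in> I" for w
    proof -
      have "locally_constant (X w) (f w)" "x w \<in> topspace (X w)"
        using f x w unfolding almost_unit_def schwartz_fun_def topspace_XX by auto
      from locally_constantE[OF this] show ?thesis by metis
    qed
    then obtain A where A: "\<And>w. w \<in> I \<Longrightarrow> openin (X w) (A w)" "\<And>w. w \<in> I \<Longrightarrow> x w \<in> A w"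
      "\<And>w. w \<in> I \<Longrightarrow> A w \<subseteq> {y. f w y = f w (x w)}" by metis
    define A' where "A' = (\<lambda>w. if w \<in> F then A w else Y w)"
    have "finite {w \<in> I. A' w \<noteq> Y w}" using F(1) by (rule rev_finite_subset) (auto simp: A'_def)
    moreover have "\<forall>w\<in>I. openin (X w) (A' w)" using A(1) Y_open by (simp add: A'_def)
    ultimately have op: "openin XX (\<Pi>\<^sub>E w\<in>I. A' w)"
      unfolding XX_eq restricted_topology_def by (intro topology_generated_by_Basis) blast
    have xA: "x \<in> (\<Pi>\<^sub>E w\<in>I. A' w)"
      using x A(2) unfolding A'_def topspace_XX F_def by (auto simp: PiE_iff)
    have "tensor R I f y = tensor R I f x" if y: "y \<in> (\<Pi>\<^sub>E w\<in>I. A' w)" for y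
    proof (rule tensor_cong)
      show "cring R" by (rule cring_R)
      show "f w (x w) \<in> carrier R" if "w \<in> I" for w using almost_unit_closed[OF f x that] .
      fix w assume w: "w \<in> I"
      have yw: "y w \<in> A' w" using y w by auto
      show "f w (y w) = f w (x w)"
      proof (cases "w \<in> F")
        case True
        then have "y w \<in> A w" using yw by (simp add: A'_def)
        then show ?thesis using A(3)[OF w] by auto
      next
        case False
        then have "f w = ch R (Y w)" "x w \<in> Y w" "y w \<in> Y w" using yw w by (auto simp: F_def A'_def)
        then show ?thesis by (simp add: ch_def)
      qed
    qed
    then have "(\<Pi>\<^sub>E w\<in>I. A' w) \<subseteq> {y. tensor R I f y = tensor R I f x}" by blast
    then show "\<exists>A. openin XX A \<and> x \<in> A \<and> A \<subseteq> {y. tensor R I f y = tensor R I f x}"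
      using op xA by blast
  qed
  show "\<exists>C. compactin XX C \<and> (\<forall>x\<in>topspace XX - C. tensor R I f x = \<zero>\<^bsub>R\<^esub>)"
  proof -
    \<comment> \<open>At almost every place the factor of the box must be \<open>Y w\<close> itself
      for the box to be compact in the restricted product.\<close>
    define C where "C = (\<lambda>w. if f w = ch R (Y w) then Y w else {y \<in> topspace (X w). f w y \<noteq> \<zero>\<^bsub>R\<^esub>})"
    have "finite {w \<in> I. C w \<noteq> Y w}"
      using f unfolding almost_unit_def by (auto simp: C_def elim!: rev_finite_subset)
    moreover have "compactin (X w) (C w)" if "w \<in> I" for w
    proof -
      have "schwartz_fun R (X w) (f w)" using f that unfolding almost_unit_def by blast
      from compactin_schwartz_fun_support[OF this] show ?thesis
        using Y_compact[OF that] by (simp add: C_def)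
    qed
    ultimately have "compactin XX (\<Pi>\<^sub>E w\<in>I. C w)" by (intro compactin_PiE_XX)
    moreover have "tensor R I f x = \<zero>\<^bsub>R\<^esub>" if x: "x \<in> topspace XX - (\<Pi>\<^sub>E w\<in>I. C w)" for x
    proof -
      have "x \<in> extensional I" using x topspace_XX[of x] by (auto simp: PiE_iff)
      then obtain w where w: "w \<in> I" "x w \<notin> C w" using x by (auto simp: PiE_iff)
      have "f w (x w) = \<zero>\<^bsub>R\<^esub>"
        using w x topspace_XX[of x] unfolding C_def by (auto simp: ch_def split: if_splits)
      moreover have "tensor R (I - {w}) f x \<in> carrier R"
        using x almost_unit_closed[OF f] by (auto intro: tensor_closed cring_R)
      ultimately show ?thesis using tensor_split_XX[OF f, of x w] x w by simp
    qed
    ultimately show ?thesis by blast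
  qed
qed

lemma almost_unit_upd:
  assumes "almost_unit f" "v \<in> I \<Longrightarrow> schwartz_fun R (X v) u"
  shows "almost_unit (f(v := u))"
proof -
  have "{w \<in> I. (f(v := u)) w \<noteq> ch R (Y w)} \<subseteq> insert v {w \<in> I. f w \<noteq> ch R (Y w)}" by auto
  then have "finite {w \<in> I. (f(v := u)) w \<noteq> ch R (Y w)}"
    using assms unfolding almost_unit_def by (meson finite_insert finite_subset)
  then show ?thesis using assms unfolding almost_unit_def by auto
qed

end

section \<open>Restricted products of groups\<close>

locale restricted_product =
  fixes I :: "'i set" and G :: "'i \<Rightarrow> 'g monoid" and K :: "'i \<Rightarrow> 'g set" and GG :: "('i \<Rightarrow> 'g) monoid"
  assumes group_G: "\<And>v. v \<in> I \<Longrightarrow> Group.group (G v)"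
    and group_GG: "Group.group GG"
    and subgroup_K: "\<And>v. v \<in> I \<Longrightarrow> subgroup (K v) (G v)"
    and GG_eq: "GG = restricted_group I G K"

sublocale restricted_product \<subseteq> GG: plain_group GG
  using group_GG by (simp add: plain_group_def)

context restricted_product begin

lemma plain_G: "v \<in> I \<Longrightarrow> plain_group (G v)"
  using group_G by (simp add: plain_group_def)

lemma carrier_GG:
  "x \<in> carrier GG \<longleftrightarrow> x \<in> (\<Pi>\<^sub>E v\<in>I. carrier (G v)) \<and> finite {v \<in> I. x v \<notin> K v}"
  by (simp add: GG_eq restricted_group_def restricted_set_def)

lemma component: "x \<in> carrier GG \<Longrightarrow> v \<in> I \<Longrightarrow> x v \<in> carrier (G v)"
  by (auto simp: carrier_GG)

lemma extensional_GG: "x \<in> carrier GG \<Longrightarrow> x \<in> extensional I"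
  by (auto simp: carrier_GG PiE_iff)

lemma mult_component [simp]: "v \<in> I \<Longrightarrow> (x \<otimes>\<^bsub>GG\<^esub> y) v = x v \<otimes>\<^bsub>G v\<^esub> y v"
  by (simp add: GG_eq restricted_group_def product_group_def)

lemma one_component [simp]: "v \<in> I \<Longrightarrow> \<one>\<^bsub>GG\<^esub> v = \<one>\<^bsub>G v\<^esub>"
  by (simp add: GG_eq restricted_group_def product_group_def)

lemma inv_component [simp]:
  assumes "x \<in> carrier GG" "v \<in> I"
  shows "(inv\<^bsub>GG\<^esub> x) v = inv\<^bsub>G v\<^esub> (x v)"
proof -
  interpret Gv: Group.group "G v" using group_G assms by blast
  have "(inv\<^bsub>GG\<^esub> x) v \<otimes>\<^bsub>G v\<^esub> x v = \<one>\<^bsub>G v\<^esub>"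
    using assms mult_component[of v "inv\<^bsub>GG\<^esub> x" x] by simp
  then show ?thesis
    using Gv.inv_equality component assms GG.inv_closed by metis
qed

lemma GG_eqI:
  assumes "x \<in> carrier GG" "y \<in> carrier GG" "\<And>v. v \<in> I \<Longrightarrow> x v = y v"
  shows "x = y"
  using assms by (intro PiE_ext[of x I "\<lambda>v. carrier (G v)" y]) (auto simp: carrier_GG)

lemma upd_closed:
  assumes "x \<in> carrier GG" "v \<in> I" "t \<in> carrier (G v)"
  shows "x(v := t) \<in> carrier GG"
proof -
  have "{w \<in> I. (x(v := t)) w \<notin> K w} \<subseteq> insert v {w \<in> I. x w \<notin> K w}" by auto
  then have "finite {w \<in> I. (x(v := t)) w \<notin> K w}"
    using assms carrier_GG by (meson finite_insert finite_subset)
  moreover have "x(v := t) \<in> (\<Pi>\<^sub>E v\<in>I. carrier (G v))"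
    using assms carrier_GG by (auto simp: PiE_iff extensional_def)
  ultimately show ?thesis by (simp add: carrier_GG)
qed

lemma at_place_eq: "at_place I G v t = (\<one>\<^bsub>GG\<^esub>)(v := t)" if "v \<in> I"
proof
  fix w show "at_place I G v t w = ((\<one>\<^bsub>GG\<^esub>)(v := t)) w"
    using that by (cases "w \<in> I") (auto simp: at_place_def GG_eq restricted_group_def)
qed

lemma at_place_closed: "v \<in> I \<Longrightarrow> t \<in> carrier (G v) \<Longrightarrow> at_place I G v t \<in> carrier GG"
  by (simp add: at_place_eq upd_closed)

lemma at_place_component:
  "w \<in> I \<Longrightarrow> at_place I G v t w = (if w = v then t else \<one>\<^bsub>G w\<^esub>)"
  by (simp add: at_place_def)

lemma PiE_subset_GG:
  assumes "\<And>v. v \<in> I \<Longrightarrow> A v \<subseteq> carrier (G v)" "finite {v \<in> I. \<not> A v \<subseteq> K v}"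
  shows "(\<Pi>\<^sub>E v\<in>I. A v) \<subseteq> carrier GG"
proof
  fix x assume x: "x \<in> (\<Pi>\<^sub>E v\<in>I. A v)"
  have "{v \<in> I. x v \<notin> K v} \<subseteq> {v \<in> I. \<not> A v \<subseteq> K v}" using x by auto
  then have "finite {v \<in> I. x v \<notin> K v}" using assms finite_subset by blast
  then show "x \<in> carrier GG" using x assms(1) by (fastforce simp: carrier_GG PiE_iff)
qed

text \<open>At all but finitely many places g v lies in \<open>K v\<close> and conjugation by it
  preserves \<open>K v\<close>; the conjugated box therefore stays inside the restricted
  product.\<close>

lemma conjugate_PiE:
  assumes g: "g \<in> carrier GG" and A: "\<And>v. v \<in> I \<Longrightarrow> A v \<subseteq> carrier (G v)"
    "finite {v \<in> I. \<not> A v \<subseteq> K v}"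
  shows "conjugate GG g (\<Pi>\<^sub>E v\<in>I. A v) = (\<Pi>\<^sub>E v\<in>I. conjugate (G v) (g v) (A v))"
    and "finite {v \<in> I. \<not> conjugate (G v) (g v) (A v) \<subseteq> K v}"
    and "(\<Pi>\<^sub>E v\<in>I. conjugate (G v) (g v) (A v)) \<subseteq> carrier GG"
proof -
  have cA: "conjugate (G v) (g v) (A v) \<subseteq> carrier (G v)" if "v \<in> I" for v
    using plain_group.conjugate_subset_carrier[OF plain_G] that component g A by blast
  have "conjugate (G v) (g v) (A v) \<subseteq> K v" if v: "v \<in> I" "A v \<subseteq> K v" "g v \<in> K v" for v
  proof -
    interpret Gv: plain_group "G v" using plain_G v by blast
    have "conjugate (G v) (g v) (A v) \<subseteq> conjugate (G v) (g v) (K v)"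
      by (rule Gv.conjugate_mono[OF v(2)])
    then show ?thesis using Gv.conjugate_self subgroup_K v by blast
  qed
  then have "{v \<in> I. \<not> conjugate (G v) (g v) (A v) \<subseteq> K v} \<subseteq> {v \<in> I. \<not> A v \<subseteq> K v} \<union> {v \<in> I. g v \<notin> K v}"
    by blast
  then show fin: "finite {v \<in> I. \<not> conjugate (G v) (g v) (A v) \<subseteq> K v}"
    using A(2) g carrier_GG finite_subset by (metis (no_types, lifting) finite_UnI)
  show sub: "(\<Pi>\<^sub>E v\<in>I. conjugate (G v) (g v) (A v)) \<subseteq> carrier GG"
    by (rule PiE_subset_GG[OF cA fin])
  have AG: "(\<Pi>\<^sub>E v\<in>I. A v) \<subseteq> carrier GG" by (rule PiE_subset_GG[OF A])
  have "x \<in> conjugate GG g (\<Pi>\<^sub>E v\<in>I. A v) \<longleftrightarrow> x \<in> (\<Pi>\<^sub>E v\<in>I. conjugate (G v) (g v) (A v))"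
    if x: "x \<in> carrier GG" for x
  proof -
    have "inv\<^bsub>GG\<^esub> g \<otimes>\<^bsub>GG\<^esub> x \<otimes>\<^bsub>GG\<^esub> g \<in> extensional I"
      using g x by (intro extensional_GG) simp
    moreover have "x \<in> extensional I" using x by (auto simp: carrier_GG PiE_iff)
    moreover have "x v \<in> conjugate (G v) (g v) (A v) \<longleftrightarrow> (inv\<^bsub>GG\<^esub> g \<otimes>\<^bsub>GG\<^esub> x \<otimes>\<^bsub>GG\<^esub> g) v \<in> A v" if "v \<in> I" for v
      using plain_group.conjugate_mem_iff[OF plain_G[OF that] component[OF g that] A(1)[OF that]]
        component[OF x that] that g by simp
    ultimately show ?thesis
      using x by (auto simp: GG.conjugate_mem_iff[OF g AG] PiE_iff)
  qed
  moreover have "conjugate GG g (\<Pi>\<^sub>E v\<in>I. A v) \<subseteq> carrier GG"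
    using GG.conjugate_subset_carrier g AG by blast
  ultimately show "conjugate GG g (\<Pi>\<^sub>E v\<in>I. A v) = (\<Pi>\<^sub>E v\<in>I. conjugate (G v) (g v) (A v))"
    using sub by blast
qed

lemma subgroup_PiE:
  assumes A: "\<And>v. v \<in> I \<Longrightarrow> subgroup (A v) (G v)" and sub: "(\<Pi>\<^sub>E v\<in>I. A v) \<subseteq> carrier GG"
  shows "subgroup (\<Pi>\<^sub>E v\<in>I. A v) GG"
proof (rule GG.subgroupI[OF sub])
  note ext = extensional_GG
  have "\<one>\<^bsub>GG\<^esub> \<in> (\<Pi>\<^sub>E v\<in>I. A v)"
    using A ext[OF GG.one_closed] by (auto simp: PiE_iff subgroup.one_closed)
  then show "(\<Pi>\<^sub>E v\<in>I. A v) \<noteq> {}" by blast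
  fix a assume a: "a \<in> (\<Pi>\<^sub>E v\<in>I. A v)"
  then have ac: "a \<in> carrier GG" using sub by blast
  show "inv\<^bsub>GG\<^esub> a \<in> (\<Pi>\<^sub>E v\<in>I. A v)"
    using a ac A ext[OF GG.inv_closed[OF ac]] by (auto simp: PiE_iff subgroup.m_inv_closed)
  fix b assume b: "b \<in> (\<Pi>\<^sub>E v\<in>I. A v)"
  then have bc: "b \<in> carrier GG" using sub by blast
  show "a \<otimes>\<^bsub>GG\<^esub> b \<in> (\<Pi>\<^sub>E v\<in>I. A v)"
    using a b A ext[OF GG.m_closed[OF ac bc]] by (auto simp: PiE_iff subgroup.m_closed)
qed

text \<open>The two boxes agree away from \<open>v\<close>, so a coset is determined by its
  component at \<open>v\<close>. The component of \<open>rep C\<close> depends on the choice only up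
  to \<open>B v\<close>.\<close>

lemma bij_betw_left_cosets_place:
  assumes v: "v \<in> I" and A: "\<And>w. w \<in> I \<Longrightarrow> subgroup (A w) (G w)" "(\<Pi>\<^sub>E w\<in>I. A w) \<subseteq> carrier GG"
    and B: "\<And>w. w \<in> I \<Longrightarrow> subgroup (B w) (G w)" "B v \<subseteq> A v" "\<And>w. w \<in> I \<Longrightarrow> w \<noteq> v \<Longrightarrow> B w = A w"
  shows "bij_betw (\<lambda>C. rep C v <#\<^bsub>G v\<^esub> B v) (left_cosets GG (\<Pi>\<^sub>E w\<in>I. A w) (\<Pi>\<^sub>E w\<in>I. B w))
    (left_cosets (G v) (A v) (B v))"
proof -
  define AA where "AA = (\<Pi>\<^sub>E w\<in>I. A w)"
  define BB where "BB = (\<Pi>\<^sub>E w\<in>I. B w)"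
  interpret Gv: plain_group "G v" using plain_G v by blast
  have BA: "BB \<subseteq> AA" unfolding AA_def BB_def using B by (intro PiE_mono) auto
  have sA: "subgroup AA GG" unfolding AA_def by (rule subgroup_PiE[OF A])
  have sB: "subgroup BB GG" unfolding BB_def using BA A(2) unfolding AA_def BB_def
    by (intro subgroup_PiE B(1)) auto
  have rC: "rep C \<in> AA" "C = rep C <#\<^bsub>GG\<^esub> BB" "rep C v \<in> A v" "rep C v \<in> carrier (G v)"
    if C: "C \<in> left_cosets GG AA BB" for C
  proof -
    show 1: "rep C \<in> AA" "C = rep C <#\<^bsub>GG\<^esub> BB"
      using GG.rep_left_cosets_subgroup[OF sB sA BA C] by auto
    then show "rep C v \<in> A v" using v by (auto simp: AA_def)
    then show "rep C v \<in> carrier (G v)" using A(1)[OF v] subgroup.subset by blast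
  qed
  have "bij_betw (\<lambda>C. rep C v <#\<^bsub>G v\<^esub> B v) (left_cosets GG AA BB) (left_cosets (G v) (A v) (B v))"
    unfolding bij_betw_def
  proof
    show "inj_on (\<lambda>C. rep C v <#\<^bsub>G v\<^esub> B v) (left_cosets GG AA BB)"
    proof (rule inj_onI)
      fix C D assume C: "C \<in> left_cosets GG AA BB" and D: "D \<in> left_cosets GG AA BB"
        and eq: "rep C v <#\<^bsub>G v\<^esub> B v = rep D v <#\<^bsub>G v\<^esub> B v"
      have cc: "rep C \<in> carrier GG" "rep D \<in> carrier GG" using rC(1)[OF C] rC(1)[OF D] A(2) AA_def by auto
      have "inv\<^bsub>G v\<^esub> (rep C v) \<otimes>\<^bsub>G v\<^esub> rep D v \<in> B v"
        using eq Gv.l_coset_eq_iff[OF B(1)[OF v] rC(4)[OF C] rC(4)[OF D]] by simp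
      moreover have "inv\<^bsub>GG\<^esub> rep C \<otimes>\<^bsub>GG\<^esub> rep D \<in> AA"
        using rC(1) C D sA by (simp add: subgroup.m_closed subgroup.m_inv_closed)
      ultimately have "inv\<^bsub>GG\<^esub> rep C \<otimes>\<^bsub>GG\<^esub> rep D \<in> BB"
        using B(3) cc v unfolding AA_def BB_def by (auto simp: PiE_iff) 
      then have "rep C <#\<^bsub>GG\<^esub> BB = rep D <#\<^bsub>GG\<^esub> BB" using GG.l_coset_eq_iff[OF sB cc] by simp
      then show "C = D" using rC(2)[OF C] rC(2)[OF D] by metis
    qed
    show "(\<lambda>C. rep C v <#\<^bsub>G v\<^esub> B v) ` left_cosets GG AA BB = left_cosets (G v) (A v) (B v)"
    proof (intro equalityI subsetI)
      fix D assume "D \<in> (\<lambda>C. rep C v <#\<^bsub>G v\<^esub> B v) ` left_cosets GG AA BB"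
      then show "D \<in> left_cosets (G v) (A v) (B v)" using rC(3) by (auto simp: left_cosets_def)
    next
      fix D assume "D \<in> left_cosets (G v) (A v) (B v)"
      then obtain a where a: "a \<in> A v" "D = a <#\<^bsub>G v\<^esub> B v" by (auto simp: left_cosets_def)
      have ac: "a \<in> carrier (G v)" using a A(1)[OF v] subgroup.subset by blast
      define a' where "a' = at_place I G v a"
      have a'c: "a' \<in> carrier GG" unfolding a'_def using at_place_closed v ac by blast
      have a'A: "a' \<in> AA"
        using a A(1) a'c unfolding AA_def a'_def
        by (auto simp: PiE_iff at_place_component subgroup.one_closed carrier_GG)
      obtain b where b: "b \<in> BB" "rep (a' <#\<^bsub>GG\<^esub> BB) = a' \<otimes>\<^bsub>GG\<^esub> b"
        using GG.rep_l_coset[OF sB a'c] by blast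
      have "rep (a' <#\<^bsub>GG\<^esub> BB) v <#\<^bsub>G v\<^esub> B v = (a \<otimes>\<^bsub>G v\<^esub> b v) <#\<^bsub>G v\<^esub> B v"
        using b v by (simp add: a'_def at_place_component)
      also have "\<dots> = D" using a b v ac by (simp add: BB_def Gv.l_coset_absorb[OF B(1)[OF v]] PiE_iff)
      finally show "D \<in> (\<lambda>C. rep C v <#\<^bsub>G v\<^esub> B v) ` left_cosets GG AA BB"
        using a'A by (auto simp: left_cosets_def)
    qed
  qed
  then show ?thesis unfolding AA_def BB_def .
qed

end

section \<open>Local Hecke operators\<close>

context topological_group begin

section \<open>Hecke operators on locally constant functions\<close>

lemma compactin_double_coset:
  assumes "compactin T A" "compactin T B" "g \<in> carrier G"
  shows "compactin T (double_coset G A g B)"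
proof -
  have AB: "A \<subseteq> carrier G" "B \<subseteq> carrier G"
    using assms compactin_subset_topspace topspace_carrier by auto
  have "continuous_map T T (\<lambda>b. g \<otimes>\<^bsub>G\<^esub> b)"
  proof -
    have "continuous_map T (prod_topology T T) (\<lambda>x. (g, x))"
      using assms topspace_carrier by (intro continuous_map_pairedI) auto
    from continuous_map_compose[OF this continuous_mult] show ?thesis by (simp add: o_def)
  qed
  then have "compactin T ((\<lambda>b. g \<otimes>\<^bsub>G\<^esub> b) ` B)" using assms image_compactin by blast
  then have "compactin (prod_topology T T) (A \<times> (\<lambda>b. g \<otimes>\<^bsub>G\<^esub> b) ` B)"
    using assms by (simp add: compactin_Times)
  then have "compactin T ((\<lambda>(x, y). x \<otimes>\<^bsub>G\<^esub> y) ` (A \<times> (\<lambda>b. g \<otimes>\<^bsub>G\<^esub> b) ` B))"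
    using continuous_mult image_compactin by blast
  moreover have "(\<lambda>(x, y). x \<otimes>\<^bsub>G\<^esub> y) ` (A \<times> (\<lambda>b. g \<otimes>\<^bsub>G\<^esub> b) ` B) = double_coset G A g B"
    by (force simp: double_coset_mem_iff)
  ultimately show ?thesis by simp
qed

end

context topological_action begin

text \<open>With k = h^-1 the map a \<mapsto> ak induces the standard bijection from A / (A \<inter>
  kBk^-1) to AkB / B. It identifies the pushforward formula for Schwartz functions with the sum over
  the double coset that defines [A h^-1 B].\<close>

lemma coset_sum_translated:
  assumes R: "cring R" and A: "subgroup A G" and B: "subgroup B G"
    and h: "h \<in> carrier G" and \<xi>: "invariant_under B \<xi>" "\<xi> \<in> topspace X \<rightarrow> carrier R"
    and x: "x \<in> topspace X"
  shows "(\<Oplus>\<^bsub>R\<^esub>C\<in>left_cosets G A (conjugate G (inv\<^bsub>G\<^esub> h) (B \<inter> conjugate G h A)).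
      \<xi> (act x (rep C \<otimes>\<^bsub>G\<^esub> inv\<^bsub>G\<^esub> h))) = coset_sum R (double_coset G A (inv\<^bsub>G\<^esub> h) B) B \<xi> x"
proof -
  interpret R: cring R by fact
  define k where "k = inv\<^bsub>G\<^esub> h"
  define V where "V = conjugate G k (B \<inter> conjugate G h A)"
  note As = subgroup.subset[OF A] and Bs = subgroup.subset[OF B]
  have k: "k \<in> carrier G" unfolding k_def using h by simp
  have V_iff: "y \<in> V \<longleftrightarrow> y \<in> A \<and> inv\<^bsub>G\<^esub> k \<otimes>\<^bsub>G\<^esub> y \<otimes>\<^bsub>G\<^esub> k \<in> B" for y
  proof -
    have "V = conjugate G k B \<inter> A"
      unfolding V_def k_def using conjugate_Int[of "inv\<^bsub>G\<^esub> h" B "conjugate G h A"] h As Bs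
      by (simp add: conjugate_subset_carrier conjugate_inv_cancel)
    then show ?thesis using conjugate_mem_iff[OF k Bs] As by auto
  qed
  have sV: "subgroup V G"
    unfolding V_def using A B h k by (intro subgroup_conjugate subgroups_Inter_pair) auto
  have VA: "V \<subseteq> A" using V_iff by auto
  define E where "E = double_coset G A k B"
  have E: "E \<subseteq> carrier G" unfolding E_def using double_coset_subset As Bs k by blast
  have rC: "rep C \<in> A" "C = rep C <#\<^bsub>G\<^esub> V" "rep C \<in> carrier G" if "C \<in> left_cosets G A V" for C
    using rep_left_cosets_subgroup[OF sV A VA that] As by auto
  have bij: "bij_betw (\<lambda>C. (rep C \<otimes>\<^bsub>G\<^esub> k) <#\<^bsub>G\<^esub> B) (left_cosets G A V) (left_cosets G E B)"
    unfolding bij_betw_def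
  proof
    show "inj_on (\<lambda>C. (rep C \<otimes>\<^bsub>G\<^esub> k) <#\<^bsub>G\<^esub> B) (left_cosets G A V)"
    proof (rule inj_onI)
      fix C D assume C: "C \<in> left_cosets G A V" and D: "D \<in> left_cosets G A V"
        and eq: "(rep C \<otimes>\<^bsub>G\<^esub> k) <#\<^bsub>G\<^esub> B = (rep D \<otimes>\<^bsub>G\<^esub> k) <#\<^bsub>G\<^esub> B"
      have "inv\<^bsub>G\<^esub> (rep C \<otimes>\<^bsub>G\<^esub> k) \<otimes>\<^bsub>G\<^esub> (rep D \<otimes>\<^bsub>G\<^esub> k) \<in> B"
        using eq l_coset_eq_iff[OF B, of "rep C \<otimes>\<^bsub>G\<^esub> k" "rep D \<otimes>\<^bsub>G\<^esub> k"] rC(3)[OF C] rC(3)[OF D] k by simp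
      moreover have "inv\<^bsub>G\<^esub> (rep C \<otimes>\<^bsub>G\<^esub> k) \<otimes>\<^bsub>G\<^esub> (rep D \<otimes>\<^bsub>G\<^esub> k) =
          inv\<^bsub>G\<^esub> k \<otimes>\<^bsub>G\<^esub> (inv\<^bsub>G\<^esub> rep C \<otimes>\<^bsub>G\<^esub> rep D) \<otimes>\<^bsub>G\<^esub> k"
        using rC(3)[OF C] rC(3)[OF D] k by (simp add: inv_mult_group m_assoc)
      moreover have "inv\<^bsub>G\<^esub> rep C \<otimes>\<^bsub>G\<^esub> rep D \<in> A"
        using rC C D A by (simp add: subgroup.m_closed subgroup.m_inv_closed)
      ultimately have "inv\<^bsub>G\<^esub> rep C \<otimes>\<^bsub>G\<^esub> rep D \<in> V" using V_iff by simp
      then have "rep C <#\<^bsub>G\<^esub> V = rep D <#\<^bsub>G\<^esub> V" using l_coset_eq_iff[OF sV rC(3)[OF C] rC(3)[OF D]] by simp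
      then show "C = D" using rC(2)[OF C] rC(2)[OF D] by metis
    qed
    show "(\<lambda>C. (rep C \<otimes>\<^bsub>G\<^esub> k) <#\<^bsub>G\<^esub> B) ` left_cosets G A V = left_cosets G E B"
    proof (intro equalityI subsetI)
      fix D assume "D \<in> (\<lambda>C. (rep C \<otimes>\<^bsub>G\<^esub> k) <#\<^bsub>G\<^esub> B) ` left_cosets G A V"
      then obtain C where C: "C \<in> left_cosets G A V" "D = (rep C \<otimes>\<^bsub>G\<^esub> k) <#\<^bsub>G\<^esub> B" by auto
      have "rep C \<otimes>\<^bsub>G\<^esub> k \<in> E"
        unfolding E_def double_coset_mem_iff using rC[OF C(1)] k subgroup.one_closed[OF B] 
        by (intro bexI[of _ "rep C"] bexI[of _ "\<one>\<^bsub>G\<^esub>"]) auto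
      then show "D \<in> left_cosets G E B" using C by (auto simp: left_cosets_def)
    next
      fix D assume "D \<in> left_cosets G E B"
      then obtain a b where ab: "a \<in> A" "b \<in> B" "D = (a \<otimes>\<^bsub>G\<^esub> (k \<otimes>\<^bsub>G\<^esub> b)) <#\<^bsub>G\<^esub> B"
        by (auto simp: left_cosets_def E_def double_coset_mem_iff)
      have c: "a \<in> carrier G" "b \<in> carrier G" using ab As Bs by auto
      have D: "D = (a \<otimes>\<^bsub>G\<^esub> k) <#\<^bsub>G\<^esub> B"
        using ab c k l_coset_absorb[OF B, of "a \<otimes>\<^bsub>G\<^esub> k" b] by (simp add: m_assoc)
      obtain v where v: "v \<in> V" "rep (a <#\<^bsub>G\<^esub> V) = a \<otimes>\<^bsub>G\<^esub> v" using rep_l_coset[OF sV c(1)] by blast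
      have vc: "v \<in> carrier G" using v VA As by auto
      have "a \<otimes>\<^bsub>G\<^esub> v \<otimes>\<^bsub>G\<^esub> k = a \<otimes>\<^bsub>G\<^esub> k \<otimes>\<^bsub>G\<^esub> (inv\<^bsub>G\<^esub> k \<otimes>\<^bsub>G\<^esub> v \<otimes>\<^bsub>G\<^esub> k)"
      proof -
        have "a \<otimes>\<^bsub>G\<^esub> k \<otimes>\<^bsub>G\<^esub> (inv\<^bsub>G\<^esub> k \<otimes>\<^bsub>G\<^esub> v \<otimes>\<^bsub>G\<^esub> k) = a \<otimes>\<^bsub>G\<^esub> (k \<otimes>\<^bsub>G\<^esub> inv\<^bsub>G\<^esub> k) \<otimes>\<^bsub>G\<^esub> v \<otimes>\<^bsub>G\<^esub> k"
          using c vc k by (simp only: m_assoc m_closed inv_closed)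
        then show ?thesis using c vc k by simp
      qed
      then have "(rep (a <#\<^bsub>G\<^esub> V) \<otimes>\<^bsub>G\<^esub> k) <#\<^bsub>G\<^esub> B = D"
        unfolding v(2) D using V_iff v(1) c k l_coset_absorb[OF B] by simp
      then show "D \<in> (\<lambda>C. (rep C \<otimes>\<^bsub>G\<^esub> k) <#\<^bsub>G\<^esub> B) ` left_cosets G A V"
        using ab by (auto simp: left_cosets_def)
    qed
  qed
  have "(\<Oplus>\<^bsub>R\<^esub>C\<in>left_cosets G A V. \<xi> (act x (rep C \<otimes>\<^bsub>G\<^esub> k))) =
      (\<Oplus>\<^bsub>R\<^esub>C\<in>left_cosets G E B. \<xi> (act x (rep C)))"
  proof (rule R.finsum_bij_betw[OF bij])
    fix C assume "C \<in> left_cosets G A V"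
    then show "\<xi> (act x (rep C \<otimes>\<^bsub>G\<^esub> k)) = \<xi> (act x (rep ((rep C \<otimes>\<^bsub>G\<^esub> k) <#\<^bsub>G\<^esub> B)))"
      using act_rep_l_coset[OF B \<xi>(1) _ x] rC k by simp
  next
    show "(\<lambda>C. \<xi> (act x (rep C))) \<in> left_cosets G E B \<rightarrow> carrier R"
    proof
      fix C assume "C \<in> left_cosets G E B"
      then obtain e where e: "e \<in> E" "C = e <#\<^bsub>G\<^esub> B" by (auto simp: left_cosets_def)
      then have "e \<in> carrier G" using E by auto
      then show "\<xi> (act x (rep C)) \<in> carrier R"
        using e act_rep_l_coset[OF B \<xi>(1) _ x] act_closed[OF x] \<xi>(2) by auto
    qed
  qed
  then show ?thesis unfolding coset_sum_def E_def V_def k_def .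
qed

lemma schwartz_hecke_eq:
  "schwartz_hecke R G act A B J d \<xi> x =
    (\<Oplus>\<^bsub>R\<^esub>h\<in>J. d h \<otimes>\<^bsub>R\<^esub> coset_sum R (double_coset G A (inv\<^bsub>G\<^esub> h) B) B \<xi> x)"
  by (simp add: schwartz_hecke_def coset_sum_def)

text \<open>The double coset is compact and \<open>B\<close> is open, so each sum has finitely many
  translates; invariance under \<open>A\<close> holds because left multiplication by
  \<open>A\<close> permutes the double coset.\<close>

lemma schwartz_fun_hecke:
  assumes R: "cring R" and A: "subgroup A G" "compactin T A"
    and B: "subgroup B G" "compactin T B" "openin T B"
    and J: "finite J" "J \<subseteq> carrier G" "d \<in> J \<rightarrow> carrier R"
    and \<xi>: "schwartz_fun R X \<xi>" "invariant_under B \<xi>"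
  shows "schwartz_fun R X (schwartz_hecke R G act A B J d \<xi>)"
    and "invariant_under A (schwartz_hecke R G act A B J d \<xi>)"
proof -
  note As = subgroup.subset[OF A(1)] and Bs = subgroup.subset[OF B(1)]
  define E where "E = (\<lambda>h. double_coset G A (inv\<^bsub>G\<^esub> h) B)"
  have E: "compactin T (E h)" "E h \<subseteq> carrier G" if "h \<in> J" for h
  proof -
    have "inv\<^bsub>G\<^esub> h \<in> carrier G" using that J by auto
    then show "compactin T (E h)" "E h \<subseteq> carrier G"
      unfolding E_def using A B As Bs by (auto intro: compactin_double_coset dest: subsetD[OF double_coset_subset])
  qed
  have eq: "schwartz_hecke R G act A B J d \<xi> = (\<lambda>x. \<Oplus>\<^bsub>R\<^esub>h\<in>J. d h \<otimes>\<^bsub>R\<^esub> coset_sum R (E h) B \<xi> x)"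
    by (simp add: fun_eq_iff schwartz_hecke_eq E_def)
  have s: "schwartz_fun R X (coset_sum R (E h) B \<xi>)" if h: "h \<in> J" for h
  proof -
    have fin: "finite (left_cosets G (E h) B)" using finite_left_cosets E[OF h] B by blast
    have "rep C \<in> carrier G" if C: "C \<in> left_cosets G (E h) B" for C
    proof -
      obtain e where e: "e \<in> E h" "C = e <#\<^bsub>G\<^esub> B" using C by (auto simp: left_cosets_def)
      then have ec: "e \<in> carrier G" using E[OF h] by auto
      then obtain b where "b \<in> B" "rep C = e \<otimes>\<^bsub>G\<^esub> b" using rep_l_coset[OF B(1) ec] e by blast
      then show ?thesis using ec Bs by auto
    qed
    then have "schwartz_fun R X (\<lambda>x. \<Oplus>\<^bsub>R\<^esub>C\<in>left_cosets G (E h) B. \<xi> (act x (rep C)))"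
      using fin \<xi>(1) by (intro schwartz_fun_finsum R schwartz_fun_translate)
    then show ?thesis by (simp add: coset_sum_def[abs_def])
  qed
  show "schwartz_fun R X (schwartz_hecke R G act A B J d \<xi>)"
    unfolding eq using J s by (intro schwartz_fun_finsum schwartz_fun_smult R) auto
  show "invariant_under A (schwartz_hecke R G act A B J d \<xi>)"
    unfolding invariant_under_def
  proof (intro ballI)
    interpret R: cring R by fact
    fix a x assume a: "a \<in> A" and x: "x \<in> topspace X"
    have ac: "a \<in> carrier G" using a As by auto
    have "coset_sum R (E h) B \<xi> (act x a) = coset_sum R (E h) B \<xi> x" if h: "h \<in> J" for h
    proof (rule coset_sum_translate[OF R B(1) \<xi>(2) _ E(2)[OF h] ac _ x])
      show "\<xi> \<in> topspace X \<rightarrow> carrier R" using \<xi>(1) by (simp add: schwartz_fun_def)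
      have hc: "inv\<^bsub>G\<^esub> h \<in> carrier G" using h J by auto
      show "(\<lambda>e. a \<otimes>\<^bsub>G\<^esub> e) ` E h = E h"
      proof (intro equalityI subsetI)
        fix e assume e: "e \<in> E h"
        then have ec: "e \<in> carrier G" using E(2)[OF h] by auto
        have "inv\<^bsub>G\<^esub> a \<otimes>\<^bsub>G\<^esub> e \<in> E h"
          using double_coset_assoc_mem(1)[OF A(1) B(1) hc] e subgroup.m_inv_closed[OF A(1) a]
            subgroup.one_closed[OF B(1)] unfolding E_def by blast
        moreover have "e = a \<otimes>\<^bsub>G\<^esub> (inv\<^bsub>G\<^esub> a \<otimes>\<^bsub>G\<^esub> e)" using ac ec by (simp add: m_assoc[symmetric])
        ultimately show "e \<in> (\<lambda>e. a \<otimes>\<^bsub>G\<^esub> e) ` E h" by blast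
      next
        fix e assume "e \<in> (\<lambda>e. a \<otimes>\<^bsub>G\<^esub> e) ` E h"
        then show "e \<in> E h"
          using double_coset_assoc_mem(1)[OF A(1) B(1) hc] a subgroup.one_closed[OF B(1)]
          unfolding E_def by blast
      qed
    qed
    moreover have "coset_sum R (E h) B \<xi> x \<in> carrier R" if "h \<in> J" for h
      using s[OF that] x by (rule schwartz_fun_closed)
    ultimately show "schwartz_hecke R G act A B J d \<xi> (act x a) = schwartz_hecke R G act A B J d \<xi> x"
      unfolding eq using J by (intro R.finsum_cong') auto
  qed
qed

end

section \<open>Regrouping a Hecke operator by classes modulo H and K\<close>

lemma (in Module.module) finsum_smult_rdistr:
  assumes "finite A" "x \<in> carrier M" "f \<in> A \<rightarrow> carrier R"
  shows "(\<Oplus>\<^bsub>R\<^esub>i\<in>A. f i) \<odot>\<^bsub>M\<^esub> x = (\<Oplus>\<^bsub>M\<^esub>i\<in>A. f i \<odot>\<^bsub>M\<^esub> x)"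
  using assms
proof (induction A)
  case empty
  then show ?case by simp
next
  case (insert a A)
  then have "f a \<in> carrier R" "f \<in> A \<rightarrow> carrier R" by auto
  then show ?case using insert by (simp add: smult_l_distr Pi_def)
qed

text \<open>Both sides equal the sum of \<open>f(t) s(t)\<close> over the double cosets \<open>UtK\<close> on which \<open>f\<close> does not
  vanish.\<close>

lemma (in plain_group) double_coset_sum_decompose:
  fixes R :: "'r ring" and M :: "('r, 'm) module"
  assumes M: "Module.module R M" and K: "subgroup K G" and H: "subgroup H G" and U: "U = H \<inter> K"
    and S: "finite S" "S \<subseteq> carrier G" "c \<in> S \<rightarrow> carrier R"
    and f: "f = double_coset_sum R G K K S c"
    and Q: "finite Q" "g \<in> Q \<rightarrow> carrier G"
      "bij_betw (\<lambda>i. double_coset G H (g i) K) Q (double_cosets G H (H <#> \<Sigma>) K)"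
    and \<Sigma>: "{t \<in> carrier G. f t \<noteq> \<zero>\<^bsub>R\<^esub>} \<subseteq> \<Sigma>"
    and Hg: "\<And>i. i \<in> Q \<Longrightarrow> Hg i = H \<inter> conjugate G (g i) K"
    and J: "\<And>i. i \<in> Q \<Longrightarrow> finite (J i)" "\<And>i. i \<in> Q \<Longrightarrow> J i \<subseteq> H"
      "\<And>i. i \<in> Q \<Longrightarrow> d i \<in> J i \<rightarrow> carrier R"
      "\<And>i. i \<in> Q \<Longrightarrow> inj_on (\<lambda>h. double_coset G U h (Hg i)) (J i)"
    and fJ: "\<And>i h. i \<in> Q \<Longrightarrow> h \<in> H \<Longrightarrow> f (h \<otimes> g i) = double_coset_sum R G U (Hg i) (J i) (d i) h"
    and fin: "\<And>\<sigma>. \<sigma> \<in> S \<Longrightarrow> finite (double_cosets G U (double_coset G K \<sigma> K) K)"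
    and s: "\<And>t. t \<in> carrier G \<Longrightarrow> s t \<in> carrier M"
      "\<And>t u k. t \<in> carrier G \<Longrightarrow> u \<in> U \<Longrightarrow> k \<in> K \<Longrightarrow> s (u \<otimes> (t \<otimes> k)) = s t"
  shows "(\<Oplus>\<^bsub>M\<^esub>\<sigma>\<in>S. c \<sigma> \<odot>\<^bsub>M\<^esub> (\<Oplus>\<^bsub>M\<^esub>D\<in>double_cosets G U (double_coset G K \<sigma> K) K. s (rep D))) =
    (\<Oplus>\<^bsub>M\<^esub>i\<in>Q. \<Oplus>\<^bsub>M\<^esub>h\<in>J i. d i h \<odot>\<^bsub>M\<^esub> s (h \<otimes> g i))"
proof -
  interpret M: Module.module R M by fact
  have Us: "subgroup U G" unfolding U using H K by (rule subgroups_Inter_pair)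
  note Kc = subgroup.subset[OF K] and Hc = subgroup.subset[OF H] and Uc = subgroup.subset[OF Us]
  define dc where "dc = (\<lambda>\<sigma>. double_cosets G U (double_coset G K \<sigma> K) K)"
  define DD where "DD = \<Union>(dc ` S)"
  have finD: "finite DD" unfolding DD_def dc_def using S fin by auto
  have KK: "double_coset G K \<sigma> K \<subseteq> carrier G" if "\<sigma> \<in> S" for \<sigma>
    using double_coset_subset Kc S that by blast
  have rD: "\<exists>u\<in>U. \<exists>k\<in>K. rep (double_coset G U t K) = u \<otimes> (t \<otimes> k)" if "t \<in> carrier G" for t
    using rep_double_coset[OF Us K that] by (simp add: double_coset_mem_iff)
  have DDt: "\<exists>t\<in>carrier G. D = double_coset G U t K" if "D \<in> DD" for D
    using that KK unfolding DD_def dc_def double_cosets_def by blast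
  have repc: "rep D \<in> carrier G" "D = double_coset G U (rep D) K" if D: "D \<in> DD" for D
  proof -
    obtain t where t: "t \<in> carrier G" "D = double_coset G U t K" using DDt[OF D] by blast
    have r: "rep D \<in> double_coset G U t K" unfolding t(2) by (rule rep_double_coset[OF Us K t(1)])
    then show "rep D \<in> carrier G" using double_coset_subset[OF Uc Kc t(1)] by blast
    show "D = double_coset G U (rep D) K" using double_coset_eqI[OF Us K t(1) r] t(2) by simp
  qed
  have mem: "rep D \<in> double_coset G K \<sigma> K \<longleftrightarrow> D \<in> dc \<sigma>" if D: "D \<in> DD" and \<sigma>: "\<sigma> \<in> S" for D \<sigma>
  proof
    assume "rep D \<in> double_coset G K \<sigma> K"
    then show "D \<in> dc \<sigma>" using repc(2)[OF D] unfolding dc_def double_cosets_def by blast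
  next
    assume "D \<in> dc \<sigma>"
    then obtain t where t: "t \<in> double_coset G K \<sigma> K" "D = double_coset G U t K"
      unfolding dc_def double_cosets_def by blast
    have tc: "t \<in> carrier G" using t KK[OF \<sigma>] by blast
    obtain u k where uk: "u \<in> U" "k \<in> K" "rep D = u \<otimes> (t \<otimes> k)" using rD[OF tc] t(2) by blast
    have \<sigma>c: "\<sigma> \<in> carrier G" using \<sigma> S by blast
    show "rep D \<in> double_coset G K \<sigma> K"
      unfolding uk(3) using uk t(1) \<sigma>c K U by (intro double_coset_assoc_mem) auto
  qed
  have f_cl: "f t \<in> carrier R" for t
    unfolding f double_coset_sum_def using S(3) by (intro M.R.finsum_closed) (auto simp: ch_def Pi_iff)
  have f_bi: "f (u \<otimes> (t \<otimes> k)) = f t" if t: "t \<in> carrier G" and u: "u \<in> K" and k: "k \<in> K" for t u k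
  proof -
    have "u \<otimes> (t \<otimes> k) \<in> double_coset G K \<sigma> K \<longleftrightarrow> t \<in> double_coset G K \<sigma> K" if \<sigma>: "\<sigma> \<in> S" for \<sigma>
    proof
      have \<sigma>c: "\<sigma> \<in> carrier G" using \<sigma> S by blast
      have c: "u \<in> carrier G" "k \<in> carrier G" using u k Kc by auto
      show "t \<in> double_coset G K \<sigma> K \<Longrightarrow> u \<otimes> (t \<otimes> k) \<in> double_coset G K \<sigma> K"
        using \<sigma>c u k K by (intro double_coset_assoc_mem) auto
      assume a: "u \<otimes> (t \<otimes> k) \<in> double_coset G K \<sigma> K"
      have "inv u \<otimes> (u \<otimes> (t \<otimes> k) \<otimes> inv k) \<in> double_coset G K \<sigma> K"
        using double_coset_assoc_mem(1)[OF K K \<sigma>c, of "u \<otimes> (t \<otimes> k) \<otimes> inv k" "inv u" "inv k"]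
          double_coset_assoc_mem(2)[OF K K \<sigma>c a u subgroup.m_inv_closed[OF K k]] u k K
        by (simp add: subgroup.m_inv_closed)
      moreover have "inv u \<otimes> (u \<otimes> (t \<otimes> k) \<otimes> inv k) = (inv u \<otimes> u) \<otimes> t \<otimes> (k \<otimes> inv k)"
        using c t by (simp only: m_assoc m_closed inv_closed)
      ultimately show "t \<in> double_coset G K \<sigma> K" using c t by simp
    qed
    then show ?thesis
      unfolding f double_coset_sum_def using S(3) by (intro M.R.finsum_cong') (auto simp: ch_def Pi_iff)
  qed
  \<comment> \<open>With the characteristic function of K\<sigma>K as a factor, each inner sum
    extends by zero to the common finite set \<open>DD\<close>. After exchanging the sums, the
    coefficients at a double coset add up to the value of \<open>f\<close> there, also when
    \<open>S\<close> lists a double coset repeatedly.\<close>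
  have coef: "c \<sigma> \<otimes>\<^bsub>R\<^esub> ch R A t \<in> carrier R" if "\<sigma> \<in> S" for \<sigma> A t
    using S(3) that by (auto simp: ch_def Pi_iff)
  define w where "w = (\<lambda>D. f (rep D) \<odot>\<^bsub>M\<^esub> s (rep D))"
  have w_cl: "w D \<in> carrier M" if "D \<in> DD" for D
    unfolding w_def using repc(1)[OF that] f_cl s(1) by simp
  have "(\<Oplus>\<^bsub>M\<^esub>\<sigma>\<in>S. c \<sigma> \<odot>\<^bsub>M\<^esub> (\<Oplus>\<^bsub>M\<^esub>D\<in>dc \<sigma>. s (rep D))) =
      (\<Oplus>\<^bsub>M\<^esub>\<sigma>\<in>S. \<Oplus>\<^bsub>M\<^esub>D\<in>DD. (c \<sigma> \<otimes>\<^bsub>R\<^esub> ch R (double_coset G K \<sigma> K) (rep D)) \<odot>\<^bsub>M\<^esub> s (rep D))"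
  proof (rule M.M.finsum_cong')
    fix \<sigma> assume \<sigma>: "\<sigma> \<in> S"
    have c\<sigma>: "c \<sigma> \<in> carrier R" using \<sigma> S by blast
    have sub: "dc \<sigma> \<subseteq> DD" unfolding DD_def using \<sigma> by blast
    have sc: "s (rep D) \<in> carrier M" if "D \<in> DD" for D using s(1) repc(1)[OF that] .
    have "c \<sigma> \<odot>\<^bsub>M\<^esub> (\<Oplus>\<^bsub>M\<^esub>D\<in>dc \<sigma>. s (rep D)) = (\<Oplus>\<^bsub>M\<^esub>D\<in>dc \<sigma>. c \<sigma> \<odot>\<^bsub>M\<^esub> s (rep D))"
      using fin[OF \<sigma>] sc sub c\<sigma> by (intro M.finsum_smult_ldistr) (auto simp: dc_def)
    also have "\<dots> = (\<Oplus>\<^bsub>M\<^esub>D\<in>dc \<sigma>. (c \<sigma> \<otimes>\<^bsub>R\<^esub> ch R (double_coset G K \<sigma> K) (rep D)) \<odot>\<^bsub>M\<^esub> s (rep D))"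
    proof (rule M.M.finsum_cong')
      fix D assume D: "D \<in> dc \<sigma>"
      then have "D \<in> DD" using sub by blast
      then have "rep D \<in> double_coset G K \<sigma> K" using mem[OF _ \<sigma>] D by blast
      then show "c \<sigma> \<odot>\<^bsub>M\<^esub> s (rep D) = (c \<sigma> \<otimes>\<^bsub>R\<^esub> ch R (double_coset G K \<sigma> K) (rep D)) \<odot>\<^bsub>M\<^esub> s (rep D)"
        using c\<sigma> by (simp add: ch_def)
    qed (use sc subsetD[OF sub] coef[OF \<sigma>] in \<open>auto intro!: M.smult_closed\<close>)
    also have "\<dots> = (\<Oplus>\<^bsub>M\<^esub>D\<in>DD. (c \<sigma> \<otimes>\<^bsub>R\<^esub> ch R (double_coset G K \<sigma> K) (rep D)) \<odot>\<^bsub>M\<^esub> s (rep D))"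
    proof (rule M.M.finsum_mono_neutral[OF finD sub])
      fix D assume D: "D \<in> DD - dc \<sigma>"
      then have "rep D \<notin> double_coset G K \<sigma> K" using mem[OF _ \<sigma>] by blast
      then show "(c \<sigma> \<otimes>\<^bsub>R\<^esub> ch R (double_coset G K \<sigma> K) (rep D)) \<odot>\<^bsub>M\<^esub> s (rep D) = \<zero>\<^bsub>M\<^esub>"
        using c\<sigma> sc D by (simp add: ch_def)
    qed (use sc coef[OF \<sigma>] in \<open>auto intro!: M.smult_closed\<close>)
    finally show "c \<sigma> \<odot>\<^bsub>M\<^esub> (\<Oplus>\<^bsub>M\<^esub>D\<in>dc \<sigma>. s (rep D)) =
      (\<Oplus>\<^bsub>M\<^esub>D\<in>DD. (c \<sigma> \<otimes>\<^bsub>R\<^esub> ch R (double_coset G K \<sigma> K) (rep D)) \<odot>\<^bsub>M\<^esub> s (rep D))" .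
  qed (use coef s(1) repc(1) in \<open>auto intro!: M.M.finsum_closed M.smult_closed\<close>)
  also have "\<dots> = (\<Oplus>\<^bsub>M\<^esub>D\<in>DD. \<Oplus>\<^bsub>M\<^esub>\<sigma>\<in>S. (c \<sigma> \<otimes>\<^bsub>R\<^esub> ch R (double_coset G K \<sigma> K) (rep D)) \<odot>\<^bsub>M\<^esub> s (rep D))"
    using S finD coef s(1) repc(1) by (intro M.M.finsum_swap M.smult_closed) auto
  also have "\<dots> = (\<Oplus>\<^bsub>M\<^esub>D\<in>DD. w D)"
  proof (rule M.M.finsum_cong')
    fix D assume D: "D \<in> DD"
    show "(\<Oplus>\<^bsub>M\<^esub>\<sigma>\<in>S. (c \<sigma> \<otimes>\<^bsub>R\<^esub> ch R (double_coset G K \<sigma> K) (rep D)) \<odot>\<^bsub>M\<^esub> s (rep D)) = w D"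
      unfolding w_def f double_coset_sum_def
      using S coef s(1)[OF repc(1)[OF D]] by (intro M.finsum_smult_rdistr[symmetric]) auto
  qed (use w_cl in auto)
  also have "\<dots> = (\<Oplus>\<^bsub>M\<^esub>D\<in>{D \<in> DD. f (rep D) \<noteq> \<zero>\<^bsub>R\<^esub>}. w D)"
    using finD w_cl s(1) repc(1) by (intro M.M.finsum_mono_neutral[symmetric]) (auto simp: w_def)
  finally have lhs: "(\<Oplus>\<^bsub>M\<^esub>\<sigma>\<in>S. c \<sigma> \<odot>\<^bsub>M\<^esub> (\<Oplus>\<^bsub>M\<^esub>D\<in>dc \<sigma>. s (rep D))) =
      (\<Oplus>\<^bsub>M\<^esub>D\<in>{D \<in> DD. f (rep D) \<noteq> \<zero>\<^bsub>R\<^esub>}. w D)" .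
  define z where "z = (\<lambda>x. d (fst x) (snd x) \<odot>\<^bsub>M\<^esub> s (snd x \<otimes> g (fst x)))"
  have hg: "h \<otimes> g i \<in> carrier G" "h \<in> carrier G" "h \<in> H" "g i \<in> carrier G" if "i \<in> Q" "h \<in> J i" for i h
    using that J(2)[OF that(1)] Hc Q(2) by auto
  have dcl: "d i h \<in> carrier R" if "i \<in> Q" "h \<in> J i" for i h
    using J(3)[OF that(1)] that(2) by blast
  have z_cl: "z x \<in> carrier M" if "x \<in> Sigma Q J" for x
    using that dcl hg s(1) by (auto simp: z_def intro!: M.smult_closed)
  \<comment> \<open>Pairs with coefficient zero may give double cosets outside of \<open>DD\<close>,
    and double cosets where \<open>f\<close> vanishes may lie in no class of some
    \<open>g i\<close>. Both are discarded before the two index sets are compared.\<close>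
  define E where "E = {x \<in> Sigma Q J. d (fst x) (snd x) \<noteq> \<zero>\<^bsub>R\<^esub>}"
  have "(\<Oplus>\<^bsub>M\<^esub>i\<in>Q. \<Oplus>\<^bsub>M\<^esub>h\<in>J i. d i h \<odot>\<^bsub>M\<^esub> s (h \<otimes> g i)) = (\<Oplus>\<^bsub>M\<^esub>x\<in>Sigma Q J. z x)"
    unfolding z_def using Q(1) J(1) dcl hg s(1) by (intro M.M.finsum_Sigma M.smult_closed) auto
  also have "\<dots> = (\<Oplus>\<^bsub>M\<^esub>x\<in>E. z x)"
    using Q(1) J(1) z_cl hg s(1) by (intro M.M.finsum_mono_neutral[symmetric]) (auto simp: E_def z_def)
  also have "\<dots> = (\<Oplus>\<^bsub>M\<^esub>D\<in>{D \<in> DD. f (rep D) \<noteq> \<zero>\<^bsub>R\<^esub>}. w D)"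
  proof -
    have Hgs: "subgroup (Hg i) G" if "i \<in> Q" for i
      unfolding Hg[OF that] using that Q(2) H K by (intro subgroups_Inter_pair subgroup_conjugate) auto
    \<comment> \<open>The double cosets attached to distinct elements of \<open>J i\<close> are
      distinct, so at \<open>h\<close> only its own term contributes.\<close>
    have fd: "f (h \<otimes> g i) = d i h" if i: "i \<in> Q" and h: "h \<in> J i" for i h
    proof -
      have hc: "h' \<in> carrier G" if "h' \<in> J i" for h' using hg(2)[OF i that] .
      have "ch R (double_coset G U h' (Hg i)) h = (if h' = h then \<one>\<^bsub>R\<^esub> else \<zero>\<^bsub>R\<^esub>)" if h': "h' \<in> J i" for h'
      proof -
        have "h \<in> double_coset G U h' (Hg i) \<longleftrightarrow> h' = h"
        proof
          assume "h \<in> double_coset G U h' (Hg i)"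
          then have "double_coset G U h (Hg i) = double_coset G U h' (Hg i)"
            by (rule double_coset_eqI[OF Us Hgs[OF i] hc[OF h']])
          then show "h' = h" using J(4)[OF i] h h' by (simp add: inj_on_def)
        qed (use mem_own_double_coset[OF Us Hgs[OF i] hc[OF h]] in simp)
        then show ?thesis by (simp add: ch_def)
      qed
      then have "f (h \<otimes> g i) = (\<Oplus>\<^bsub>R\<^esub>h'\<in>J i. if h = h' then d i h' else \<zero>\<^bsub>R\<^esub>)"
        unfolding fJ[OF i hg(3)[OF i h]] double_coset_sum_def using J(3)[OF i] dcl[OF i] h
        by (intro M.R.finsum_cong') auto
      also have "\<dots> = d i h" using J(1,3)[OF i] h by (intro M.R.finsum_singleton) auto
      finally show ?thesis .
    qed
    \<comment> \<open>U h Hg_i is sent to U h g_i K; this is well behaved because Hg_i is the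
      stabilizer in H of the coset g_i K.\<close>
    define \<Phi> where "\<Phi> = (\<lambda>x. double_coset G U (snd x \<otimes> g (fst x)) K)"
    have rep\<Phi>: "\<exists>u\<in>U. \<exists>k\<in>K. rep (\<Phi> (i, h)) = u \<otimes> (h \<otimes> g i \<otimes> k)" if "i \<in> Q" "h \<in> J i" for i h
      unfolding \<Phi>_def using rD[OF hg(1)[OF that]] by simp
    have UK: "u \<in> K" if "u \<in> U" for u using that U by simp
    have frep: "f (rep (\<Phi> (i, h))) = d i h" "s (rep (\<Phi> (i, h))) = s (h \<otimes> g i)"
      if i: "i \<in> Q" and h: "h \<in> J i" for i h
      using rep\<Phi>[OF i h] f_bi[OF hg(1)[OF i h]] s(2)[OF hg(1)[OF i h]] fd[OF i h] UK by auto
    have "bij_betw \<Phi> E {D \<in> DD. f (rep D) \<noteq> \<zero>\<^bsub>R\<^esub>}"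
      unfolding bij_betw_def
    proof
      show "inj_on \<Phi> E"
      proof (rule inj_onI)
        fix x y assume x: "x \<in> E" and y: "y \<in> E" and eq: "\<Phi> x = \<Phi> y"
        obtain i h where ih: "x = (i, h)" "i \<in> Q" "h \<in> J i" using x by (auto simp: E_def)
        obtain i' h' where ih': "y = (i', h')" "i' \<in> Q" "h' \<in> J i'" using y by (auto simp: E_def)
        note c = hg[OF ih(2,3)] hg[OF ih'(2,3)]
        have "h' \<otimes> g i' \<in> \<Phi> x"
          using mem_own_double_coset[OF Us K, of "h' \<otimes> g i'"] c eq ih' by (simp add: \<Phi>_def)
        then obtain u k where uk: "u \<in> U" "k \<in> K" "h' \<otimes> g i' = u \<otimes> (h \<otimes> g i \<otimes> k)"
          by (auto simp: \<Phi>_def ih(1) double_coset_mem_iff)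
        have uc: "u \<in> carrier G" "k \<in> carrier G" "u \<in> H" using uk Uc Kc U by auto
        \<comment> \<open>The relation places g i' in the class of g i modulo H and K, and distinct
          indices have distinct classes.\<close>
        have gi': "g i' = (inv h' \<otimes> u \<otimes> h) \<otimes> (g i \<otimes> k)"
        proof -
          have "g i' = inv h' \<otimes> (h' \<otimes> g i')" using c by (simp add: m_assoc[symmetric])
          also have "\<dots> = (inv h' \<otimes> u \<otimes> h) \<otimes> (g i \<otimes> k)"
            unfolding uk(3) using c uc by (simp add: m_assoc)
          finally show ?thesis .
        qed
        have "inv h' \<otimes> u \<otimes> h \<in> H" using c uc H by (simp add: subgroup.m_closed subgroup.m_inv_closed)
        then have "double_coset G H (g i') K = double_coset G H (g i) K"
          unfolding gi' by (rule double_coset_absorb[OF H K c(4) _ uk(2)])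
        then have ii: "i' = i" using Q(3) ih ih' by (auto simp: bij_betw_def inj_on_def)
        \<comment> \<open>Solving h' = u h q for q and conjugating by g i gives back k in K, so q
          lies in Hg i.\<close>
        define q where "q = inv h \<otimes> inv u \<otimes> h'"
        have qc: "q \<in> carrier G" "q \<in> H"
          unfolding q_def using c uc H by (simp_all add: subgroup.m_closed subgroup.m_inv_closed)
        have h'q: "h' = u \<otimes> (h \<otimes> q)"
        proof -
          have "u \<otimes> (h \<otimes> q) = u \<otimes> (h \<otimes> inv h) \<otimes> inv u \<otimes> h'"
            unfolding q_def using c uc by (simp only: m_assoc m_closed inv_closed)
          then show ?thesis using c uc by simp
        qed
        have "inv (g i) \<otimes> q \<otimes> g i = k"
        proof -
          have "inv (g i) \<otimes> q \<otimes> g i = inv (g i) \<otimes> inv h \<otimes> inv u \<otimes> (h' \<otimes> g i')"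
            unfolding q_def ii using c uc by (simp add: m_assoc)
          also have "\<dots> = inv (g i) \<otimes> (inv h \<otimes> (inv u \<otimes> u) \<otimes> h) \<otimes> g i \<otimes> k"
            unfolding uk(3) using c uc by (simp only: m_assoc m_closed inv_closed)
          finally show ?thesis using c uc by (simp add: m_assoc)
        qed
        then have "q \<in> Hg i" unfolding Hg[OF ih(2)] using qc uk(2) c Kc by (simp add: conjugate_mem_iff)
        then have "double_coset G U h' (Hg i) = double_coset G U h (Hg i)"
          unfolding h'q by (rule double_coset_absorb[OF Us Hgs[OF ih(2)] c(2) uk(1)])
        then have "h' = h" using J(4)[OF ih(2)] ih ih' ii by (simp add: inj_on_def)
        then show "x = y" using ih ih' ii by simp
      qed
      show "\<Phi> ` E = {D \<in> DD. f (rep D) \<noteq> \<zero>\<^bsub>R\<^esub>}"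
      proof (intro equalityI subsetI)
        fix D assume "D \<in> \<Phi> ` E"
        then obtain i h where ih: "D = \<Phi> (i, h)" "i \<in> Q" "h \<in> J i" "d i h \<noteq> \<zero>\<^bsub>R\<^esub>"
          by (auto simp: E_def)
        note c = hg[OF ih(2,3)]
        have "f (h \<otimes> g i) \<noteq> \<zero>\<^bsub>R\<^esub>" using fd[OF ih(2,3)] ih(4) by simp
        have "\<exists>\<sigma>\<in>S. h \<otimes> g i \<in> double_coset G K \<sigma> K"
        proof (rule ccontr)
          assume "\<not> ?thesis"
          then have "f (h \<otimes> g i) = \<zero>\<^bsub>R\<^esub>"
            unfolding f double_coset_sum_def using subsetD[OF S(2)] funcset_mem[OF S(3)]
            by (intro M.R.add.finprod_one_eqI) (auto simp: ch_def)
          then show False using \<open>f (h \<otimes> g i) \<noteq> \<zero>\<^bsub>R\<^esub>\<close> by simp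
        qed
        then have "D \<in> DD" unfolding DD_def dc_def double_cosets_def ih(1) \<Phi>_def by auto
        then show "D \<in> {D \<in> DD. f (rep D) \<noteq> \<zero>\<^bsub>R\<^esub>}" using frep(1)[OF ih(2,3)] ih by simp
      next
        fix D assume "D \<in> {D \<in> DD. f (rep D) \<noteq> \<zero>\<^bsub>R\<^esub>}"
        then have D: "D \<in> DD" "f (rep D) \<noteq> \<zero>\<^bsub>R\<^esub>" by auto
        define t where "t = rep D"
        have t: "t \<in> carrier G" "D = double_coset G U t K" unfolding t_def using repc[OF D(1)] by auto
        \<comment> \<open>A point where \<open>f\<close> is nonzero lies in \<Sigma>, hence in the
          class of some \<open>g i\<close>; its component in \<open>H\<close> is located afterwards
          through the expansion over \<open>J i\<close>.\<close>
        have "t \<in> \<Sigma>" using \<Sigma> t D(2) unfolding t_def by blast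
        then have "t \<in> H <#> \<Sigma>"
          using subgroup.one_closed[OF H] t(1) unfolding set_mult_def by force
        then have "double_coset G H t K \<in> double_cosets G H (H <#> \<Sigma>) K" by (auto simp: double_cosets_def)
        then obtain i where i: "i \<in> Q" "double_coset G H t K = double_coset G H (g i) K"
          using Q(3) unfolding bij_betw_def by (metis (no_types, lifting) imageE)
        have "t \<in> double_coset G H (g i) K" using mem_own_double_coset[OF H K t(1)] i by simp
        then obtain a k where ak: "a \<in> H" "k \<in> K" "t = a \<otimes> (g i \<otimes> k)" by (auto simp: double_coset_mem_iff)
        have c: "a \<in> carrier G" "k \<in> carrier G" "g i \<in> carrier G" using ak Hc Kc Q(2) i by auto
        have ta: "t = \<one> \<otimes> (a \<otimes> g i \<otimes> k)" using ak c by (simp add: m_assoc)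
        have "f t = f (a \<otimes> g i)"
          unfolding ta using c ak subgroup.one_closed[OF K] by (intro f_bi) auto
        then have "f (a \<otimes> g i) \<noteq> \<zero>\<^bsub>R\<^esub>" using D(2) t_def by simp
        have "\<exists>h\<in>J i. a \<in> double_coset G U h (Hg i)"
        proof (rule ccontr)
          assume "\<not> ?thesis"
          then have "f (a \<otimes> g i) = \<zero>\<^bsub>R\<^esub>"
            unfolding fJ[OF i(1) ak(1)] double_coset_sum_def using dcl[OF i(1)]
            by (intro M.R.add.finprod_one_eqI) (auto simp: ch_def)
          then show False using \<open>f (a \<otimes> g i) \<noteq> \<zero>\<^bsub>R\<^esub>\<close> by simp
        qed
        then obtain h u y where h: "h \<in> J i" "u \<in> U" "y \<in> Hg i" "a = u \<otimes> (h \<otimes> y)"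
          by (auto simp: double_coset_mem_iff)
        have yc: "y \<in> carrier G" "inv (g i) \<otimes> y \<otimes> g i \<in> K"
          using h(3) c Kc unfolding Hg[OF i(1)] by (auto simp: conjugate_mem_iff)
        \<comment> \<open>The factor y in Hg i moves across g i and becomes an element of K.\<close>
        define k' where "k' = (inv (g i) \<otimes> y \<otimes> g i) \<otimes> k"
        have k': "k' \<in> K" unfolding k'_def using yc ak K by (simp add: subgroup.m_closed)
        have hc: "h \<in> carrier G" "u \<in> carrier G" using hg[OF i(1) h(1)] h(2) Uc by auto
        have tt: "t = u \<otimes> (h \<otimes> g i \<otimes> k')"
        proof -
          have "u \<otimes> (h \<otimes> g i \<otimes> k') = u \<otimes> (h \<otimes> (g i \<otimes> inv (g i)) \<otimes> y \<otimes> g i \<otimes> k)"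
            unfolding k'_def using hc c yc by (simp only: m_assoc m_closed inv_closed)
          also have "\<dots> = t" unfolding ak(3) h(4) using hc c yc by (simp add: m_assoc)
          finally show ?thesis by simp
        qed
        have "D = \<Phi> (i, h)"
          unfolding t(2) tt \<Phi>_def using double_coset_absorb[OF Us K _ h(2) k', of "h \<otimes> g i"] hc c by simp
        moreover have "d i h \<noteq> \<zero>\<^bsub>R\<^esub>" using frep(1)[OF i(1) h(1)] D(2) calculation by simp
        ultimately show "D \<in> \<Phi> ` E" using i h by (auto simp: E_def)
      qed
    qed
    then show ?thesis
    proof (rule M.M.finsum_bij_betw)
      fix x assume "x \<in> E"
      then obtain i h where ih: "x = (i, h)" "i \<in> Q" "h \<in> J i" by (auto simp: E_def)
      show "z x = w (\<Phi> x)" unfolding z_def w_def ih(1) using frep[OF ih(2,3)] by simp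
    qed (use w_cl in auto)
  qed
  finally show ?thesis using lhs unfolding dc_def by simp
qed

section \<open>Symbols attached to pure tensors\<close>

text \<open>Over an infinite set both sums are zero by default, so the coset sums of the pushforward
  formula are treated uniformly.\<close>

lemma (in cring) finsum_rdistr_any:
  assumes "a \<in> carrier R" "f \<in> A \<rightarrow> carrier R"
  shows "a \<otimes> (\<Oplus>i\<in>A. f i) = (\<Oplus>i\<in>A. a \<otimes> f i)"
  using assms by (cases "finite A") (auto intro: finsum_rdistr)

text \<open>The coefficient ring is an arbitrary commutative ring here; the p-adic integers are
  substituted at the end.\<close>

locale zeta_setting =
  fixes R :: "'r ring" and I :: "'i set"
    and G :: "'i \<Rightarrow> 'g monoid" and T :: "'i \<Rightarrow> 'g topology"
    and H K L U :: "'i \<Rightarrow> 'g set"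
    and GG HH :: "('i \<Rightarrow> 'g) monoid" and TG TH :: "('i \<Rightarrow> 'g) topology"
    and \<Upsilon>\<^sub>G \<Upsilon>\<^sub>H :: "('i \<Rightarrow> 'g) set set"
    and N :: "('i \<Rightarrow> 'g, 'r, 'n) ric" and M :: "('i \<Rightarrow> 'g, 'r, 'm) ric"
    and \<iota> :: "('i \<Rightarrow> 'g) set \<Rightarrow> ('i \<Rightarrow> 'g) set \<Rightarrow> 'n \<Rightarrow> 'm"
    and X :: "'i \<Rightarrow> 'x topology" and Y :: "'i \<Rightarrow> 'x set" and act :: "'i \<Rightarrow> 'x \<Rightarrow> 'g \<Rightarrow> 'x"
    and XX :: "('i \<Rightarrow> 'x) topology" and Act :: "('i \<Rightarrow> 'x) \<Rightarrow> ('i \<Rightarrow> 'g) \<Rightarrow> ('i \<Rightarrow> 'x)"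
    and \<theta> :: "('i \<Rightarrow> 'g) set \<Rightarrow> 'n \<Rightarrow> (('i \<Rightarrow> 'x) \<Rightarrow> 'r)"
  assumes R_cring: "cring R"
    and G_lp: "\<And>v. v \<in> I \<Longrightarrow> locally_profinite_group (G v) (T v)"
    and H_closed: "\<And>v. v \<in> I \<Longrightarrow> subgroup (H v) (G v) \<and> closedin (T v) (H v)"
    and H_lp: "\<And>v. v \<in> I \<Longrightarrow>
      locally_profinite_group ((G v)\<lparr>carrier := H v\<rparr>) (subtopology (T v) (H v))"
    and K_co: "\<And>v. v \<in> I \<Longrightarrow> compact_open_subgroup (G v) (T v) (K v)"
    and L_co: "\<And>v. v \<in> I \<Longrightarrow> compact_open_subgroup (G v) (T v) (L v) \<and> L v \<lhd> (G v)\<lparr>carrier := K v\<rparr>"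
    and U_eq: "U = (\<lambda>v. H v \<inter> K v)"
    and GG_def: "GG = restricted_group I G K"
    and HH_def: "HH = restricted_group I (\<lambda>v. (G v)\<lparr>carrier := H v\<rparr>) U"
    and GG_levels: "level_collection GG TG \<Upsilon>\<^sub>G"
    and level_in: "\<And>\<nu>. finite \<nu> \<Longrightarrow> \<nu> \<subseteq> I \<Longrightarrow> level I K L \<nu> \<in> \<Upsilon>\<^sub>G"
    and HH_levels: "level_collection HH TH \<Upsilon>\<^sub>H"
    and HH_restrict: "(\<lambda>K'. K' \<inter> carrier HH) ` \<Upsilon>\<^sub>G \<subseteq> \<Upsilon>\<^sub>H"
    and N_ric: "ric_functor R HH \<Upsilon>\<^sub>H N" and M_ric: "ric_functor R GG \<Upsilon>\<^sub>G M"
    and \<iota>_push: "pushforward R HH GG \<Upsilon>\<^sub>H \<Upsilon>\<^sub>G N M \<iota>"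
    and \<iota>_mackey: "mackey_pushforward GG \<Upsilon>\<^sub>H \<Upsilon>\<^sub>G N M \<iota>"
    and X_lp: "\<And>v. v \<in> I \<Longrightarrow> locally_profinite_space (X v)"
    and X_act: "\<And>v. v \<in> I \<Longrightarrow> continuous_right_action ((G v)\<lparr>carrier := H v\<rparr>)
      (subtopology (T v) (H v)) (X v) (act v)"
    and Y_co: "\<And>v. v \<in> I \<Longrightarrow> compactin (X v) (Y v) \<and> openin (X v) (Y v) \<and>
      (\<forall>y\<in>Y v. \<forall>u\<in>U v. act v y u \<in> Y v)"
    and XX_def: "XX = restricted_topology I X Y"
    and Act_def: "Act = (\<lambda>x h. \<lambda>v\<in>I. act v (x v) (h v))"
    and \<theta>_id: "schwartz_identification R I HH \<Upsilon>\<^sub>H N XX Act \<theta>"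
begin

abbreviation Hl :: "'i \<Rightarrow> 'g monoid" where "Hl v \<equiv> (G v)\<lparr>carrier := H v\<rparr>"

lemma G_plain: "v \<in> I \<Longrightarrow> plain_group (G v)"
  using G_lp by (simp add: plain_group_def locally_profinite_group_def topological_group_def)

lemma G_top: "v \<in> I \<Longrightarrow> topological_group (G v) (T v)"
  using G_lp by (simp add: locally_profinite_group_def)

lemma H_sub: "v \<in> I \<Longrightarrow> subgroup (H v) (G v)"
  using H_closed by blast

lemma K_sub: "v \<in> I \<Longrightarrow> subgroup (K v) (G v)" and L_sub: "v \<in> I \<Longrightarrow> subgroup (L v) (G v)"
  using K_co L_co by (auto simp: compact_open_subgroup_def)

lemma L_K: "v \<in> I \<Longrightarrow> L v \<subseteq> K v"
  using L_co subgroup.subset by (fastforce simp: normal_def)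

lemma local_action: "v \<in> I \<Longrightarrow> topological_action (Hl v) (subtopology (T v) (H v)) (X v) (act v)"
  using H_lp X_act by (simp add: topological_action_def locally_profinite_group_def)

sublocale P: restricted_product I G K GG
proof (rule restricted_product.intro)
  show "Group.group (G v)" if "v \<in> I" for v using G_plain[OF that] by (simp add: plain_group_def)
  show "Group.group GG" using GG_levels
    by (simp add: level_collection_def locally_profinite_group_def topological_group_def)
  show "subgroup (K v) (G v)" if "v \<in> I" for v using K_sub that .
qed (rule GG_def)

sublocale S: restricted_space R I X Y XX
proof (rule restricted_space.intro)
  show "cring R" by (rule R_cring)
  show "openin (X v) (Y v)" "compactin (X v) (Y v)" "Hausdorff_space (X v)" if "v \<in> I" for v
    using Y_co[OF that] X_lp[OF that] by (auto simp: locally_profinite_space_def)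
qed (rule XX_def)

text \<open>As U v = H v \<inter> K v, the finiteness conditions of the two restricted products
  coincide for elements with components in the H v.\<close>

lemma carrier_HH: "x \<in> carrier HH \<longleftrightarrow> x \<in> carrier GG \<and> (\<forall>v\<in>I. x v \<in> H v)"
proof -
  have "(x \<in> (\<Pi>\<^sub>E v\<in>I. H v) \<and> finite {v \<in> I. x v \<notin> U v}) \<longleftrightarrow>
      (x \<in> (\<Pi>\<^sub>E v\<in>I. carrier (G v)) \<and> finite {v \<in> I. x v \<notin> K v}) \<and> (\<forall>v\<in>I. x v \<in> H v)"
  proof -
    have "{v \<in> I. x v \<notin> U v} = {v \<in> I. x v \<notin> K v}" if "\<forall>v\<in>I. x v \<in> H v"
      using that by (auto simp: U_eq)
    moreover have "x v \<in> carrier (G v)" if "\<forall>v\<in>I. x v \<in> H v" "v \<in> I" for v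
      using that H_sub subgroup.subset by blast
    ultimately show ?thesis by (auto simp: PiE_iff)
  qed
  then show ?thesis by (simp add: P.carrier_GG HH_def restricted_group_def restricted_set_def)
qed

lemma HH_record: "HH = GG\<lparr>carrier := carrier HH\<rparr>"
  by (simp add: HH_def GG_def restricted_group_def product_group_def)

sublocale ric: ric_pushforward R GG HH TG TH \<Upsilon>\<^sub>G \<Upsilon>\<^sub>H M N \<iota>
proof (intro ric_pushforward.intro ric_pushforward_axioms.intro)
  show "HH = GG\<lparr>carrier := carrier HH\<rparr>" by (rule HH_record)
  show "carrier HH \<subseteq> carrier GG" using carrier_HH by blast
  show "P \<inter> carrier HH \<in> \<Upsilon>\<^sub>H" if "P \<in> \<Upsilon>\<^sub>G" for P using HH_restrict that by blast
qed (rule R_cring \<iota>_mackey GG_levels HH_levels M_ric N_ric \<iota>_push)+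

sublocale sch: schwartz_identification R I HH \<Upsilon>\<^sub>H N XX Act \<theta>
  by (rule \<theta>_id)

section \<open>Levels of product form and pure tensors on them\<close>

definition Pl :: "'i set \<Rightarrow> 'i \<Rightarrow> 'g set" where
  "Pl \<nu> v = (if v \<in> \<nu> then L v else K v)"

definition Wl :: "'i set \<Rightarrow> ('i \<Rightarrow> 'g) \<Rightarrow> 'i \<Rightarrow> 'g set" where
  "Wl \<nu> g v = H v \<inter> conjugate (G v) (g v) (Pl \<nu> v)"

text \<open>The largest subgroup of \<open>HH\<close> in the conjugate of K[\<nu>] by g. Symbols are
  kept at this level, so that traces and Hecke operators always relate levels of the same
  kind.\<close>

definition WW :: "'i set \<Rightarrow> ('i \<Rightarrow> 'g) \<Rightarrow> ('i \<Rightarrow> 'g) set" where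
  "WW \<nu> g = (\<Pi>\<^sub>E v\<in>I. Wl \<nu> g v)"

lemma level_eq: "level I K L \<nu> = (\<Pi>\<^sub>E v\<in>I. Pl \<nu> v)"
  by (simp add: level_def Pl_def)

lemma Pl_sub:
  assumes "v \<in> I"
  shows "subgroup (Pl \<nu> v) (G v)" "Pl \<nu> v \<subseteq> K v" "Pl \<nu> v \<subseteq> carrier (G v)"
proof -
  show 1: "subgroup (Pl \<nu> v) (G v)" "Pl \<nu> v \<subseteq> K v"
    using K_sub[OF assms] L_sub[OF assms] L_K[OF assms] by (auto simp: Pl_def)
  show "Pl \<nu> v \<subseteq> carrier (G v)" by (rule subgroup.subset[OF 1(1)])
qed

lemma Pl_fin: "finite {v \<in> I. \<not> Pl \<nu> v \<subseteq> K v}"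
proof -
  have "{v \<in> I. \<not> Pl \<nu> v \<subseteq> K v} = {}" using Pl_sub(2) by blast
  then show ?thesis by (simp only: finite.emptyI)
qed

lemma conjugate_level:
  "g \<in> carrier GG \<Longrightarrow> conjugate GG g (level I K L \<nu>) = (\<Pi>\<^sub>E v\<in>I. conjugate (G v) (g v) (Pl \<nu> v))"
  unfolding level_eq using P.conjugate_PiE(1)[OF _ Pl_sub(3) Pl_fin] .

lemma WW_eq:
  assumes g: "g \<in> carrier GG"
  shows "WW \<nu> g = carrier HH \<inter> conjugate GG g (level I K L \<nu>)"
proof -
  have "conjugate GG g (level I K L \<nu>) \<subseteq> carrier GG"
    using P.conjugate_PiE(3)[OF g Pl_sub(3) Pl_fin, of \<nu>] conjugate_level[OF g, of \<nu>] by simp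
  then show ?thesis
    unfolding conjugate_level[OF g] WW_def Wl_def by (auto simp: carrier_HH PiE_iff)
qed

lemma Wl_sub:
  assumes "g \<in> carrier GG" "v \<in> I"
  shows "subgroup (Wl \<nu> g v) (G v)" "Wl \<nu> g v \<subseteq> H v" "Wl \<nu> g v \<subseteq> carrier (G v)"
proof -
  interpret Gv: plain_group "G v" using G_plain assms by blast
  show 1: "subgroup (Wl \<nu> g v) (G v)" unfolding Wl_def
    using assms by (intro Gv.subgroups_Inter_pair Gv.subgroup_conjugate H_sub Pl_sub P.component)
  show "Wl \<nu> g v \<subseteq> H v" "Wl \<nu> g v \<subseteq> carrier (G v)" using subgroup.subset[OF 1] by (auto simp: Wl_def)
qed

lemma WW_level:
  assumes "finite \<nu>" "\<nu> \<subseteq> I" "g \<in> carrier GG"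
  shows "WW \<nu> g \<in> \<Upsilon>\<^sub>H" "product_form I (WW \<nu> g)" "WW \<nu> g \<subseteq> conjugate GG g (level I K L \<nu>)"
proof -
  have "conjugate GG g (level I K L \<nu>) \<in> \<Upsilon>\<^sub>G" using level_in ric.G.T1 assms by blast
  from ric.restrict_level[OF this] show "WW \<nu> g \<in> \<Upsilon>\<^sub>H"
    unfolding WW_eq[OF assms(3)] by (simp add: Int_commute)
  show "product_form I (WW \<nu> g)" unfolding product_form_def WW_def by blast
  show "WW \<nu> g \<subseteq> conjugate GG g (level I K L \<nu>)" unfolding WW_eq[OF assms(3)] by simp
qed

text \<open>This is \<open>invariant_under\<close> for the local action at \<open>v\<close>, stated
  without interpreting a locale because the place varies.\<close>

definition fixed_by :: "'i \<Rightarrow> 'g set \<Rightarrow> ('x \<Rightarrow> 'r) \<Rightarrow> bool" where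
  "fixed_by v B f \<longleftrightarrow> (\<forall>u\<in>B. \<forall>x\<in>topspace (X v). f (act v x u) = f x)"

lemma fixed_byD: "fixed_by v B f \<Longrightarrow> u \<in> B \<Longrightarrow> x \<in> topspace (X v) \<Longrightarrow> f (act v x u) = f x"
  by (simp add: fixed_by_def)

text \<open>These conditions make the pure tensor of \<open>f\<close> a Schwartz function on
  \<open>XX\<close> that is invariant under \<open>WW \<nu> g\<close>.\<close>

definition admissible :: "'i set \<Rightarrow> ('i \<Rightarrow> 'g) \<Rightarrow> ('i \<Rightarrow> 'x \<Rightarrow> 'r) \<Rightarrow> bool" where
  "admissible \<nu> g f \<longleftrightarrow> g \<in> carrier GG \<and> S.almost_unit f \<and> (\<forall>w\<in>I. fixed_by w (Wl \<nu> g w) (f w))"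

lemma act_in: "v \<in> I \<Longrightarrow> x \<in> topspace (X v) \<Longrightarrow> h \<in> H v \<Longrightarrow> act v x h \<in> topspace (X v)"
  using topological_action.act_closed[OF local_action] by simp

lemma act_times:
  "v \<in> I \<Longrightarrow> x \<in> topspace (X v) \<Longrightarrow> h \<in> H v \<Longrightarrow> k \<in> H v \<Longrightarrow>
    act v x (h \<otimes>\<^bsub>G v\<^esub> k) = act v (act v x h) k"
  using continuous_right_action.act_mult[OF X_act] by fastforce

lemma act_unit: "v \<in> I \<Longrightarrow> x \<in> topspace (X v) \<Longrightarrow> act v x \<one>\<^bsub>G v\<^esub> = x"
  using continuous_right_action.act_one[OF X_act] by fastforce

lemma XX_comp: "x \<in> topspace XX \<Longrightarrow> v \<in> I \<Longrightarrow> x v \<in> topspace (X v)"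
  unfolding S.topspace_XX by auto

lemma Act_comp: "v \<in> I \<Longrightarrow> Act x h v = act v (x v) (h v)"
  by (simp add: Act_def)

lemma Act_in:
  assumes x: "x \<in> topspace XX" and h: "h \<in> carrier HH"
  shows "Act x h \<in> topspace XX"
proof -
  have hv: "h v \<in> H v" if "v \<in> I" for v using h carrier_HH that by blast
  have "{v \<in> I. Act x h v \<notin> Y v} \<subseteq> {v \<in> I. x v \<notin> Y v} \<union> {v \<in> I. h v \<notin> K v}"
  proof
    fix v assume v: "v \<in> {v \<in> I. Act x h v \<notin> Y v}"
    have "act v (x v) (h v) \<in> Y v" if "x v \<in> Y v" "h v \<in> K v"
      using Y_co[of v] that hv[of v] v by (simp add: U_eq)
    then show "v \<in> {v \<in> I. x v \<notin> Y v} \<union> {v \<in> I. h v \<notin> K v}" using v by (auto simp: Act_comp)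
  qed
  moreover have "finite {v \<in> I. x v \<notin> Y v}" "finite {v \<in> I. h v \<notin> K v}"
    using x h by (auto simp: S.topspace_XX carrier_HH P.carrier_GG)
  ultimately have "finite {v \<in> I. Act x h v \<notin> Y v}" using finite_subset by blast
  moreover have "Act x h \<in> (\<Pi>\<^sub>E v\<in>I. topspace (X v))"
    using XX_comp[OF x] act_in hv by (auto simp: Act_def)
  ultimately show ?thesis by (simp add: S.topspace_XX)
qed

lemma Act_unit:
  assumes "x \<in> topspace XX"
  shows "Act x \<one>\<^bsub>GG\<^esub> = x"
proof -
  have "x \<in> extensional I" using assms by (auto simp: S.topspace_XX PiE_iff)
  then show ?thesis using XX_comp[OF assms] act_unit
    by (intro extensionalityI[of _ I]) (auto simp: Act_def)
qed

text \<open>\<open>N\<close> is only isomorphic to Schwartz functions at such a level, so the pure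
  tensor is transported back along \<open>\<theta>\<close>.\<close>

definition tensor_elt :: "'i set \<Rightarrow> ('i \<Rightarrow> 'g) \<Rightarrow> ('i \<Rightarrow> 'x \<Rightarrow> 'r) \<Rightarrow> 'n" where
  "tensor_elt \<nu> g f = inv_into (carrier (obj N (WW \<nu> g))) (\<theta> (WW \<nu> g)) (restrict (tensor R I f) (topspace XX))"

lemma tensor_elt:
  assumes \<nu>: "finite \<nu>" "\<nu> \<subseteq> I" and a: "admissible \<nu> g f"
  shows "tensor_elt \<nu> g f \<in> carrier (obj N (WW \<nu> g))"
    and "\<theta> (WW \<nu> g) (tensor_elt \<nu> g f) = restrict (tensor R I f) (topspace XX)"
proof -
  have g: "g \<in> carrier GG" and f: "S.almost_unit f" and fi: "\<And>w. w \<in> I \<Longrightarrow> fixed_by w (Wl \<nu> g w) (f w)"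
    using a by (auto simp: admissible_def)
  note W = WW_level[OF \<nu> g]
  have "restrict (tensor R I f) (topspace XX) \<in> schwartz R XX"
    by (rule restrict_schwartz[OF S.schwartz_fun_tensor[OF f]])
  moreover have "restrict (tensor R I f) (topspace XX) (Act x u) = restrict (tensor R I f) (topspace XX) x"
    if u: "u \<in> WW \<nu> g" and x: "x \<in> topspace XX" for u x
  proof -
    have uH: "u \<in> carrier HH" using u WW_eq[OF g] by simp
    have "tensor R I f (Act x u) = tensor R I f x"
    proof (rule tensor_cong)
      fix w assume w: "w \<in> I"
      show "f w (Act x u w) = f w (x w)"
        using fixed_byD[OF fi[OF w]] u w XX_comp[OF x w] by (auto simp: Act_comp WW_def)
      show "f w (x w) \<in> carrier R" by (rule S.almost_unit_closed[OF f x w])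
    qed (rule R_cring)
    then show ?thesis using x Act_in[OF x uH] by simp
  qed
  ultimately have "restrict (tensor R I f) (topspace XX) \<in> carrier (schwartz_invariants R XX Act (WW \<nu> g))"
    by (simp add: schwartz_invariants_def)
  moreover have "bij_betw (\<theta> (WW \<nu> g)) (carrier (obj N (WW \<nu> g))) (carrier (schwartz_invariants R XX Act (WW \<nu> g)))"
    using sch.iso W by blast
  ultimately have "restrict (tensor R I f) (topspace XX) \<in> \<theta> (WW \<nu> g) ` carrier (obj N (WW \<nu> g))"
    by (simp add: bij_betw_def)
  then show "tensor_elt \<nu> g f \<in> carrier (obj N (WW \<nu> g))"
    and "\<theta> (WW \<nu> g) (tensor_elt \<nu> g f) = restrict (tensor R I f) (topspace XX)"
    unfolding tensor_elt_def by (rule inv_into_into, rule f_inv_into_f)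
qed

lemma \<theta>_eqI:
  assumes W: "W \<in> \<Upsilon>\<^sub>H" "product_form I W" and a: "a \<in> carrier (obj N W)" and b: "b \<in> carrier (obj N W)"
    and eq: "\<And>x. x \<in> topspace XX \<Longrightarrow> \<theta> W a x = \<theta> W b x"
  shows "a = b"
proof -
  have bij: "bij_betw (\<theta> W) (carrier (obj N W)) (carrier (schwartz_invariants R XX Act W))"
    using sch.iso[OF W] by blast
  have "\<theta> W z \<in> extensional (topspace XX)" if "z \<in> carrier (obj N W)" for z
  proof -
    have "\<theta> W z \<in> carrier (schwartz_invariants R XX Act W)" using bij that by (auto simp: bij_betw_def)
    then show ?thesis by (auto simp: schwartz_invariants_def schwartz_def PiE_iff)
  qed
  then have "\<theta> W a = \<theta> W b" using a b eq by (intro extensionalityI[of _ "topspace XX"]) auto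
  then show ?thesis using bij a b by (auto simp: bij_betw_def inj_on_def)
qed

text \<open>Restriction leaves the function alone and merely regards it at a smaller level.\<close>

lemma \<theta>_pull_unit:
  assumes "V \<in> \<Upsilon>\<^sub>H" "W \<in> \<Upsilon>\<^sub>H" "product_form I V" "product_form I W" "V \<subseteq> W" "n \<in> carrier (obj N W)"
    "\<theta> W n = restrict F (topspace XX)"
  shows "\<theta> V (pull N V W \<one>\<^bsub>GG\<^esub> n) = restrict F (topspace XX)"
proof -
  have "\<theta> V (pull N V W \<one>\<^bsub>GG\<^esub> n) = (\<lambda>x\<in>topspace XX. \<theta> W n (Act x \<one>\<^bsub>GG\<^esub>))"
    using assms ric.one_level_hom_H by (intro sch.pull_eq) auto
  then show ?thesis using assms(7) by (auto simp: Act_unit restrict_def fun_eq_iff)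
qed

text \<open>The levels agree away from \<open>v\<close> and the morphism is trivial there, so the
  coset space of the pushforward formula is the local one at \<open>v\<close>. In each term the
  factors at the other places are unchanged by invariance and come out of the sum.\<close>

lemma \<theta>_push_tensor:
  assumes v: "v \<in> I" and h: "h \<in> H v"
    and Vl: "\<And>w. w \<in> I \<Longrightarrow> subgroup (Vl w) (G w) \<and> Vl w \<subseteq> H w"
    and Al: "\<And>w. w \<in> I \<Longrightarrow> subgroup (Al w) (G w) \<and> Al w \<subseteq> H w"
    and VA: "\<And>w. w \<in> I \<Longrightarrow> w \<noteq> v \<Longrightarrow> Vl w = Al w"
    and V: "V = (\<Pi>\<^sub>E w\<in>I. Vl w)" "V \<in> \<Upsilon>\<^sub>H" and A: "A = (\<Pi>\<^sub>E w\<in>I. Al w)" "A \<in> \<Upsilon>\<^sub>H"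
    and hom: "at_place I G v h \<in> level_hom HH V A" and n: "n \<in> carrier (obj N V)"
    and \<theta>n: "\<theta> V n = restrict (tensor R I f) (topspace XX)" and f: "S.almost_unit f"
    and fi: "\<And>w. w \<in> I \<Longrightarrow> fixed_by w (Vl w) (f w)"
    and x: "x \<in> topspace XX"
  shows "\<theta> A (push N V A (at_place I G v h) n) x = tensor R (I - {v}) f x \<otimes>\<^bsub>R\<^esub>
    (\<Oplus>\<^bsub>R\<^esub>C\<in>left_cosets (G v) (Al v) (conjugate (G v) (inv\<^bsub>G v\<^esub> h) (Vl v)).
       f v (act v (x v) (rep C \<otimes>\<^bsub>G v\<^esub> inv\<^bsub>G v\<^esub> h)))"
proof -
  interpret R: cring R by (rule R_cring)
  interpret Gv: plain_group "G v" using G_plain v .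
  define hh where "hh = at_place I G v h"
  have hc: "h \<in> carrier (G v)" using h H_sub[OF v] subgroup.subset by blast
  have hhG: "hh \<in> carrier GG" unfolding hh_def using P.at_place_closed v hc .
  have hhH: "hh \<in> carrier HH"
    using hhG h H_sub by (auto simp: carrier_HH hh_def P.at_place_component subgroup.one_closed)
  have ihhH: "inv\<^bsub>GG\<^esub> hh \<in> carrier HH" using subgroup.m_inv_closed[OF ric.subgroup_H hhH] .
  define B where "B = (\<lambda>w. conjugate (G w) ((inv\<^bsub>GG\<^esub> hh) w) (Vl w))"
  have ihh: "(inv\<^bsub>GG\<^esub> hh) w = (if w = v then inv\<^bsub>G v\<^esub> h else \<one>\<^bsub>G w\<^esub>)" if "w \<in> I" for w
  proof -
    interpret Gw: plain_group "G w" using G_plain that .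
    show ?thesis using that hhG by (simp add: hh_def P.at_place_component)
  qed
  have Vc: "Vl w \<subseteq> carrier (G w)" if "w \<in> I" for w using Vl[OF that] subgroup.subset by blast
  have B_other: "B w = Al w" if "w \<in> I" "w \<noteq> v" for w
  proof -
    interpret Gw: plain_group "G w" using G_plain that by blast
    show ?thesis using that VA[OF that] ihh Gw.conjugate_one[OF Vc[OF that(1)]] by (simp add: B_def)
  qed
  have Bv: "B v = conjugate (G v) (inv\<^bsub>G v\<^esub> h) (Vl v)" using v ihh by (simp add: B_def)
  have B_sub: "subgroup (B w) (G w)" if "w \<in> I" for w
  proof -
    interpret Gw: plain_group "G w" using G_plain that .
    show ?thesis unfolding B_def using Vl that P.component[OF P.GG.inv_closed[OF hhG]]
      by (intro Gw.subgroup_conjugate) auto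
  qed
  have AG: "A \<subseteq> carrier GG" using ric.level_H(3)[OF A(2)] .
  have VG: "V \<subseteq> carrier GG" using ric.level_H(3)[OF V(2)] .
  \<comment> \<open>The factors \<open>Vl\<close> are not confined to the subgroups
    \<open>K w\<close>, so the conjugate is computed componentwise.\<close>
  have cV: "conjugate HH (inv\<^bsub>HH\<^esub> hh) V = (\<Pi>\<^sub>E w\<in>I. B w)"
  proof -
    have "x \<in> conjugate GG (inv\<^bsub>GG\<^esub> hh) V \<longleftrightarrow> x \<in> (\<Pi>\<^sub>E w\<in>I. B w)" if x: "x \<in> carrier GG" for x
    proof -
      have "x \<in> conjugate GG (inv\<^bsub>GG\<^esub> hh) V \<longleftrightarrow> hh \<otimes>\<^bsub>GG\<^esub> x \<otimes>\<^bsub>GG\<^esub> inv\<^bsub>GG\<^esub> hh \<in> V"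
        using P.GG.conjugate_mem_iff[OF P.GG.inv_closed[OF hhG] VG] x hhG by simp
      also have "\<dots> \<longleftrightarrow> (\<forall>w\<in>I. x w \<in> B w)"
      proof -
        have "hh \<otimes>\<^bsub>GG\<^esub> x \<otimes>\<^bsub>GG\<^esub> inv\<^bsub>GG\<^esub> hh \<in> extensional I" using hhG x by (intro P.extensional_GG) simp
        moreover have "(hh \<otimes>\<^bsub>GG\<^esub> x \<otimes>\<^bsub>GG\<^esub> inv\<^bsub>GG\<^esub> hh) w \<in> Vl w \<longleftrightarrow> x w \<in> B w" if w: "w \<in> I" for w
        proof -
          interpret Gw: plain_group "G w" using G_plain w .
          show ?thesis unfolding B_def
            using Gw.conjugate_mem_iff[OF P.component[OF P.GG.inv_closed[OF hhG] w] Vc[OF w]] w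
              P.component[OF x w] P.component[OF hhG w] hhG by simp
        qed
        ultimately show ?thesis unfolding V(1) by (auto simp: PiE_iff)
      qed
      finally show ?thesis using P.extensional_GG[OF x] by (auto simp: PiE_iff)
    qed
    moreover have "(\<Pi>\<^sub>E w\<in>I. B w) \<subseteq> carrier GG"
    proof -
      have s: "conjugate GG (inv\<^bsub>GG\<^esub> hh) V \<subseteq> A"
        using hom ric.conjugate_H[of "inv\<^bsub>HH\<^esub> hh"] ihhH ric.inv_H[OF hhH]
        unfolding level_hom_def hh_def by simp
      show ?thesis
      proof
        fix y assume y: "y \<in> (\<Pi>\<^sub>E w\<in>I. B w)"
        have Al1: "\<one>\<^bsub>G w\<^esub> \<in> Al w" if "w \<in> I" for w using Al[OF that] subgroup.one_closed by blast
        \<comment> \<open>Resetting the component at \<open>v\<close> gives an element of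
          \<open>A\<close>, hence of the restricted product; a single component can then be
          restored.\<close>
        define y' where "y' = y(v := \<one>\<^bsub>G v\<^esub>)"
        have "y' \<in> A" unfolding A(1) y'_def using y v Al1 B_other
          by (auto simp: PiE_iff extensional_def)
        then have "y' \<in> carrier GG" using AG by blast
        then have "y'(v := y v) \<in> carrier GG"
          using v y subgroup.subset[OF B_sub[OF v]] by (intro P.upd_closed) (auto simp: PiE_iff)
        then show "y \<in> carrier GG" unfolding y'_def by simp
      qed
    qed
    moreover have "conjugate GG (inv\<^bsub>GG\<^esub> hh) V \<subseteq> carrier GG"
      using P.GG.conjugate_subset_carrier hhG VG by simp
    ultimately have "conjugate GG (inv\<^bsub>GG\<^esub> hh) V = (\<Pi>\<^sub>E w\<in>I. B w)" by blast
    then show ?thesis using ric.conjugate_H[of "inv\<^bsub>HH\<^esub> hh"] ihhH ric.inv_H[OF hhH] by simp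
  qed
  have BA: "B v \<subseteq> Al v"
  proof -
    have "(\<Pi>\<^sub>E w\<in>I. B w) \<subseteq> (\<Pi>\<^sub>E w\<in>I. Al w)"
      using hom cV unfolding level_hom_def hh_def A(1) by simp
    moreover have "(\<Pi>\<^sub>E w\<in>I. B w) \<noteq> {}"
      unfolding PiE_eq_empty_iff using B_sub subgroup.one_closed by blast
    ultimately show ?thesis using v unfolding subset_PiE by blast
  qed
  define F where "F = (\<lambda>t. f v (act v (x v) (t \<otimes>\<^bsub>G v\<^esub> inv\<^bsub>G v\<^esub> h)))"
  define T0 where "T0 = tensor R (I - {v}) f x"
  have xv: "x v \<in> topspace (X v)" using XX_comp[OF x v] .
  have T0: "T0 \<in> carrier R"
    unfolding T0_def using S.almost_unit_closed[OF f x] by (intro tensor_closed R_cring) auto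
  have ih: "inv\<^bsub>G v\<^esub> h \<in> H v" using subgroup.m_inv_closed[OF H_sub[OF v] h] .
  have F_cl: "F t \<in> carrier R" if "t \<in> H v" for t
  proof -
    have "t \<otimes>\<^bsub>G v\<^esub> inv\<^bsub>G v\<^esub> h \<in> H v" using that ih H_sub[OF v] by (simp add: subgroup.m_closed)
    then have "act v (x v) (t \<otimes>\<^bsub>G v\<^esub> inv\<^bsub>G v\<^esub> h) \<in> topspace (X v)" using act_in v xv by blast
    moreover have "schwartz_fun R (X v) (f v)" using f v unfolding S.almost_unit_def by blast
    ultimately show ?thesis unfolding F_def by (rule schwartz_fun_closed[rotated])
  qed
  \<comment> \<open>Moved across h^-1, the element b becomes h b h^-1, which lies in
    \<open>Vl v\<close> and fixes \<open>f v\<close>; so \<open>F\<close> depends only on the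
    coset.\<close>
  have F_B: "F (t \<otimes>\<^bsub>G v\<^esub> b) = F t" if t: "t \<in> H v" and b: "b \<in> B v" for t b
  proof -
    have bA: "b \<in> H v" using b BA Al[OF v] by blast
    have c: "t \<in> carrier (G v)" "b \<in> carrier (G v)" using t bA H_sub[OF v] subgroup.subset by blast+
    define b' where "b' = h \<otimes>\<^bsub>G v\<^esub> b \<otimes>\<^bsub>G v\<^esub> inv\<^bsub>G v\<^esub> h"
    have b': "b' \<in> Vl v" using b hc unfolding Bv b'_def
      by (simp add: Gv.conjugate_mem_iff[OF _ Vc[OF v]])
    have b'H: "b' \<in> H v" using b' Vl[OF v] by blast
    have "t \<otimes>\<^bsub>G v\<^esub> b \<otimes>\<^bsub>G v\<^esub> inv\<^bsub>G v\<^esub> h = (t \<otimes>\<^bsub>G v\<^esub> inv\<^bsub>G v\<^esub> h) \<otimes>\<^bsub>G v\<^esub> b'"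
    proof -
      have "(t \<otimes>\<^bsub>G v\<^esub> inv\<^bsub>G v\<^esub> h) \<otimes>\<^bsub>G v\<^esub> b' = t \<otimes>\<^bsub>G v\<^esub> (inv\<^bsub>G v\<^esub> h \<otimes>\<^bsub>G v\<^esub> h) \<otimes>\<^bsub>G v\<^esub> b \<otimes>\<^bsub>G v\<^esub> inv\<^bsub>G v\<^esub> h"
        unfolding b'_def using c hc by (simp only: Gv.m_assoc Gv.m_closed Gv.inv_closed)
      then show ?thesis using c hc by simp
    qed
    moreover have tH: "t \<otimes>\<^bsub>G v\<^esub> inv\<^bsub>G v\<^esub> h \<in> H v" using t ih H_sub[OF v] by (simp add: subgroup.m_closed)
    ultimately show ?thesis
      unfolding F_def using fixed_byD[OF fi[OF v] b'] act_in[OF v xv tH] act_times[OF v xv tH b'H] by simp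
  qed
  have lc: "left_cosets HH A (\<Pi>\<^sub>E w\<in>I. B w) = left_cosets GG A (\<Pi>\<^sub>E w\<in>I. B w)"
    by (simp add: left_cosets_def l_coset_def)
  have Al_sub: "subgroup (Al w) (G w)" if "w \<in> I" for w using Al[OF that] by blast
  have B_mono: "B w \<subseteq> Al w" if "w \<in> I" for w
    using B_other BA that by (cases "w = v") auto
  have BBA: "(\<Pi>\<^sub>E w\<in>I. B w) \<subseteq> A" unfolding A(1) using B_mono by (intro PiE_mono)
  have BBs: "subgroup (\<Pi>\<^sub>E w\<in>I. B w) GG"
    using BBA AG by (intro P.subgroup_PiE B_sub) auto
  have As: "subgroup A GG" using ric.level_H(4)[OF A(2)] .
  have rC: "rep C \<in> A" if "C \<in> left_cosets GG A (\<Pi>\<^sub>E w\<in>I. B w)" for C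
    using P.GG.rep_left_cosets_subgroup(1)[OF BBs As BBA that] .
  have bij: "bij_betw (\<lambda>C. rep C v <#\<^bsub>G v\<^esub> B v) (left_cosets GG A (\<Pi>\<^sub>E w\<in>I. B w))
      (left_cosets (G v) (Al v) (B v))"
    unfolding A(1) using AG A(1)
    by (intro P.bij_betw_left_cosets_place[OF v Al_sub _ B_sub BA B_other]) auto
  have "\<theta> A (push N V A hh n) x =
      (\<Oplus>\<^bsub>R\<^esub>C\<in>left_cosets HH A (conjugate HH (inv\<^bsub>HH\<^esub> hh) V). \<theta> V n (Act x (rep C \<otimes>\<^bsub>HH\<^esub> inv\<^bsub>HH\<^esub> hh)))"
  proof -
    have "product_form I V" "product_form I A" unfolding product_form_def V(1) A(1) by blast+
    from sch.push_eq[OF V(2) A(2) this hom n] show ?thesis using x by (simp add: hh_def)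
  qed
  also have "\<dots> = (\<Oplus>\<^bsub>R\<^esub>C\<in>left_cosets GG A (\<Pi>\<^sub>E w\<in>I. B w). \<theta> V n (Act x (rep C \<otimes>\<^bsub>GG\<^esub> inv\<^bsub>GG\<^esub> hh)))"
    unfolding cV lc by (simp add: ric.inv_H[OF hhH])
  also have "\<dots> = (\<Oplus>\<^bsub>R\<^esub>D\<in>left_cosets (G v) (Al v) (B v). T0 \<otimes>\<^bsub>R\<^esub> F (rep D))"
  proof (rule R.finsum_bij_betw[OF bij])
    fix C assume C: "C \<in> left_cosets GG A (\<Pi>\<^sub>E w\<in>I. B w)"
    define c where "c = rep C"
    have cA: "c \<in> A" "c \<in> carrier GG" "c \<in> carrier HH"
      using rC[OF C] AG ric.level_H(2)[OF A(2)] by (auto simp: c_def)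
    have cv: "c v \<in> Al v" "c v \<in> H v" using cA v Al unfolding A(1) by auto
    define x' where "x' = Act x (c \<otimes>\<^bsub>GG\<^esub> inv\<^bsub>GG\<^esub> hh)"
    have mH: "c \<otimes>\<^bsub>GG\<^esub> inv\<^bsub>GG\<^esub> hh \<in> carrier HH"
      using cA ihhH ric.subgroup_H by (simp add: subgroup.m_closed)
    have x': "x' \<in> topspace XX" unfolding x'_def by (rule Act_in[OF x mH])
    have "\<theta> V n x' = f v (x' v) \<otimes>\<^bsub>R\<^esub> tensor R (I - {v}) f x'"
      unfolding \<theta>n using S.tensor_split_XX[OF f x' v] x' by simp
    \<comment> \<open>Away from \<open>v\<close> the element \<open>hh\<close> is 1, and the
      components of \<open>c\<close> lie in \<open>Al w = Vl w\<close>, which fixes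
      \<open>f w\<close>.\<close>
    also have "tensor R (I - {v}) f x' = T0" unfolding T0_def
    proof (rule tensor_cong)
      fix w assume w: "w \<in> I - {v}"
      interpret Gw: plain_group "G w" using G_plain w by blast
      have cw: "c w \<in> Vl w" "c w \<in> carrier (G w)"
        using cA w VA P.component[OF cA(2)] unfolding A(1) by auto
      have "x' w = act w (x w) (c w)"
        unfolding x'_def using w cw ihh by (simp add: Act_comp)
      then show "f w (x' w) = f w (x w)"
        using fixed_byD[OF fi cw(1)] w XX_comp[OF x] by simp
      show "f w (x w) \<in> carrier R" using S.almost_unit_closed[OF f x] w by simp
    qed (rule R_cring)
    also have "f v (x' v) = F (c v)"
      unfolding x'_def F_def using v ihh by (simp add: Act_comp)
    also have "F (c v) = F (rep (c v <#\<^bsub>G v\<^esub> B v))"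
    proof -
      have "c v \<in> carrier (G v)" using P.component cA v by blast
      then obtain b where "b \<in> B v" "rep (c v <#\<^bsub>G v\<^esub> B v) = c v \<otimes>\<^bsub>G v\<^esub> b"
        using Gv.rep_l_coset[OF B_sub[OF v]] by blast
      then show ?thesis using F_B cv by simp
    qed
    finally have *: "\<theta> V n x' = F (rep (c v <#\<^bsub>G v\<^esub> B v)) \<otimes>\<^bsub>R\<^esub> T0" .
    have "rep (c v <#\<^bsub>G v\<^esub> B v) \<in> H v"
    proof -
      have "c v <#\<^bsub>G v\<^esub> B v \<in> left_cosets (G v) (Al v) (B v)" using cv by (auto simp: left_cosets_def)
      then show ?thesis using Gv.rep_left_cosets_subgroup(1)[OF B_sub[OF v] Al_sub[OF v] BA] Al[OF v] by blast
    qed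
    then show "\<theta> V n (Act x (rep C \<otimes>\<^bsub>GG\<^esub> inv\<^bsub>GG\<^esub> hh)) = T0 \<otimes>\<^bsub>R\<^esub> F (rep (rep C v <#\<^bsub>G v\<^esub> B v))"
      using * F_cl T0 R.m_comm unfolding x'_def c_def by simp
  next
    show "(\<lambda>D. T0 \<otimes>\<^bsub>R\<^esub> F (rep D)) \<in> left_cosets (G v) (Al v) (B v) \<rightarrow> carrier R"
    proof
      fix D assume "D \<in> left_cosets (G v) (Al v) (B v)"
      then have "rep D \<in> H v" using Gv.rep_left_cosets_subgroup(1)[OF B_sub[OF v] Al_sub[OF v] BA] Al[OF v] by blast
      then show "T0 \<otimes>\<^bsub>R\<^esub> F (rep D) \<in> carrier R" using F_cl T0 by simp
    qed
  qed
  also have "\<dots> = T0 \<otimes>\<^bsub>R\<^esub> (\<Oplus>\<^bsub>R\<^esub>D\<in>left_cosets (G v) (Al v) (B v). F (rep D))"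
  proof (rule R.finsum_rdistr_any[symmetric, OF T0])
    show "(\<lambda>D. F (rep D)) \<in> left_cosets (G v) (Al v) (B v) \<rightarrow> carrier R"
    proof
      fix D assume "D \<in> left_cosets (G v) (Al v) (B v)"
      then have "rep D \<in> H v" using Gv.rep_left_cosets_subgroup(1)[OF B_sub[OF v] Al_sub[OF v] BA] Al[OF v] by blast
      then show "F (rep D) \<in> carrier R" using F_cl by simp
    qed
  qed
  finally show ?thesis unfolding T0_def F_def Bv hh_def .
qed

definition tensor_symbol :: "'i set \<Rightarrow> ('i \<Rightarrow> 'g) \<Rightarrow> ('i \<Rightarrow> 'x \<Rightarrow> 'r) \<Rightarrow> 'm" where
  "tensor_symbol \<nu> g f = ric.symbol (level I K L \<nu>) (WW \<nu> g) g (tensor_elt \<nu> g f)"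

lemma tensor_symbol_closed:
  assumes "finite \<nu>" "\<nu> \<subseteq> I" "admissible \<nu> g f"
  shows "tensor_symbol \<nu> g f \<in> carrier (obj M (level I K L \<nu>))"
proof -
  have g: "g \<in> carrier GG" using assms by (simp add: admissible_def)
  show ?thesis unfolding tensor_symbol_def
    using assms g WW_level tensor_elt(1) level_in by (intro ric.symbol_closed) auto
qed

text \<open>For a fixed representative the levels of \<nu> and \<nu> \<union> {v} differ only at v,
  so the trace in \<open>M\<close> becomes a trace in \<open>N\<close> that affects the factor at v
  alone.\<close>

proposition push_tensor_symbol:
  assumes \<nu>: "finite \<nu>" "\<nu> \<subseteq> I" and v: "v \<in> I" "v \<notin> \<nu>" and a: "admissible (insert v \<nu>) g f"
    and a': "admissible \<nu> g (f(v := u))"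
    and u: "\<And>x. x \<in> topspace (X v) \<Longrightarrow> u x =
      (\<Oplus>\<^bsub>R\<^esub>C\<in>left_cosets (G v) (Wl \<nu> g v) (Wl (insert v \<nu>) g v). f v (act v x (rep C)))"
  shows "push M (level I K L (insert v \<nu>)) (level I K L \<nu>) \<one>\<^bsub>GG\<^esub> (tensor_symbol (insert v \<nu>) g f) = tensor_symbol \<nu> g (f(v := u))"
proof -
  interpret R: cring R by (rule R_cring)
  interpret Gv: plain_group "G v" using G_plain v by blast
  define V where "V = WW (insert v \<nu>) g"
  define A where "A = WW \<nu> g"
  have \<mu>: "finite (insert v \<nu>)" "insert v \<nu> \<subseteq> I" using \<nu> v by auto
  have g: "g \<in> carrier GG" and f: "S.almost_unit f" and fi: "\<And>w. w \<in> I \<Longrightarrow> fixed_by w (Wl (insert v \<nu>) g w) (f w)"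
    using a by (auto simp: admissible_def)
  have f': "S.almost_unit (f(v := u))" using a' by (simp add: admissible_def)
  note V = WW_level[OF \<mu> g, folded V_def] and A = WW_level[OF \<nu> g, folded A_def]
  note n = tensor_elt[OF \<mu> a, folded V_def] and n' = tensor_elt[OF \<nu> a', folded A_def]
  have Wl_other: "Wl (insert v \<nu>) g w = Wl \<nu> g w" if "w \<noteq> v" for w using that by (simp add: Wl_def Pl_def)
  have Wlv: "Wl (insert v \<nu>) g v \<subseteq> Wl \<nu> g v"
    using Gv.conjugate_mono[OF L_K[OF v(1)], of "g v"] v by (auto simp: Wl_def Pl_def)
  have Wl_mono: "Wl (insert v \<nu>) g w \<subseteq> Wl \<nu> g w" for w
    using Wl_other Wlv by (cases "w = v") auto
  have VA: "V \<subseteq> A" unfolding V_def A_def WW_def using Wl_mono by (intro PiE_mono)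
  have levels: "level I K L (insert v \<nu>) \<subseteq> level I K L \<nu>"
    unfolding level_eq using L_K by (intro PiE_mono) (auto simp: Pl_def)
  \<comment> \<open>The trace is the case h = 1 of the pushforward formula for an element supported
    at \<open>v\<close>.\<close>
  have one: "at_place I G v \<one>\<^bsub>G v\<^esub> = \<one>\<^bsub>GG\<^esub>"
    using P.at_place_closed[OF v(1)] by (intro P.GG_eqI) (auto simp: P.at_place_component)
  have hom: "\<one>\<^bsub>GG\<^esub> \<in> level_hom HH V A" using ric.one_level_hom_H V A VA by blast
  have "push M (level I K L (insert v \<nu>)) (level I K L \<nu>) \<one>\<^bsub>GG\<^esub> (tensor_symbol (insert v \<nu>) g f) =
      ric.symbol (level I K L \<nu>) A g (push N V A \<one>\<^bsub>GG\<^esub> (tensor_elt (insert v \<nu>) g f))"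
    unfolding tensor_symbol_def V_def[symmetric]
    by (rule ric.push_symbol[OF level_in[OF \<mu>] level_in[OF \<nu>] levels V(1) A(1) VA V(3) A(3) g n(1)])
  also have "push N V A \<one>\<^bsub>GG\<^esub> (tensor_elt (insert v \<nu>) g f) = tensor_elt \<nu> g (f(v := u))"
  proof (rule \<theta>_eqI[OF A(1,2) _ n'(1)])
    show "push N V A \<one>\<^bsub>GG\<^esub> (tensor_elt (insert v \<nu>) g f) \<in> carrier (obj N A)"
      using linear_mapsD(1)[OF ric.N.push_linear[OF V(1) A(1) hom] n(1)] .
    fix x assume x: "x \<in> topspace XX"
    have "\<theta> A (push N V A (at_place I G v \<one>\<^bsub>G v\<^esub>) (tensor_elt (insert v \<nu>) g f)) x =
      tensor R (I - {v}) f x \<otimes>\<^bsub>R\<^esub> (\<Oplus>\<^bsub>R\<^esub>C\<in>left_cosets (G v) (Wl \<nu> g v)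
        (conjugate (G v) (inv\<^bsub>G v\<^esub> \<one>\<^bsub>G v\<^esub>) (Wl (insert v \<nu>) g v)).
         f v (act v (x v) (rep C \<otimes>\<^bsub>G v\<^esub> inv\<^bsub>G v\<^esub> \<one>\<^bsub>G v\<^esub>)))"
      using Wl_sub[OF g] Wl_other V(1) A(1) hom n fi
      by (intro \<theta>_push_tensor[where Vl = "Wl (insert v \<nu>) g" and Al = "Wl \<nu> g"] v(1) f x)
        (auto simp: one V_def A_def WW_def subgroup.one_closed[OF H_sub[OF v(1)]])
    also have "(\<Oplus>\<^bsub>R\<^esub>C\<in>left_cosets (G v) (Wl \<nu> g v)
        (conjugate (G v) (inv\<^bsub>G v\<^esub> \<one>\<^bsub>G v\<^esub>) (Wl (insert v \<nu>) g v)).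
         f v (act v (x v) (rep C \<otimes>\<^bsub>G v\<^esub> inv\<^bsub>G v\<^esub> \<one>\<^bsub>G v\<^esub>))) = u (x v)"
    proof -
      have c1: "conjugate (G v) (inv\<^bsub>G v\<^esub> \<one>\<^bsub>G v\<^esub>) (Wl (insert v \<nu>) g v) = Wl (insert v \<nu>) g v"
        using Gv.conjugate_one[OF Wl_sub(3)[OF g v(1)]] by simp
      have rC: "rep C \<in> H v" if "C \<in> left_cosets (G v) (Wl \<nu> g v) (Wl (insert v \<nu>) g v)" for C
        using Gv.rep_left_cosets_subgroup(1)[OF Wl_sub(1)[OF g v(1)] Wl_sub(1)[OF g v(1)] Wlv that]
          Wl_sub(2)[OF g v(1)] by blast
      have Hc: "t \<in> carrier (G v)" if "t \<in> H v" for t using that H_sub[OF v(1)] subgroup.subset by blast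
      have xv: "x v \<in> topspace (X v)" using XX_comp[OF x v(1)] .
      have sf: "schwartz_fun R (X v) (f v)" using f v unfolding S.almost_unit_def by blast
      show ?thesis unfolding c1 u[OF xv]
        using rC Hc act_in[OF v(1) xv] by (intro R.finsum_cong') (auto intro!: schwartz_fun_closed[OF sf])
    qed
    also have "tensor R (I - {v}) f x \<otimes>\<^bsub>R\<^esub> u (x v) = tensor R I (f(v := u)) x"
    proof -
      have ux: "u (x v) \<in> carrier R" using S.almost_unit_closed[OF f' x v(1)] by simp
      have tc: "tensor R (I - {v}) f x \<in> carrier R"
        using S.almost_unit_closed[OF f x] by (intro tensor_closed R_cring) auto
      have "tensor R (I - {v}) (f(v := u)) x = tensor R (I - {v}) f x"
        using S.almost_unit_closed[OF f x] by (intro tensor_cong R_cring) auto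
      then show ?thesis using S.tensor_split_XX[OF f' x v(1)] ux tc R.m_comm by simp
    qed
    finally show "\<theta> A (push N V A \<one>\<^bsub>GG\<^esub> (tensor_elt (insert v \<nu>) g f)) x = \<theta> A (tensor_elt \<nu> g (f(v := u))) x"
      using n'(2) x one by simp
  qed
  finally show ?thesis unfolding tensor_symbol_def A_def .
qed

end

section \<open>Local Hecke data and the divisibility condition\<close>

lemma (in topological_group) continuous_conjugation:
  assumes "g \<in> carrier G"
  shows "continuous_map T T (\<lambda>x. g \<otimes>\<^bsub>G\<^esub> x \<otimes>\<^bsub>G\<^esub> inv\<^bsub>G\<^esub> g)"
proof -
  have "continuous_map T (prod_topology T T) (\<lambda>x. (g, x))"
    using assms topspace_carrier by (intro continuous_map_pairedI) auto
  from continuous_map_compose[OF this continuous_mult]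
  have "continuous_map T T (\<lambda>x. g \<otimes>\<^bsub>G\<^esub> x)" by (simp add: o_def)
  then have "continuous_map T (prod_topology T T) (\<lambda>x. (g \<otimes>\<^bsub>G\<^esub> x, inv\<^bsub>G\<^esub> g))"
    using assms topspace_carrier by (intro continuous_map_pairedI) auto
  from continuous_map_compose[OF this continuous_mult] show ?thesis by (simp add: o_def)
qed

lemma (in topological_group) conjugate_compact_open:
  assumes g: "g \<in> carrier G"
  shows "compactin T A \<Longrightarrow> compactin T (conjugate G g A)" and "openin T A \<Longrightarrow> openin T (conjugate G g A)"
proof -
  have "conjugate G g A = (\<lambda>x. g \<otimes>\<^bsub>G\<^esub> x \<otimes>\<^bsub>G\<^esub> inv\<^bsub>G\<^esub> g) ` A"
    by (auto simp: conjugate_def l_coset_def r_coset_def)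
  then show "compactin T A \<Longrightarrow> compactin T (conjugate G g A)"
    using image_compactin[OF _ continuous_conjugation[OF g]] by metis
  assume A: "openin T A"
  then have As: "A \<subseteq> carrier G" using openin_subset topspace_carrier by blast
  have "conjugate G g A = {x \<in> topspace T. inv\<^bsub>G\<^esub> g \<otimes>\<^bsub>G\<^esub> x \<otimes>\<^bsub>G\<^esub> inv\<^bsub>G\<^esub> (inv\<^bsub>G\<^esub> g) \<in> A}"
    using g As by (auto simp: conjugate_mem_iff topspace_carrier)
  then show "openin T (conjugate G g A)"
    using openin_continuous_map_preimage[OF continuous_conjugation A, of "inv\<^bsub>G\<^esub> g"] g by simp
qed

locale zeta_hecke = zeta_setting R I G T H K L U GG HH TG TH \<Upsilon>\<^sub>G \<Upsilon>\<^sub>H N M \<iota> X Y act XX Act \<theta>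
  for R :: "'r ring" and I :: "'i set"
    and G :: "'i \<Rightarrow> 'g monoid" and T :: "'i \<Rightarrow> 'g topology"
    and H K L U :: "'i \<Rightarrow> 'g set"
    and GG HH :: "('i \<Rightarrow> 'g) monoid" and TG TH :: "('i \<Rightarrow> 'g) topology"
    and \<Upsilon>\<^sub>G \<Upsilon>\<^sub>H :: "('i \<Rightarrow> 'g) set set"
    and N :: "('i \<Rightarrow> 'g, 'r, 'n) ric" and M :: "('i \<Rightarrow> 'g, 'r, 'm) ric"
    and \<iota> :: "('i \<Rightarrow> 'g) set \<Rightarrow> ('i \<Rightarrow> 'g) set \<Rightarrow> 'n \<Rightarrow> 'm"
    and X :: "'i \<Rightarrow> 'x topology" and Y :: "'i \<Rightarrow> 'x set" and act :: "'i \<Rightarrow> 'x \<Rightarrow> 'g \<Rightarrow> 'x"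
    and XX :: "('i \<Rightarrow> 'x) topology" and Act :: "('i \<Rightarrow> 'x) \<Rightarrow> ('i \<Rightarrow> 'g) \<Rightarrow> ('i \<Rightarrow> 'x)"
    and \<theta> :: "('i \<Rightarrow> 'g) set \<Rightarrow> 'n \<Rightarrow> (('i \<Rightarrow> 'x) \<Rightarrow> 'r)" +
  fixes SS :: "'i \<Rightarrow> 'g set" and c :: "'i \<Rightarrow> 'g \<Rightarrow> 'r" and \<HH> :: "'i \<Rightarrow> 'g \<Rightarrow> 'r"
    and r :: "'i \<Rightarrow> nat" and gg :: "'i \<Rightarrow> nat \<Rightarrow> 'g"
    and Hg Vg :: "'i \<Rightarrow> nat \<Rightarrow> 'g set"
    and J :: "'i \<Rightarrow> nat \<Rightarrow> 'g set" and d :: "'i \<Rightarrow> nat \<Rightarrow> 'g \<Rightarrow> 'r"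
    and h\<phi> :: "'i \<Rightarrow> nat \<Rightarrow> 'x \<Rightarrow> 'r"
  assumes SS: "\<And>v. v \<in> I \<Longrightarrow> finite (SS v) \<and> SS v \<subseteq> carrier (G v) \<and> c v \<in> SS v \<rightarrow> carrier R"
    and \<HH>_eq: "\<And>v. v \<in> I \<Longrightarrow> \<HH> v = double_coset_sum R (G v) (K v) (K v) (SS v) (c v)"
    and gg: "\<And>v. v \<in> I \<Longrightarrow> gg v \<in> {1..r v} \<rightarrow> carrier (G v) \<and>
      bij_betw (\<lambda>i. double_coset (G v) (H v) (gg v i) (K v)) {1..r v}
        (double_cosets (G v) (H v) (H v <#>\<^bsub>G v\<^esub> supp R (T v) (\<HH> v)) (K v))"
    and Hg_eq: "\<And>v i. v \<in> I \<Longrightarrow> i \<in> {1..r v} \<Longrightarrow> Hg v i = H v \<inter> conjugate (G v) (gg v i) (K v)"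
    and Vg_eq: "\<And>v i. v \<in> I \<Longrightarrow> i \<in> {1..r v} \<Longrightarrow> Vg v i = H v \<inter> conjugate (G v) (gg v i) (L v)"
    and J: "\<And>v i. v \<in> I \<Longrightarrow> i \<in> {1..r v} \<Longrightarrow>
      finite (J v i) \<and> J v i \<subseteq> H v \<and> d v i \<in> J v i \<rightarrow> carrier R \<and>
      inj_on (\<lambda>h. double_coset (G v) (U v) h (Hg v i)) (J v i)"
    and \<HH>_J: "\<And>v i h. v \<in> I \<Longrightarrow> i \<in> {1..r v} \<Longrightarrow> h \<in> H v \<Longrightarrow>
      \<HH> v (h \<otimes>\<^bsub>G v\<^esub> gg v i) = double_coset_sum R (G v) (U v) (Hg v i) (J v i) (d v i) h"
    and h\<phi>_eq: "\<And>v i. v \<in> I \<Longrightarrow> i \<in> {1..r v} \<Longrightarrow>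
      h\<phi> v i = schwartz_hecke R (G v) (act v) (Hg v i) (U v) (J v i) (d v i) (ch R (Y v))"
    and h\<phi>_div: "\<And>v i x. v \<in> I \<Longrightarrow> i \<in> {1..r v} \<Longrightarrow> x \<in> supp R (X v) (h\<phi> v i) \<Longrightarrow>
      \<exists>z\<in>carrier R. h\<phi> v i x =
        [subgroup_index (G v) (stab_extension (G v) (act v) (Vg v i) x (Hg v i)) (Vg v i)] \<cdot>\<^bsub>R\<^esub> z"
begin

lemma gg_in: "v \<in> I \<Longrightarrow> i \<in> {1..r v} \<Longrightarrow> gg v i \<in> carrier (G v)"
  using gg by blast

lemma U_sub: "v \<in> I \<Longrightarrow> subgroup (U v) (G v)"
  using Group.group.subgroups_Inter_pair[OF P.group_G] H_sub K_sub by (simp add: U_eq)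

lemma inv_Hl:
  assumes v: "v \<in> I" and h: "h \<in> H v"
  shows "inv\<^bsub>Hl v\<^esub> h = inv\<^bsub>G v\<^esub> h"
proof -
  interpret plain_group "G v" using G_plain[OF v] .
  show ?thesis using m_inv_consistent[OF H_sub[OF v] h] .
qed

lemma subgroup_Hl:
  assumes v: "v \<in> I" and "subgroup A (G v)" "A \<subseteq> H v"
  shows "subgroup A (Hl v)"
proof -
  interpret plain_group "G v" using G_plain[OF v] .
  show ?thesis using subgroup_incl[OF assms(2) H_sub[OF v] assms(3)] .
qed

lemma conjugate_Hl:
  "v \<in> I \<Longrightarrow> h \<in> H v \<Longrightarrow> conjugate (Hl v) h A = conjugate (G v) h A"
  by (simp add: conjugate_def l_coset_def r_coset_def inv_Hl)

lemma invariant_under_Hl: 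
  "v \<in> I \<Longrightarrow> topological_action.invariant_under (X v) (act v) B f \<longleftrightarrow> fixed_by v B f"
  by (simp add: topological_action.invariant_under_def[OF local_action] fixed_by_def)

lemma Hg_group:
  assumes v: "v \<in> I" and i: "i \<in> {1..r v}"
  shows "subgroup (Hg v i) (G v)" "subgroup (Hg v i) (Hl v)" "compactin (subtopology (T v) (H v)) (Hg v i)"
    "Hg v i \<subseteq> H v"
proof -
  interpret Gt: topological_group "G v" "T v" using G_top[OF v] .
  show 1: "subgroup (Hg v i) (G v)"
    unfolding Hg_eq[OF v i] using H_sub[OF v] K_sub[OF v] gg_in[OF v i]
    by (intro Gt.subgroups_Inter_pair Gt.subgroup_conjugate)
  show 2: "Hg v i \<subseteq> H v" using Hg_eq[OF v i] by simp
  show "subgroup (Hg v i) (Hl v)" using subgroup_Hl[OF v 1 2] .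
  have "compactin (T v) (conjugate (G v) (gg v i) (K v))"
    using K_co[OF v] gg_in[OF v i] by (intro Gt.conjugate_compact_open) (auto simp: compact_open_subgroup_def)
  then have "compactin (T v) (Hg v i)"
    unfolding Hg_eq[OF v i] using H_closed[OF v] closed_Int_compactin by blast
  then show "compactin (subtopology (T v) (H v)) (Hg v i)" using 2 by (simp add: compactin_subtopology)
qed

lemma U_group:
  assumes v: "v \<in> I"
  shows "subgroup (U v) (Hl v)" "compactin (subtopology (T v) (H v)) (U v)"
    "openin (subtopology (T v) (H v)) (U v)" "U v \<subseteq> H v"
proof -
  show 2: "U v \<subseteq> H v" by (simp add: U_eq)
  show "subgroup (U v) (Hl v)" using subgroup_Hl[OF v U_sub[OF v] 2] .
  have "compactin (T v) (U v)"
    unfolding U_eq using K_co[OF v] H_closed[OF v] closed_Int_compactin unfolding compact_open_subgroup_def by blast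
  then show "compactin (subtopology (T v) (H v)) (U v)" using 2 by (simp add: compactin_subtopology)
  show "openin (subtopology (T v) (H v)) (U v)"
    unfolding U_eq openin_subtopology using K_co[OF v] unfolding compact_open_subgroup_def by blast
qed

lemma ch_Y:
  assumes v: "v \<in> I"
  shows "schwartz_fun R (X v) (ch R (Y v))" "fixed_by v (U v) (ch R (Y v))"
proof -
  show "schwartz_fun R (X v) (ch R (Y v))"
    using S.Y_open S.Y_compact S.X_hausdorff R_cring v by (intro schwartz_fun_ch) auto
  have "act v x u \<in> Y v \<longleftrightarrow> x \<in> Y v" if u: "u \<in> U v" and x: "x \<in> topspace (X v)" for u x
  proof
    assume a: "act v x u \<in> Y v"
    have iu: "inv\<^bsub>G v\<^esub> u \<in> U v" using subgroup.m_inv_closed[OF U_sub[OF v] u] .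
    have uH: "u \<in> H v" using u U_group(4)[OF v] by blast
    have "act v (act v x u) (inv\<^bsub>G v\<^esub> u) = x"
      using topological_action.act_inv_cancel(1)[OF local_action[OF v] x, of u] uH inv_Hl[OF v uH] by simp
    then show "x \<in> Y v" using Y_co[OF v] a iu by metis
  next
    show "x \<in> Y v \<Longrightarrow> act v x u \<in> Y v" using Y_co[OF v] u by blast
  qed
  then show "fixed_by v (U v) (ch R (Y v))" by (simp add: fixed_by_def ch_def)
qed

lemma h\<phi>_sum:
  assumes v: "v \<in> I" and i: "i \<in> {1..r v}" and x: "x \<in> topspace (X v)"
  shows "h\<phi> v i x = (\<Oplus>\<^bsub>R\<^esub>h\<in>J v i. d v i h \<otimes>\<^bsub>R\<^esub>
      topological_action.coset_sum (Hl v) (act v) R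
        (double_coset (G v) (Hg v i) (inv\<^bsub>G v\<^esub> h) (U v)) (U v) (ch R (Y v)) x)"
  unfolding h\<phi>_eq[OF v i] schwartz_hecke_def topological_action.coset_sum_def[OF local_action[OF v]]
  by (simp add: left_cosets_def l_coset_def)

text \<open>\<open>h\<phi>\<close> is given in terms of the record of \<open>G v\<close>, while the
  action is one of \<open>H v\<close>. Inverses and products agree on \<open>H v\<close>, so the
  double cosets are the same.\<close>

lemma h\<phi>_hecke_Hl:
  assumes v: "v \<in> I" and i: "i \<in> {1..r v}" and x: "x \<in> topspace (X v)"
  shows "h\<phi> v i x = schwartz_hecke R (Hl v) (act v) (Hg v i) (U v) (J v i) (d v i) (ch R (Y v)) x"
proof -
  interpret R: cring R by (rule R_cring)
  interpret A: topological_action "Hl v" "subtopology (T v) (H v)" "X v" "act v" using local_action[OF v] .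
  have dc: "double_coset (Hl v) (Hg v i) (inv\<^bsub>Hl v\<^esub> h) (U v) = double_coset (G v) (Hg v i) (inv\<^bsub>G v\<^esub> h) (U v)"
    if "h \<in> J v i" for h
  proof -
    have "h \<in> H v" using J[OF v i] that by blast
    then show ?thesis by (simp add: double_coset_def set_mult_def l_coset_def inv_Hl[OF v])
  qed
  have dR: "d v i h \<in> carrier R" if "h \<in> J v i" for h using J[OF v i] that by blast
  have cl: "A.coset_sum R (double_coset (Hl v) (Hg v i) (inv\<^bsub>Hl v\<^esub> h) (U v)) (U v) (ch R (Y v)) x \<in> carrier R"
    if h: "h \<in> J v i" for h
  proof (rule A.coset_sum_closed[OF R_cring U_group(1)[OF v]])
    show "ch R (Y v) \<in> topspace (X v) \<rightarrow> carrier R" by (simp add: ch_def)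
    have "h \<in> carrier (Hl v)" using J[OF v i] h by auto
    then show "double_coset (Hl v) (Hg v i) (inv\<^bsub>Hl v\<^esub> h) (U v) \<subseteq> carrier (Hl v)"
      using A.double_coset_subset[OF subgroup.subset[OF Hg_group(2)[OF v i]] subgroup.subset[OF U_group(1)[OF v]]]
      by blast
    show "A.invariant_under (U v) (ch R (Y v))" using invariant_under_Hl[OF v] ch_Y[OF v] by blast
  qed (rule x)
  show ?thesis
    unfolding h\<phi>_sum[OF assms] A.schwartz_hecke_eq using dc cl dR by (intro R.finsum_cong') auto
qed

lemma h\<phi>_schwartz:
  assumes v: "v \<in> I" and i: "i \<in> {1..r v}"
  shows "schwartz_fun R (X v) (h\<phi> v i)" "fixed_by v (Hg v i) (h\<phi> v i)"
proof -
  interpret A: topological_action "Hl v" "subtopology (T v) (H v)" "X v" "act v" using local_action[OF v] .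
  define F where "F = schwartz_hecke R (Hl v) (act v) (Hg v i) (U v) (J v i) (d v i) (ch R (Y v))"
  have inv: "A.invariant_under (U v) (ch R (Y v))" using invariant_under_Hl[OF v] ch_Y[OF v] by blast
  have Jc: "finite (J v i)" "J v i \<subseteq> carrier (Hl v)" "d v i \<in> J v i \<rightarrow> carrier R" using J[OF v i] by auto
  note F = A.schwartz_fun_hecke[OF R_cring Hg_group(2,3)[OF v i] U_group(1-3)[OF v] Jc ch_Y(1)[OF v] inv,
    folded F_def]
  have eq: "F x = h\<phi> v i x" if "x \<in> topspace (X v)" for x unfolding F_def using h\<phi>_hecke_Hl[OF v i that] by simp
  have "locally_constant (X v) (h\<phi> v i)"
    using F(1) eq by (intro locally_constant_cong[of "X v" F "h\<phi> v i"]) (auto simp: schwartz_fun_def)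
  moreover have "h\<phi> v i x \<in> carrier R" if "x \<in> topspace (X v)" for x
    using schwartz_fun_closed[OF F(1) that] eq[OF that] by simp
  ultimately show "schwartz_fun R (X v) (h\<phi> v i)" using F(1) eq unfolding schwartz_fun_def by auto
  have "fixed_by v (Hg v i) F" using F(2) invariant_under_Hl[OF v] by blast
  then show "fixed_by v (Hg v i) (h\<phi> v i)"
    unfolding fixed_by_def using eq act_in[OF v] Hg_group(4)[OF v i] by (metis subsetD)
qed

text \<open>Here the divisibility condition enters: it is the hypothesis of
  \<open>divisible_imp_coset_sum\<close> for the action of \<open>H v\<close>, with
  \<open>Hg v i\<close> and its normal open subgroup \<open>Vg v i\<close>.\<close>

lemma exists_local_section:
  assumes v: "v \<in> I" and i: "i \<in> {1..r v}"
  shows "\<exists>\<zeta>. schwartz_fun R (X v) \<zeta> \<and> fixed_by v (Vg v i) \<zeta> \<and>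
    (\<forall>x\<in>topspace (X v). h\<phi> v i x =
      (\<Oplus>\<^bsub>R\<^esub>C\<in>left_cosets (G v) (Hg v i) (Vg v i). \<zeta> (act v x (rep C))))"
proof -
  interpret Gt: topological_group "G v" "T v" using G_top[OF v] .
  interpret A: topological_action "Hl v" "subtopology (T v) (H v)" "X v" "act v" using local_action[OF v] .
  note g = gg_in[OF v i]
  have Vs: "subgroup (Vg v i) (G v)"
    unfolding Vg_eq[OF v i] using H_sub[OF v] L_sub[OF v] g by (intro Gt.subgroups_Inter_pair Gt.subgroup_conjugate)
  have VH: "Vg v i \<subseteq> Hg v i"
    unfolding Vg_eq[OF v i] Hg_eq[OF v i] using Gt.conjugate_mono[OF L_K[OF v]] by blast
  have Vo: "openin (subtopology (T v) (H v)) (Vg v i)"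
    using L_co[OF v] g Gt.conjugate_compact_open(2) unfolding Vg_eq[OF v i] openin_subtopology compact_open_subgroup_def
    by blast
  have Lc: "L v \<subseteq> carrier (G v)" "K v \<subseteq> carrier (G v)"
    using L_sub[OF v] K_sub[OF v] subgroup.subset by blast+
  \<comment> \<open>Conjugation by g_i carries normality of L in K over to the conjugates, and
    intersecting with H preserves it.\<close>
  have normal: "Vg v i \<lhd> (Hl v)\<lparr>carrier := Hg v i\<rparr>"
  proof -
    interpret W: Group.group "(G v)\<lparr>carrier := Hg v i\<rparr>"
      using subgroup.subgroup_is_group[OF Hg_group(1)[OF v i] Gt.is_group] .
    have "subgroup (Vg v i) ((G v)\<lparr>carrier := Hg v i\<rparr>)"
      using Gt.subgroup_incl[OF Vs Hg_group(1)[OF v i] VH] .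
    moreover have "x \<otimes>\<^bsub>G v\<^esub> y \<otimes>\<^bsub>G v\<^esub> inv\<^bsub>G v\<^esub> x \<in> Vg v i" if x: "x \<in> Hg v i" and y: "y \<in> Vg v i" for x y
    proof -
      have c: "x \<in> carrier (G v)" "y \<in> carrier (G v)" "x \<in> H v" "y \<in> H v"
        using x y VH subgroup.subset[OF Hg_group(1)[OF v i]] Hg_group(4)[OF v i] by auto
      define x' where "x' = inv\<^bsub>G v\<^esub> (gg v i) \<otimes>\<^bsub>G v\<^esub> x \<otimes>\<^bsub>G v\<^esub> gg v i"
      define y' where "y' = inv\<^bsub>G v\<^esub> (gg v i) \<otimes>\<^bsub>G v\<^esub> y \<otimes>\<^bsub>G v\<^esub> gg v i"
      have x': "x' \<in> K v" "x' \<in> carrier (G v)" and y': "y' \<in> L v" "y' \<in> carrier (G v)"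
        using x y c g Lc by (auto simp: Hg_eq[OF v i] Vg_eq[OF v i] Gt.conjugate_mem_iff x'_def y'_def)
      interpret KG: Group.group "(G v)\<lparr>carrier := K v\<rparr>"
        using subgroup.subgroup_is_group[OF K_sub[OF v] Gt.is_group] .
      have LK: "L v \<lhd> (G v)\<lparr>carrier := K v\<rparr>" using L_co[OF v] by blast
      have "x' \<otimes>\<^bsub>G v\<^esub> y' \<otimes>\<^bsub>G v\<^esub> inv\<^bsub>G v\<^esub> x' \<in> L v"
        using KG.normal_invE(2)[OF LK, of x' y'] x' y' Gt.m_inv_consistent[OF K_sub[OF v] x'(1)] by simp
      moreover have "x' \<otimes>\<^bsub>G v\<^esub> y' \<otimes>\<^bsub>G v\<^esub> inv\<^bsub>G v\<^esub> x' =
          inv\<^bsub>G v\<^esub> (gg v i) \<otimes>\<^bsub>G v\<^esub> (x \<otimes>\<^bsub>G v\<^esub> y \<otimes>\<^bsub>G v\<^esub> inv\<^bsub>G v\<^esub> x) \<otimes>\<^bsub>G v\<^esub> gg v i"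
      proof -
        have ix: "inv\<^bsub>G v\<^esub> x' = inv\<^bsub>G v\<^esub> (gg v i) \<otimes>\<^bsub>G v\<^esub> inv\<^bsub>G v\<^esub> x \<otimes>\<^bsub>G v\<^esub> gg v i"
          unfolding x'_def using c g by (simp add: Gt.inv_mult_group Gt.m_assoc)
        have "x' \<otimes>\<^bsub>G v\<^esub> y' \<otimes>\<^bsub>G v\<^esub> inv\<^bsub>G v\<^esub> x' =
          inv\<^bsub>G v\<^esub> (gg v i) \<otimes>\<^bsub>G v\<^esub> (x \<otimes>\<^bsub>G v\<^esub> (gg v i \<otimes>\<^bsub>G v\<^esub> inv\<^bsub>G v\<^esub> (gg v i)) \<otimes>\<^bsub>G v\<^esub> y \<otimes>\<^bsub>G v\<^esub>
            (gg v i \<otimes>\<^bsub>G v\<^esub> inv\<^bsub>G v\<^esub> (gg v i)) \<otimes>\<^bsub>G v\<^esub> inv\<^bsub>G v\<^esub> x) \<otimes>\<^bsub>G v\<^esub> gg v i"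
          unfolding ix unfolding x'_def y'_def using c g by (simp only: Gt.m_assoc Gt.m_closed Gt.inv_closed)
        then show ?thesis using c g by simp
      qed
      moreover have "x \<otimes>\<^bsub>G v\<^esub> y \<otimes>\<^bsub>G v\<^esub> inv\<^bsub>G v\<^esub> x \<in> H v"
        using c H_sub[OF v] by (simp add: subgroup.m_closed subgroup.m_inv_closed)
      ultimately show ?thesis using c g Lc by (simp add: Vg_eq[OF v i] Gt.conjugate_mem_iff)
    qed
    ultimately show ?thesis
      using Gt.m_inv_consistent[OF Hg_group(1)[OF v i]] by (simp add: W.normal_inv_iff)
  qed
  have inv: "A.invariant_under (Hg v i) (h\<phi> v i)" using h\<phi>_schwartz(2)[OF v i] invariant_under_Hl[OF v] by blast
  have div: "\<exists>z\<in>carrier R. h\<phi> v i x =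
      [subgroup_index (Hl v) (stab_extension (Hl v) (act v) (Vg v i) x (Hg v i)) (Vg v i)] \<cdot>\<^bsub>R\<^esub> z"
    if x: "x \<in> topspace (X v)" "h\<phi> v i x \<noteq> \<zero>\<^bsub>R\<^esub>" for x
  proof -
    have "x \<in> supp R (X v) (h\<phi> v i)"
      unfolding supp_def using x closure_of_subset[of "{x \<in> topspace (X v). h\<phi> v i x \<noteq> \<zero>\<^bsub>R\<^esub>}" "X v"] by blast
    \<comment> \<open>A generated subgroup is the same whether computed in H v or in G v.\<close>
    moreover have "stab_extension (Hl v) (act v) (Vg v i) x (Hg v i) = stab_extension (G v) (act v) (Vg v i) x (Hg v i)"
      unfolding stab_extension_def
      by (rule Gt.generate_consistent[OF _ H_sub[OF v]]) (use VH Hg_group(4)[OF v i] in auto)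
    ultimately show ?thesis using h\<phi>_div[OF v i] by (simp add: subgroup_index_def)
  qed
  obtain \<zeta> where \<zeta>: "schwartz_fun R (X v) \<zeta>" "A.invariant_under (Vg v i) \<zeta>"
      "\<And>x. x \<in> topspace (X v) \<Longrightarrow> A.coset_sum R (Hg v i) (Vg v i) \<zeta> x = h\<phi> v i x"
    using A.divisible_imp_coset_sum[OF R_cring X_lp[OF v] Hg_group(3,2)[OF v i] Vo normal h\<phi>_schwartz(1)[OF v i] inv div]
    by metis
  have "left_cosets (Hl v) (Hg v i) (Vg v i) = left_cosets (G v) (Hg v i) (Vg v i)"
    by (simp add: left_cosets_def l_coset_def)
  then have "h\<phi> v i x = (\<Oplus>\<^bsub>R\<^esub>C\<in>left_cosets (G v) (Hg v i) (Vg v i). \<zeta> (act v x (rep C)))"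
    if "x \<in> topspace (X v)" for x using \<zeta>(3)[OF that] by (simp add: A.coset_sum_def)
  moreover have "fixed_by v (Vg v i) \<zeta>" using \<zeta>(2) invariant_under_Hl[OF v] by blast
  ultimately show ?thesis using \<zeta>(1) by blast
qed

section \<open>The Hecke operator at a single place\<close>

lemma \<theta>_smult:
  assumes "W \<in> \<Upsilon>\<^sub>H" "product_form I W" "b \<in> carrier R" "n \<in> carrier (obj N W)" "x \<in> topspace XX"
  shows "\<theta> W (b \<odot>\<^bsub>obj N W\<^esub> n) x = b \<otimes>\<^bsub>R\<^esub> \<theta> W n x"
proof -
  have "\<theta> W (b \<odot>\<^bsub>obj N W\<^esub> n) = b \<odot>\<^bsub>schwartz_invariants R XX Act W\<^esub> \<theta> W n"
    using sch.iso[OF assms(1,2)] by (intro linear_mapsD(3)[OF _ assms(3,4)]) blast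
  then show ?thesis using assms(5) by (simp add: schwartz_invariants_def)
qed

lemma \<theta>_value:
  assumes "W \<in> \<Upsilon>\<^sub>H" "product_form I W" "n \<in> carrier (obj N W)" "x \<in> topspace XX"
  shows "\<theta> W n x \<in> carrier R"
proof -
  have "\<theta> W n \<in> carrier (schwartz_invariants R XX Act W)"
    using sch.iso[OF assms(1,2)] assms(3) by (auto simp: bij_betw_def)
  then show ?thesis using assms(4) by (auto simp: schwartz_invariants_def schwartz_def)
qed

lemma \<theta>_finsum:
  assumes W: "W \<in> \<Upsilon>\<^sub>H" "product_form I W" and A: "finite A" "u \<in> A \<rightarrow> carrier (obj N W)"
    and x: "x \<in> topspace XX"
  shows "\<theta> W (\<Oplus>\<^bsub>obj N W\<^esub>a\<in>A. u a) x = (\<Oplus>\<^bsub>R\<^esub>a\<in>A. \<theta> W (u a) x)"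
proof -
  interpret R: cring R by (rule R_cring)
  interpret NW: Module.module R "obj N W" using ric.N.obj_module[OF W(1)] .
  show ?thesis using A
  proof (induction A)
    case empty
    have "\<theta> W \<zero>\<^bsub>obj N W\<^esub> x = \<zero>\<^bsub>R\<^esub>"
      using \<theta>_smult[OF W R.zero_closed NW.M.zero_closed x] \<theta>_value[OF W NW.M.zero_closed x] by simp
    then show ?case by simp
  next
    case (insert a A)
    then have cl: "u a \<in> carrier (obj N W)" "u \<in> A \<rightarrow> carrier (obj N W)" by auto
    have "\<theta> W (\<Oplus>\<^bsub>obj N W\<^esub>a\<in>insert a A. u a) = \<theta> W (u a \<oplus>\<^bsub>obj N W\<^esub> (\<Oplus>\<^bsub>obj N W\<^esub>a\<in>A. u a))"
      using insert cl by simp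
    also have "\<dots> = \<theta> W (u a) \<oplus>\<^bsub>schwartz_invariants R XX Act W\<^esub> \<theta> W (\<Oplus>\<^bsub>obj N W\<^esub>a\<in>A. u a)"
      using sch.iso[OF W] cl by (intro linear_mapsD(2)[of "\<theta> W" R]) (auto intro: NW.M.finsum_closed)
    finally have "\<theta> W (\<Oplus>\<^bsub>obj N W\<^esub>a\<in>insert a A. u a) x = \<theta> W (u a) x \<oplus>\<^bsub>R\<^esub> \<theta> W (\<Oplus>\<^bsub>obj N W\<^esub>a\<in>A. u a) x"
      using x by (simp add: schwartz_invariants_def)
    also have "\<dots> = (\<Oplus>\<^bsub>R\<^esub>a\<in>insert a A. \<theta> W (u a) x)"
      unfolding insert.IH[OF cl(2)] using insert.hyps cl \<theta>_value[OF W _ x]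
      by (intro R.finsum_insert[symmetric]) auto
    finally show ?case .
  qed
qed

text \<open>Every term with representative h g_i is brought to the representative g_i. On the side
  of \<open>N\<close> the terms assemble to the combination of the correspondences [Hg_i h^-1 U]
  with coefficients d_h, applied to the factor ch(Y v), and this is h\<phi>.\<close>

lemma sum_res_symbol:
  assumes \<nu>: "finite \<nu>" "\<nu> \<subseteq> I" and v: "v \<in> I" "v \<notin> \<nu>" and a: "admissible \<nu> g f"
    and gv: "g v = \<one>\<^bsub>G v\<^esub>" and fv: "f v = ch R (Y v)" and i: "i \<in> {1..r v}"
    and a': "admissible \<nu> (g(v := gg v i)) (f(v := h\<phi> v i))"
  shows "(\<Oplus>\<^bsub>obj M (level I K L \<nu>)\<^esub>h\<in>J v i. d v i h \<odot>\<^bsub>obj M (level I K L \<nu>)\<^esub>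
      ric.res_symbol (level I K L \<nu>) (WW \<nu> g) (g(v := h \<otimes>\<^bsub>G v\<^esub> gg v i)) (tensor_elt \<nu> g f)) =
    tensor_symbol \<nu> (g(v := gg v i)) (f(v := h\<phi> v i))"
proof -
  interpret R: cring R by (rule R_cring)
  interpret Gv: plain_group "G v" using G_plain[OF v(1)] .
  interpret A: topological_action "Hl v" "subtopology (T v) (H v)" "X v" "act v" using local_action[OF v(1)] .
  define P where "P = level I K L \<nu>"
  define W where "W = WW \<nu> g"
  define n where "n = tensor_elt \<nu> g f"
  define g' where "g' = g(v := gg v i)"
  define f' where "f' = f(v := h\<phi> v i)"
  define W' where "W' = WW \<nu> g'"
  have g: "g \<in> carrier GG" and f: "S.almost_unit f" and fi: "\<And>w. w \<in> I \<Longrightarrow> fixed_by w (Wl \<nu> g w) (f w)"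
    using a by (auto simp: admissible_def)
  have g': "g' \<in> carrier GG" and f': "S.almost_unit f'" using a' by (auto simp: admissible_def g'_def f'_def)
  have P: "P \<in> \<Upsilon>\<^sub>G" unfolding P_def using level_in \<nu> by blast
  interpret MP: Module.module R "obj M P" using ric.M.obj_module[OF P] .
  note W = WW_level[OF \<nu> g, folded W_def P_def] and W' = WW_level[OF \<nu> g', folded W'_def P_def]
  note n = tensor_elt[OF \<nu> a, folded n_def W_def]
  note n' = tensor_elt[OF \<nu> a', folded g'_def f'_def, folded W'_def]
  interpret NW: Module.module R "obj N W'" using ric.N.obj_module[OF W'(1)] .
  have W'_eq: "W' = carrier HH \<inter> conjugate GG g' P" unfolding W'_def P_def by (rule WW_eq[OF g'])
  have Plv: "Pl \<nu> v = K v" using v by (simp add: Pl_def)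
  have Kc: "K v \<subseteq> carrier (G v)" using Pl_sub(3)[OF v(1), of \<nu>] Plv by simp
  have Wlv: "Wl \<nu> g v = U v" unfolding Wl_def Plv gv using Gv.conjugate_one[OF Kc] by (simp add: U_eq)
  have Wlv': "Wl \<nu> g' v = Hg v i" unfolding Wl_def Plv g'_def using Hg_eq[OF v(1) i] by simp
  have Wl_other: "Wl \<nu> g' w = Wl \<nu> g w" if "w \<noteq> v" for w using that by (simp add: Wl_def g'_def)
  note gi = gg_in[OF v(1) i]
  have JH: "h \<in> H v" "h \<in> carrier (G v)" if "h \<in> J v i" for h
    using J[OF v(1) i] that H_sub[OF v(1)] subgroup.subset by blast+
  have dR: "d v i h \<in> carrier R" if "h \<in> J v i" for h using J[OF v(1) i] that by blast
  define hh where "hh = at_place I G v"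
  define V where "V = (\<lambda>h. W \<inter> conjugate GG (hh h \<otimes>\<^bsub>GG\<^esub> g') P)"
  define m where "m = (\<lambda>h. push N (V h) W' (hh h) (pull N (V h) W \<one>\<^bsub>GG\<^esub> n))"
  have hhH: "hh h \<in> carrier HH" "hh h \<in> carrier GG" if h: "h \<in> J v i" for h
    using P.at_place_closed[OF v(1) JH(2)[OF h]] JH(1)[OF h] H_sub
    by (auto simp: carrier_HH hh_def P.at_place_component subgroup.one_closed)
  have hg: "hh h \<otimes>\<^bsub>GG\<^esub> g' = g(v := h \<otimes>\<^bsub>G v\<^esub> gg v i)" if h: "h \<in> J v i" for h
  proof (rule P.GG_eqI)
    fix w assume w: "w \<in> I"
    interpret Gw: plain_group "G w" using G_plain w .
    show "(hh h \<otimes>\<^bsub>GG\<^esub> g') w = (g(v := h \<otimes>\<^bsub>G v\<^esub> gg v i)) w"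
      using w P.component[OF g w] by (simp add: hh_def g'_def P.at_place_component)
  qed (use hhH[OF h] g' P.upd_closed[OF g v(1)] JH[OF h] gi in auto)
  have rs: "ric.res_symbol P W (g(v := h \<otimes>\<^bsub>G v\<^esub> gg v i)) n = ric.symbol P W' g' (m h)"
    "V h \<in> \<Upsilon>\<^sub>H" "V h \<subseteq> W" "hh h \<in> level_hom HH (V h) W'" if h: "h \<in> J v i" for h
    using ric.res_symbol_push[OF P W(1) W'(1) W'_eq g' hhH(1)[OF h] n(1) fun_cong[OF V_def, of h]]
    unfolding m_def hg[OF h] by auto
  have m_cl: "m h \<in> carrier (obj N W')" if h: "h \<in> J v i" for h
    unfolding m_def using linear_mapsD(1)[OF ric.N.push_linear[OF rs(2)[OF h] W'(1) rs(4)[OF h]]]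
      ric.pull_sub_closed[OF rs(2)[OF h] W(1) rs(3)[OF h] n(1)] by blast
  have lin: "ric.symbol P W' g' \<in> linear_maps R (obj N W') (obj M P)"
    by (rule ric.symbol_linear[OF P W'(1) g' W'(3)])
  define E where "E = (\<lambda>h. double_coset (G v) (Hg v i) (inv\<^bsub>G v\<^esub> h) (U v))"
  have \<theta>m: "\<theta> W' (m h) x = tensor R (I - {v}) f x \<otimes>\<^bsub>R\<^esub> A.coset_sum R (E h) (U v) (ch R (Y v)) (x v)"
    "A.coset_sum R (E h) (U v) (ch R (Y v)) (x v) \<in> carrier R"
    if h: "h \<in> J v i" and x: "x \<in> topspace XX" for h x
  proof -
    define Vl where "Vl = (\<lambda>w. Wl \<nu> g w \<inter> conjugate (G w) ((hh h \<otimes>\<^bsub>GG\<^esub> g') w) (Pl \<nu> w))"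
    have hgc: "hh h \<otimes>\<^bsub>GG\<^esub> g' \<in> carrier GG" using hhH[OF h] g' by simp
    have V_eq: "V h = (\<Pi>\<^sub>E w\<in>I. Vl w)"
      unfolding V_def W_def WW_def P_def conjugate_level[OF hgc] PiE_Int Vl_def ..
    have Vl_sub: "subgroup (Vl w) (G w) \<and> Vl w \<subseteq> H w" if w: "w \<in> I" for w
    proof -
      interpret Gw: plain_group "G w" using G_plain w .
      show ?thesis unfolding Vl_def
        using Wl_sub[OF g w] Pl_sub(1)[OF w] P.component[OF hgc w]
        by (auto intro!: Gw.subgroups_Inter_pair Gw.subgroup_conjugate)
    qed
    have Vl_other: "Vl w = Wl \<nu> g' w" if "w \<in> I" "w \<noteq> v" for w
      unfolding Vl_def hg[OF h] Wl_other[OF that(2)] using that by (auto simp: Wl_def)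
    \<comment> \<open>At \<open>v\<close> the level has the shape U \<inter> h Hg h^-1 for which the
      pushforward is the sum over the double coset Hg h^-1 U.\<close>
    have Vlv: "Vl v = U v \<inter> conjugate (G v) h (Hg v i)"
    proof -
      have "conjugate (G v) h (Hg v i) = H v \<inter> conjugate (G v) (h \<otimes>\<^bsub>G v\<^esub> gg v i) (K v)"
        unfolding Hg_eq[OF v(1) i]
        using Gv.conjugate_Int[OF JH(2)[OF h] subgroup.subset[OF H_sub[OF v(1)]] Gv.conjugate_subset_carrier[OF gi Kc]]
          Gv.conjugate_self[OF H_sub[OF v(1)] JH(1)[OF h]] Gv.conjugate_mult[OF JH(2)[OF h] gi Kc] by simp
      then show ?thesis unfolding Vl_def hg[OF h] Wlv Plv by (auto simp: U_eq)
    qed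
    have pf: "product_form I (V h)" unfolding product_form_def V_eq by blast
    have pn: "pull N (V h) W \<one>\<^bsub>GG\<^esub> n \<in> carrier (obj N (V h))"
      by (rule ric.pull_sub_closed[OF rs(2)[OF h] W(1) rs(3)[OF h] n(1)])
    have p\<theta>: "\<theta> (V h) (pull N (V h) W \<one>\<^bsub>GG\<^esub> n) = restrict (tensor R I f) (topspace XX)"
      by (rule \<theta>_pull_unit[OF rs(2)[OF h] W(1) pf W(2) rs(3)[OF h] n])
    have Al: "subgroup (Wl \<nu> g' w) (G w) \<and> Wl \<nu> g' w \<subseteq> H w" if "w \<in> I" for w
      using Wl_sub[OF g' that] by blast
    have fV: "fixed_by w (Vl w) (f w)" if "w \<in> I" for w
      using fi[OF that] unfolding fixed_by_def Vl_def by blast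
    have 1: "\<theta> W' (m h) x = tensor R (I - {v}) f x \<otimes>\<^bsub>R\<^esub>
      (\<Oplus>\<^bsub>R\<^esub>C\<in>left_cosets (G v) (Wl \<nu> g' v) (conjugate (G v) (inv\<^bsub>G v\<^esub> h) (Vl v)).
       f v (act v (x v) (rep C \<otimes>\<^bsub>G v\<^esub> inv\<^bsub>G v\<^esub> h)))"
      unfolding m_def hh_def
      by (rule \<theta>_push_tensor[OF v(1) JH(1)[OF h] Vl_sub Al Vl_other V_eq rs(2)[OF h] W'_def[unfolded WW_def]
            W'(1) rs(4)[OF h, unfolded hh_def] pn p\<theta> f fV x])
    have hH: "h \<in> carrier (Hl v)" using JH(1)[OF h] by simp
    have inv: "A.invariant_under (U v) (ch R (Y v))" using invariant_under_Hl[OF v(1)] ch_Y[OF v(1)] by blast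
    have chc: "ch R (Y v) \<in> topspace (X v) \<rightarrow> carrier R" by (simp add: ch_def)
    have xv: "x v \<in> topspace (X v)" using XX_comp[OF x v(1)] .
    have ih: "inv\<^bsub>G v\<^esub> h \<in> H v" using subgroup.m_inv_closed[OF H_sub[OF v(1)] JH(1)[OF h]] .
    have E_Hl: "double_coset (Hl v) (Hg v i) (inv\<^bsub>Hl v\<^esub> h) (U v) = E h"
      unfolding E_def inv_Hl[OF v(1) JH(1)[OF h]] by (simp add: double_coset_def set_mult_def l_coset_def)
    have "(\<Oplus>\<^bsub>R\<^esub>C\<in>left_cosets (G v) (Wl \<nu> g' v) (conjugate (G v) (inv\<^bsub>G v\<^esub> h) (Vl v)).
       f v (act v (x v) (rep C \<otimes>\<^bsub>G v\<^esub> inv\<^bsub>G v\<^esub> h))) = A.coset_sum R (E h) (U v) (ch R (Y v)) (x v)"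
      using A.coset_sum_translated[OF R_cring Hg_group(2)[OF v(1) i] U_group(1)[OF v(1)] hH inv chc xv]
      unfolding E_Hl unfolding Wlv' Vlv fv inv_Hl[OF v(1) JH(1)[OF h]] conjugate_Hl[OF v(1) JH(1)[OF h]] conjugate_Hl[OF v(1) ih]
      by (simp add: left_cosets_def l_coset_def)
    then show "\<theta> W' (m h) x = tensor R (I - {v}) f x \<otimes>\<^bsub>R\<^esub> A.coset_sum R (E h) (U v) (ch R (Y v)) (x v)"
      using 1 by simp
    have "E h \<subseteq> carrier (Hl v)"
      using A.double_coset_subset[OF subgroup.subset[OF Hg_group(2)[OF v(1) i]] subgroup.subset[OF U_group(1)[OF v(1)]],
          of "inv\<^bsub>Hl v\<^esub> h"] ih inv_Hl[OF v(1) JH(1)[OF h]] unfolding E_Hl by simp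
    then show "A.coset_sum R (E h) (U v) (ch R (Y v)) (x v) \<in> carrier R"
      by (rule A.coset_sum_closed[OF R_cring U_group(1)[OF v(1)] chc _ inv xv])
  qed
  have sum_eq: "(\<Oplus>\<^bsub>obj N W'\<^esub>h\<in>J v i. d v i h \<odot>\<^bsub>obj N W'\<^esub> m h) = tensor_elt \<nu> g' f'"
  proof (rule \<theta>_eqI[OF W'(1,2) _ n'(1)])
    show "(\<Oplus>\<^bsub>obj N W'\<^esub>h\<in>J v i. d v i h \<odot>\<^bsub>obj N W'\<^esub> m h) \<in> carrier (obj N W')"
      using dR m_cl by (intro NW.M.finsum_closed) auto
    fix x assume x: "x \<in> topspace XX"
    define T0 where "T0 = tensor R (I - {v}) f x"
    have T0: "T0 \<in> carrier R"
      unfolding T0_def using S.almost_unit_closed[OF f x] by (intro tensor_closed R_cring) auto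
    define cs where "cs = (\<lambda>h. A.coset_sum R (E h) (U v) (ch R (Y v)) (x v))"
    have cs: "cs h \<in> carrier R" if "h \<in> J v i" for h unfolding cs_def using \<theta>m(2)[OF that x] .
    have "\<theta> W' (\<Oplus>\<^bsub>obj N W'\<^esub>h\<in>J v i. d v i h \<odot>\<^bsub>obj N W'\<^esub> m h) x =
        (\<Oplus>\<^bsub>R\<^esub>h\<in>J v i. \<theta> W' (d v i h \<odot>\<^bsub>obj N W'\<^esub> m h) x)"
      using J[OF v(1) i] dR m_cl by (intro \<theta>_finsum[OF W'(1,2) _ _ x]) auto
    also have "\<dots> = (\<Oplus>\<^bsub>R\<^esub>h\<in>J v i. T0 \<otimes>\<^bsub>R\<^esub> (d v i h \<otimes>\<^bsub>R\<^esub> cs h))"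
    proof (rule R.finsum_cong')
      fix h assume h: "h \<in> J v i"
      have "\<theta> W' (d v i h \<odot>\<^bsub>obj N W'\<^esub> m h) x = d v i h \<otimes>\<^bsub>R\<^esub> (T0 \<otimes>\<^bsub>R\<^esub> cs h)"
        unfolding \<theta>_smult[OF W'(1,2) dR[OF h] m_cl[OF h] x] \<theta>m(1)[OF h x] T0_def cs_def ..
      then show "\<theta> W' (d v i h \<odot>\<^bsub>obj N W'\<^esub> m h) x = T0 \<otimes>\<^bsub>R\<^esub> (d v i h \<otimes>\<^bsub>R\<^esub> cs h)"
        using T0 dR[OF h] cs[OF h] by (simp add: R.m_lcomm)
    qed (use T0 dR cs in auto)
    also have "\<dots> = T0 \<otimes>\<^bsub>R\<^esub> (\<Oplus>\<^bsub>R\<^esub>h\<in>J v i. d v i h \<otimes>\<^bsub>R\<^esub> cs h)"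
      using T0 dR cs by (intro R.finsum_rdistr_any[symmetric]) auto
    also have "(\<Oplus>\<^bsub>R\<^esub>h\<in>J v i. d v i h \<otimes>\<^bsub>R\<^esub> cs h) = h\<phi> v i (x v)"
      unfolding h\<phi>_sum[OF v(1) i XX_comp[OF x v(1)]] cs_def E_def ..
    also have "T0 \<otimes>\<^bsub>R\<^esub> h\<phi> v i (x v) = tensor R I f' x"
    proof -
      have ux: "h\<phi> v i (x v) \<in> carrier R" using S.almost_unit_closed[OF f' x v(1)] by (simp add: f'_def)
      have "tensor R (I - {v}) f' x = T0"
        unfolding T0_def f'_def using S.almost_unit_closed[OF f x] by (intro tensor_cong R_cring) auto
      then show ?thesis using S.tensor_split_XX[OF f' x v(1)] ux T0 R.m_comm by (simp add: f'_def)
    qed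
    finally show "\<theta> W' (\<Oplus>\<^bsub>obj N W'\<^esub>h\<in>J v i. d v i h \<odot>\<^bsub>obj N W'\<^esub> m h) x = \<theta> W' (tensor_elt \<nu> g' f') x"
      using n'(2) x by simp
  qed
  have "(\<Oplus>\<^bsub>obj M P\<^esub>h\<in>J v i. d v i h \<odot>\<^bsub>obj M P\<^esub> ric.res_symbol P W (g(v := h \<otimes>\<^bsub>G v\<^esub> gg v i)) n) =
      (\<Oplus>\<^bsub>obj M P\<^esub>h\<in>J v i. ric.symbol P W' g' (d v i h \<odot>\<^bsub>obj N W'\<^esub> m h))"
    using rs(1) linear_mapsD(3)[OF lin dR m_cl] linear_mapsD(1)[OF lin] dR m_cl
    by (intro MP.M.finsum_cong') (auto intro!: MP.smult_closed)
  also have "\<dots> = ric.symbol P W' g' (\<Oplus>\<^bsub>obj N W'\<^esub>h\<in>J v i. d v i h \<odot>\<^bsub>obj N W'\<^esub> m h)"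
    using dR m_cl by (intro linear_maps_finsum[OF lin NW.module_axioms MP.module_axioms, symmetric]) auto
  also have "\<dots> = tensor_symbol \<nu> g' f'"
    unfolding sum_eq unfolding tensor_symbol_def P_def W'_def ..
  finally show ?thesis unfolding P_def W_def n_def g'_def f'_def .
qed

text \<open>The Mackey formula sums over double cosets in the restricted product. Because the
  correspondence is supported at v, where g is 1 and the level is K v, these match the local double
  cosets of U in K\<sigma>K modulo K, which are then sorted by the classes of the g_i.\<close>

proposition hecke_tensor_symbol:
  assumes \<nu>: "finite \<nu>" "\<nu> \<subseteq> I" and v: "v \<in> I" "v \<notin> \<nu>" and a: "admissible \<nu> g f"
    and gv: "g v = \<one>\<^bsub>G v\<^esub>" and fv: "f v = ch R (Y v)"
  shows "local_hecke I G GG M (level I K L \<nu>) v (SS v) (c v) (tensor_symbol \<nu> g f) =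
    (\<Oplus>\<^bsub>obj M (level I K L \<nu>)\<^esub>i\<in>{1..r v}. tensor_symbol \<nu> (g(v := gg v i)) (f(v := h\<phi> v i)))"
    and "i \<in> {1..r v} \<Longrightarrow> admissible \<nu> (g(v := gg v i)) (f(v := h\<phi> v i))"
proof -
  interpret R: cring R by (rule R_cring)
  interpret Gv: topological_group "G v" "T v" using G_top[OF v(1)] .
  define P where "P = level I K L \<nu>"
  define W where "W = WW \<nu> g"
  define n where "n = tensor_elt \<nu> g f"
  have g: "g \<in> carrier GG" and f: "S.almost_unit f" and fi: "\<And>w. w \<in> I \<Longrightarrow> fixed_by w (Wl \<nu> g w) (f w)"
    using a by (auto simp: admissible_def)
  have P: "P \<in> \<Upsilon>\<^sub>G" unfolding P_def using level_in \<nu> by blast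
  interpret MP: Module.module R "obj M P" using ric.M.obj_module[OF P] .
  note W = WW_level[OF \<nu> g, folded W_def P_def]
  note n = tensor_elt[OF \<nu> a, folded n_def W_def]
  have P_eq: "P = (\<Pi>\<^sub>E w\<in>I. Pl \<nu> w)" unfolding P_def by (rule level_eq)
  have Plv: "Pl \<nu> v = K v" using v by (simp add: Pl_def)
  have Kc: "K v \<subseteq> carrier (G v)" using Pl_sub(3)[OF v(1), of \<nu>] Plv by simp
  have Wlv: "Wl \<nu> g v = U v" unfolding Wl_def Plv gv using Gv.conjugate_one[OF Kc] by (simp add: U_eq)
  have up: "g(v := t) \<in> carrier GG" if "t \<in> carrier (G v)" for t using P.upd_closed[OF g v(1) that] .
  \<comment> \<open>All terms of the Mackey formula have, up to K[\<nu>] on the right, a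
    representative that differs from g at \<open>v\<close> only; \<open>s\<close> records them as a
    function of that component.\<close>
  define s where "s = (\<lambda>t. ric.res_symbol P W (g(v := t)) n)"
  have s_cl: "s t \<in> carrier (obj M P)" if "t \<in> carrier (G v)" for t
    unfolding s_def using ric.res_symbol_closed[OF P W(1) up[OF that] n(1)] .
  have one_W: "\<one>\<^bsub>G w\<^esub> \<in> Wl \<nu> g w" "\<one>\<^bsub>G w\<^esub> \<in> Pl \<nu> w" if "w \<in> I" for w
    using Wl_sub(1)[OF g that] Pl_sub(1)[OF that] subgroup.one_closed by blast+
  \<comment> \<open>Elements of U v and K v, placed at \<open>v\<close>, lie in the level
    \<open>W\<close> and in \<open>P\<close>, so the invariance of the terms applies to them; thus
    \<open>s\<close> is a function on double cosets of U v and K v.\<close>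
  have s_bi: "s (u \<otimes>\<^bsub>G v\<^esub> (t \<otimes>\<^bsub>G v\<^esub> k)) = s t"
    if t: "t \<in> carrier (G v)" and u: "u \<in> U v" and k: "k \<in> K v" for t u k
  proof -
    have uc: "u \<in> carrier (G v)" "k \<in> carrier (G v)" using u k Kc by (auto simp: U_eq)
    define uu where "uu = at_place I G v u"
    define kk where "kk = at_place I G v k"
    have uk: "uu \<in> carrier GG" "kk \<in> carrier GG" unfolding uu_def kk_def using P.at_place_closed v uc by auto
    have uW: "uu \<in> W"
      unfolding W_def WW_def using u Wlv one_W P.extensional_GG[OF uk(1)]
      by (auto simp: PiE_iff uu_def P.at_place_component)
    have kP: "kk \<in> P"
      unfolding P_eq using k Plv one_W P.extensional_GG[OF uk(2)]
      by (auto simp: PiE_iff kk_def P.at_place_component)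
    have gt: "g(v := t) \<in> carrier GG" using up t by blast
    have "g(v := u \<otimes>\<^bsub>G v\<^esub> (t \<otimes>\<^bsub>G v\<^esub> k)) = uu \<otimes>\<^bsub>GG\<^esub> (g(v := t) \<otimes>\<^bsub>GG\<^esub> kk)"
    proof (rule P.GG_eqI)
      fix w assume w: "w \<in> I"
      interpret Gw: plain_group "G w" using G_plain w .
      show "(g(v := u \<otimes>\<^bsub>G v\<^esub> (t \<otimes>\<^bsub>G v\<^esub> k))) w = (uu \<otimes>\<^bsub>GG\<^esub> (g(v := t) \<otimes>\<^bsub>GG\<^esub> kk)) w"
        using w P.component[OF g w] by (simp add: uu_def kk_def P.at_place_component)
    qed (use up t uc gt uk in auto)
    then show ?thesis
      unfolding s_def using ric.res_symbol_left[OF P W(1) _ uW n(1)] ric.res_symbol_right[OF P W(1) gt kP n(1)] gt uk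
      by simp
  qed
  have s_rep: "s (rep D) = s t" if D: "D = double_coset (G v) (U v) t (K v)" and t: "t \<in> carrier (G v)" for D t
    using Gv.rep_double_coset[OF U_sub[OF v(1)] K_sub[OF v(1)] t] s_bi[OF t]
    unfolding D Gv.double_coset_mem_iff by auto
  define dc where "dc = (\<lambda>\<sigma>. double_cosets (G v) (U v) (double_coset (G v) (K v) \<sigma> (K v)) (K v))"
  have Kco: "compactin (T v) (K v)" "openin (T v) (K v)"
    using K_co[OF v(1)] by (auto simp: compact_open_subgroup_def)
  have hp: "hecke_push GG M P (at_place I G v \<sigma>) P (tensor_symbol \<nu> g f) = (\<Oplus>\<^bsub>obj M P\<^esub>D\<in>dc \<sigma>. s (rep D))"
    if \<sigma>S: "\<sigma> \<in> SS v" for \<sigma>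
  proof -
    have \<sigma>: "\<sigma> \<in> carrier (G v)" using SS[OF v(1)] \<sigma>S by blast
    define \<sigma>\<sigma> where "\<sigma>\<sigma> = at_place I G v \<sigma>"
    have \<sigma>\<sigma>: "\<sigma>\<sigma> \<in> carrier GG" unfolding \<sigma>\<sigma>_def using P.at_place_closed v \<sigma> by blast
    have \<sigma>w: "\<sigma>\<sigma> w = (if w = v then \<sigma> else \<one>\<^bsub>G w\<^esub>)" if "w \<in> I" for w
      using that by (simp add: \<sigma>\<sigma>_def P.at_place_component)
    define Q where "Q = conjugate GG g P"
    define B where "B = conjugate GG g (P \<inter> conjugate GG \<sigma>\<sigma> P)"
    have Q: "Q \<in> \<Upsilon>\<^sub>G" "B \<in> \<Upsilon>\<^sub>G" unfolding Q_def B_def using ric.G.T1 ric.G.T3 P g \<sigma>\<sigma> by auto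
    have Qs: "subgroup Q GG" "subgroup B GG" "Q \<subseteq> carrier GG" "B \<subseteq> carrier GG"
      using ric.level_G[OF Q(1)] ric.level_G[OF Q(2)] by auto
    have BQ: "B \<subseteq> Q" unfolding B_def Q_def by (rule P.GG.conjugate_mono) simp
    have WQ: "W \<subseteq> Q" using W(3) unfolding Q_def .
    have Ws: "subgroup W GG" using ric.level_H(4)[OF W(1)] .
    have QP: "y \<in> Q \<longleftrightarrow> (\<forall>w\<in>I. inv\<^bsub>G w\<^esub> (g w) \<otimes>\<^bsub>G w\<^esub> y w \<otimes>\<^bsub>G w\<^esub> g w \<in> Pl \<nu> w)" if y: "y \<in> carrier GG" for y
    proof -
      have "y \<in> Q \<longleftrightarrow> inv\<^bsub>GG\<^esub> g \<otimes>\<^bsub>GG\<^esub> y \<otimes>\<^bsub>GG\<^esub> g \<in> P"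
        unfolding Q_def using P.GG.conjugate_mem_iff[OF g ric.level_G(2)[OF P]] y by simp
      also have "\<dots> \<longleftrightarrow> (\<forall>w\<in>I. inv\<^bsub>G w\<^esub> (g w) \<otimes>\<^bsub>G w\<^esub> y w \<otimes>\<^bsub>G w\<^esub> g w \<in> Pl \<nu> w)"
        unfolding P_eq using P.extensional_GG[of "inv\<^bsub>GG\<^esub> g \<otimes>\<^bsub>GG\<^esub> y \<otimes>\<^bsub>GG\<^esub> g"] y g by (auto simp: PiE_iff)
      finally show ?thesis .
    qed
    have Qv: "y v \<in> K v" if "y \<in> Q" for y
    proof -
      have yc: "y \<in> carrier GG" using that Qs(3) by blast
      have "inv\<^bsub>G v\<^esub> (g v) \<otimes>\<^bsub>G v\<^esub> y v \<otimes>\<^bsub>G v\<^esub> g v \<in> Pl \<nu> v" using QP[OF yc] that v(1) by blast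
      then show ?thesis using P.component[OF yc v(1)] by (simp add: gv Plv)
    qed
    \<comment> \<open>The element \<sigma> is trivial away from \<open>v\<close>, so inside
      \<open>Q\<close> membership in \<open>B\<close> is a condition on the component at
      \<open>v\<close> alone.\<close>
    have B_iff: "y \<in> B \<longleftrightarrow> inv\<^bsub>G v\<^esub> \<sigma> \<otimes>\<^bsub>G v\<^esub> y v \<otimes>\<^bsub>G v\<^esub> \<sigma> \<in> K v" if y: "y \<in> Q" for y
    proof -
      have yc: "y \<in> carrier GG" using y Qs by blast
      define z where "z = inv\<^bsub>GG\<^esub> g \<otimes>\<^bsub>GG\<^esub> y \<otimes>\<^bsub>GG\<^esub> g"
      have zc: "z \<in> carrier GG" unfolding z_def using yc g by simp
      have zP: "z \<in> P" unfolding z_def using y P.GG.conjugate_mem_iff[OF g ric.level_G(2)[OF P]] unfolding Q_def by simp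
      have PP: "P \<inter> conjugate GG \<sigma>\<sigma> P \<subseteq> carrier GG" using ric.level_G(2)[OF P] by blast
      have "y \<in> B \<longleftrightarrow> z \<in> conjugate GG \<sigma>\<sigma> P"
        unfolding B_def using P.GG.conjugate_mem_iff[OF g PP] yc zP by (simp add: z_def)
      also have "\<dots> \<longleftrightarrow> inv\<^bsub>GG\<^esub> \<sigma>\<sigma> \<otimes>\<^bsub>GG\<^esub> z \<otimes>\<^bsub>GG\<^esub> \<sigma>\<sigma> \<in> P"
        using P.GG.conjugate_mem_iff[OF \<sigma>\<sigma> ric.level_G(2)[OF P]] zc by simp
      also have "\<dots> \<longleftrightarrow> (\<forall>w\<in>I. (inv\<^bsub>GG\<^esub> \<sigma>\<sigma> \<otimes>\<^bsub>GG\<^esub> z \<otimes>\<^bsub>GG\<^esub> \<sigma>\<sigma>) w \<in> Pl \<nu> w)"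
        unfolding P_eq using P.extensional_GG[of "inv\<^bsub>GG\<^esub> \<sigma>\<sigma> \<otimes>\<^bsub>GG\<^esub> z \<otimes>\<^bsub>GG\<^esub> \<sigma>\<sigma>"] zc \<sigma>\<sigma> by (auto simp: PiE_iff)
      also have "\<dots> \<longleftrightarrow> inv\<^bsub>G v\<^esub> \<sigma> \<otimes>\<^bsub>G v\<^esub> y v \<otimes>\<^bsub>G v\<^esub> \<sigma> \<in> K v"
      proof -
        have "(inv\<^bsub>GG\<^esub> \<sigma>\<sigma> \<otimes>\<^bsub>GG\<^esub> z \<otimes>\<^bsub>GG\<^esub> \<sigma>\<sigma>) w \<in> Pl \<nu> w" if "w \<in> I" "w \<noteq> v" for w
        proof -
          interpret Gw: plain_group "G w" using G_plain that by blast
          have "z w \<in> Pl \<nu> w" using zP that unfolding P_eq by auto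
          then show ?thesis using that \<sigma>\<sigma> \<sigma>w P.component[OF zc that(1)] by simp
        qed
        moreover have "(inv\<^bsub>GG\<^esub> \<sigma>\<sigma> \<otimes>\<^bsub>GG\<^esub> z \<otimes>\<^bsub>GG\<^esub> \<sigma>\<sigma>) v = inv\<^bsub>G v\<^esub> \<sigma> \<otimes>\<^bsub>G v\<^esub> y v \<otimes>\<^bsub>G v\<^esub> \<sigma>"
          using v(1) \<sigma>\<sigma> \<sigma>w g gv P.component[OF yc v(1)] by (simp add: z_def)
        ultimately show ?thesis using v(1) Plv by metis
      qed
      finally show ?thesis .
    qed
    define DC where "DC = double_cosets GG W Q B"
    have rC: "rep C \<in> Q" "C = double_coset GG W (rep C) B" "rep C v \<in> K v" "rep C v \<in> carrier (G v)" "rep C \<in> carrier GG"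
      if C: "C \<in> DC" for C
    proof -
      obtain \<gamma> where \<gamma>: "\<gamma> \<in> Q" "C = double_coset GG W \<gamma> B" using C by (auto simp: DC_def double_cosets_def)
      have \<gamma>c: "\<gamma> \<in> carrier GG" using \<gamma> Qs by blast
      have r: "rep C \<in> double_coset GG W \<gamma> B" unfolding \<gamma>(2) by (rule P.GG.rep_double_coset[OF Ws Qs(2) \<gamma>c])
      show "C = double_coset GG W (rep C) B" using P.GG.double_coset_eqI[OF Ws Qs(2) \<gamma>c r] \<gamma> by simp
      obtain w b where "w \<in> W" "b \<in> B" "rep C = w \<otimes>\<^bsub>GG\<^esub> (\<gamma> \<otimes>\<^bsub>GG\<^esub> b)"
        using r unfolding P.GG.double_coset_mem_iff by blast
      then show rQ: "rep C \<in> Q" using \<gamma>(1) WQ BQ Qs(1) by (auto intro!: subgroup.m_closed)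
      then show "rep C v \<in> K v" by (rule Qv)
      then show "rep C v \<in> carrier (G v)" using Kc by blast
      show "rep C \<in> carrier GG" using rQ Qs by blast
    qed
    \<comment> \<open>The double coset of \<gamma> modulo W and B is sent to that of \<gamma>_v
      \<sigma> modulo U and K, where \<gamma>_v is the component at \<open>v\<close>.\<close>
    define \<Phi> where "\<Phi> = (\<lambda>C. double_coset (G v) (U v) (rep C v \<otimes>\<^bsub>G v\<^esub> \<sigma>) (K v))"
    have K\<sigma>: "k \<otimes>\<^bsub>G v\<^esub> \<sigma> \<in> double_coset (G v) (K v) \<sigma> (K v)" if "k \<in> K v" for k
      unfolding Gv.double_coset_mem_iff using that \<sigma> subgroup.one_closed[OF K_sub[OF v(1)]]
      by (intro bexI[of _ k] bexI[of _ "\<one>\<^bsub>G v\<^esub>"]) auto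
    have bij: "bij_betw \<Phi> DC (dc \<sigma>)"
      unfolding bij_betw_def
    proof
      show "inj_on \<Phi> DC"
      proof (rule inj_onI)
        fix C D assume C: "C \<in> DC" and D: "D \<in> DC" and eq: "\<Phi> C = \<Phi> D"
        define x where "x = rep C v"
        define y where "y = rep D v"
        have xy: "x \<in> K v" "y \<in> K v" "x \<in> carrier (G v)" "y \<in> carrier (G v)"
          unfolding x_def y_def using rC(3,4) C D by auto
        have "y \<otimes>\<^bsub>G v\<^esub> \<sigma> \<in> \<Phi> C"
          unfolding eq unfolding \<Phi>_def y_def using rC(4)[OF D] \<sigma>
          by (intro Gv.mem_own_double_coset U_sub K_sub v(1)) simp
        then obtain u k where uk: "u \<in> U v" "k \<in> K v" "y \<otimes>\<^bsub>G v\<^esub> \<sigma> = u \<otimes>\<^bsub>G v\<^esub> (x \<otimes>\<^bsub>G v\<^esub> \<sigma> \<otimes>\<^bsub>G v\<^esub> k)"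
          unfolding \<Phi>_def Gv.double_coset_mem_iff x_def by blast
        have ukc: "u \<in> carrier (G v)" "k \<in> carrier (G v)" using uk Kc by (auto simp: U_eq)
        define uu where "uu = at_place I G v u"
        have uuc: "uu \<in> carrier GG" unfolding uu_def using P.at_place_closed v ukc by blast
        have uuW: "uu \<in> W"
          unfolding W_def WW_def using uk(1) Wlv one_W P.extensional_GG[OF uuc]
          by (auto simp: PiE_iff uu_def P.at_place_component)
        \<comment> \<open>\<open>b\<close> solves rep D = uu (rep C) b. It lies in \<open>Q\<close>
          automatically, and its component at \<open>v\<close>, conjugated by \<sigma>, is the given
          k, so it lies in \<open>B\<close>.\<close>
        define b where "b = inv\<^bsub>GG\<^esub> (rep C) \<otimes>\<^bsub>GG\<^esub> (inv\<^bsub>GG\<^esub> uu \<otimes>\<^bsub>GG\<^esub> rep D)"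
        have bQ: "b \<in> Q" unfolding b_def using rC(1)[OF C] rC(1)[OF D] uuW WQ Qs(1)
          by (auto intro!: subgroup.m_closed subgroup.m_inv_closed)
        have bv: "b v = inv\<^bsub>G v\<^esub> x \<otimes>\<^bsub>G v\<^esub> (inv\<^bsub>G v\<^esub> u \<otimes>\<^bsub>G v\<^esub> y)"
          unfolding b_def x_def y_def using v(1) rC(5)[OF C] uuc by (simp add: uu_def P.at_place_component)
        have "inv\<^bsub>G v\<^esub> \<sigma> \<otimes>\<^bsub>G v\<^esub> b v \<otimes>\<^bsub>G v\<^esub> \<sigma> = k"
        proof -
          have "inv\<^bsub>G v\<^esub> \<sigma> \<otimes>\<^bsub>G v\<^esub> b v \<otimes>\<^bsub>G v\<^esub> \<sigma> =
              inv\<^bsub>G v\<^esub> \<sigma> \<otimes>\<^bsub>G v\<^esub> inv\<^bsub>G v\<^esub> x \<otimes>\<^bsub>G v\<^esub> inv\<^bsub>G v\<^esub> u \<otimes>\<^bsub>G v\<^esub> (y \<otimes>\<^bsub>G v\<^esub> \<sigma>)"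
            unfolding bv using xy ukc \<sigma> by (simp add: Gv.m_assoc)
          also have "\<dots> = inv\<^bsub>G v\<^esub> \<sigma> \<otimes>\<^bsub>G v\<^esub> (inv\<^bsub>G v\<^esub> x \<otimes>\<^bsub>G v\<^esub> (inv\<^bsub>G v\<^esub> u \<otimes>\<^bsub>G v\<^esub> u) \<otimes>\<^bsub>G v\<^esub> x) \<otimes>\<^bsub>G v\<^esub> \<sigma> \<otimes>\<^bsub>G v\<^esub> k"
            unfolding uk(3) using xy ukc \<sigma> by (simp only: Gv.m_assoc Gv.m_closed Gv.inv_closed)
          finally show ?thesis using xy ukc \<sigma> by (simp add: Gv.m_assoc)
        qed
        then have bB: "b \<in> B" using B_iff[OF bQ] uk(2) by simp
        have "uu \<otimes>\<^bsub>GG\<^esub> (rep C \<otimes>\<^bsub>GG\<^esub> b) = rep D"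
        proof -
          have "uu \<otimes>\<^bsub>GG\<^esub> (rep C \<otimes>\<^bsub>GG\<^esub> b) = uu \<otimes>\<^bsub>GG\<^esub> (rep C \<otimes>\<^bsub>GG\<^esub> inv\<^bsub>GG\<^esub> (rep C)) \<otimes>\<^bsub>GG\<^esub> inv\<^bsub>GG\<^esub> uu \<otimes>\<^bsub>GG\<^esub> rep D"
            unfolding b_def using uuc rC(5)[OF C] rC(5)[OF D]
            by (simp only: P.GG.m_assoc P.GG.m_closed P.GG.inv_closed)
          then show ?thesis using uuc rC(5)[OF C] rC(5)[OF D] by simp
        qed
        then have "double_coset GG W (rep D) B = double_coset GG W (rep C) B"
          using P.GG.double_coset_absorb[OF Ws Qs(2) rC(5)[OF C] uuW bB] by simp
        then show "C = D" using rC(2)[OF C] rC(2)[OF D] by metis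
      qed
      show "\<Phi> ` DC = dc \<sigma>"
      proof (intro equalityI subsetI)
        fix D assume "D \<in> \<Phi> ` DC"
        then obtain C where C: "C \<in> DC" "D = \<Phi> C" by blast
        then show "D \<in> dc \<sigma>"
          using K\<sigma>[OF rC(3)[OF C(1)]] unfolding dc_def double_cosets_def \<Phi>_def by blast
      next
        fix D assume "D \<in> dc \<sigma>"
        then obtain t where "t \<in> double_coset (G v) (K v) \<sigma> (K v)" and D: "D = double_coset (G v) (U v) t (K v)"
          unfolding dc_def double_cosets_def by blast
        then obtain k k' where k: "k \<in> K v" "k' \<in> K v" "t = k \<otimes>\<^bsub>G v\<^esub> (\<sigma> \<otimes>\<^bsub>G v\<^esub> k')"
          unfolding Gv.double_coset_mem_iff by blast
        have kc: "k \<in> carrier (G v)" "k' \<in> carrier (G v)" using k Kc by auto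
        \<comment> \<open>The right factor k' is absorbed, so each local double coset inside
          K\<sigma>K has a representative of the form k\<sigma> with k in K; this k is then placed
          at \<open>v\<close>.\<close>
        have D': "D = double_coset (G v) (U v) (k \<otimes>\<^bsub>G v\<^esub> \<sigma>) (K v)"
          using Gv.double_coset_absorb[OF U_sub[OF v(1)] K_sub[OF v(1)], of "k \<otimes>\<^bsub>G v\<^esub> \<sigma>" "\<one>\<^bsub>G v\<^esub>" k']
            k kc \<sigma> subgroup.one_closed[OF U_sub[OF v(1)]] unfolding D k(3) by (simp add: Gv.m_assoc)
        define \<gamma> where "\<gamma> = at_place I G v k"
        have \<gamma>: "\<gamma> \<in> carrier GG" unfolding \<gamma>_def using P.at_place_closed v kc by blast
        have \<gamma>Q: "\<gamma> \<in> Q"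
          unfolding QP[OF \<gamma>]
        proof
          fix w assume w: "w \<in> I"
          interpret Gw: plain_group "G w" using G_plain w .
          show "inv\<^bsub>G w\<^esub> (g w) \<otimes>\<^bsub>G w\<^esub> \<gamma> w \<otimes>\<^bsub>G w\<^esub> g w \<in> Pl \<nu> w"
            using w one_W(2)[OF w] P.component[OF g w] gv Plv k(1) kc
            by (cases "w = v") (auto simp: \<gamma>_def P.at_place_component)
        qed
        define C where "C = double_coset GG W \<gamma> B"
        have C: "C \<in> DC" unfolding C_def DC_def double_cosets_def using \<gamma>Q by blast
        have "rep C \<in> double_coset GG W \<gamma> B" unfolding C_def by (rule P.GG.rep_double_coset[OF Ws Qs(2) \<gamma>])
        then obtain w b where wb: "w \<in> W" "b \<in> B" "rep C = w \<otimes>\<^bsub>GG\<^esub> (\<gamma> \<otimes>\<^bsub>GG\<^esub> b)"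
          unfolding P.GG.double_coset_mem_iff by blast
        have wv: "w v \<in> U v" using wb(1) v(1) Wlv unfolding W_def WW_def by auto
        have wvc: "w v \<in> carrier (G v)" using wv Kc by (auto simp: U_eq)
        have bQ: "b \<in> Q" using wb BQ by blast
        have bvc: "b v \<in> carrier (G v)" using Qv[OF bQ] Kc by blast
        define k2 where "k2 = inv\<^bsub>G v\<^esub> \<sigma> \<otimes>\<^bsub>G v\<^esub> b v \<otimes>\<^bsub>G v\<^esub> \<sigma>"
        have k2: "k2 \<in> K v" unfolding k2_def using B_iff[OF bQ] wb(2) by simp
        have "rep C v = w v \<otimes>\<^bsub>G v\<^esub> (k \<otimes>\<^bsub>G v\<^esub> b v)"
          unfolding wb(3) using v(1) by (simp add: \<gamma>_def P.at_place_component)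
        then have "rep C v \<otimes>\<^bsub>G v\<^esub> \<sigma> = w v \<otimes>\<^bsub>G v\<^esub> (k \<otimes>\<^bsub>G v\<^esub> \<sigma> \<otimes>\<^bsub>G v\<^esub> k2)"
        proof -
          have "w v \<otimes>\<^bsub>G v\<^esub> (k \<otimes>\<^bsub>G v\<^esub> \<sigma> \<otimes>\<^bsub>G v\<^esub> k2) =
              w v \<otimes>\<^bsub>G v\<^esub> (k \<otimes>\<^bsub>G v\<^esub> (\<sigma> \<otimes>\<^bsub>G v\<^esub> inv\<^bsub>G v\<^esub> \<sigma>) \<otimes>\<^bsub>G v\<^esub> b v \<otimes>\<^bsub>G v\<^esub> \<sigma>)"
            unfolding k2_def using wvc kc bvc \<sigma> by (simp only: Gv.m_assoc Gv.m_closed Gv.inv_closed)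
          then show ?thesis using \<open>rep C v = _\<close> wvc kc bvc \<sigma> by (simp add: Gv.m_assoc)
        qed
        then have "\<Phi> C = D"
          unfolding \<Phi>_def D' using Gv.double_coset_absorb[OF U_sub[OF v(1)] K_sub[OF v(1)] _ wv k2, of "k \<otimes>\<^bsub>G v\<^esub> \<sigma>"]
            kc \<sigma> by simp
        then show "D \<in> \<Phi> ` DC" using C by blast
      qed
    qed
    have val: "ric.res_symbol P W (rep C \<otimes>\<^bsub>GG\<^esub> g \<otimes>\<^bsub>GG\<^esub> \<sigma>\<sigma>) n = s (rep C v \<otimes>\<^bsub>G v\<^esub> \<sigma>)" if C: "C \<in> DC" for C
    proof -
      define \<gamma> where "\<gamma> = rep C"
      define t where "t = \<gamma> v \<otimes>\<^bsub>G v\<^esub> \<sigma>"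
      have \<gamma>: "\<gamma> \<in> carrier GG" "\<gamma> \<in> Q" unfolding \<gamma>_def using rC[OF C] by auto
      have t: "t \<in> carrier (G v)" unfolding t_def \<gamma>_def using rC[OF C] \<sigma> by simp
      have gt: "g(v := t) \<in> carrier GG" using up[OF t] .
      \<comment> \<open>\<open>q\<close> is the error made by replacing \<gamma>g\<sigma> with the
        element that differs from g at \<open>v\<close> only. It is 1 at \<open>v\<close>, and
        elsewhere it is g^-1 \<gamma> g, which lies in the factor of the level because \<gamma> is
        in \<open>Q\<close>.\<close>
      define q where "q = inv\<^bsub>GG\<^esub> (g(v := t)) \<otimes>\<^bsub>GG\<^esub> (\<gamma> \<otimes>\<^bsub>GG\<^esub> g \<otimes>\<^bsub>GG\<^esub> \<sigma>\<sigma>)"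
      have qc: "q \<in> carrier GG" unfolding q_def using gt \<gamma> g \<sigma>\<sigma> by simp
      have "q w \<in> Pl \<nu> w" if w: "w \<in> I" for w
      proof -
        interpret Gw: plain_group "G w" using G_plain w .
        note c = P.component[OF g w] P.component[OF \<gamma>(1) w]
        show ?thesis
        proof (cases "w = v")
          case True
          have "q w = inv\<^bsub>G w\<^esub> t \<otimes>\<^bsub>G w\<^esub> t"
            unfolding q_def t_def using True w gt g \<gamma> \<sigma>\<sigma> \<sigma>w gv c t_def by simp
          then show ?thesis using True t one_W(2)[OF w] by simp
        next
          case False
          have "q w = inv\<^bsub>G w\<^esub> (g w) \<otimes>\<^bsub>G w\<^esub> \<gamma> w \<otimes>\<^bsub>G w\<^esub> g w"
            unfolding q_def using False w gt g \<gamma> \<sigma>\<sigma> \<sigma>w c by (simp add: Gw.m_assoc)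
          then show ?thesis using QP[OF \<gamma>(1)] \<gamma>(2) w by simp
        qed
      qed
      then have "q \<in> P" unfolding P_eq using P.extensional_GG[OF qc] by (auto simp: PiE_iff)
      moreover have "\<gamma> \<otimes>\<^bsub>GG\<^esub> g \<otimes>\<^bsub>GG\<^esub> \<sigma>\<sigma> = g(v := t) \<otimes>\<^bsub>GG\<^esub> q"
        unfolding q_def using gt \<gamma> g \<sigma>\<sigma> by (simp add: P.GG.m_assoc[symmetric])
      ultimately show ?thesis
        using ric.res_symbol_right[OF P W(1) gt _ n(1)] unfolding s_def \<gamma>_def t_def by simp
    qed
    have "hecke_push GG M P \<sigma>\<sigma> P (tensor_symbol \<nu> g f) = (\<Oplus>\<^bsub>obj M P\<^esub>C\<in>DC. ric.res_symbol P W (rep C \<otimes>\<^bsub>GG\<^esub> g \<otimes>\<^bsub>GG\<^esub> \<sigma>\<sigma>) n)"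
      unfolding tensor_symbol_def P_def[symmetric] W_def[symmetric] n_def[symmetric] DC_def Q_def B_def
      by (rule ric.hecke_push_symbol[OF P \<sigma>\<sigma> g W(1,3) n(1)])
    also have "\<dots> = (\<Oplus>\<^bsub>obj M P\<^esub>D\<in>dc \<sigma>. s (rep D))"
    proof (rule MP.M.finsum_bij_betw[OF bij])
      fix C assume C: "C \<in> DC"
      have "s (rep (\<Phi> C)) = s (rep C v \<otimes>\<^bsub>G v\<^esub> \<sigma>)"
        using rC(4)[OF C] \<sigma> by (intro s_rep) (auto simp: \<Phi>_def)
      then show "ric.res_symbol P W (rep C \<otimes>\<^bsub>GG\<^esub> g \<otimes>\<^bsub>GG\<^esub> \<sigma>\<sigma>) n = s (rep (\<Phi> C))" using val[OF C] by simp
    next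
      show "(\<lambda>D. s (rep D)) \<in> dc \<sigma> \<rightarrow> carrier (obj M P)"
      proof
        fix D assume "D \<in> dc \<sigma>"
        then obtain t where t: "t \<in> double_coset (G v) (K v) \<sigma> (K v)" "D = double_coset (G v) (U v) t (K v)"
          unfolding dc_def double_cosets_def by blast
        have "t \<in> carrier (G v)" using t(1) Gv.double_coset_subset[OF Kc Kc \<sigma>] by blast
        then show "s (rep D) \<in> carrier (obj M P)" using s_rep[OF t(2)] s_cl by simp
      qed
    qed
    finally show ?thesis unfolding \<sigma>\<sigma>_def .
  qed
  have fin: "finite (dc \<sigma>)" if "\<sigma> \<in> SS v" for \<sigma>
  proof -
    have \<sigma>: "\<sigma> \<in> carrier (G v)" using SS[OF v(1)] that by blast
    show ?thesis unfolding dc_def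
      by (intro Gv.finite_double_cosets Gv.compactin_double_coset Kco \<sigma> K_sub v(1))
  qed
  \<comment> \<open>\<open>supp\<close> is a closure, so it contains every point where the function
    is nonzero.\<close>
  have suppS: "{t \<in> carrier (G v). \<HH> v t \<noteq> \<zero>\<^bsub>R\<^esub>} \<subseteq> supp R (T v) (\<HH> v)"
    unfolding supp_def using closure_of_subset[of "{t \<in> topspace (T v). \<HH> v t \<noteq> \<zero>\<^bsub>R\<^esub>}" "T v"]
    by (simp add: Gv.topspace_carrier)
  have Uv: "U v = H v \<inter> K v" by (simp add: U_eq)
  have "local_hecke I G GG M P v (SS v) (c v) (tensor_symbol \<nu> g f) =
      (\<Oplus>\<^bsub>obj M P\<^esub>\<sigma>\<in>SS v. c v \<sigma> \<odot>\<^bsub>obj M P\<^esub> (\<Oplus>\<^bsub>obj M P\<^esub>D\<in>dc \<sigma>. s (rep D)))"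
    unfolding local_hecke_def
  proof (rule MP.M.finsum_cong')
    have cl: "c v \<sigma> \<in> carrier R" if "\<sigma> \<in> SS v" for \<sigma> using SS[OF v(1)] that by blast
    have "s (rep D) \<in> carrier (obj M P)" if \<sigma>: "\<sigma> \<in> SS v" and D: "D \<in> dc \<sigma>" for \<sigma> D
    proof -
      have \<sigma>c: "\<sigma> \<in> carrier (G v)" using SS[OF v(1)] \<sigma> by blast
      obtain t where t: "t \<in> double_coset (G v) (K v) \<sigma> (K v)" "D = double_coset (G v) (U v) t (K v)"
        using D unfolding dc_def double_cosets_def by blast
      have "t \<in> carrier (G v)" using t(1) Gv.double_coset_subset[OF Kc Kc \<sigma>c] by blast
      then show ?thesis using s_rep[OF t(2)] s_cl by simp
    qed
    then show "(\<lambda>\<sigma>. c v \<sigma> \<odot>\<^bsub>obj M P\<^esub> (\<Oplus>\<^bsub>obj M P\<^esub>D\<in>dc \<sigma>. s (rep D))) \<in> SS v \<rightarrow> carrier (obj M P)"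
      using cl by (auto intro!: MP.smult_closed MP.M.finsum_closed)
    show "c v \<sigma> \<odot>\<^bsub>obj M P\<^esub> hecke_push GG M P (at_place I G v \<sigma>) P (tensor_symbol \<nu> g f) =
      c v \<sigma> \<odot>\<^bsub>obj M P\<^esub> (\<Oplus>\<^bsub>obj M P\<^esub>D\<in>dc \<sigma>. s (rep D))" if "\<sigma> \<in> SS v" for \<sigma>
      using hp[OF that] by simp
  qed simp
  also have "\<dots> = (\<Oplus>\<^bsub>obj M P\<^esub>i\<in>{1..r v}. \<Oplus>\<^bsub>obj M P\<^esub>h\<in>J v i. d v i h \<odot>\<^bsub>obj M P\<^esub> s (h \<otimes>\<^bsub>G v\<^esub> gg v i))"
    unfolding dc_def
    using SS[OF v(1)] gg[OF v(1)] J[OF v(1)] \<HH>_J[OF v(1)] Hg_eq[OF v(1)] fin s_cl s_bi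
    by (intro Gv.double_coset_sum_decompose[OF MP.module_axioms K_sub[OF v(1)] H_sub[OF v(1)] Uv _ _ _ \<HH>_eq[OF v(1)]
          _ _ _ suppS]) (auto simp: dc_def)
  finally have 1: "local_hecke I G GG M P v (SS v) (c v) (tensor_symbol \<nu> g f) =
      (\<Oplus>\<^bsub>obj M P\<^esub>i\<in>{1..r v}. \<Oplus>\<^bsub>obj M P\<^esub>h\<in>J v i. d v i h \<odot>\<^bsub>obj M P\<^esub> s (h \<otimes>\<^bsub>G v\<^esub> gg v i))" .
  have a': "admissible \<nu> (g(v := gg v i)) (f(v := h\<phi> v i))" if i: "i \<in> {1..r v}" for i
  proof -
    have "fixed_by w (Wl \<nu> (g(v := gg v i)) w) ((f(v := h\<phi> v i)) w)" if w: "w \<in> I" for w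
    proof (cases "w = v")
      case True
      then show ?thesis using h\<phi>_schwartz(2)[OF v(1) i] Hg_eq[OF v(1) i] by (simp add: Wl_def Plv)
    next
      case False
      then show ?thesis using fi[OF w] by (simp add: Wl_def)
    qed
    then show ?thesis
      unfolding admissible_def using up[OF gg_in[OF v(1) i]] S.almost_unit_upd[OF f h\<phi>_schwartz(1)[OF v(1) i]] by blast
  qed
  then show "i \<in> {1..r v} \<Longrightarrow> admissible \<nu> (g(v := gg v i)) (f(v := h\<phi> v i))" .
  have 2: "(\<Oplus>\<^bsub>obj M P\<^esub>h\<in>J v i. d v i h \<odot>\<^bsub>obj M P\<^esub> s (h \<otimes>\<^bsub>G v\<^esub> gg v i)) =
      tensor_symbol \<nu> (g(v := gg v i)) (f(v := h\<phi> v i))" if i: "i \<in> {1..r v}" for i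
    using sum_res_symbol[OF \<nu> v a gv fv i a'[OF i]] unfolding s_def P_def W_def n_def .
  have "(\<Oplus>\<^bsub>obj M P\<^esub>i\<in>{1..r v}. \<Oplus>\<^bsub>obj M P\<^esub>h\<in>J v i. d v i h \<odot>\<^bsub>obj M P\<^esub> s (h \<otimes>\<^bsub>G v\<^esub> gg v i)) =
      (\<Oplus>\<^bsub>obj M P\<^esub>i\<in>{1..r v}. tensor_symbol \<nu> (g(v := gg v i)) (f(v := h\<phi> v i)))"
    using 2 tensor_symbol_closed[OF \<nu> a'] unfolding P_def by (intro MP.M.finsum_cong'[unfolded P_def]) auto
  then show "local_hecke I G GG M (level I K L \<nu>) v (SS v) (c v) (tensor_symbol \<nu> g f) =
    (\<Oplus>\<^bsub>obj M (level I K L \<nu>)\<^esub>i\<in>{1..r v}. tensor_symbol \<nu> (g(v := gg v i)) (f(v := h\<phi> v i)))"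
    using 1 unfolding P_def by simp
qed

end

section \<open>The zeta elements\<close>

context zeta_hecke begin

lemma level_module: "finite \<nu> \<Longrightarrow> \<nu> \<subseteq> I \<Longrightarrow> Module.module R (obj M (level I K L \<nu>))"
  using ric.M.obj_module level_in by blast

lemma hecke_push_linear:
  assumes P: "P \<in> \<Upsilon>\<^sub>G" and \<sigma>: "\<sigma> \<in> carrier GG"
  shows "hecke_push GG M P \<sigma> P \<in> linear_maps R (obj M P) (obj M P)"
proof -
  define B where "B = P \<inter> conjugate GG \<sigma> P"
  have B: "B \<in> \<Upsilon>\<^sub>G" "B \<subseteq> P" unfolding B_def using ric.G.T1 ric.G.T3 P \<sigma> by auto
  have 1: "pull M B P \<one>\<^bsub>GG\<^esub> \<in> linear_maps R (obj M P) (obj M B)"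
    by (rule ric.M.pull_linear[OF B(1) P ric.one_level_hom_G[OF B(1) P B(2)]])
  have "\<sigma> \<in> level_hom GG B P" using ric.level_hom_G_iff[OF B(1) P] \<sigma> by (auto simp: B_def)
  then have 2: "push M B P \<sigma> \<in> linear_maps R (obj M B) (obj M P)"
    by (rule ric.M.push_linear[OF B(1) P])
  interpret MP: Module.module R "obj M P" using ric.M.obj_module[OF P] .
  show ?thesis
    unfolding linear_maps_def
    using ric.hecke_push_eq[OF P \<sigma> _ B_def] linear_mapsD[OF 1] linear_mapsD[OF 2] by auto
qed

lemma local_hecke_finsum:
  assumes P: "P \<in> \<Upsilon>\<^sub>G" and v: "v \<in> I" and A: "finite A" "u \<in> A \<rightarrow> carrier (obj M P)"
  shows "local_hecke I G GG M P v (SS v) (c v) (\<Oplus>\<^bsub>obj M P\<^esub>a\<in>A. u a) =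
    (\<Oplus>\<^bsub>obj M P\<^esub>a\<in>A. local_hecke I G GG M P v (SS v) (c v) (u a))"
proof -
  interpret MP: Module.module R "obj M P" using ric.M.obj_module[OF P] .
  define F where "F \<sigma> = hecke_push GG M P (at_place I G v \<sigma>) P" for \<sigma>
  have S: "finite (SS v)" "\<And>\<sigma>. \<sigma> \<in> SS v \<Longrightarrow> c v \<sigma> \<in> carrier R" using SS[OF v] by blast+
  have F: "F \<sigma> \<in> linear_maps R (obj M P) (obj M P)" if "\<sigma> \<in> SS v" for \<sigma>
    unfolding F_def using SS[OF v] that by (intro hecke_push_linear P P.at_place_closed v) blast
  have Fu: "F \<sigma> (u a) \<in> carrier (obj M P)" if "\<sigma> \<in> SS v" "a \<in> A" for \<sigma> a
    using linear_mapsD(1)[OF F[OF that(1)]] A that by blast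
  have "local_hecke I G GG M P v (SS v) (c v) (\<Oplus>\<^bsub>obj M P\<^esub>a\<in>A. u a) =
      (\<Oplus>\<^bsub>obj M P\<^esub>\<sigma>\<in>SS v. \<Oplus>\<^bsub>obj M P\<^esub>a\<in>A. c v \<sigma> \<odot>\<^bsub>obj M P\<^esub> F \<sigma> (u a))"
    unfolding local_hecke_def F_def[symmetric]
  proof (rule MP.M.finsum_cong')
    fix \<sigma> assume \<sigma>: "\<sigma> \<in> SS v"
    have "F \<sigma> (\<Oplus>\<^bsub>obj M P\<^esub>a\<in>A. u a) = (\<Oplus>\<^bsub>obj M P\<^esub>a\<in>A. F \<sigma> (u a))"
      by (rule linear_maps_finsum[OF F[OF \<sigma>] MP.module_axioms MP.module_axioms A(2)])
    then show "c v \<sigma> \<odot>\<^bsub>obj M P\<^esub> F \<sigma> (\<Oplus>\<^bsub>obj M P\<^esub>a\<in>A. u a) =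
        (\<Oplus>\<^bsub>obj M P\<^esub>a\<in>A. c v \<sigma> \<odot>\<^bsub>obj M P\<^esub> F \<sigma> (u a))"
      using A S(2)[OF \<sigma>] Fu[OF \<sigma>] by (simp add: MP.finsum_smult_ldistr)
  qed (use S Fu in \<open>auto intro!: MP.M.finsum_closed MP.smult_closed\<close>)
  also have "\<dots> = (\<Oplus>\<^bsub>obj M P\<^esub>a\<in>A. \<Oplus>\<^bsub>obj M P\<^esub>\<sigma>\<in>SS v. c v \<sigma> \<odot>\<^bsub>obj M P\<^esub> F \<sigma> (u a))"
    using S A Fu by (intro MP.M.finsum_swap) (auto intro!: MP.smult_closed)
  finally show ?thesis unfolding local_hecke_def F_def .
qed

section \<open>Sums of symbols over choices of representatives at finitely many places\<close>

definition gA :: "'i set \<Rightarrow> ('i \<Rightarrow> nat) \<Rightarrow> 'i \<Rightarrow> 'g" where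
  "gA \<rho> \<alpha> = (\<lambda>w\<in>I. if w \<in> \<rho> then gg w (\<alpha> w) else \<one>\<^bsub>G w\<^esub>)"

text \<open>The three cases are the possible states of a place: level lowered to L, Hecke operator
  applied at level K, untouched.\<close>

definition fA :: "('i \<Rightarrow> nat \<Rightarrow> 'x \<Rightarrow> 'r) \<Rightarrow> 'i set \<Rightarrow> 'i set \<Rightarrow> ('i \<Rightarrow> nat) \<Rightarrow> 'i \<Rightarrow> 'x \<Rightarrow> 'r" where
  "fA \<zeta> \<nu> \<rho> \<alpha> = (\<lambda>w. if w \<in> \<nu> then \<zeta> w (\<alpha> w) else if w \<in> \<rho> then h\<phi> w (\<alpha> w) else ch R (Y w))"

definition idx :: "'i set \<Rightarrow> ('i \<Rightarrow> nat) set" where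
  "idx \<rho> = (\<Pi>\<^sub>E w\<in>\<rho>. {1..r w})"

lemma finite_idx: "finite \<rho> \<Longrightarrow> finite (idx \<rho>)"
  unfolding idx_def by (intro finite_PiE) auto

definition local_sections :: "('i \<Rightarrow> nat \<Rightarrow> 'x \<Rightarrow> 'r) \<Rightarrow> bool" where
  "local_sections \<zeta> \<longleftrightarrow> (\<forall>v\<in>I. \<forall>i\<in>{1..r v}. schwartz_fun R (X v) (\<zeta> v i) \<and> fixed_by v (Vg v i) (\<zeta> v i) \<and>
    (\<forall>x\<in>topspace (X v). h\<phi> v i x =
      (\<Oplus>\<^bsub>R\<^esub>C\<in>left_cosets (G v) (Hg v i) (Vg v i). \<zeta> v i (act v x (rep C)))))"

lemma exists_local_sections: "\<exists>\<zeta>. local_sections \<zeta>"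
proof -
  \<comment> \<open>The condition is vacuous outside of \<open>I\<close> and of the range of
    indices, which allows a choice for all arguments at once.\<close>
  define Q where "Q = (\<lambda>v i z. v \<in> I \<longrightarrow> i \<in> {1..r v} \<longrightarrow> (schwartz_fun R (X v) z \<and> fixed_by v (Vg v i) z \<and>
    (\<forall>x\<in>topspace (X v). h\<phi> v i x =
      (\<Oplus>\<^bsub>R\<^esub>C\<in>left_cosets (G v) (Hg v i) (Vg v i). z (act v x (rep C))))))"
  have "\<exists>z. Q v i z" for v i
    unfolding Q_def using exists_local_section[of v i] by (cases "v \<in> I \<and> i \<in> {1..r v}") auto
  then have "\<forall>v. \<exists>f. \<forall>i. Q v i (f i)" by (intro allI choice)
  then have "\<exists>\<zeta>. \<forall>v i. Q v i (\<zeta> v i)" by (rule choice)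
  then obtain \<zeta> where "\<And>v i. Q v i (\<zeta> v i)" by auto
  then have "local_sections \<zeta>" unfolding local_sections_def Q_def by simp
  then show ?thesis by (rule exI[of _ \<zeta>])
qed

text \<open>In each of the three states the local level is the subgroup under which the
  corresponding factor, namely \<zeta>, h\<phi> or ch(Y), is invariant.\<close>

lemma gA_Wl:
  assumes "w \<in> I" "\<nu> \<subseteq> \<rho>" "\<alpha> \<in> idx \<rho>"
  shows "Wl \<nu> (gA \<rho> \<alpha>) w = (if w \<in> \<nu> then Vg w (\<alpha> w) else if w \<in> \<rho> then Hg w (\<alpha> w) else U w)"
proof -
  interpret Gw: plain_group "G w" using G_plain[OF assms(1)] .
  have "\<alpha> w \<in> {1..r w}" if "w \<in> \<rho>" using assms(3) that by (auto simp: idx_def)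
  then show ?thesis
    using assms(1,2) Vg_eq[OF assms(1)] Hg_eq[OF assms(1)] Gw.conjugate_one[OF subgroup.subset[OF K_sub[OF assms(1)]]]
    by (auto simp: Wl_def Pl_def gA_def U_eq)
qed

lemma gA_closed:
  assumes "finite \<rho>" "\<rho> \<subseteq> I" "\<alpha> \<in> idx \<rho>"
  shows "gA \<rho> \<alpha> \<in> carrier GG"
proof -
  have "gg w (\<alpha> w) \<in> carrier (G w)" if "w \<in> \<rho>" for w
    using PiE_mem[OF assms(3)[unfolded idx_def] that] gg_in[of w "\<alpha> w"] assms(2) that by blast
  moreover have "\<one>\<^bsub>G w\<^esub> \<in> K w" "\<one>\<^bsub>G w\<^esub> \<in> carrier (G w)" if "w \<in> I" for w
    using K_sub[OF that] subgroup.one_closed subgroup.subset by blast+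
  moreover have "{w \<in> I. gA \<rho> \<alpha> w \<notin> K w} \<subseteq> \<rho>" using calculation(2) by (auto simp: gA_def)
  ultimately show ?thesis
    using finite_subset[OF _ assms(1)] by (auto simp: P.carrier_GG gA_def)
qed

lemma admissible_A:
  assumes \<zeta>: "local_sections \<zeta>" and \<rho>: "finite \<rho>" "\<rho> \<subseteq> I" "\<nu> \<subseteq> \<rho>" and \<alpha>: "\<alpha> \<in> idx \<rho>"
  shows "admissible \<nu> (gA \<rho> \<alpha>) (fA \<zeta> \<nu> \<rho> \<alpha>)"
  unfolding admissible_def
proof (intro conjI ballI)
  have \<alpha>r: "\<alpha> w \<in> {1..r w}" if "w \<in> \<rho>" for w using \<alpha> that by (auto simp: idx_def)
  have loc: "schwartz_fun R (X w) (fA \<zeta> \<nu> \<rho> \<alpha> w) \<and> fixed_by w (Wl \<nu> (gA \<rho> \<alpha>) w) (fA \<zeta> \<nu> \<rho> \<alpha> w)" if w: "w \<in> I" for w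
  proof (cases "w \<in> \<rho>")
    case True
    show ?thesis unfolding gA_Wl[OF w \<rho>(3) \<alpha>]
      using True \<alpha>r[OF True] \<zeta> w h\<phi>_schwartz[OF w \<alpha>r[OF True]] by (auto simp: fA_def local_sections_def)
  next
    case False
    then show ?thesis unfolding gA_Wl[OF w \<rho>(3) \<alpha>] using ch_Y[OF w] \<rho>(3) by (auto simp: fA_def)
  qed
  show "gA \<rho> \<alpha> \<in> carrier GG" using gA_closed \<rho> \<alpha> by blast
  have "{w \<in> I. fA \<zeta> \<nu> \<rho> \<alpha> w \<noteq> ch R (Y w)} \<subseteq> \<rho>" using \<rho>(3) by (auto simp: fA_def)
  then show "S.almost_unit (fA \<zeta> \<nu> \<rho> \<alpha>)"
    unfolding S.almost_unit_def using finite_subset[OF _ \<rho>(1)] loc by blast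
  show "fixed_by w (Wl \<nu> (gA \<rho> \<alpha>) w) (fA \<zeta> \<nu> \<rho> \<alpha> w)" if "w \<in> I" for w using loc[OF that] by blast
qed

text \<open>The element \<open>y\<^sub>\<nu>\<close> is \<open>zeta \<zeta> \<nu> \<nu>\<close>; for \<open>\<nu> \<subseteq> \<rho>\<close>, \<open>zeta \<zeta> \<nu> \<rho>\<close> is both its image under the
  Hecke operators at the places in \<open>\<rho> - \<nu>\<close> and the trace of \<open>y\<^sub>\<rho>\<close>.\<close>

definition zeta :: "('i \<Rightarrow> nat \<Rightarrow> 'x \<Rightarrow> 'r) \<Rightarrow> 'i set \<Rightarrow> 'i set \<Rightarrow> 'm" where
  "zeta \<zeta> \<nu> \<rho> = (\<Oplus>\<^bsub>obj M (level I K L \<nu>)\<^esub>\<alpha>\<in>idx \<rho>. tensor_symbol \<nu> (gA \<rho> \<alpha>) (fA \<zeta> \<nu> \<rho> \<alpha>))"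

lemma zeta_term_closed:
  assumes "local_sections \<zeta>" "finite \<rho>" "\<rho> \<subseteq> I" "\<nu> \<subseteq> \<rho>" "\<alpha> \<in> idx \<rho>"
  shows "tensor_symbol \<nu> (gA \<rho> \<alpha>) (fA \<zeta> \<nu> \<rho> \<alpha>) \<in> carrier (obj M (level I K L \<nu>))"
  using assms finite_subset by (intro tensor_symbol_closed admissible_A) auto

lemma zeta_closed:
  assumes "local_sections \<zeta>" "finite \<rho>" "\<rho> \<subseteq> I" "\<nu> \<subseteq> \<rho>"
  shows "zeta \<zeta> \<nu> \<rho> \<in> carrier (obj M (level I K L \<nu>))"
proof -
  have "finite \<nu>" "\<nu> \<subseteq> I" using assms finite_subset by auto
  then interpret MP: Module.module R "obj M (level I K L \<nu>)" by (rule level_module)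
  show ?thesis unfolding zeta_def using assms zeta_term_closed by (intro MP.M.finsum_closed) auto
qed

text \<open>The operator sends each symbol to a sum over the classes at \<open>v\<close>, and a pair
  consisting of \<alpha> and a class i is the same as the extended index
  \<open>\<alpha>(v := i)\<close>.\<close>

lemma local_hecke_zeta:
  assumes \<zeta>: "local_sections \<zeta>" and \<rho>: "finite \<rho>" "\<rho> \<subseteq> I" "\<nu> \<subseteq> \<rho>" and v: "v \<in> I" "v \<notin> \<rho>"
  shows "local_hecke I G GG M (level I K L \<nu>) v (SS v) (c v) (zeta \<zeta> \<nu> \<rho>) = zeta \<zeta> \<nu> (insert v \<rho>)"
proof -
  have \<nu>: "finite \<nu>" "\<nu> \<subseteq> I" "v \<notin> \<nu>" using \<rho> v finite_subset by auto
  interpret MP: Module.module R "obj M (level I K L \<nu>)" using level_module \<nu> by blast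
  note fin = finite_idx[OF \<rho>(1)]
  have \<rho>v: "finite (insert v \<rho>)" "insert v \<rho> \<subseteq> I" "\<nu> \<subseteq> insert v \<rho>" using \<rho> v by auto
  define t where "t = (\<lambda>\<beta>. tensor_symbol \<nu> (gA (insert v \<rho>) \<beta>) (fA \<zeta> \<nu> (insert v \<rho>) \<beta>))"
  have t_cl: "t \<beta> \<in> carrier (obj M (level I K L \<nu>))" if "\<beta> \<in> idx (insert v \<rho>)" for \<beta>
    unfolding t_def by (rule zeta_term_closed[OF \<zeta> \<rho>v that])
  have upd: "gA (insert v \<rho>) (\<alpha>(v := i)) = (gA \<rho> \<alpha>)(v := gg v i)"
    "fA \<zeta> \<nu> (insert v \<rho>) (\<alpha>(v := i)) = (fA \<zeta> \<nu> \<rho> \<alpha>)(v := h\<phi> v i)" for \<alpha> i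
    using v \<nu>(3) by (auto simp: gA_def fA_def fun_eq_iff)
  have upd_in: "\<alpha>(v := i) \<in> idx (insert v \<rho>)" if "\<alpha> \<in> idx \<rho>" "i \<in> {1..r v}" for \<alpha> i
    using that unfolding idx_def by (intro PiE_fun_upd) auto
  have "local_hecke I G GG M (level I K L \<nu>) v (SS v) (c v) (zeta \<zeta> \<nu> \<rho>) =
      (\<Oplus>\<^bsub>obj M (level I K L \<nu>)\<^esub>\<alpha>\<in>idx \<rho>. local_hecke I G GG M (level I K L \<nu>) v (SS v) (c v)
        (tensor_symbol \<nu> (gA \<rho> \<alpha>) (fA \<zeta> \<nu> \<rho> \<alpha>)))"
    unfolding zeta_def using level_in \<nu> v fin zeta_term_closed[OF \<zeta> \<rho>]
    by (intro local_hecke_finsum) auto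
  also have "\<dots> = (\<Oplus>\<^bsub>obj M (level I K L \<nu>)\<^esub>\<alpha>\<in>idx \<rho>. \<Oplus>\<^bsub>obj M (level I K L \<nu>)\<^esub>i\<in>{1..r v}. t (\<alpha>(v := i)))"
  proof (rule MP.M.finsum_cong')
    fix \<alpha> assume \<alpha>: "\<alpha> \<in> idx \<rho>"
    have "gA \<rho> \<alpha> v = \<one>\<^bsub>G v\<^esub>" "fA \<zeta> \<nu> \<rho> \<alpha> v = ch R (Y v)" using v \<nu>(3) by (auto simp: gA_def fA_def)
    from hecke_tensor_symbol(1)[OF \<nu>(1,2) v(1) \<nu>(3) admissible_A[OF \<zeta> \<rho> \<alpha>] this]
    show "local_hecke I G GG M (level I K L \<nu>) v (SS v) (c v) (tensor_symbol \<nu> (gA \<rho> \<alpha>) (fA \<zeta> \<nu> \<rho> \<alpha>)) =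
      (\<Oplus>\<^bsub>obj M (level I K L \<nu>)\<^esub>i\<in>{1..r v}. t (\<alpha>(v := i)))"
      unfolding t_def upd .
  qed (use t_cl upd_in in \<open>auto intro!: MP.M.finsum_closed\<close>)
  also have "\<dots> = (\<Oplus>\<^bsub>obj M (level I K L \<nu>)\<^esub>i\<in>{1..r v}. \<Oplus>\<^bsub>obj M (level I K L \<nu>)\<^esub>\<alpha>\<in>idx \<rho>. t (\<alpha>(v := i)))"
    using fin t_cl upd_in by (intro MP.M.finsum_swap) auto
  also have "\<dots> = (\<Oplus>\<^bsub>obj M (level I K L \<nu>)\<^esub>x\<in>Sigma {1..r v} (\<lambda>_. idx \<rho>). t ((snd x)(v := fst x)))"
    using fin t_cl upd_in by (intro MP.M.finsum_Sigma) auto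
  also have "\<dots> = (\<Oplus>\<^bsub>obj M (level I K L \<nu>)\<^esub>\<beta>\<in>idx (insert v \<rho>). t \<beta>)"
  proof (rule MP.M.finsum_bij_betw)
    have "inj_on (\<lambda>(y, g). g(v := y)) ({1..r v} \<times> idx \<rho>)"
      unfolding idx_def by (rule inj_combinator[OF v(2), of "\<lambda>w. {1..r w}"])
    moreover have "idx (insert v \<rho>) = (\<lambda>(y, g). g(v := y)) ` ({1..r v} \<times> idx \<rho>)"
      unfolding idx_def by (rule PiE_insert_eq)
    ultimately show "bij_betw (\<lambda>(y, g). g(v := y)) (Sigma {1..r v} (\<lambda>_. idx \<rho>)) (idx (insert v \<rho>))"
      by (simp add: bij_betw_def)
  qed (use t_cl in auto)
  finally show ?thesis unfolding zeta_def t_def .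
qed

text \<open>The index set stays that of \<rho>: in every symbol the trace at \<open>v\<close>
  replaces \<zeta> by h\<phi>, which moves \<open>v\<close> from the first state to the
  second.\<close>

lemma push_zeta_step:
  assumes \<zeta>: "local_sections \<zeta>" and \<rho>: "finite \<rho>" "\<rho> \<subseteq> I" "insert v \<nu> \<subseteq> \<rho>" and v: "v \<notin> \<nu>"
  shows "push M (level I K L (insert v \<nu>)) (level I K L \<nu>) \<one>\<^bsub>GG\<^esub> (zeta \<zeta> (insert v \<nu>) \<rho>) = zeta \<zeta> \<nu> \<rho>"
proof -
  have vI: "v \<in> I" and v\<rho>: "v \<in> \<rho>" and \<nu>\<rho>: "\<nu> \<subseteq> \<rho>" using \<rho> by auto
  have \<nu>: "finite \<nu>" "\<nu> \<subseteq> I" and \<mu>: "finite (insert v \<nu>)" "insert v \<nu> \<subseteq> I" using \<rho> finite_subset by auto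
  interpret MP: Module.module R "obj M (level I K L \<nu>)" using level_module \<nu> by blast
  have "level I K L (insert v \<nu>) \<subseteq> level I K L \<nu>"
    unfolding level_eq using L_K by (intro PiE_mono) (auto simp: Pl_def)
  then have hom: "\<one>\<^bsub>GG\<^esub> \<in> level_hom GG (level I K L (insert v \<nu>)) (level I K L \<nu>)"
    by (rule ric.one_level_hom_G[OF level_in[OF \<mu>] level_in[OF \<nu>]])
  have "push M (level I K L (insert v \<nu>)) (level I K L \<nu>) \<one>\<^bsub>GG\<^esub> (zeta \<zeta> (insert v \<nu>) \<rho>) =
      (\<Oplus>\<^bsub>obj M (level I K L \<nu>)\<^esub>\<alpha>\<in>idx \<rho>. push M (level I K L (insert v \<nu>)) (level I K L \<nu>) \<one>\<^bsub>GG\<^esub>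
        (tensor_symbol (insert v \<nu>) (gA \<rho> \<alpha>) (fA \<zeta> (insert v \<nu>) \<rho> \<alpha>)))"
    unfolding zeta_def using zeta_term_closed[OF \<zeta> \<rho>]
    by (intro linear_maps_finsum[OF ric.M.push_linear[OF level_in[OF \<mu>] level_in[OF \<nu>] hom]
          level_module[OF \<mu>] level_module[OF \<nu>]]) auto
  also have "\<dots> = zeta \<zeta> \<nu> \<rho>"
    unfolding zeta_def
  proof (rule MP.M.finsum_cong')
    fix \<alpha> assume \<alpha>: "\<alpha> \<in> idx \<rho>"
    have \<alpha>v: "\<alpha> v \<in> {1..r v}" using \<alpha> v\<rho> by (auto simp: idx_def)
    have f: "fA \<zeta> \<nu> \<rho> \<alpha> = (fA \<zeta> (insert v \<nu>) \<rho> \<alpha>)(v := h\<phi> v (\<alpha> v))"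
      using v v\<rho> by (auto simp: fA_def fun_eq_iff)
    have fv: "fA \<zeta> (insert v \<nu>) \<rho> \<alpha> v = \<zeta> v (\<alpha> v)" by (simp add: fA_def)
    have W: "Wl \<nu> (gA \<rho> \<alpha>) v = Hg v (\<alpha> v)" "Wl (insert v \<nu>) (gA \<rho> \<alpha>) v = Vg v (\<alpha> v)"
      using gA_Wl[OF vI \<nu>\<rho> \<alpha>] gA_Wl[OF vI \<rho>(3) \<alpha>] v v\<rho> by auto
    show "push M (level I K L (insert v \<nu>)) (level I K L \<nu>) \<one>\<^bsub>GG\<^esub>
        (tensor_symbol (insert v \<nu>) (gA \<rho> \<alpha>) (fA \<zeta> (insert v \<nu>) \<rho> \<alpha>)) = tensor_symbol \<nu> (gA \<rho> \<alpha>) (fA \<zeta> \<nu> \<rho> \<alpha>)"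
      unfolding f
    proof (rule push_tensor_symbol[OF \<nu> vI v admissible_A[OF \<zeta> \<rho> \<alpha>]])
      show "admissible \<nu> (gA \<rho> \<alpha>) ((fA \<zeta> (insert v \<nu>) \<rho> \<alpha>)(v := h\<phi> v (\<alpha> v)))"
        using admissible_A[OF \<zeta> \<rho>(1,2) \<nu>\<rho> \<alpha>] unfolding f .
      fix x assume "x \<in> topspace (X v)"
      then show "h\<phi> v (\<alpha> v) x = (\<Oplus>\<^bsub>R\<^esub>C\<in>left_cosets (G v) (Wl \<nu> (gA \<rho> \<alpha>) v) (Wl (insert v \<nu>) (gA \<rho> \<alpha>) v).
          fA \<zeta> (insert v \<nu>) \<rho> \<alpha> v (act v x (rep C)))"
        unfolding W fv using \<zeta> vI \<alpha>v unfolding local_sections_def by blast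
    qed
  qed (use zeta_term_closed[OF \<zeta> \<rho>(1,2) \<nu>\<rho>] in auto)
  finally show ?thesis .
qed

text \<open>The projection is factored into steps that raise the level at one place each.\<close>

lemma push_zeta:
  assumes \<zeta>: "local_sections \<zeta>" and \<rho>: "finite \<rho>" "\<rho> \<subseteq> I" and \<tau>: "finite \<tau>" "\<tau> \<inter> \<nu> = {}" "\<nu> \<union> \<tau> \<subseteq> \<rho>"
  shows "push M (level I K L (\<nu> \<union> \<tau>)) (level I K L \<nu>) \<one>\<^bsub>GG\<^esub> (zeta \<zeta> (\<nu> \<union> \<tau>) \<rho>) = zeta \<zeta> \<nu> \<rho>"
  using \<tau>
proof (induction \<tau>)
  case empty
  then have "finite \<nu>" "\<nu> \<subseteq> I" using \<rho> finite_subset by auto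
  then show ?case using ric.M.push_id[OF level_in] zeta_closed[OF \<zeta> \<rho>] empty by simp
next
  case (insert v \<tau>)
  have sub: "\<nu> \<union> \<tau> \<subseteq> \<rho>" "insert v (\<nu> \<union> \<tau>) \<subseteq> \<rho>" "v \<notin> \<nu> \<union> \<tau>" "\<tau> \<inter> \<nu> = {}" "\<nu> \<subseteq> \<rho>"
    using insert by auto
  have fin: "finite \<nu>" "\<nu> \<subseteq> I" "finite (\<nu> \<union> \<tau>)" "\<nu> \<union> \<tau> \<subseteq> I" "finite (insert v (\<nu> \<union> \<tau>))" "insert v (\<nu> \<union> \<tau>) \<subseteq> I"
    using sub \<rho> finite_subset by (auto simp del: finite_Un finite_insert)
  have mono: "level I K L \<mu>' \<subseteq> level I K L \<mu>" if "\<mu> \<subseteq> \<mu>'" for \<mu> \<mu>'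
    unfolding level_eq using L_K that by (intro PiE_mono) (auto simp: Pl_def)
  note lv = level_in[OF fin(1,2)] level_in[OF fin(3,4)] level_in[OF fin(5,6)]
  have h1: "\<one>\<^bsub>GG\<^esub> \<in> level_hom GG (level I K L (insert v (\<nu> \<union> \<tau>))) (level I K L (\<nu> \<union> \<tau>))"
    and h2: "\<one>\<^bsub>GG\<^esub> \<in> level_hom GG (level I K L (\<nu> \<union> \<tau>)) (level I K L \<nu>)"
    by (rule ric.one_level_hom_G[OF lv(3,2) mono], blast) (rule ric.one_level_hom_G[OF lv(2,1) mono], blast)
  have "push M (level I K L (insert v (\<nu> \<union> \<tau>))) (level I K L \<nu>) (\<one>\<^bsub>GG\<^esub> \<otimes>\<^bsub>GG\<^esub> \<one>\<^bsub>GG\<^esub>) (zeta \<zeta> (insert v (\<nu> \<union> \<tau>)) \<rho>) =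
      push M (level I K L (\<nu> \<union> \<tau>)) (level I K L \<nu>) \<one>\<^bsub>GG\<^esub>
        (push M (level I K L (insert v (\<nu> \<union> \<tau>))) (level I K L (\<nu> \<union> \<tau>)) \<one>\<^bsub>GG\<^esub> (zeta \<zeta> (insert v (\<nu> \<union> \<tau>)) \<rho>))"
    by (rule ric.M.push_comp[OF lv(3,2,1) h1 h2 zeta_closed[OF \<zeta> \<rho> sub(2)]])
  then show ?case
    using push_zeta_step[OF \<zeta> \<rho> sub(2,3)] insert.IH[OF sub(4,1)] by simp
qed

theorem zeta_system:
  assumes \<phi>: "\<phi> \<in> carrier (obj N (\<Pi>\<^sub>E v\<in>I. U v))"
    and \<theta>\<phi>: "\<theta> (\<Pi>\<^sub>E v\<in>I. U v) \<phi> = restrict (ch R (\<Pi>\<^sub>E v\<in>I. Y v)) (topspace XX)"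
  shows "\<exists>y. (\<forall>\<nu>. finite \<nu> \<and> \<nu> \<subseteq> I \<longrightarrow> y \<nu> \<in> carrier (obj M (level I K L \<nu>))) \<and>
    y {} = \<iota> (\<Pi>\<^sub>E v\<in>I. U v) (\<Pi>\<^sub>E v\<in>I. K v) \<phi> \<and>
    (\<forall>\<nu> \<mu>. finite \<mu> \<and> \<mu> \<subseteq> I \<and> \<nu> \<subseteq> \<mu> \<longrightarrow>
       (\<forall>vs. distinct vs \<and> set vs = \<mu> - \<nu> \<longrightarrow>
          foldr (\<lambda>v. local_hecke I G GG M (level I K L \<nu>) v (SS v) (c v)) vs (y \<nu>) =
          push M (level I K L \<mu>) (level I K L \<nu>) \<one>\<^bsub>GG\<^esub> (y \<mu>)))"
proof -
  obtain \<zeta> where \<zeta>: "local_sections \<zeta>" using exists_local_sections by blast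
  define y where "y = (\<lambda>\<nu>. zeta \<zeta> \<nu> \<nu>)"
  have y_closed: "y \<nu> \<in> carrier (obj M (level I K L \<nu>))" if "finite \<nu>" "\<nu> \<subseteq> I" for \<nu>
    unfolding y_def using zeta_closed[OF \<zeta> that] by simp
  have y_empty: "y {} = \<iota> (\<Pi>\<^sub>E v\<in>I. U v) (\<Pi>\<^sub>E v\<in>I. K v) \<phi>"
  proof -
    \<comment> \<open>There is one index over the empty set of places, the function undefined
      everywhere, so \<open>y {}\<close> is a single symbol.\<close>
    define \<alpha> :: "'i \<Rightarrow> nat" where "\<alpha> = (\<lambda>_. undefined)"
    have \<alpha>: "idx {} = {\<alpha>}" unfolding idx_def \<alpha>_def by (rule PiE_empty_domain)
    interpret MP: Module.module R "obj M (level I K L {})" using level_module by simp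
    have a: "admissible {} (gA {} \<alpha>) (fA \<zeta> {} {} \<alpha>)" using \<alpha> by (intro admissible_A[OF \<zeta>]) auto
    have g1: "gA {} \<alpha> = \<one>\<^bsub>GG\<^esub>"
      using a by (intro P.GG_eqI) (auto simp: admissible_def gA_def)
    have fY: "fA \<zeta> {} {} \<alpha> = (\<lambda>w. ch R (Y w))" by (simp add: fA_def)
    define V where "V = (\<Pi>\<^sub>E v\<in>I. U v)"
    have W: "WW {} (gA {} \<alpha>) = V"
      unfolding WW_def V_def using gA_Wl[of _ "{}" "{}" \<alpha>] \<alpha> by (intro PiE_cong) auto
    have P0: "level I K L {} = (\<Pi>\<^sub>E v\<in>I. K v)" by (simp add: level_def)
    have lv: "level I K L {} \<in> \<Upsilon>\<^sub>G" using level_in by blast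
    note Wl = WW_level[OF finite.emptyI empty_subsetI P.GG.one_closed, folded g1, unfolded W]
    have "tensor_elt {} (gA {} \<alpha>) (fA \<zeta> {} {} \<alpha>) = \<phi>"
    proof (rule \<theta>_eqI[OF Wl(1,2)])
      note n = tensor_elt[OF finite.emptyI empty_subsetI a, unfolded W]
      show "tensor_elt {} (gA {} \<alpha>) (fA \<zeta> {} {} \<alpha>) \<in> carrier (obj N V)" by (rule n(1))
      show "\<phi> \<in> carrier (obj N V)" using \<phi> unfolding V_def .
      fix x assume x: "x \<in> topspace XX"
      have xe: "x \<in> extensional I" using x by (auto simp: S.topspace_XX PiE_iff)
      \<comment> \<open>Inside the product of the \<open>Y v\<close> all factors are 1, and outside
        of it some factor is 0, which annihilates the product.\<close>
      have "tensor R I (fA \<zeta> {} {} \<alpha>) x = ch R (\<Pi>\<^sub>E v\<in>I. Y v) x"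
      proof (cases "x \<in> (\<Pi>\<^sub>E v\<in>I. Y v)")
        case True
        then have none: "{w \<in> I. ch R (Y w) (x w) \<noteq> \<one>\<^bsub>R\<^esub>} = {}" by (auto simp: ch_def)
        interpret R: cring R by (rule R_cring)
        show ?thesis using True unfolding tensor_def fY none by (simp add: ch_def)
      next
        case False
        then obtain w where w: "w \<in> I" "x w \<notin> Y w" using xe by (auto simp: PiE_iff)
        interpret R: cring R by (rule R_cring)
        have f: "S.almost_unit (fA \<zeta> {} {} \<alpha>)" using a by (simp add: admissible_def)
        have "tensor R (I - {w}) (fA \<zeta> {} {} \<alpha>) x \<in> carrier R"
          using S.almost_unit_closed[OF f x] by (intro tensor_closed R_cring) auto
        then show ?thesis using S.tensor_split_XX[OF f x w(1)] w False by (simp add: fY ch_def)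
      qed
      then show "\<theta> V (tensor_elt {} (gA {} \<alpha>) (fA \<zeta> {} {} \<alpha>)) x = \<theta> V \<phi> x"
        unfolding n(2) using \<theta>\<phi> x unfolding V_def by simp
    qed
    then have "tensor_symbol {} (gA {} \<alpha>) (fA \<zeta> {} {} \<alpha>) = ric.symbol (level I K L {}) V (gA {} \<alpha>) \<phi>"
      unfolding tensor_symbol_def W by simp
    also have "\<dots> = ric.symbol (level I K L {}) V \<one>\<^bsub>GG\<^esub> \<phi>" by (simp only: g1)
    also have "\<dots> = \<iota> V (level I K L {}) \<phi>"
    proof -
      have c: "conjugate GG \<one>\<^bsub>GG\<^esub> (level I K L {}) = level I K L {}"
        by (rule P.GG.conjugate_one[OF ric.level_G(2)[OF lv]])
      have VP: "V \<subseteq> level I K L {}" using Wl(3) unfolding g1 c .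
      have "\<iota> V (level I K L {}) \<phi> \<in> carrier (obj M (level I K L {}))"
        using linear_mapsD(1)[OF ric.\<iota>.linear[OF Wl(1) lv VP]] \<phi> unfolding V_def by blast
      then show ?thesis unfolding ric.symbol_def c using ric.M.push_id[OF lv] by simp
    qed
    finally have "tensor_symbol {} (gA {} \<alpha>) (fA \<zeta> {} {} \<alpha>) = \<iota> V (\<Pi>\<^sub>E v\<in>I. K v) \<phi>" unfolding P0 .
    moreover have "y {} = tensor_symbol {} (gA {} \<alpha>) (fA \<zeta> {} {} \<alpha>)"
      unfolding y_def zeta_def \<alpha> using tensor_symbol_closed[OF finite.emptyI empty_subsetI a] by simp
    ultimately show ?thesis unfolding V_def by simp
  qed
  have y_compat: "foldr (\<lambda>v. local_hecke I G GG M (level I K L \<nu>) v (SS v) (c v)) vs (y \<nu>) =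
      push M (level I K L \<mu>) (level I K L \<nu>) \<one>\<^bsub>GG\<^esub> (y \<mu>)"
    if \<mu>: "finite \<mu>" "\<mu> \<subseteq> I" "\<nu> \<subseteq> \<mu>" and vs: "distinct vs" "set vs = \<mu> - \<nu>" for \<nu> \<mu> vs
  proof -
    have \<nu>: "finite \<nu>" "\<nu> \<subseteq> I" using \<mu> finite_subset by auto
    \<comment> \<open>The claim is made for every list of new places: each operator adds its place
      to \<rho>, so the result depends only on the set of places, and all enumerations are covered
      at once.\<close>
    have "foldr (\<lambda>v. local_hecke I G GG M (level I K L \<nu>) v (SS v) (c v)) us (y \<nu>) = zeta \<zeta> \<nu> (\<nu> \<union> set us)"
      if "distinct us" "set us \<subseteq> I - \<nu>" for us
      using that
    proof (induction us)
      case Nil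
      then show ?case by (simp add: y_def)
    next
      case (Cons u us)
      have "local_hecke I G GG M (level I K L \<nu>) u (SS u) (c u) (zeta \<zeta> \<nu> (\<nu> \<union> set us)) = zeta \<zeta> \<nu> (insert u (\<nu> \<union> set us))"
        using Cons.prems \<nu> by (intro local_hecke_zeta[OF \<zeta>]) auto
      then show ?case using Cons by simp
    qed
    from this[OF vs(1)] have "foldr (\<lambda>v. local_hecke I G GG M (level I K L \<nu>) v (SS v) (c v)) vs (y \<nu>) = zeta \<zeta> \<nu> (\<nu> \<union> (\<mu> - \<nu>))"
      using vs \<mu> by auto
    moreover have "\<nu> \<union> (\<mu> - \<nu>) = \<mu>" using \<mu>(3) by auto
    moreover have "push M (level I K L (\<nu> \<union> (\<mu> - \<nu>))) (level I K L \<nu>) \<one>\<^bsub>GG\<^esub> (zeta \<zeta> (\<nu> \<union> (\<mu> - \<nu>)) \<mu>) = zeta \<zeta> \<nu> \<mu>"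
      using \<mu> by (intro push_zeta[OF \<zeta> \<mu>(1,2)]) auto
    ultimately show ?thesis by (simp add: y_def)
  qed
  show ?thesis
    by (intro exI[of _ y] conjI allI impI y_empty; elim conjE) (rule y_closed y_compat; assumption)+
qed

end

theorem theorem3:
  fixes p :: nat and I :: "'i set"
    and G :: "'i \<Rightarrow> 'g monoid" and T :: "'i \<Rightarrow> 'g topology"
    and H K L U :: "'i \<Rightarrow> 'g set"
    and GG HH :: "('i \<Rightarrow> 'g) monoid" and TG TH :: "('i \<Rightarrow> 'g) topology"
    and \<Upsilon>\<^sub>G \<Upsilon>\<^sub>H :: "('i \<Rightarrow> 'g) set set"
    and N :: "('i \<Rightarrow> 'g, padic, 'n) ric" and M :: "('i \<Rightarrow> 'g, padic, 'm) ric"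
    and \<iota> :: "('i \<Rightarrow> 'g) set \<Rightarrow> ('i \<Rightarrow> 'g) set \<Rightarrow> 'n \<Rightarrow> 'm"
    and S :: "'i \<Rightarrow> 'g set" and c :: "'i \<Rightarrow> 'g \<Rightarrow> padic" and \<HH> :: "'i \<Rightarrow> 'g \<Rightarrow> padic"
    and r :: "'i \<Rightarrow> nat" and g :: "'i \<Rightarrow> nat \<Rightarrow> 'g"
    and Hg Vg :: "'i \<Rightarrow> nat \<Rightarrow> 'g set"
    and J :: "'i \<Rightarrow> nat \<Rightarrow> 'g set" and d :: "'i \<Rightarrow> nat \<Rightarrow> 'g \<Rightarrow> padic"
    and X :: "'i \<Rightarrow> 'x topology" and Y :: "'i \<Rightarrow> 'x set" and act :: "'i \<Rightarrow> 'x \<Rightarrow> 'g \<Rightarrow> 'x"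
    and XX :: "('i \<Rightarrow> 'x) topology" and Act :: "('i \<Rightarrow> 'x) \<Rightarrow> ('i \<Rightarrow> 'g) \<Rightarrow> ('i \<Rightarrow> 'x)"
    and \<theta> :: "('i \<Rightarrow> 'g) set \<Rightarrow> 'n \<Rightarrow> (('i \<Rightarrow> 'x) \<Rightarrow> padic)"
    and \<phi> :: 'n and h\<phi> :: "'i \<Rightarrow> nat \<Rightarrow> 'x \<Rightarrow> padic"
  assumes "prime p"
    \<comment> \<open>local groups\<close>
    and "\<And>v. v \<in> I \<Longrightarrow> locally_profinite_group (G v) (T v)"
    and "\<And>v. v \<in> I \<Longrightarrow> unimodular (G v) (T v)"
    and "\<And>v. v \<in> I \<Longrightarrow> subgroup (H v) (G v) \<and> closedin (T v) (H v)"
    and "\<And>v. v \<in> I \<Longrightarrow>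
          locally_profinite_group ((G v)\<lparr>carrier := H v\<rparr>) (subtopology (T v) (H v))"
    and "\<And>v. v \<in> I \<Longrightarrow> unimodular ((G v)\<lparr>carrier := H v\<rparr>) (subtopology (T v) (H v))"
    and "\<And>v. v \<in> I \<Longrightarrow> compact_open_subgroup (G v) (T v) (K v)"
    and "\<And>v. v \<in> I \<Longrightarrow> compact_open_subgroup (G v) (T v) (L v) \<and> L v \<lhd> (G v)\<lparr>carrier := K v\<rparr>"
    and "U = (\<lambda>v. H v \<inter> K v)"
    \<comment> \<open>restricted products\<close>
    and "GG = restricted_group I G K"
    and "TG = restricted_topology I T K"
    and "HH = restricted_group I (\<lambda>v. (G v)\<lparr>carrier := H v\<rparr>) U"
    and "TH = restricted_topology I (\<lambda>v. subtopology (T v) (H v)) U"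
    \<comment> \<open>functors and pushforward\<close>
    and "level_collection GG TG \<Upsilon>\<^sub>G"
    and "(\<Pi>\<^sub>E v\<in>I. K v) \<in> \<Upsilon>\<^sub>G"
    and "\<And>\<nu>. finite \<nu> \<Longrightarrow> \<nu> \<subseteq> I \<Longrightarrow> level I K L \<nu> \<in> \<Upsilon>\<^sub>G"
    and "level_collection HH TH \<Upsilon>\<^sub>H"
    and "(\<lambda>K'. K' \<inter> carrier HH) ` \<Upsilon>\<^sub>G \<subseteq> \<Upsilon>\<^sub>H"
    and "comackey_functor (padic_int p) HH \<Upsilon>\<^sub>H N"
    and "comackey_functor (padic_int p) GG \<Upsilon>\<^sub>G M"
    and "pushforward (padic_int p) HH GG \<Upsilon>\<^sub>H \<Upsilon>\<^sub>G N M \<iota>"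
    and "mackey_pushforward GG \<Upsilon>\<^sub>H \<Upsilon>\<^sub>G N M \<iota>"
    \<comment> \<open>local Hecke data\<close>
    and "\<And>v. v \<in> I \<Longrightarrow> finite (S v) \<and> S v \<subseteq> carrier (G v) \<and> c v \<in> S v \<rightarrow> carrier (padic_int p)"
    and "\<And>v. v \<in> I \<Longrightarrow> \<HH> v = double_coset_sum (padic_int p) (G v) (K v) (K v) (S v) (c v)"
    and "\<And>v. v \<in> I \<Longrightarrow> g v \<in> {1..r v} \<rightarrow> carrier (G v) \<and>
          bij_betw (\<lambda>i. double_coset (G v) (H v) (g v i) (K v)) {1..r v}
            (double_cosets (G v) (H v) (H v <#>\<^bsub>G v\<^esub> supp (padic_int p) (T v) (\<HH> v)) (K v))"
    and "\<And>v i. v \<in> I \<Longrightarrow> i \<in> {1..r v} \<Longrightarrow> Hg v i = H v \<inter> conjugate (G v) (g v i) (K v)"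
    and "\<And>v i. v \<in> I \<Longrightarrow> i \<in> {1..r v} \<Longrightarrow> Vg v i = H v \<inter> conjugate (G v) (g v i) (L v)"
    and "\<And>v i. v \<in> I \<Longrightarrow> i \<in> {1..r v} \<Longrightarrow>
          finite (J v i) \<and> J v i \<subseteq> H v \<and> d v i \<in> J v i \<rightarrow> carrier (padic_int p) \<and>
          inj_on (\<lambda>h. double_coset (G v) (U v) h (Hg v i)) (J v i)"
    and "\<And>v i h. v \<in> I \<Longrightarrow> i \<in> {1..r v} \<Longrightarrow> h \<in> H v \<Longrightarrow>
          \<HH> v (h \<otimes>\<^bsub>G v\<^esub> g v i) =
          double_coset_sum (padic_int p) (G v) (U v) (Hg v i) (J v i) (d v i) h"
    \<comment> \<open>Schwartz spaces\<close>
    and "\<And>v. v \<in> I \<Longrightarrow> locally_profinite_space (X v)"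
    and "\<And>v. v \<in> I \<Longrightarrow> continuous_right_action ((G v)\<lparr>carrier := H v\<rparr>) (subtopology (T v) (H v))
          (X v) (act v)"
    and "\<And>v. v \<in> I \<Longrightarrow> compactin (X v) (Y v) \<and> openin (X v) (Y v) \<and>
          (\<forall>y\<in>Y v. \<forall>u\<in>U v. act v y u \<in> Y v)"
    and "XX = restricted_topology I X Y"
    and "Act = (\<lambda>x h. \<lambda>v\<in>I. act v (x v) (h v))"
    and "schwartz_identification (padic_int p) I HH \<Upsilon>\<^sub>H N XX Act \<theta>"
    and "\<phi> \<in> carrier (obj N (\<Pi>\<^sub>E v\<in>I. U v))"
    and "\<theta> (\<Pi>\<^sub>E v\<in>I. U v) \<phi> = restrict (ch (padic_int p) (\<Pi>\<^sub>E v\<in>I. Y v)) (topspace XX)"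
    \<comment> \<open>the local divisibility condition\<close>
    and "\<And>v i. v \<in> I \<Longrightarrow> i \<in> {1..r v} \<Longrightarrow>
          h\<phi> v i = schwartz_hecke (padic_int p) (G v) (act v) (Hg v i) (U v) (J v i) (d v i)
                     (ch (padic_int p) (Y v))"
    and "\<And>v i x. v \<in> I \<Longrightarrow> i \<in> {1..r v} \<Longrightarrow> x \<in> supp (padic_int p) (X v) (h\<phi> v i) \<Longrightarrow>
          \<exists>z\<in>carrier (padic_int p). h\<phi> v i x =
            [subgroup_index (G v) (stab_extension (G v) (act v) (Vg v i) x (Hg v i)) (Vg v i)]
              \<cdot>\<^bsub>padic_int p\<^esub> z"
  shows "\<exists>y. (\<forall>\<nu>. finite \<nu> \<and> \<nu> \<subseteq> I \<longrightarrow> y \<nu> \<in> carrier (obj M (level I K L \<nu>))) \<and>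
          y {} = \<iota> (\<Pi>\<^sub>E v\<in>I. U v) (\<Pi>\<^sub>E v\<in>I. K v) \<phi> \<and>
          (\<forall>\<nu> \<mu>. finite \<mu> \<and> \<mu> \<subseteq> I \<and> \<nu> \<subseteq> \<mu> \<longrightarrow>
             (\<forall>vs. distinct vs \<and> set vs = \<mu> - \<nu> \<longrightarrow>
                foldr (\<lambda>v. local_hecke I G GG M (level I K L \<nu>) v (S v) (c v)) vs (y \<nu>) =
                push M (level I K L \<mu>) (level I K L \<nu>) \<one>\<^bsub>GG\<^esub> (y \<mu>)))"
proof -
  interpret zeta_hecke "padic_int p" I G T H K L U GG HH TG TH \<Upsilon>\<^sub>G \<Upsilon>\<^sub>H N M \<iota> X Y act XX Act \<theta>
    S c \<HH> r g Hg Vg J d h\<phi>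
  proof (intro zeta_hecke.intro zeta_setting.intro zeta_hecke_axioms.intro)
    show "cring (padic_int p)"
      using assms(1) by (intro padic_int_cring prime_gt_0_nat)
    show "ric_functor (padic_int p) HH \<Upsilon>\<^sub>H N" "ric_functor (padic_int p) GG \<Upsilon>\<^sub>G M"
      using assms(19,20) by (simp_all add: comackey_functor_def)
  qed (fact assms)+
  show ?thesis
    by (rule zeta_system[OF assms(36,37)])
qed

end
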